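(* For $i\in\{0,1,2\}$ let $h^{(i)}(I,J)$ denote the number of $\mathrm{GL}_2(\mathbb{Z})$-equivalence classes of integral binary quartic forms that are irreducible over $\mathbb{Q}$, have exactly $4-2i$ real roots in $\mathbb{P}^1(\mathbb{R})$, and have invariants $I$ and $J$. Let $n_0=4$, $n_1=2$, $n_2=2$. Then for $i=0,1,2$, $$\lim_{X\to\infty}\frac{\sum_{H(I,J)<X}h^{(i)}(I,J)}{\#\{(I,J)\in\mathbb{Z}^2 \text{ eligible}: (-1)^i\Delta(I,J)>0,\ H(I,J)<X\}}=\frac{2\zeta(2)}{n_i}.$$
   Context: An integral binary quartic form is $f(x,y)=ax^4+bx^3y+cx^2y^2+dxy^3+ey^4$ with $a,b,c,d,e\in\mathbb{Z}$; $\mathrm{GL}_2(\mathbb{Z})$ acts by $\gamma\cdot f(x,y)=f((x,y)\gamma)$. Invariants: $I(f)=12ae-3bd+c^2$, $J(f)=72ace+9bcd-27ad^2-27eb^2-2c^3$. $\Delta(I,J)=(4I^3-J^2)/27$, and $H(I,J)=\max\{|I|^3,J^2/4\}$. A pair $(I,J)\in\mathbb{Z}^2$ is eligible if it occurs as the invariants of some integral binary quartic form. *)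

theory Defs
  imports "HOL-Analysis.Analysis" "HOL-Computational_Algebra.Computational_Algebra"
begin

text \<open>\<open>BQF a b c d e\<close> is the form
  \<open>a x\<^sup>4 + b x\<^sup>3 y + c x\<^sup>2 y\<^sup>2 + d x y\<^sup>3 + e y\<^sup>4\<close>.\<close>

datatype bqf = BQF int int int int int

primrec form :: "bqf \<Rightarrow> 'a :: comm_ring_1 \<Rightarrow> 'a \<Rightarrow> 'a" where
  "form (BQF a b c d e) x y =
     of_int a * x ^ 4 + of_int b * x ^ 3 * y + of_int c * x ^ 2 * y ^ 2
       + of_int d * x * y ^ 3 + of_int e * y ^ 4"

primrec inv_I :: "bqf \<Rightarrow> int" where
  "inv_I (BQF a b c d e) = 12 * a * e - 3 * b * d + c ^ 2"

primrec inv_J :: "bqf \<Rightarrow> int" where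
  "inv_J (BQF a b c d e) =
     72 * a * c * e + 9 * b * c * d - 27 * a * d ^ 2 - 27 * e * b ^ 2 - 2 * c ^ 3"

definition Delta :: "int \<Rightarrow> int \<Rightarrow> real" where
  "Delta I J = (4 * real_of_int I ^ 3 - real_of_int J ^ 2) / 27"

definition height :: "int \<Rightarrow> int \<Rightarrow> real" where
  "height I J = max (\<bar>real_of_int I\<bar> ^ 3) (real_of_int J ^ 2 / 4)"

definition eligible :: "int \<Rightarrow> int \<Rightarrow> bool" where
  "eligible I J \<longleftrightarrow> (\<exists>f. inv_I f = I \<and> inv_J f = J)"

text \<open>The pairs \<open>(f, g)\<close> with \<open>g = \<gamma> \<cdot> f\<close>, i.e. \<open>g(x, y) = f((x, y)\<gamma>)\<close>, for some
  \<open>\<gamma>\<close> in \<open>GL\<^sub>2(\<int>)\<close>. An integral form is determined by its values on \<open>\<int>\<^sup>2\<close>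
  (lemma \<open>form_int_inject\<close>), so this is the same as an identity of polynomials.\<close>

definition GL2Z_rel :: "(bqf \<times> bqf) set" where
  "GL2Z_rel = {(f, g). \<exists>\<gamma> :: int ^ 2 ^ 2. invertible \<gamma> \<and>
     (\<forall>v :: int ^ 2. form g (v $ 1) (v $ 2) = form f ((v v* \<gamma>) $ 1) ((v v* \<gamma>) $ 2))}"

text \<open>Irreducibility in \<open>\<rat>[x, y]\<close>, represented as \<open>\<rat>[x][y]\<close>: \<open>[:[:0, 1:]:]\<close> is \<open>x\<close> and
  \<open>[:0, 1:]\<close> is \<open>y\<close>.\<close>

definition irreducible_over_rat :: "bqf \<Rightarrow> bool" where
  "irreducible_over_rat f \<longleftrightarrow> irreducible (form f [:[:0, 1:]:] [:0, 1:] :: rat poly poly)"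

text \<open>A point \<open>[x : y]\<close> of the real projective line is the line through the origin spanned
  by \<open>(x, y)\<close>.\<close>

definition real_roots :: "bqf \<Rightarrow> (real \<times> real) set set" where
  "real_roots f = {span {(x, y)} | x y. (x, y) \<noteq> (0, 0) \<and> form f x y = 0}"

definition h_forms :: "nat \<Rightarrow> int \<Rightarrow> int \<Rightarrow> bqf set" where
  "h_forms i I J = {f. irreducible_over_rat f \<and>
     finite (real_roots f) \<and> card (real_roots f) = 4 - 2 * i \<and> inv_I f = I \<and> inv_J f = J}"

text \<open>Only finitely many classes of irreducible integral binary quartic forms share given
  invariants, so the convention that infinite sets have cardinality 0 plays no role here.\<close>

definition h :: "nat \<Rightarrow> int \<Rightarrow> int \<Rightarrow> nat" where
  "h i I J = card (h_forms i I J // GL2Z_rel)"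

text \<open>The Dirichlet series of the Riemann zeta function, for real \<open>s > 1\<close>.\<close>

definition zeta :: "real \<Rightarrow> real" where
  "zeta s = (\<Sum>n. 1 / real (Suc n) powr s)"

lemma form_int_inject:
  assumes "\<And>x y :: int. form f x y = form g x y"
  shows "f = g"
proof (cases f; cases g)
  fix a b c d e a' b' c' d' e'
  assume f: "f = BQF a b c d e" and g: "g = BQF a' b' c' d' e'"
  show "f = g"
    using assms[of 1 0] assms[of 0 1] assms[of 1 1] assms[of 1 "-1"] assms[of 2 1]
    unfolding f g by simp
qed

lemma equiv_GL2Z_rel: "equiv UNIV GL2Z_rel"
proof (rule equivI)
  show "refl GL2Z_rel"
  proof (rule reflI)
    fix f
    have "invertible (mat 1 :: int ^ 2 ^ 2)"
      unfolding invertible_def by (rule exI[of _ "mat 1"]) simp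
    then show "(f, f) \<in> GL2Z_rel"
      unfolding GL2Z_rel_def by (auto intro!: exI[of _ "mat 1 :: int ^ 2 ^ 2"])
  qed
  show "sym GL2Z_rel"
  proof (rule symI)
    fix f g
    assume "(f, g) \<in> GL2Z_rel"
    then obtain \<gamma> :: "int ^ 2 ^ 2" where \<gamma>: "invertible \<gamma>"
      and eq: "\<And>v. form g (v $ 1) (v $ 2) = form f ((v v* \<gamma>) $ 1) ((v v* \<gamma>) $ 2)"
      unfolding GL2Z_rel_def by blast
    from \<gamma> obtain \<delta> where \<delta>: "\<gamma> ** \<delta> = mat 1" "\<delta> ** \<gamma> = mat 1"
      unfolding invertible_def by blast
    then have "invertible \<delta>" unfolding invertible_def by blast
    moreover have "form f (v $ 1) (v $ 2) = form g ((v v* \<delta>) $ 1) ((v v* \<delta>) $ 2)" for v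
      using eq[of "v v* \<delta>"] by (simp add: vector_matrix_mul_assoc \<delta>)
    ultimately show "(g, f) \<in> GL2Z_rel" unfolding GL2Z_rel_def by blast
  qed
  show "trans GL2Z_rel"
  proof (rule transI)
    fix f g k
    assume "(f, g) \<in> GL2Z_rel" "(g, k) \<in> GL2Z_rel"
    then obtain \<gamma> \<delta> :: "int ^ 2 ^ 2" where inv: "invertible \<gamma>" "invertible \<delta>"
      and eq: "\<And>v. form g (v $ 1) (v $ 2) = form f ((v v* \<gamma>) $ 1) ((v v* \<gamma>) $ 2)"
        "\<And>v. form k (v $ 1) (v $ 2) = form g ((v v* \<delta>) $ 1) ((v v* \<delta>) $ 2)"
      unfolding GL2Z_rel_def by blast
    have "invertible (\<delta> ** \<gamma>)" using inv by (simp add: invertible_mult)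
    moreover have "form k (v $ 1) (v $ 2) = form f ((v v* (\<delta> ** \<gamma>)) $ 1) ((v v* (\<delta> ** \<gamma>)) $ 2)"
      for v by (simp add: eq vector_matrix_mul_assoc)
    ultimately show "(f, k) \<in> GL2Z_rel" unfolding GL2Z_rel_def by blast
  qed
qed simp_all

lemma finite_height_less: "finite {(I, J). height I J < X}"
proof (rule finite_subset)
  define N where "N = \<lceil>X\<rceil>"
  show "{(I, J). height I J < X} \<subseteq> {-N..N} \<times> {-4*N..4*N}"
  proof clarify
    fix I J
    assume "height I J < X"
    then have *: "\<bar>real_of_int I\<bar> ^ 3 < X" "real_of_int J ^ 2 / 4 < X"
      by (auto simp: height_def)
    have "X \<le> of_int N" by (simp add: N_def)
    with * have "real_of_int (\<bar>I\<bar> ^ 3) < of_int N" "real_of_int (J ^ 2) < of_int (4 * N)"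
      by auto
    then have "\<bar>I\<bar> ^ 3 < N" "J ^ 2 < 4 * N" by (simp_all only: of_int_less_iff)
    moreover have "\<bar>I\<bar> \<le> \<bar>I\<bar> ^ 3"
      by (cases "I = 0") (auto intro!: self_le_power)
    moreover have "\<bar>J\<bar> \<le> \<bar>J\<bar> ^ 2"
      using self_le_power[of "\<bar>J\<bar>" 2] by (cases "J = 0") simp_all
    ultimately show "I \<in> {-N..N} \<and> J \<in> {-4*N..4*N}" by auto
  qed
qed simp

end

theory Submission
  imports Defs
begin

text \<open>A real binary quartic with \<open>4 - 2 i\<close> real roots has a covariant point in the upper half-plane: for
  \<open>i = 1\<close> its complex root, and for \<open>i = 0, 2\<close> the fixed point of the elliptic one of the three involutions
  that permute its roots. An irreducible integral form is equivalent to one whose covariant point lies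
  in the half \<open>0 \<le> x \<le> 1/2\<close>, \<open>x\<^sup>2 + y\<^sup>2 \<ge> 1\<close> of the modular domain, which is a fundamental domain for
  \<open>GL\<^sub>2(\<int>)\<close>; the representative is unique up to boundary cases. With \<open>t\<^sup>6 = X\<close>, the classes of height below
  \<open>X\<close> are therefore the lattice points in the dilation by \<open>t\<close> of a fixed region, apart from reducible forms,
  forms with covariant point high in the cusp and boundary cases, all of which contribute little.
  In the coordinates \<open>(a, b, c, x, y\<^sup>2)\<close>, translation and scaling move the covariant point to \<open>\<i>\<close>,
  and the volume of the region becomes \<open>(\<pi>/3) c\<^sub>i\<close> with \<open>c\<^sub>0 = 2\<pi>/135\<close>, \<open>c\<^sub>1 = 16\<pi>/135\<close>,
  \<open>c\<^sub>2 = 4\<pi>/135\<close>. Eligibility of \<open>(I, J)\<close> is a condition on \<open>(I mod 9, J mod 27)\<close> of density \<open>1/27\<close>, and the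
  regions of the \<open>(I, J)\<close>-plane have area \<open>8/5\<close> for \<open>i = 0, 2\<close> and \<open>32/5\<close> for \<open>i = 1\<close>.\<close>

section \<open>Covariant points of real quartics\<close>

text \<open>For given \<open>a\<close>, \<open>b\<close>, \<open>c\<close> and a given point,
  covariance is linear in \<open>d\<close> and \<open>e\<close> and determines both; this is why (a,
  b, c, x, Y) are coordinates on the space of quartics. The square \<open>Y\<close> of the imaginary
  part is used because it keeps all formulas polynomial. The obstacle is the cusp: the region is
  unbounded, so lattice points cannot be compared with volume at once. It is cut at Y = m^2, where
  the volume cut off is O(1/m) and the number of forms beyond the cut is O(t^5/m) uniformly in t;
  the limit in t is taken for fixed m, and m is chosen from the tolerance. The count beyond the cut
  rests on \<open>a\<close> being a nonzero integer, which irreducibility guarantees and which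
  forces Y <= 2 t. The open region, after removal of reducible forms, bounds the number of classes
  from below, its compact counterpart together with the cusp from above. Both have the same volume,
  so ties on the boundary never have to be resolved. The constants n_i come out of comparing the c_i
  with the areas in the (I, J)-plane, not from stabilizers.\<close>

text \<open>Substituting \<open>t + x\<close> for \<open>t\<close> turns the coefficients \<open>(a, b, c, d, e)\<close> of a quartic into
  \<open>(a, sB, sC, sD, sE)\<close>. The covariant point \<open>x + \<i> sqrt Y\<close> of the quartic is the point at which the
  translated quartic has \<open>cD\<close> and \<open>cE\<close> as its two last coefficients and \<open>dm > 0\<close>, so that \<open>pD\<close> and \<open>pE\<close>
  are the two last coefficients of the quartic itself; \<open>jc\<close> is the Jacobian of \<open>(x, Y) \<mapsto> (pD, pE)\<close>.\<close>

definition sB :: "real \<Rightarrow> real \<Rightarrow> real \<Rightarrow> real" where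
  "sB x a b = b + 4 * x * a"
definition sC :: "real \<Rightarrow> real \<Rightarrow> real \<Rightarrow> real \<Rightarrow> real" where
  "sC x a b c = c + 3 * x * b + 6 * x^2 * a"
definition sD :: "real \<Rightarrow> real \<Rightarrow> real \<Rightarrow> real \<Rightarrow> real \<Rightarrow> real" where
  "sD x a b c d = d + 2 * x * c + 3 * x^2 * b + 4 * x^3 * a"
definition sE :: "real \<Rightarrow> real \<Rightarrow> real \<Rightarrow> real \<Rightarrow> real \<Rightarrow> real \<Rightarrow> real" where
  "sE x a b c d e = e + x * d + x^2 * c + x^3 * b + x^4 * a"

definition cD :: "nat \<Rightarrow> real \<Rightarrow> real \<Rightarrow> real" where
  "cD i Y b = (if i = 1 then Y * b else - Y * b)"
definition cE :: "nat \<Rightarrow> real \<Rightarrow> real \<Rightarrow> real \<Rightarrow> real" where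
  "cE i Y a c = (if i = 1 then Y * (c - Y * a) else Y^2 * a)"
definition dm :: "nat \<Rightarrow> real \<Rightarrow> real \<Rightarrow> real \<Rightarrow> real \<Rightarrow> real" where
  "dm i Y a b c = (if i = 0 then b^2 - 4 * a * c - 8 * a^2 * Y
     else if i = 1 then b^2 - 4 * a * c + 4 * a^2 * Y else 8 * a^2 * Y + 4 * a * c - b^2)"
definition jc :: "nat \<Rightarrow> real \<Rightarrow> real \<Rightarrow> real \<Rightarrow> real \<Rightarrow> real" where
  "jc i Y a b c = (if i = 1 then 2 * ((c - 2 * Y * a)^2 + Y * b^2) else Y * \<bar>8 * a^2 * Y + 4 * a * c - b^2\<bar>)"

lemma cD_cases: "cD 0 Y b = - Y * b" "cD 1 Y b = Y * b" "cD 2 Y b = - Y * b"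
  by (simp_all add: cD_def)
lemma cE_cases: "cE 0 Y a c = Y^2 * a" "cE 1 Y a c = Y * (c - Y * a)" "cE 2 Y a c = Y^2 * a"
  by (simp_all add: cE_def)
lemma dm_cases: "dm 0 Y a b c = b^2 - 4 * a * c - 8 * a^2 * Y"
  "dm 1 Y a b c = b^2 - 4 * a * c + 4 * a^2 * Y" "dm 2 Y a b c = 8 * a^2 * Y + 4 * a * c - b^2"
  by (simp_all add: dm_def)

definition rI :: "real \<Rightarrow> real \<Rightarrow> real \<Rightarrow> real \<Rightarrow> real \<Rightarrow> real" where
  "rI a b c d e = 12 * a * e - 3 * b * d + c^2"
definition rJ :: "real \<Rightarrow> real \<Rightarrow> real \<Rightarrow> real \<Rightarrow> real \<Rightarrow> real" where
  "rJ a b c d e = 72 * a * c * e + 9 * b * c * d - 27 * a * d^2 - 27 * e * b^2 - 2 * c^3"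

definition pD :: "nat \<Rightarrow> real \<Rightarrow> real \<Rightarrow> real \<Rightarrow> real \<Rightarrow> real \<Rightarrow> real" where
  "pD i x Y a b c = cD i Y (sB x a b) - 2 * x * c - 3 * x^2 * b - 4 * x^3 * a"
definition pE :: "nat \<Rightarrow> real \<Rightarrow> real \<Rightarrow> real \<Rightarrow> real \<Rightarrow> real \<Rightarrow> real" where
  "pE i x Y a b c = cE i Y a (sC x a b c) - x * pD i x Y a b c - x^2 * c - x^3 * b - x^4 * a"

lemma pD_eq_iff: "d = pD i x Y a b c \<longleftrightarrow> sD x a b c d = cD i Y (sB x a b)"
  unfolding pD_def sD_def by auto

lemma pE_eq_iff:
  assumes "d = pD i x Y a b c"
  shows "e = pE i x Y a b c \<longleftrightarrow> sE x a b c d e = cE i Y a (sC x a b c)"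
  unfolding pE_def sE_def assms by auto

lemma sB_add: "sB (x + t) a b = sB t a (sB x a b)"
  unfolding sB_def by (simp add: algebra_simps)
lemma sC_add: "sC (x + t) a b c = sC t a (sB x a b) (sC x a b c)"
  unfolding sB_def sC_def by (simp add: algebra_simps power2_eq_square)
lemma sD_add: "sD (x + t) a b c d = sD t a (sB x a b) (sC x a b c) (sD x a b c d)"
  unfolding sB_def sC_def sD_def by (simp add: algebra_simps power2_eq_square power3_eq_cube)
lemma sE_add: "sE (x + t) a b c d e
    = sE t a (sB x a b) (sC x a b c) (sD x a b c d) (sE x a b c d e)"
  unfolding sB_def sC_def sD_def sE_def
  by (simp add: algebra_simps power2_eq_square power3_eq_cube power4_eq_xxxx)

lemma rI_shift: "rI a (sB x a b) (sC x a b c) (sD x a b c d) (sE x a b c d e) = rI a b c d e"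
  unfolding sB_def sC_def sD_def sE_def rI_def by algebra
lemma rJ_shift: "rJ a (sB x a b) (sC x a b c) (sD x a b c d) (sE x a b c d e) = rJ a b c d e"
  unfolding sB_def sC_def sD_def sE_def rJ_def by algebra

text \<open>For \<open>i = 1\<close> the quartic is t^2 + Y1 times a quadratic with discriminant
  \<open>dm\<close>. A second covariant point is again a non-real root; the quadratic has none
  because \<open>dm\<close> is positive, so it is a root of t^2 + Y1. For the other \<open>i\<close>
  elimination leads to \<open>x\<close> times \<open>dm\<close> being zero.\<close>

lemma covariant_point_unique_base:
  assumes Y: "Y1 > 0" "Y > 0"
    and 1: "d = cD i Y1 b" "e = cE i Y1 a c"
    and 2: "sD x a b c d = cD i Y (sB x a b)" "sE x a b c d e = cE i Y a (sC x a b c)"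
    and dm: "dm i Y1 a b c > 0"
  shows "x = 0 \<and> Y = Y1"
proof (cases "i = 1")
  case True
  define M where "M = 2 * a * x + b"
  define N where "N = a * x^2 + b * x + (c - Y1 * a) - a * Y"
  define L where "L = x^2 - Y + Y1"
  define K where "K = 2 * x"
  have d: "d = Y1 * b" and e: "e = Y1 * (c-Y1 * a)" using 1 True by (auto simp: cD_def cE_def)
  \<comment> \<open>At the point x + i sqrt Y the factor t^2 + Y1 has the value L + i K sqrt Y and
    the quadratic has the value N + i M sqrt Y. \<open>e1\<close> and, up to the factor sqrt Y,
    \<open>e2\<close> are the real and imaginary part of their product.\<close>
  have "L * N - Y * K * M = sE x a b c d e - Y * (sC x a b c - Y * a)"
    unfolding d e sE_def sC_def L_def N_def K_def M_def by algebra
  then have e1: "L * N - Y * K * M = 0" using 2 True by (simp add: cE_def)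
  have "L * M + K * N = sD x a b c d - Y * sB x a b"
    unfolding d e sD_def sB_def L_def N_def K_def M_def by algebra
  then have e2: "L * M + K * N = 0" using 2 True by (simp add: cD_def)
  have "(L^2 + Y * K^2) * (N^2 + Y * M^2) = (L * N - Y * K * M)^2 + Y * (L * M+K * N)^2"
    by algebra
  then have "(L^2 + Y * K^2) * (N^2 + Y * M^2) = 0" using e1 e2 by simp
  then consider "L^2 + Y * K^2 = 0" | "N^2 + Y * M^2 = 0" by auto
  then show ?thesis
  proof cases
    case 1
    have "L^2 \<ge> 0" "Y * K^2 \<ge> 0" using Y by auto
    then have "L^2 = 0" "Y * K^2 = 0" using 1 by linarith+
    then show ?thesis using Y by (auto simp: L_def K_def)
  next
    case 2
    have "N^2 \<ge> 0" "Y * M^2 \<ge> 0" using Y by auto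
    then have "N^2 = 0" "Y * M^2 = 0" using 2 by linarith+
    then have NM: "N = 0" "M = 0" using Y by auto
    have "dm i Y1 a b c = - 4 * a^2 * Y"
      using NM unfolding True dm_cases N_def M_def by algebra
    moreover have "a^2 * Y \<ge> 0" using Y by auto
    ultimately show ?thesis using dm by linarith
  qed
next
  case False
  have c1: "d = - Y1 * b" "e = Y1^2 * a" using 1 False by (auto simp: cD_def cE_def)
  have c2: "- Y1 * b + 2 * x * c + 3 * x^2 * b + 4 * x^3 * a = - Y * (b+4 * x * a)"
    "Y1^2 * a - x * Y1 * b + x^2 * c + x^3 * b+x^4 * a = Y^2 * a"
    using 2 False c1 by (auto simp: cD_def cE_def sD_def sE_def sB_def)
  \<comment> \<open>Twice the second relation minus \<open>x\<close> times the first no longer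
    contains \<open>c\<close>, and it factors.\<close>
  have "(Y1 + x^2 + Y) * (2 * a * (Y1 - x^2 - Y) - x * b) = 0"
    using c2 by algebra
  moreover have "Y1 + x^2 + Y > 0" using Y by (simp add: add_pos_nonneg)
  ultimately have k: "2 * a * (Y1 - x^2 - Y) = x * b" by auto
  have dm': "8 * a^2 * Y1 + 4 * a * c - b^2 \<noteq> 0" using dm False by (auto simp: dm_def split: if_splits)
  have "x * (8 * a^2 * Y1 + 4 * a * c - b^2) = 0" using c2(1) k by algebra
  then have x: "x = 0" using dm' by auto
  have "a * (Y1 - Y) = 0" using k x by auto
  moreover have "a = 0 \<Longrightarrow> b * (Y1 - Y) = 0" using c2(1) x by (simp add: algebra_simps)
  ultimately show ?thesis using x dm' by auto
qed

text \<open>Translation by \<open>x1\<close> moves the first point to real part 0. The sign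
  condition is imposed on this point only.\<close>

lemma covariant_point_unique:
  assumes Y: "Y1 > 0" "Y2 > 0"
    and 1: "sD x1 a b c d = cD i Y1 (sB x1 a b)" "sE x1 a b c d e = cE i Y1 a (sC x1 a b c)"
    and 2: "sD x2 a b c d = cD i Y2 (sB x2 a b)" "sE x2 a b c d e = cE i Y2 a (sC x2 a b c)"
    and dm: "dm i Y1 a (sB x1 a b) (sC x1 a b c) > 0"
  shows "x1 = x2 \<and> Y1 = Y2"
proof -
  have x: "x2 = x1 + (x2 - x1)" by simp
  note 3 = 2[unfolded sB_add[of x1 "x2-x1", folded x] sC_add[of x1 "x2-x1", folded x]
    sD_add[of x1 "x2-x1", folded x] sE_add[of x1 "x2-x1", folded x]]
  from sB_add[of x1 "x2-x1"] sC_add[of x1 "x2-x1"] sD_add[of x1 "x2-x1"] sE_add[of x1 "x2-x1"]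
  have 3: "sD (x2-x1) a (sB x1 a b) (sC x1 a b c) (sD x1 a b c d) = cD i Y2 (sB (x2-x1) a (sB x1 a b))"
     "sE (x2-x1) a (sB x1 a b) (sC x1 a b c) (sD x1 a b c d) (sE x1 a b c d e)
       = cE i Y2 a (sC (x2-x1) a (sB x1 a b) (sC x1 a b c))"
    using 2 by simp_all
  from covariant_point_unique_base[OF Y 1 3 dm] show ?thesis by simp
qed

text \<open>For \<open>i \<noteq> 1\<close> the first invariant is the definite form 12 a^2 + 3 b^2
  + c^2. For \<open>i = 1\<close> it is the indefinite 16 A^2 - 12 w, which by itself bounds
  nothing; there the second invariant, of absolute value 16 A |9 w - 8 A^2|, bounds
  \<open>A\<close>.\<close>

lemma reduced_coeff_bounds_unit:
  assumes i: "\<bar>rI a b c (cD i 1 b) (cE i 1 a c)\<bar> \<le> 1" "\<bar>rJ a b c (cD i 1 b) (cE i 1 a c)\<bar> \<le> 2"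
  shows "\<bar>a\<bar> \<le> 2 \<and> \<bar>b\<bar> \<le> 2 \<and> \<bar>c\<bar> \<le> 2"
proof (cases "i = 1")
  case False
  then have "12 * a^2 + 3 * b^2 + c^2 \<le> 1"
    using i(1) by (simp add: rI_def cD_def cE_def power2_eq_square)
  moreover have "0 \<le> a^2" "0 \<le> b^2" "0 \<le> c^2" by auto
  moreover have four: "(2::real)^2 = 4" by simp
  ultimately have "a^2 \<le> 2^2" "b^2 \<le> 2^2" "c^2 \<le> 2^2" unfolding four by linarith+
  then show ?thesis by (simp add: abs_le_square_iff[symmetric, of _ 2, simplified])
next
  case True
  define A where "A = \<bar>c\<bar> / 2"
  define w where "w = (a - c/2)^2 + (b/2)^2"
  have A2: "A^2 = c^2/4" by (simp add: A_def power_divide)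
  have I: "rI a b c (cD i 1 b) (cE i 1 a c) = 16 * A^2 - 12 * w"
    using True unfolding A2 w_def by (simp add: rI_def cD_def cE_def power2_eq_square algebra_simps)
  have J0: "rJ a b c (cD i 1 b) (cE i 1 a c) = - 8 * c * (9 * w - 8 * A^2)"
    unfolding A2 w_def rJ_def True cD_cases cE_cases
    by (simp add: field_simps power2_eq_square power3_eq_cube)
  have "\<bar>rJ a b c (cD i 1 b) (cE i 1 a c)\<bar> = 16 * A * \<bar>9 * w - 8 * A^2\<bar>"
    unfolding J0 by (simp add: abs_mult A_def)
  then have J: "16 * A * \<bar>9 * w - 8 * A^2\<bar> \<le> 2" using i by simp
  have I': "16 * A^2 - 12 * w \<le> 1" "12 * w - 16 * A^2 \<le> 1" using i(1) unfolding I by linarith+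
  have A0: "A \<ge> 0" by (simp add: A_def)
  have A1: "A \<le> 1/2"
  proof (rule ccontr)
    assume "\<not> ?thesis" then have * : "A > 1/2" by simp
    then have q: "A^2 > 1/4" using power_strict_mono[of "1/2" A 2] by (simp add: power2_eq_square)
    \<comment> \<open>The first invariant keeps w above (16 A^2 - 1)/12, hence 9 w - 8 A^2 >= 4 A^2
      - 3/4 > 1/4.\<close>
    have v: "\<bar>9 * w - 8 * A^2\<bar> > 1/4" using I' q by linarith
    have "(1/2) * (1/4) < A * \<bar>9 * w - 8 * A^2\<bar>"
      by (rule mult_strict_mono) (use * v in auto)
    then show False using J by simp
  qed
  have "A^2 \<le> 1/4" using power_mono[OF A1 A0, of 2] by (simp add: power2_eq_square)
  then have "w \<le> 5/12" using I' by linarith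
  moreover have "0 \<le> (b/2)^2" "0 \<le> (a-c/2)^2" by auto
  ultimately have "(a-c/2)^2 \<le> 1^2" "(b/2)^2 \<le> 1^2" unfolding w_def power_one by linarith+
  then have "\<bar>a - c/2\<bar> \<le> 1" "\<bar>b/2\<bar> \<le> 1" by (simp_all only: abs_le_square_iff[symmetric] abs_one)
  then show ?thesis using A1 unfolding A_def by linarith
qed

text \<open>Scaling the variable by sqrt Y replaces (a, b, c) by (a Y, b sqrt Y, c) and keeps both
  invariants, so Y = 1 suffices. The bounds show how \<open>a\<close> and \<open>b\<close> shrink as
  the covariant point rises into the cusp.\<close>

lemma reduced_coeff_bounds:
  assumes Y: "Y > 0"
    and i: "\<bar>rI a b c (cD i Y b) (cE i Y a c)\<bar> \<le> 1" "\<bar>rJ a b c (cD i Y b) (cE i Y a c)\<bar> \<le> 2"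
  shows "\<bar>a\<bar> * Y \<le> 2" "\<bar>b\<bar> * sqrt Y \<le> 2" "\<bar>c\<bar> \<le> 2"
proof -
  define s where "s = sqrt Y"
  have s: "s > 0" "Y = s^2" using Y by (auto simp: s_def)
  have "rI (a * Y) (b * s) c (cD i 1 (b * s)) (cE i 1 (a * Y) c) = rI a b c (cD i Y b) (cE i Y a c)"
    unfolding rI_def cD_def cE_def s(2) by (auto simp: power2_eq_square algebra_simps)
  moreover have "rJ (a * Y) (b * s) c (cD i 1 (b * s)) (cE i 1 (a * Y) c) = rJ a b c (cD i Y b) (cE i Y a c)"
    unfolding rJ_def cD_def cE_def s(2) by (auto simp: power2_eq_square algebra_simps)
  ultimately have "\<bar>a * Y\<bar> \<le> 2 \<and> \<bar>b * s\<bar> \<le> 2 \<and> \<bar>c\<bar> \<le> 2"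
    using reduced_coeff_bounds_unit[of "a * Y" "b * s" c i] i by simp
  then show "\<bar>a\<bar> * Y \<le> 2" "\<bar>b\<bar> * sqrt Y \<le> 2" "\<bar>c\<bar> \<le> 2"
    using Y s(1) by (simp_all add: abs_mult s_def[symmetric])
qed

section \<open>Real roots and the existence of covariant points\<close>

lemma span_eq_homogeneous_iff:
  "span {(t::real, 1::real)} = span {(s, 1)} \<longleftrightarrow> t = s"
proof
  assume "span {(t::real, 1::real)} = span {(s, 1)}"
  then have "(t, 1) \<in> span {(s, 1::real)}" using span_base[of "(t,1)" "{(t,1)}"] by auto
  then show "t = s" by (auto simp: span_singleton)
qed simp

lemma form_homogeneous: "form f (k * x) (k * y) = k ^ 4 * form f x (y::'a::comm_ring_1)"
  by (cases f) (simp add: algebra_simps power_mult_distrib power2_eq_square power3_eq_cube power4_eq_xxxx)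

text \<open>Since \<open>a\<close> is nonzero, the point [1 : 0] is not a root, so every projective
  root has a representative (t, 1).\<close>

lemma real_roots_eq_image:
  assumes "a \<noteq> 0"
  shows "real_roots (BQF a b c d e)
    = (\<lambda>t. span {(t, 1)}) ` {t::real. form (BQF a b c d e) t 1 = 0}" (is "_ = ?R")
proof
  let ?f = "BQF a b c d e"
  show "?R \<subseteq> real_roots ?f"
  proof
    fix S assume "S \<in> ?R"
    then obtain t :: real where "S = span {(t, 1)}" "form ?f t 1 = 0" by blast
    moreover have "(t, 1::real) \<noteq> (0, 0)" by simp
    ultimately show "S \<in> real_roots ?f" unfolding real_roots_def by blast
  qed
  show "real_roots ?f \<subseteq> ?R"
  proof
    fix S assume "S \<in> real_roots ?f"
    then obtain x y where S: "S = span {(x::real, y)}" "(x,y) \<noteq> (0,0)" "form ?f x y = 0"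
      unfolding real_roots_def by blast
    have y: "y \<noteq> 0"
    proof
      assume "y = 0" then show False using S(2,3) assms by simp
    qed
    have * : "(x, y) = y *\<^sub>R (x/y, 1)" using y by simp
    have "S = span {(x/y, 1)}"
      unfolding S(1) using y
      by (simp add: span_singleton set_eq_iff image_iff)
        (metis divide_inverse mult.assoc mult.commute nonzero_eq_divide_eq)
    moreover have "form ?f (x/y) 1 = 0"
      using form_homogeneous[of ?f y "x/y" 1] S(3) y by simp
    ultimately show "S \<in> ?R" by auto
  qed
qed

lemma card_real_roots:
  assumes "a \<noteq> 0"
  shows "card (real_roots (BQF a b c d e)) = card {t::real. form (BQF a b c d e) t 1 = 0}"
    "finite (real_roots (BQF a b c d e)) \<longleftrightarrow> finite {t::real. form (BQF a b c d e) t 1 = 0}"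
proof -
  have "inj_on (\<lambda>t::real. span {(t, 1::real)}) S" for S
    by (auto simp: inj_on_def span_eq_homogeneous_iff)
  then show "card (real_roots (BQF a b c d e)) = card {t::real. form (BQF a b c d e) t 1 = 0}"
    "finite (real_roots (BQF a b c d e)) \<longleftrightarrow> finite {t::real. form (BQF a b c d e) t 1 = 0}"
    unfolding real_roots_eq_image[OF assms] by (simp_all add: card_image finite_image_iff)
qed

lemma real_quadratic_factor:
  fixes a b c :: real
  assumes "a \<noteq> 0" "b^2 - 4 * a * c > 0"
  obtains r s where "r < s" "b = - a * (r+s)" "c = a * r * s"
proof -
  define D where "D = sqrt (b^2-4 * a * c)"
  have D: "D > 0" "D^2 = b^2-4 * a * c" using assms by (auto simp: D_def)
  define r s where "r = (-b-D)/(2 * a)" and "s = (-b+D)/(2 * a)"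
  have b: "b = - a * (r+s)" using assms(1) by (simp add: r_def s_def field_simps)
  have "a * r * s = (b^2 - D^2)/(4 * a)" using assms(1)
    by (simp add: r_def s_def field_simps power2_eq_square)
  then have c: "c = a * r * s" using D(2) assms(1) by simp
  have "r \<noteq> s" using assms D by (auto simp: r_def s_def)
  then show ?thesis using that[of r s] that[of s r] b c by (cases "r < s") (auto simp: algebra_simps)
qed

text \<open>The translated quartic is \<open>a (t\<^sup>2 - S\<^sub>1 t - Y) (t\<^sup>2 - S\<^sub>2 t - Y)\<close> for \<open>i \<noteq> 1\<close>, where \<open>S\<^sub>1\<close> and \<open>S\<^sub>2\<close>
  are real or complex conjugate according to the sign of \<open>dm\<close>, and it is divisible by \<open>t\<^sup>2 + Y\<close> for \<open>i = 1\<close>.\<close>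

lemma card_roots_of_covariant:
  fixes a b c d e :: real
  assumes Y: "Y > 0" and a: "a \<noteq> 0" and i: "i \<in> {0,1,2}"
    and 1: "sD x a b c d = cD i Y (sB x a b)" "sE x a b c d e = cE i Y a (sC x a b c)"
    and dm: "dm i Y a (sB x a b) (sC x a b c) > 0"
  shows "finite {t. a * t^4+b * t^3+c * t^2+d * t+e = 0} \<and> card {t. a * t^4+b * t^3+c * t^2+d * t+e = 0} = 4 - 2 * i"
proof -
  define B where "B = sB x a b" define C where "C = sC x a b c"
  have "a * (t+x)^4+b * (t+x)^3+c * (t+x)^2+d * (t+x)+e
     = a * t^4 + sB x a b * t^3+sC x a b c * t^2+sD x a b c d * t+sE x a b c d e" for t
    unfolding sB_def sC_def sD_def sE_def by algebra
  then have sh: "a * (t+x)^4+b * (t+x)^3+c * (t+x)^2+d * (t+x)+e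
     = a * t^4 + B * t^3+C * t^2+cD i Y B * t+cE i Y a C" for t
    unfolding 1 B_def C_def .
  have im: "{t. a * t^4+b * t^3+c * t^2+d * t+e = 0} = (\<lambda>t. t + x) ` {t. a * t^4 + B * t^3+C * t^2+cD i Y B * t+cE i Y a C = 0}"
    (is "?S = _ ` ?T")
  proof -
    have "t \<in> ?S \<longleftrightarrow> t - x \<in> ?T" for t using sh[of "t-x"] by simp
    moreover have "t \<in> (\<lambda>t. t + x) ` ?T \<longleftrightarrow> t - x \<in> ?T" for t
      by (metis (no_types, lifting) add_diff_cancel diff_add_cancel image_iff)
    ultimately show ?thesis by blast
  qed
  have "finite ?T \<and> card ?T = 4 - 2 * i"
  proof -
    consider "i = 0" | "i = 1" | "i = 2" using i by auto
    then show ?thesis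
    proof cases
      case 1
      have "(B/a)^2 - 4 * 1 * (C/a + 2 * Y) = (B^2-4 * a * C-8 * a^2 * Y)/a^2"
        using a by (simp add: field_simps power2_eq_square)
      also have "\<dots> > 0" using dm a 1 by (simp add: dm_def B_def C_def)
      finally have "(B/a)^2 - 4 * 1 * (C/a + 2 * Y) > 0" .
      from real_quadratic_factor[OF one_neq_zero this] obtain S1 S2 where
        S: "S1 < S2" "B/a = - 1 * (S1+S2)" "C/a+2 * Y = 1 * S1 * S2" by blast
      have B: "B = -a * (S1+S2)" and C: "C = a * (S1 * S2 - 2 * Y)"
        using S a by (simp_all add: field_simps)
      \<comment> \<open>The roots of t^2 - S t - Y have the negative product -Y, so they are real
        whatever S is.\<close>
      have q: "(-S)^2 - 4 * 1 * (-Y) > 0" for S :: real using Y by (simp add: add_nonneg_pos)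
      obtain r s where r: "r < s" "-S1 = -1 * (r+s)" "-Y = 1 * r * s"
        by (rule real_quadratic_factor[OF one_neq_zero q])
      obtain r' s' where r': "r' < s'" "-S2 = -1 * (r'+s')" "-Y = 1 * r' * s'"
        by (rule real_quadratic_factor[OF one_neq_zero q])
      have fac: "a * t^4 + B * t^3+C * t^2+cD i Y B * t+cE i Y a C = a * (t-r) * (t-s) * ((t-r') * (t-s'))" for t
      proof -
        have "a * t^4 + B * t^3+C * t^2+cD i Y B * t+cE i Y a C = a * (t^2-S1 * t-Y) * (t^2-S2 * t-Y)"
          unfolding 1 B C cD_cases cE_cases by algebra
        also have "t^2-S1 * t-Y = (t-r) * (t-s)" using r(2,3) by algebra
        also have "t^2-S2 * t-Y = (t-r') * (t-s')" using r'(2,3) by algebra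
        finally show ?thesis by (simp add: mult.assoc)
      qed
      have T: "?T = {r,s,r',s'}" unfolding fac using a by auto
      have ne: "t \<notin> {r',s'}" if "t \<in> {r,s}" for t
      proof
        assume "t \<in> {r',s'}"
        then have "(t-r') * (t-s') = 0" by auto
        then have "t^2-S2 * t-Y = 0" using r'(2,3) by algebra
        moreover have "(t-r) * (t-s) = 0" using that by auto
        then have "t^2-S1 * t-Y = 0" using r(2,3) by algebra
        ultimately have "(S1-S2) * t = 0" by algebra
        then have "t = 0" using S by simp
        then show False using \<open>t^2-S1 * t-Y = 0\<close> Y by simp
      qed
      show ?thesis unfolding T using ne[of r] ne[of s] r r' 1 by auto
    next
      case 2
      have "B^2 - 4 * a * (C-a * Y) > 0" using dm 2 by (simp add: dm_def B_def C_def power2_eq_square algebra_simps)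
      from real_quadratic_factor[OF a this] obtain r s where
        r: "r < s" "B = -a * (r+s)" "C - a * Y = a * r * s" by blast
      have fac: "a * t^4 + B * t^3+C * t^2+cD i Y B * t+cE i Y a C = a * ((t-r) * (t-s)) * (t^2+Y)" for t
      proof -
        have "C = a * r * s + a * Y" using r by simp
        then show ?thesis unfolding 2 r(2) cD_cases cE_cases by algebra
      qed
      have "t^2+Y > 0" for t using Y by (simp add: add_nonneg_pos)
      then have "t^2 + Y \<noteq> 0" for t by (metis less_irrefl)
      then have T: "?T = {r,s}" unfolding fac using a by auto
      show ?thesis unfolding T using r 2 by auto
    next
      case 3
      have fac: "4 * a * (a * t^4 + B * t^3+C * t^2+cD i Y B * t+cE i Y a C)
        = (2 * a * t^2+B * t-2 * a * Y)^2 + dm i Y a B C * t^2" for t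
        unfolding 3 dm_cases cD_cases cE_cases by algebra
      have "a * t^4 + B * t^3+C * t^2+cD i Y B * t+cE i Y a C \<noteq> 0" for t
      proof
        assume "a * t^4 + B * t^3+C * t^2+cD i Y B * t+cE i Y a C = 0"
        then have z: "(2 * a * t^2+B * t-2 * a * Y)^2 + dm i Y a B C * t^2 = 0" using fac[of t] by simp
        have "(2 * a * t^2+B * t-2 * a * Y)^2 \<ge> 0" "dm i Y a B C * t^2 \<ge> 0" using dm by (auto simp: B_def C_def)
        then have "dm i Y a B C * t^2 = 0" "(2 * a * t^2+B * t-2 * a * Y)^2 = 0" using z by linarith+
        then have "t = 0" "2 * a * t^2+B * t-2 * a * Y = 0" using dm by (auto simp: B_def C_def)
        then show False using a Y by auto
      qed
      then show ?thesis using 3 by simp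
    qed
  qed
  then show ?thesis unfolding im by (simp add: finite_imageI card_image)
qed

text \<open>\<open>u\<close> and \<open>w\<close> are read off from the top coefficients. What
  remains after subtracting the product is linear in t with two distinct zeros, hence
  vanishes.\<close>

lemma quartic_two_roots_factor:
  fixes a b c d e :: real
  assumes a: "a \<noteq> 0" and r: "r \<noteq> s"
   and "a * r^4+b * r^3+c * r^2+d * r+e = 0" "a * s^4+b * s^3+c * s^2+d * s+e = 0"
  obtains u w where "b = a * (u - (r+s))" "c = a * (w - (r+s) * u + r * s)" "d = a * (r * s * u - (r+s) * w)" "e = a * r * s * w"
proof -
  define u where "u = b/a + (r+s)"
  define w where "w = c/a + (r+s) * u - r * s"
  have b: "b = a * (u - (r+s))" using a by (simp add: u_def)
  have c: "c = a * (w - (r+s) * u + r * s)" using a by (simp add: w_def)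
  have 1: "(d - a * (r * s * u - (r+s) * w)) * t + (e - a * r * s * w) = 0" if "t = r \<or> t = s" for t
  proof -
    have "a * t^4+b * t^3+c * t^2+d * t+e = 0" using assms that by auto
    moreover have "(t-r) * (t-s) = 0" using that by auto
    ultimately show ?thesis unfolding b c by algebra
  qed
  have "(d - a * (r * s * u - (r+s) * w)) * (r - s) = 0" using 1[OF disjI1[OF refl]] 1[OF disjI2[OF refl]] by algebra
  then have d: "d = a * (r * s * u - (r+s) * w)" using r by simp
  then have "e = a * r * s * w" using 1[of r] by simp
  then show ?thesis using that b c d by blast
qed

text \<open>The same division, by (t - x)^2 + y^2; a real linear remainder that vanishes at a
  non-real point is zero.\<close>

lemma quartic_complex_root_factor:
  fixes a b c d e x y :: real
  assumes a: "a \<noteq> 0" and y: "y > 0"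
   and z: "of_real a * Complex x y^4+ of_real b * Complex x y^3+ of_real c * Complex x y^2+ of_real d * Complex x y+ of_real e = 0"
  obtains u w where "b = a * (u - 2 * x)" "c = a * (w - 2 * x * u + (x^2+y^2))"
    "d = a * ((x^2+y^2) * u - 2 * x * w)" "e = a * (x^2+y^2) * w"
proof -
  define u where "u = b/a + 2 * x"
  define w where "w = c/a + 2 * x * u - (x^2+y^2)"
  have b: "b = a * (u - 2 * x)" using a by (simp add: u_def)
  have c: "c = a * (w - 2 * x * u + (x^2+y^2))" using a by (simp add: w_def)
  let ?z = "Complex x y"
  define d' where "d' = d - a * ((x^2+y^2) * u - 2 * x * w)"
  define e' where "e' = e - a * (x^2+y^2) * w"
  have q: "?z^2 = of_real (2 * x) * ?z - of_real (x^2+y^2)"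
    by (simp add: complex_eq_iff power2_eq_square algebra_simps)
  have "of_real a * ?z^4+ of_real b * ?z^3+ of_real c * ?z^2+ of_real d * ?z+ of_real e
    = of_real d' * ?z + of_real e'"
    using q unfolding b c d'_def e'_def of_real_mult of_real_add of_real_diff of_real_power of_real_numeral
    by algebra
  then have "of_real d' * ?z + of_real e' = 0" using z by simp
  then have "d' = 0" "e' = 0" using y by (auto simp: complex_eq_iff)
  then show ?thesis using that[of u w] b c unfolding d'_def e'_def by simp
qed

text \<open>For \<open>i = 1\<close> the point is the non-real root. Otherwise it is the fixed point
  of an involution t -> x - Y/(t - x) that exchanges the roots in pairs, and Y > 0 dictates the
  pairs: four real roots are paired alternately, and with no real roots the two roots in the upper
  half-plane are exchanged.\<close>

lemma covariant_exists:
  fixes a b c d e :: real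
  assumes a: "a \<noteq> 0" and i: "i \<in> {0,1,2}"
   and fin: "finite {t. a * t^4+b * t^3+c * t^2+d * t+e = 0}"
   and card: "card {t. a * t^4+b * t^3+c * t^2+d * t+e = 0} = 4 - 2 * i"
   and sq: "\<And>t. a * t^4+b * t^3+c * t^2+d * t+e = 0 \<Longrightarrow> 4 * a * t^3+3 * b * t^2+2 * c * t+d \<noteq> 0"
  shows "\<exists>x Y. Y > 0 \<and> sD x a b c d = cD i Y (sB x a b) \<and> sE x a b c d e = cE i Y a (sC x a b c)
    \<and> dm i Y a (sB x a b) (sC x a b c) > 0"
proof -
  let ?S = "{t. a * t^4+b * t^3+c * t^2+d * t+e = 0}"
  consider "i = 0" | "i = 1" | "i = 2" using i by auto
  then show ?thesis
  proof cases
    case 1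
    define l where "l = sorted_list_of_set ?S"
    have l: "sorted_wrt (<) l" "length l = 4" "set l = ?S"
      using card fin 1 by (auto simp: l_def)
    then obtain r1 r2 r3 r4 where ll: "l = [r1,r2,r3,r4]"
      by (auto simp: numeral_eq_Suc length_Suc_conv)
    have lt: "r1 < r2" "r2 < r3" "r3 < r4" and S: "?S = {r1,r2,r3,r4}"
      using l unfolding ll by auto
    have root: "a * t^4+b * t^3+c * t^2+d * t+e = 0" if "t \<in> {r1,r2,r3,r4}" for t using that S by blast
    obtain u w where uw: "b = a * (u - (r1+r3))" "c = a * (w - (r1+r3) * u + r1 * r3)"
        "d = a * (r1 * r3 * u - (r1+r3) * w)" "e = a * r1 * r3 * w"
      using quartic_two_roots_factor[OF a, of r1 r3 b c d e] root lt by auto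
    have q: "t^2+u * t+w = 0" if t: "t = r2 \<or> t = r4" for t
    proof -
      have "a * (t-r1) * (t-r3) * (t^2+u * t+w) = a * t^4+b * t^3+c * t^2+d * t+e"
        unfolding uw by algebra
      also have "\<dots> = 0" using root[of t] t by auto
      finally have "a * (t-r1) * (t-r3) * (t^2+u * t+w) = 0" .
      moreover have "t - r1 \<noteq> 0" "t - r3 \<noteq> 0" using t lt by auto
      ultimately show ?thesis using a by simp
    qed
    have "(u + r2 + r4) * (r2-r4) = 0" using q[OF disjI1[OF refl]] q[OF disjI2[OF refl]] by algebra
    then have u: "u = - (r2+r4)" using lt by simp
    have w: "w = r2 * r4" using q[OF disjI1[OF refl]] unfolding u by (simp add: algebra_simps power2_eq_square)
    define D where "D = r2 + r4 - (r1+r3)"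
    have D: "D > 0" using lt by (simp add: D_def)
    \<comment> \<open>At this \<open>x\<close> the products (r1 - x)(r3 - x) and (r2 - x)(r4 - x)
      agree. Their common value is -Y, negative because \<open>x\<close> lies between
      \<open>r1\<close> and \<open>r3\<close>.\<close>
    define x where "x = (r2 * r4 - r1 * r3)/D"
    define Y where "Y = - ((r1-x) * (r3-x))"
    have xD: "x * D = r2 * r4 - r1 * r3" using D by (simp add: x_def)
    have "(x-r1) * D = (r2-r1) * (r4-r1)" using xD unfolding D_def by (simp add: algebra_simps)
    moreover have "(r2-r1) * (r4-r1) > 0" using lt by simp
    ultimately have x1: "x - r1 > 0" using D by (metis zero_less_mult_pos2)
    have "(r3-x) * D = (r3-r2) * (r4-r3)" using xD unfolding D_def by (simp add: algebra_simps)
    moreover have "(r3-r2) * (r4-r3) > 0" using lt by simp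
    ultimately have x2: "r3 - x > 0" using D by (metis zero_less_mult_pos2)
    have Y: "Y > 0" using x1 x2 unfolding Y_def by (simp add: mult_neg_pos)
    have Y2: "Y = - ((r2-x) * (r4-x))" using xD unfolding Y_def D_def by (simp add: algebra_simps)
    have uw4: "e = a * (r1 * r3) * w" using uw(4) by simp
    define S1 S2 where "S1 = r1+r3-2 * x" and "S2 = r2+r4-2 * x"
    have p1: "r1 * r3 = -Y + x * (S1 + 2 * x) - x^2" unfolding Y_def S1_def by algebra
    have p2: "r2 * r4 = -Y + x * (S2 + 2 * x) - x^2" unfolding Y2 S2_def by algebra
    have s1: "r1+r3 = S1 + 2 * x" "r2+r4 = S2+2 * x" unfolding S1_def S2_def by auto
    have B: "sB x a b = - a * (S1+S2)" unfolding sB_def uw(1) u s1 by algebra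
    have C: "sC x a b c = a * (S1 * S2 - 2 * Y)" unfolding sC_def uw(1,2) u w s1 p1 p2 by algebra
    have "sD x a b c d = cD i Y (sB x a b)"
      unfolding 1 B unfolding cD_cases sD_def uw(1-3) u w s1 p1 p2 by algebra
    moreover have "sE x a b c d e = cE i Y a (sC x a b c)"
      unfolding 1 cE_cases sE_def uw(1-3) uw4 u w s1 p1 p2 by algebra
    moreover have "dm i Y a (sB x a b) (sC x a b c) > 0"
    proof -
      have "dm i Y a (sB x a b) (sC x a b c) = a^2 * (S2-S1)^2"
        unfolding 1 B C dm_cases by algebra
      moreover have "S2 - S1 > 0" using D unfolding S1_def S2_def D_def by simp
      ultimately show ?thesis using a by simp
    qed
    ultimately show ?thesis using Y by blast
  next
    case 2
    then have "card ?S = 2" using card by simp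
    then obtain r s where S: "?S = {r,s}" "r \<noteq> s" by (auto simp: card_2_iff)
    have root: "a * t^4+b * t^3+c * t^2+d * t+e = 0" if "t \<in> {r,s}" for t using that S by blast
    obtain u w where uw: "b = a * (u - (r+s))" "c = a * (w - (r+s) * u + r * s)"
        "d = a * (r * s * u - (r+s) * w)" "e = a * r * s * w"
      using quartic_two_roots_factor[OF a S(2), of b c d e] root by auto
    have ev: "a * t^4+b * t^3+c * t^2+d * t+e = a * ((t-r) * (t-s)) * (t^2+u * t+w)" for t
      unfolding uw by algebra
    \<comment> \<open>\<open>r\<close> and \<open>s\<close> are all the real roots, so a real zero
      of the remaining factor would be one of them and hence a double root.\<close>
    have nr: "t^2+u * t+w \<noteq> 0" for t
    proof
      assume 0: "t^2+u * t+w = 0"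
      then have "t \<in> ?S" using ev[of t] by simp
      then have t: "t = r \<or> t = s" using S by auto
      have "4 * a * t^3+3 * b * t^2+2 * c * t+d
         = a * ((t-r)+(t-s)) * (t^2+u * t+w) + a * ((t-r) * (t-s)) * (2 * t+u)" unfolding uw by algebra
      then have "4 * a * t^3+3 * b * t^2+2 * c * t+d = 0" using 0 t by auto
      then show False using sq \<open>t \<in> ?S\<close> by blast
    qed
    define x where "x = - u/2"
    define Y where "Y = w - x^2"
    have Y: "Y > 0"
    proof (rule ccontr)
      assume "\<not> Y > 0"
      then have "(x + sqrt (-Y))^2 + u * (x+sqrt (-Y)) + w = 0"
        unfolding power2_sum by (simp add: x_def Y_def algebra_simps power2_eq_square)
      then show False using nr by blast
    qed
    have u: "u = -2 * x" and w: "w = Y + x^2" by (auto simp: x_def Y_def)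
    have "sD x a b c d = cD i Y (sB x a b)"
      unfolding 2 cD_cases sD_def sB_def uw(1-3) u w by algebra
    moreover have "sE x a b c d e = cE i Y a (sC x a b c)"
      unfolding 2 cE_cases sE_def sC_def uw u w by algebra
    moreover have "dm i Y a (sB x a b) (sC x a b c) > 0"
    proof -
      have "dm i Y a (sB x a b) (sC x a b c) = a^2 * (r-s)^2"
        unfolding 2 sB_def sC_def uw(1,2) u w dm_cases by algebra
      then show ?thesis using a S by simp
    qed
    ultimately show ?thesis using Y by blast
  next
    case 3
    then have nr: "a * t^4+b * t^3+c * t^2+d * t+e \<noteq> 0" for t using card fin by auto
    define p where "p = [:of_real e, of_real d, of_real c, of_real b, of_real a :: complex:]"
    have "degree p = 4" unfolding p_def using a by simp
    then have "\<not> constant (poly p)" by (simp add: constant_degree)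
    from fundamental_theorem_of_algebra[OF this] obtain z where z: "poly p z = 0" by blast
    have pe: "poly p z = of_real a * z^4+ of_real b * z^3+ of_real c * z^2+ of_real d * z+ of_real e" for z
      unfolding p_def by (simp add: algebra_simps power2_eq_square power3_eq_cube power4_eq_xxxx)
    have imz: "Im z \<noteq> 0"
    proof
      assume "Im z = 0"
      then have "z = of_real (Re z)" by (simp add: complex_eq_iff)
      moreover have "poly p (of_real t) = of_real (a * t^4+b * t^3+c * t^2+d * t+e)" for t
        unfolding pe by simp
      ultimately have "of_real (a * Re z^4+b * Re z^3+c * Re z^2+d * Re z+e) = (0::complex)" using z by metis
      then show False using nr[of "Re z"] by (simp only: of_real_eq_0_iff)
    qed
    have "poly p (cnj z) = cnj (poly p z)" unfolding pe by simp
    then have zc: "poly p (cnj z) = 0" using z by simp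
    define x1 where "x1 = Re z" define y1 where "y1 = \<bar>Im z\<bar>"
    have y1: "y1 > 0" using imz by (simp add: y1_def)
    have "poly p (Complex x1 y1) = 0"
    proof (cases "Im z > 0")
      case True
      then have "Complex x1 y1 = z" by (simp add: complex_eq_iff x1_def y1_def)
      then show ?thesis using z by simp
    next
      case False
      then have "Complex x1 y1 = cnj z" by (simp add: complex_eq_iff x1_def y1_def)
      then show ?thesis using zc by simp
    qed
    then obtain u w where uw: "b = a * (u - 2 * x1)" "c = a * (w - 2 * x1 * u + (x1^2+y1^2))"
       "d = a * ((x1^2+y1^2) * u - 2 * x1 * w)" "e = a * (x1^2+y1^2) * w"
      using quartic_complex_root_factor[OF a y1] unfolding pe by blast
    have ev: "a * t^4+b * t^3+c * t^2+d * t+e = a * ((t-x1)^2+y1^2) * (t^2+u * t+w)" for t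
      unfolding uw by algebra
    have nq: "t^2+u * t+w \<noteq> 0" for t using nr[of t] ev[of t] by auto
    define x2 where "x2 = - u/2"
    define y2 where "y2 = sqrt (w - x2^2)"
    have "w - x2^2 > 0"
    proof (rule ccontr)
      assume "\<not> w - x2^2 > 0"
      then have "(x2 + sqrt (x2^2-w))^2 + u * (x2+sqrt (x2^2-w)) + w = 0"
        unfolding power2_sum by (simp add: x2_def algebra_simps power2_eq_square)
      then show False using nq by blast
    qed
    then have y2: "y2 > 0" "y2^2 = w - x2^2" by (auto simp: y2_def)
    have u: "u = -2 * x2" and w: "w = y2^2 + x2^2" using y2 by (auto simp: x2_def)
    \<comment> \<open>\<open>x\<close> and \<open>Y\<close> are made such that (z1 - x)(z2 - x) = -Y
      for the roots z1 = x1 + i y1 and z2 = x2 + i y2. Thus x + i sqrt Y is the hyperbolic midpoint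
      of the two roots.\<close>
    define m where "m = (x1-x2)/(y1+y2)"
    define x where "x = x1 - m * y1"
    have mm: "m * (y1+y2) = x1 - x2" using y1 y2 by (simp add: m_def)
    have xs: "x1 = x + m * y1" "x2 = x - m * y2" using mm unfolding x_def by (auto simp: algebra_simps)
    define Y where "Y = y1 * y2 * (1+m^2)"
    have Y: "Y > 0" using y1 y2 unfolding Y_def by (simp add: add_pos_nonneg)
    have "sD x a b c d = cD i Y (sB x a b)"
      unfolding 3 cD_cases sD_def sB_def uw(1-3) u w xs Y_def by algebra
    moreover have "sE x a b c d e = cE i Y a (sC x a b c)"
      unfolding 3 cE_cases sE_def sC_def uw u w xs Y_def by algebra
    moreover have "dm i Y a (sB x a b) (sC x a b c) > 0"
    proof -
      have "dm i Y a (sB x a b) (sC x a b c) = 4 * a^2 * (y1+y2)^2"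
        unfolding 3 sB_def sC_def uw(1,2) u w xs dm_cases Y_def by algebra
      then show ?thesis using a y1 y2 by simp
    qed
    ultimately show ?thesis using Y by blast
  qed
qed

section \<open>The action of integral matrices\<close>

text \<open>The matrix has the rows (p, q) and (r, s). Coefficients are written out so that the
  effect on invariants and on factorizations is a polynomial identity.\<close>

fun act :: "int \<Rightarrow> int \<Rightarrow> int \<Rightarrow> int \<Rightarrow> bqf \<Rightarrow> bqf" where
  "act p q r s (BQF a b c d e) = BQF
     (a * p^4 + b * p^3 * q + c * p^2 * q^2 + d * p * q^3 + e * q^4)
     (4 * a * p^3 * r + b * (3 * p^2 * q * r + p^3 * s) + c * (2 * p * q^2 * r + 2 * p^2 * q * s) + d * (q^3 * r + 3 * p * q^2 * s) + 4 * e * q^3 * s)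
     (6 * a * p^2 * r^2 + b * (3 * p * q * r^2 + 3 * p^2 * r * s) + c * (p^2 * s^2 + 4 * p * q * r * s + q^2 * r^2) + d * (3 * p * q * s^2 + 3 * q^2 * r * s) + 6 * e * q^2 * s^2)
     (4 * a * p * r^3 + b * (q * r^3 + 3 * p * r^2 * s) + c * (2 * p * r * s^2 + 2 * q * r^2 * s) + d * (p * s^3 + 3 * q * r * s^2) + 4 * e * q * s^3)
     (a * r^4 + b * r^3 * s + c * r^2 * s^2 + d * r * s^3 + e * s^4)"

lemma form_act:
  "form (act p q r s f) u v
   = form f (of_int p * u + of_int r * v) (of_int q * u + of_int s * (v::'a::comm_ring_1))"
proof (cases f)
  case (BQF a b c d e)
  show ?thesis unfolding BQF
    by (simp add: algebra_simps power2_eq_square power3_eq_cube power4_eq_xxxx)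
qed

text \<open>Invertibility over the integers means determinant 1 or -1, and equal values on integer
  points mean equal coefficients. The inverse is \<open>D\<close> times the adjugate because D^2 =
  1.\<close>

lemma GL2Z_rel_iff_act:
  "(f, g) \<in> GL2Z_rel \<longleftrightarrow> (\<exists>p q r s. \<bar>p * s - q * r\<bar> = 1 \<and> g = act p q r s f)"
proof
  assume "(f, g) \<in> GL2Z_rel"
  then obtain \<gamma> :: "int ^ 2 ^ 2" where \<gamma>: "invertible \<gamma>"
    and eq: "\<And>v. form g (v $ 1) (v $ 2) = form f ((v v* \<gamma>) $ 1) ((v v* \<gamma>) $ 2)"
    unfolding GL2Z_rel_def by blast
  obtain \<delta> where \<delta>: "\<gamma> ** \<delta> = mat 1" using \<gamma> unfolding invertible_def by blast
  have "det \<gamma> * det \<delta> = 1" using \<delta> by (metis det_I det_mul)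
  then have "\<bar>det \<gamma>\<bar> = 1" using zmult_eq_1_iff by (metis abs_1 abs_minus_cancel)
  then have det: "\<bar>\<gamma>$1$1 * \<gamma>$2$2 - \<gamma>$1$2 * \<gamma>$2$1\<bar> = 1" by (simp add: det_2)
  have "g = act (\<gamma>$1$1) (\<gamma>$1$2) (\<gamma>$2$1) (\<gamma>$2$2) f"
  proof (rule form_int_inject)
    fix x y :: int
    show "form g x y = form (act (\<gamma>$1$1) (\<gamma>$1$2) (\<gamma>$2$1) (\<gamma>$2$2) f) x y"
      using eq[of "vector [x, y]"] unfolding form_act
      by (simp add: vector_matrix_mult_def sum_2 mult.commute)
  qed
  then show "\<exists>p q r s. \<bar>p * s - q * r\<bar> = 1 \<and> g = act p q r s f" using det by blast
next
  assume "\<exists>p q r s. \<bar>p * s - q * r\<bar> = 1 \<and> g = act p q r s f"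
  then obtain p q r s where d: "\<bar>p * s - q * r\<bar> = 1" and g: "g = act p q r s f" by blast
  define \<gamma> :: "int ^ 2 ^ 2" where "\<gamma> = vector [vector [p, q], vector [r, s]]"
  define D where "D = p * s - q * r"
  have DD: "D * D = 1" using d unfolding D_def[symmetric] by (metis abs_mult_self_eq mult_1)
  define \<delta> :: "int ^ 2 ^ 2" where "\<delta> = vector [vector [D * s, - D * q], vector [- D * r, D * p]]"
  have "\<gamma> ** \<delta> = mat 1 \<and> \<delta> ** \<gamma> = mat 1"
    using DD unfolding \<gamma>_def \<delta>_def
    by (simp add: matrix_matrix_mult_def mat_def vec_eq_iff forall_2 sum_2 D_def algebra_simps)
  then have "invertible \<gamma>" unfolding invertible_def by blast
  moreover have "form g (v $ 1) (v $ 2) = form f ((v v* \<gamma>) $ 1) ((v v* \<gamma>) $ 2)" for v :: "int ^ 2"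
    unfolding g form_act by (simp add: vector_matrix_mult_def sum_2 mult.commute \<gamma>_def)
  ultimately show "(f, g) \<in> GL2Z_rel" unfolding GL2Z_rel_def by blast
qed

lemma inv_I_act: "inv_I (act p q r s f) = (p * s - q * r)^4 * inv_I f"
proof (cases f)
  case (BQF a b c d e)
  show ?thesis unfolding BQF act.simps inv_I.simps by algebra
qed

lemma inv_J_act: "inv_J (act p q r s f) = (p * s - q * r)^6 * inv_J f"
proof (cases f)
  case (BQF a b c d e)
  show ?thesis unfolding BQF act.simps inv_J.simps by algebra
qed

text \<open>The polarization of a form, evaluated at \<open>(z, z, z, w)\<close>. At \<open>w = z\<close> it is four times the form;
  at \<open>w = cnj z\<close> its vanishing means that the part of weight 2 of the form under the rotations
  around \<open>z\<close> vanishes.\<close>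

primrec polar :: "bqf \<Rightarrow> complex \<Rightarrow> complex \<Rightarrow> complex \<Rightarrow> complex \<Rightarrow> complex" where
  "polar (BQF a b c d e) z1 z2 w1 w2 = 4 * of_int a * z1^3 * w1
     + of_int b * (z1^3 * w2 + 3 * z1^2 * z2 * w1) + 2 * of_int c * (z1^2 * z2 * w2 + z1 * z2^2 * w1)
     + of_int d * (3 * z1 * z2^2 * w2 + z2^3 * w1) + 4 * of_int e * z2^3 * w2"

lemma polar_act: "polar (act p q r s f) z1 z2 w1 w2
  = polar f (of_int p * z1 + of_int r * z2) (of_int q * z1 + of_int s * z2)
      (of_int p * w1 + of_int r * w2) (of_int q * w1 + of_int s * w2)"
proof (cases f)
  case (BQF a b c d e)
  show ?thesis unfolding BQF act.simps polar.simps of_int_add of_int_mult of_int_power of_int_numeral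
    by algebra
qed

lemma polar_homogeneous: "polar f (k * z1) (k * z2) (l * w1) (l * w2) = k^3 * l * polar f z1 z2 w1 w2"
  by (cases f) (simp add: algebra_simps power2_eq_square power3_eq_cube)

lemma polar_cnj: "polar f (cnj z1) (cnj z2) (cnj w1) (cnj w2) = cnj (polar f z1 z2 w1 w2)"
  by (cases f) simp

definition mate :: "nat \<Rightarrow> complex \<Rightarrow> complex" where
  "mate i z = (if i = 1 then z else cnj z)"

text \<open>The two real conditions on the last coefficients become one complex equation, whose
  equivariance under matrices can be read off from the polarization. The sign condition on
  \<open>dm\<close> is kept separate.\<close>

definition is_cov :: "nat \<Rightarrow> bqf \<Rightarrow> complex \<Rightarrow> bool" where
  "is_cov i f z \<longleftrightarrow> polar f z 1 (mate i z) 1 = 0"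

lemma is_cov_cnj: "is_cov i f (cnj z) \<longleftrightarrow> is_cov i f z"
  using polar_cnj[of f z 1 "mate i z" 1] by (simp add: is_cov_def mate_def split: if_splits)

text \<open>Up to nonzero factors, the two real conditions are the real and imaginary parts of the
  polarization.\<close>

lemma is_cov_iff:
  assumes y: "y > 0"
  shows "is_cov i (BQF a b c d e) (Complex x y) \<longleftrightarrow>
    sD x a b c d = cD i (y^2) (sB x a b) \<and> sE x a b c d e = cE i (y^2) a (sC x a b c)"
proof (cases "i = 1")
  case True
  have "Re (polar (BQF a b c d e) (Complex x y) 1 (Complex x y) 1)
     = 4 * (sE x a b c d e - y^2 * (sC x a b c - y^2 * a))"
    by (simp add: sE_def sC_def power2_eq_square power3_eq_cube power4_eq_xxxx algebra_simps)
  moreover have "Im (polar (BQF a b c d e) (Complex x y) 1 (Complex x y) 1)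
     = 4 * y * (sD x a b c d - y^2 * sB x a b)"
    by (simp add: sD_def sB_def power2_eq_square power3_eq_cube power4_eq_xxxx algebra_simps)
  ultimately show ?thesis using y True
    unfolding is_cov_def mate_def complex_eq_iff by (simp add: cD_def cE_def) auto
next
  case False
  have "Re (polar (BQF a b c d e) (Complex x y) 1 (cnj (Complex x y)) 1)
     = 4 * (sE x a b c d e - (y^2)^2 * a) - 4 * 0"
    by (simp add: sE_def sC_def power2_eq_square power3_eq_cube power4_eq_xxxx algebra_simps)
  moreover have "Im (polar (BQF a b c d e) (Complex x y) 1 (cnj (Complex x y)) 1)
     = 2 * y * (sD x a b c d + y^2 * sB x a b)"
    by (simp add: sD_def sB_def power2_eq_square power3_eq_cube power4_eq_xxxx algebra_simps)
  ultimately show ?thesis using y False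
    unfolding is_cov_def mate_def complex_eq_iff by (simp add: cD_def cE_def) auto
qed

text \<open>Determinant \<open>-1\<close> exchanges the half-planes, so \<open>GL\<^sub>2\<close> acts on the upper one by \<open>moeb\<close> followed by \<open>upper\<close>.\<close>

definition moeb :: "int \<Rightarrow> int \<Rightarrow> int \<Rightarrow> int \<Rightarrow> complex \<Rightarrow> complex" where
  "moeb p q r s z = (z * of_int s - of_int r) / (of_int p - z * of_int q)"

definition upper :: "complex \<Rightarrow> complex" where
  "upper z = (if Im z < 0 then cnj z else z)"

section \<open>The action on the upper half-plane and its fundamental domain\<close>

lemma moeb_denom_nonzero:
  assumes "\<bar>p * s - q * r\<bar> = 1" "Im z \<noteq> 0"
  shows "of_int p - z * of_int q \<noteq> (0::complex)"
proof
  assume 0: "of_int p - z * of_int q = (0::complex)"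
  then have "Im z * of_int q = 0" by (simp add: complex_eq_iff)
  then have "q = 0" using assms by simp
  moreover then have "p = 0" using 0 by simp
  ultimately show False using assms by simp
qed

text \<open>The matrix sends the vector (\<open>moeb p q r s z\<close>, 1) to D/m times (z, 1), and
  the conjugate vector to the conjugate multiple. The polarization is homogeneous, so the two
  equations differ by a nonzero factor.\<close>

lemma is_cov_act:
  assumes d: "\<bar>p * s - q * r\<bar> = 1" and z: "Im z \<noteq> 0"
  shows "is_cov i (act p q r s f) (moeb p q r s z) \<longleftrightarrow> is_cov i f z"
proof -
  define D where "D = p * s - q * r"
  have "D \<noteq> 0" using d by (auto simp: D_def)
  then have D: "of_int D \<noteq> (0::complex)" by simp
  define m where "m = of_int p - z * of_int q"
  have m: "m \<noteq> 0" using moeb_denom_nonzero[OF d z] by (simp add: m_def)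
  have 1: "of_int p * moeb p q r s z + of_int r * 1 = (of_int D / m) * z"
    "of_int q * moeb p q r s z + of_int s * 1 = (of_int D / m) * 1"
    using m unfolding moeb_def m_def[symmetric] by (simp_all add: field_simps) (simp_all add: m_def D_def algebra_simps)
  have 2: "of_int p * cnj (moeb p q r s z) + of_int r * 1 = cnj (of_int D / m) * cnj z"
    "of_int q * cnj (moeb p q r s z) + of_int s * 1 = cnj (of_int D / m) * 1"
    using arg_cong[OF 1(1), of cnj] arg_cong[OF 1(2), of cnj] by simp_all
  show ?thesis
  proof (cases "i = 1")
    case True
    then show ?thesis unfolding is_cov_def polar_act mate_def 1 if_P[OF True] polar_homogeneous
      using D m by simp
  next
    case False
    then show ?thesis unfolding is_cov_def polar_act mate_def if_not_P[OF False] 1 2 polar_homogeneous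
      using D m by simp
  qed
qed

lemma is_cov_upper: "is_cov i f (upper z) \<longleftrightarrow> is_cov i f z"
  by (simp add: upper_def is_cov_cnj)

lemma norm_denom: "norm (of_int p - z * of_int q)^2 = (of_int p - Re z * of_int q)^2 + (Im z)^2 * of_int q^2"
  by (simp add: cmod_power2 power_mult_distrib)

lemma Im_moeb:
  assumes d: "\<bar>p * s - q * r\<bar> = 1" and z: "Im z \<noteq> 0"
  shows "\<bar>Im (moeb p q r s z)\<bar> = \<bar>Im z\<bar> / norm (of_int p - z * of_int q)^2"
proof -
  let ?m = "of_int p - z * of_int q"
  have m: "?m \<noteq> 0" using moeb_denom_nonzero[OF d z] .
  have "u / v = u * cnj v / of_real (norm v ^ 2)" if "v \<noteq> 0" for u v :: complex
    using that unfolding complex_norm_square by simp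
  from this[OF m] have "moeb p q r s z = (z * of_int s - of_int r) * cnj ?m / of_real (norm ?m ^ 2)"
    unfolding moeb_def .
  then have "Im (moeb p q r s z) = Im ((z * of_int s - of_int r) * cnj ?m) / norm ?m ^ 2"
    by (metis Im_divide_of_real)
  also have "Im ((z * of_int s - of_int r) * cnj ?m) = Im z * of_int (p * s - q * r)"
    by (simp add: algebra_simps)
  also have "\<bar>Im z * of_int (p * s - q * r) / norm ?m ^ 2\<bar> = \<bar>Im z\<bar> * of_int \<bar>p * s - q * r\<bar> / norm ?m ^ 2"
    by (simp only: abs_divide abs_mult abs_power2 abs_power_minus of_int_abs abs_norm_cancel power_abs)
  finally show ?thesis using d by simp
qed

lemma finite_norm_denom_le:
  assumes z: "Im z > 0"
  shows "finite {(p::int, q::int). norm (of_int p - z * of_int q) \<le> R}"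
proof (rule finite_subset)
  define N where "N = \<lceil>\<bar>R\<bar> / Im z\<rceil>"
  define M where "M = \<lceil>\<bar>R\<bar> + \<bar>Re z\<bar> * of_int N\<rceil>"
  show "{(p::int, q::int). norm (of_int p - z * of_int q) \<le> R} \<subseteq> {-M..M} \<times> {-N..N}"
  proof clarify
    fix p q :: int
    assume n: "norm (of_int p - z * of_int q) \<le> R"
    have "\<bar>Im z * of_int q\<bar> \<le> R" using abs_Im_le_cmod[of "of_int p - z * of_int q"] n by simp
    then have "\<bar>of_int q\<bar> \<le> \<bar>R\<bar> / Im z" using z by (simp add: field_simps abs_mult)
    also have "\<dots> \<le> of_int N" by (simp add: N_def)
    finally have q: "of_int \<bar>q\<bar> \<le> (of_int N :: real)" by simp
    then have q': "\<bar>q\<bar> \<le> N" by (simp only: of_int_le_iff)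
    have "\<bar>of_int p - Re z * of_int q\<bar> \<le> R" using abs_Re_le_cmod[of "of_int p - z * of_int q"] n by simp
    then have "\<bar>of_int p\<bar> \<le> \<bar>R\<bar> + \<bar>Re z\<bar> * \<bar>of_int q\<bar>" by (simp add: abs_mult[symmetric])
    also have "\<dots> \<le> \<bar>R\<bar> + \<bar>Re z\<bar> * of_int N" using q by (intro add_left_mono mult_left_mono) auto
    also have "\<dots> \<le> of_int M" by (simp add: M_def)
    finally have "of_int \<bar>p\<bar> \<le> (of_int M :: real)" by simp
    then have "\<bar>p\<bar> \<le> M" by (simp only: of_int_le_iff)
    then show "p \<in> {-M..M} \<and> q \<in> {-N..N}" using q' by auto
  qed
qed simp

text \<open>The classical reduction: the row (p, q) minimizes |p - z q|, which maximizes the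
  imaginary part; the other row is adjusted by rounding the real part. Changing the sign of the
  first row reflects the point in the imaginary axis, which makes the real part nonnegative.\<close>

lemma fundamental_domain_exists:
  assumes z: "Im z > 0"
  shows "\<exists>p q r s. \<bar>p * s - q * r\<bar> = 1 \<and> 0 \<le> Re (upper (moeb p q r s z))
    \<and> Re (upper (moeb p q r s z)) \<le> 1/2 \<and> 1 \<le> norm (upper (moeb p q r s z))"
proof -
  let ?n = "\<lambda>p q. norm (of_int p - z * of_int q)"
  define S where "S = {(p, q). (\<exists>r s. \<bar>p * s - q * r\<bar> = 1) \<and> ?n p q \<le> 1}"
  have "finite S" by (rule finite_subset[OF _ finite_norm_denom_le[OF z, of 1]]) (auto simp: S_def)
  moreover have "(1, 0) \<in> S" unfolding S_def by (auto intro: exI[of _ 1])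
  ultimately obtain pq where pq: "pq \<in> S" "\<And>v. v \<in> S \<Longrightarrow> ?n (fst pq) (snd pq) \<le> ?n (fst v) (snd v)"
    using ex_min_if_finite[of "(\<lambda>v. ?n (fst v) (snd v)) ` S"] by (metis (no_types, lifting) empty_iff
      finite_imageI imageE image_eqI linorder_not_less)
  obtain p q where pqe: "pq = (p, q)" by (cases pq)
  \<comment> \<open>The row (1, 0) has norm 1, so the minimum over the finitely many rows of norm at
    most 1 is a minimum over all primitive rows.\<close>
  have min: "?n p q \<le> ?n p' q'" if "\<bar>p' * s' - q' * r'\<bar> = 1" for p' q' r' s'
  proof (cases "?n p' q' \<le> 1")
    case True
    then have "(p', q') \<in> S" using that unfolding S_def by blast
    then show ?thesis using pq(2)[of "(p', q')"] pqe by simp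
  next
    case False
    then show ?thesis using pq(1) pqe by (auto simp: S_def)
  qed
  from pq(1) obtain r0 s0 where d0: "\<bar>p * s0 - q * r0\<bar> = 1" unfolding S_def pqe by blast
  have m: "of_int p - z * of_int q \<noteq> (0::complex)" using moeb_denom_nonzero[OF d0] z by simp
  define k where "k = round (Re (moeb p q r0 s0 z))"
  define r s where "r = r0 + k * p" and "s = s0 + k * q"
  have d: "p * s - q * r = p * s0 - q * r0" unfolding r_def s_def by (simp add: algebra_simps)
  have mo: "moeb p q r s z = moeb p q r0 s0 z - of_int k"
    using m unfolding moeb_def r_def s_def by (simp add: field_simps)
  have neg: "moeb (-p) (-q) r s z = - moeb p q r s z"
    using m unfolding moeb_def by (simp add: minus_divide_right)
  have "\<bar>Re (moeb p q r s z)\<bar> \<le> 1/2"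
    unfolding mo k_def using of_int_round_abs_le[of "Re (moeb p q r0 s0 z)"] by (simp add: abs_minus_commute)
  moreover have "norm (moeb p q r s z) \<ge> 1"
  proof -
    \<comment> \<open>(r, s) is itself a row of a unimodular matrix, so minimality applies to it;
      the quotient of the two norms is the absolute value of the image point.\<close>
    have "?n p q \<le> ?n r s" by (rule min[of r q s p]) (use d d0 in \<open>simp add: algebra_simps\<close>)
    moreover have "norm (moeb p q r s z) = ?n r s / ?n p q"
      unfolding moeb_def by (simp add: norm_divide norm_minus_commute)
    ultimately show ?thesis using m by simp
  qed
  moreover have "\<bar>(-p) * s - (-q) * r\<bar> = 1"
  proof -
    have "(-p) * s - (-q) * r = - (p * s - q * r)" by simp
    then show ?thesis using d d0 by (metis abs_minus_cancel)
  qed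
  moreover have "Re (upper w) = Re w" "norm (upper w) = norm w" for w by (auto simp: upper_def)
  ultimately show ?thesis using d d0 neg
    by (cases "Re (moeb p q r s z) \<ge> 0")
      (rule exI[of _ p], rule exI[of _ q], rule exI[of _ r], rule exI[of _ s], simp,
       rule exI[of _ "-p"], rule exI[of _ "-q"], rule exI[of _ r], rule exI[of _ s], simp)
qed

text \<open>The square p^2 - 2 Re z p q + |z|^2 q^2 exceeds p^2 - |p q| + q^2, which is a positive
  integer because \<open>q\<close> is nonzero.\<close>

lemma norm_denom_gt_1:
  fixes p q :: int
  assumes "0 < Re z" "Re z < 1/2" "1 < norm z" "q \<noteq> 0"
  shows "norm (of_int p - z * of_int q) > 1"
proof -
  have n: "norm z ^ 2 > 1" using assms(3) power_strict_mono[of 1 "norm z" 2] by simp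
  have nn: "norm z ^ 2 = Re z^2 + Im z^2" by (rule cmod_power2)
  have "norm (of_int p - z * of_int q)^2 = of_int p^2 - 2 * Re z * of_int p * of_int q + norm z^2 * of_int q^2"
    unfolding norm_denom nn by (simp add: algebra_simps power2_eq_square)
  also have "\<dots> > of_int p^2 - \<bar>of_int p * of_int q\<bar> + of_int q^2"
  proof -
    have "2 * Re z * of_int p * of_int q \<le> \<bar>2 * Re z\<bar> * \<bar>of_int p * of_int q\<bar>"
      by (metis abs_ge_self abs_mult mult.assoc)
    also have "\<dots> \<le> 1 * \<bar>of_int p * of_int q\<bar>" using assms by (intro mult_right_mono) auto
    finally have "2 * Re z * of_int p * of_int q \<le> \<bar>of_int p * of_int q\<bar>" by simp
    moreover have "norm z^2 * of_int q^2 > 1 * of_int q^2"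
      using n assms by (intro mult_strict_right_mono) auto
    ultimately show ?thesis by simp
  qed
  finally have 1: "norm (of_int p - z * of_int q)^2 > of_int (p^2 - \<bar>p * q\<bar> + q^2)" by (simp add: abs_mult)
  have "p^2 - \<bar>p * q\<bar> + q^2 \<ge> 1"
  proof -
    have "4 * (p^2 - \<bar>p * q\<bar> + q^2) = (2 * \<bar>p\<bar> - \<bar>q\<bar>)^2 + 3 * q^2"
      by (simp add: abs_mult power2_eq_square algebra_simps)
    moreover have "q^2 > 0" using assms by simp
    ultimately show ?thesis by (smt (verit) zero_le_power2)
  qed
  then have "of_int (p^2 - \<bar>p * q\<bar> + q^2) \<ge> (1::real)" by (metis of_int_1 of_int_le_iff)
  then have "norm (of_int p - z * of_int q)^2 > 1^2" using 1 by simp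
  then show ?thesis by (rule power_less_imp_less_base) simp
qed

text \<open>If \<open>q\<close> were nonzero, the matrix and its inverse would both strictly lower
  the imaginary part. So the real part changes by an integral translation or a reflection x -> n -
  x, and among these only the identity takes a point of the open interval from 0 to 1/2 into that
  interval.\<close>

lemma fundamental_domain_unique:
  assumes d: "\<bar>p * s - q * r\<bar> = 1"
    and z: "0 < Re z" "Re z < 1/2" "1 < norm z" "Im z > 0"
    and w: "0 < Re w" "Re w < 1/2" "1 < norm w" "Im w > 0"
    and m: "w = upper (moeb p q r s z)"
  shows "q = 0 \<and> r = 0 \<and> p = s"
proof -
  have Imu: "Im (upper v) = \<bar>Im v\<bar>" for v by (simp add: upper_def)
  have q: "q = 0"
  proof (rule ccontr)
    assume q: "q \<noteq> 0"
    define D where "D = p * s - q * r"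
    have DD: "D * D = 1" using d unfolding D_def by (metis abs_mult_self_eq mult_1)
    have inv: "moeb s (-q) (-r) p (moeb p q r s z) = z"
    proof -
      let ?m = "of_int p - z * of_int q"
      have m0: "?m \<noteq> 0" using moeb_denom_nonzero[OF d] z by simp
      have Dn: "of_int D \<noteq> (0::complex)" using DD by auto
      have "of_int s - moeb p q r s z * of_int (-q) = of_int D / ?m"
        unfolding moeb_def using m0 by (simp add: field_simps D_def)
      moreover have "moeb p q r s z * of_int p - of_int (-r) = z * of_int D / ?m"
        unfolding moeb_def using m0 by (simp add: field_simps D_def)
      ultimately show ?thesis
        unfolding moeb_def[of s] using m0 Dn by simp
    qed
    have lt: "a / n < a" if "n > 1" "a > 0" for a n :: real using that by (simp add: divide_less_eq)
    have d': "\<bar>s * p - (-q) * (-r)\<bar> = 1" using d by (simp add: algebra_simps)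
    have I1: "Im w = Im z / norm (of_int p - z * of_int q)^2"
      unfolding m Imu using Im_moeb[OF d] z by simp
    have nz: "Im (moeb p q r s z) \<noteq> 0" using w(4) unfolding m Imu by simp
    have I2: "Im z = Im w / norm (of_int s - moeb p q r s z * of_int (-q))^2"
      using Im_moeb[OF d' nz] unfolding inv m Imu using z by simp
    have "norm (of_int s - moeb p q r s z * of_int (-q)) = norm (of_int s - w * of_int (-q))"
    proof (cases "Im (moeb p q r s z) < 0")
      case True
      then have "w = cnj (moeb p q r s z)" unfolding m upper_def by simp
      then have "of_int s - w * of_int (-q) = cnj (of_int s - moeb p q r s z * of_int (-q))" by simp
      then show ?thesis by (metis complex_mod_cnj)
    qed (simp add: m upper_def)
    then have "norm (of_int s - moeb p q r s z * of_int (-q)) > 1"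
      using norm_denom_gt_1[OF w(1-3), of "-q" s] q by simp
    then have "norm (of_int s - moeb p q r s z * of_int (-q))^2 > 1" by simp
    then have "Im z < Im w" using lt[OF _ w(4)] unfolding I2 by blast
    moreover have "norm (of_int p - z * of_int q)^2 > 1" using norm_denom_gt_1[OF z(1-3) q] by simp
    then have "Im w < Im z" using lt[OF _ z(4)] unfolding I1 by blast
    ultimately show False by simp
  qed
  have "\<bar>p\<bar> * \<bar>s\<bar> = 1" using d q by (simp add: abs_mult)
  then have "\<bar>p\<bar> = 1 \<and> \<bar>s\<bar> = 1" using zmult_eq_1_iff[of "\<bar>p\<bar>" "\<bar>s\<bar>"] by auto
  then have ps: "p = 1 \<or> p = -1" "s = 1 \<or> s = -1" by auto
  have Rew: "Re w = Re (moeb p q r s z)" unfolding m upper_def by simp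
  have int0: "k = 0" if "-1 < (of_int k :: real)" "(of_int k :: real) < 1" for k :: int
    using that by linarith
  show ?thesis
  proof (cases "p = s")
    case True
    have "Re w = Re z - of_int (p * r)" unfolding Rew moeb_def q using ps True by auto
    then have "p * r = 0" using z w by (intro int0) auto
    then show ?thesis using q True ps by auto
  next
    case False
    then have "s = - p" using ps by auto
    then have "Re w = - Re z - of_int (p * r)" unfolding Rew moeb_def q using ps by auto
    then have *: "Re w + Re z = of_int (- (p * r))" by simp
    then have "- (p * r) = 0" using z w by (intro int0) auto
    then have "Re w + Re z = 0" using * by simp
    then show ?thesis using z w by simp
  qed
qed

section \<open>Irreducibility\<close>

definition lin_cub :: "'a::comm_ring_1 \<Rightarrow> 'a \<Rightarrow> 'a \<Rightarrow> 'a \<Rightarrow> 'a \<Rightarrow> 'a \<Rightarrow> bqf \<Rightarrow> bool" where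
  "lin_cub g1 g0 h3 h2 h1 h0 f \<longleftrightarrow> (case f of BQF a b c d e \<Rightarrow>
     of_int a = g1 * h3 \<and> of_int b = g1 * h2 + g0 * h3 \<and> of_int c = g1 * h1 + g0 * h2 \<and>
     of_int d = g1 * h0 + g0 * h1 \<and> of_int e = g0 * h0)"

definition quad_quad :: "'a::comm_ring_1 \<Rightarrow> 'a \<Rightarrow> 'a \<Rightarrow> 'a \<Rightarrow> 'a \<Rightarrow> 'a \<Rightarrow> bqf \<Rightarrow> bool" where
  "quad_quad g2 g1 g0 h2 h1 h0 f \<longleftrightarrow> (case f of BQF a b c d e \<Rightarrow>
     of_int a = g2 * h2 \<and> of_int b = g2 * h1 + g1 * h2 \<and> of_int c = g2 * h0 + g1 * h1 + g0 * h2 \<and>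
     of_int d = g1 * h0 + g0 * h1 \<and> of_int e = g0 * h0)"

text \<open>Factorizations are recorded through coefficients, so that they can be transported along
  \<open>act\<close> and from the rationals to the integers. Leading coefficients may be zero: a
  form with \<open>a = 0\<close> splits off the factor y.\<close>

definition splits :: "'a::comm_ring_1 itself \<Rightarrow> bqf \<Rightarrow> bool" where
  "splits _ f \<longleftrightarrow> (\<exists>g1 g0 h3 h2 h1 h0 :: 'a. lin_cub g1 g0 h3 h2 h1 h0 f)
     \<or> (\<exists>g2 g1 g0 h2 h1 h0 :: 'a. quad_quad g2 g1 g0 h2 h1 h0 f)"

text \<open>The witnesses are the two factors after the linear substitution.\<close>

lemma splits_act:
  assumes "splits TYPE(rat) f"
  shows "splits TYPE(rat) (act p q r s f)"
proof (cases f)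
  case (BQF a b c d e)
  define p' q' r' s' :: rat where "p' = of_int p" "q' = of_int q" "r' = of_int r" "s' = of_int s"
  from assms consider (1) g1 g0 h3 h2 h1 h0 :: rat where "lin_cub g1 g0 h3 h2 h1 h0 f"
    | (2) g2 g1 g0 h2 h1 h0 :: rat where "quad_quad g2 g1 g0 h2 h1 h0 f"
    unfolding splits_def by blast
  then show ?thesis
  proof cases
    case 1
    then have eq: "of_int a = g1 * h3" "of_int b = g1 * h2 + g0 * h3" "of_int c = g1 * h1 + g0 * h2"
       "of_int d = g1 * h0 + g0 * h1" "of_int e = g0 * h0"
      unfolding lin_cub_def BQF by auto
    have "lin_cub (g1 * p' + g0 * q') (g1 * r' + g0 * s')
      (h3 * p'^3 + h2 * p'^2 * q' + h1 * p' * q'^2 + h0 * q'^3)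
      (3 * h3 * p'^2 * r' + h2 * (2 * p' * q' * r' + p'^2 * s') + h1 * (2 * p' * q' * s' + q'^2 * r') + 3 * h0 * q'^2 * s')
      (3 * h3 * p' * r'^2 + h2 * (2 * p' * r' * s' + q' * r'^2) + h1 * (2 * q' * r' * s' + p' * s'^2) + 3 * h0 * q' * s'^2)
      (h3 * r'^3 + h2 * r'^2 * s' + h1 * r' * s'^2 + h0 * s'^3) (act p q r s f)"
      unfolding BQF act.simps lin_cub_def bqf.case of_int_add of_int_mult of_int_power of_int_numeral eq
        p'_q'_r'_s'_def[symmetric]
      by (intro conjI; algebra)
    then show ?thesis unfolding splits_def by blast
  next
    case 2
    then have eq: "of_int a = g2 * h2" "of_int b = g2 * h1 + g1 * h2" "of_int c = g2 * h0 + g1 * h1 + g0 * h2"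
       "of_int d = g1 * h0 + g0 * h1" "of_int e = g0 * h0"
      unfolding quad_quad_def BQF by auto
    have "quad_quad (g2 * p'^2 + g1 * p' * q' + g0 * q'^2)
       (2 * g2 * p' * r' + g1 * (p' * s' + q' * r') + 2 * g0 * q' * s') (g2 * r'^2 + g1 * r' * s' + g0 * s'^2)
       (h2 * p'^2 + h1 * p' * q' + h0 * q'^2)
       (2 * h2 * p' * r' + h1 * (p' * s' + q' * r') + 2 * h0 * q' * s') (h2 * r'^2 + h1 * r' * s' + h0 * s'^2) (act p q r s f)"
      unfolding BQF act.simps quad_quad_def bqf.case of_int_add of_int_mult of_int_power of_int_numeral eq
        p'_q'_r'_s'_def[symmetric]
      by (intro conjI; algebra)
    then show ?thesis unfolding splits_def by blast
  qed
qed

text \<open>The form is dehomogenized at x = 1, so \<open>e\<close> is the leading coefficient and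
  the powers of y increase along the list.\<close>

lemma splits_of_poly_factor:
  fixes g h :: "rat poly"
  assumes gh: "[:of_int a, of_int b, of_int c, of_int d, of_int e:] = g * h" and e: "e \<noteq> 0"
    and deg: "degree g > 0" "degree h > 0"
  shows "splits TYPE(rat) (BQF a b c d e)"
proof -
  let ?p = "[:of_int a, of_int b, of_int c, of_int d, of_int e:] :: rat poly"
  have "degree ?p = 4" using e by simp
  moreover have "g \<noteq> 0" "h \<noteq> 0" using deg by auto
  ultimately have sum: "degree g + degree h = 4" using gh by (simp add: degree_mult_eq)
  have c0: "coeff ?p 0 = of_int a" "coeff ?p 1 = of_int b" "coeff ?p 2 = of_int c"
    "coeff ?p 3 = of_int d" "coeff ?p 4 = of_int e" by (simp_all add: numeral_eq_Suc)
  have cm: "coeff ?p n = (\<Sum>i\<le>n. coeff g i * coeff h (n - i))" for n unfolding gh coeff_mult ..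
  note ev = c0[unfolded cm]
  have z: "coeff g i = 0" if "i > degree g" for i using that by (rule coeff_eq_0)
  have z': "coeff h i = 0" if "i > degree h" for i using that by (rule coeff_eq_0)
  consider "degree g = 1" "degree h = 3" | "degree g = 2" "degree h = 2" | "degree g = 3" "degree h = 1"
    using sum deg by linarith
  then show ?thesis
  proof cases
    case 1
    have "lin_cub (coeff g 0) (coeff g 1) (coeff h 0) (coeff h 1) (coeff h 2) (coeff h 3) (BQF a b c d e)"
      using ev z z' 1 by (simp add: lin_cub_def numeral_eq_Suc algebra_simps)
    then show ?thesis unfolding splits_def by blast
  next
    case 2
    have "quad_quad (coeff g 0) (coeff g 1) (coeff g 2) (coeff h 0) (coeff h 1) (coeff h 2) (BQF a b c d e)"
      using ev z z' 2 by (simp add: quad_quad_def numeral_eq_Suc algebra_simps)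
    then show ?thesis unfolding splits_def by blast
  next
    case 3
    have "lin_cub (coeff h 0) (coeff h 1) (coeff g 0) (coeff g 1) (coeff g 2) (coeff g 3) (BQF a b c d e)"
      using ev z z' 3 by (simp add: lin_cub_def numeral_eq_Suc algebra_simps)
    then show ?thesis unfolding splits_def by blast
  qed
qed

lemma not_unit_poly_poly:
  fixes G :: "rat poly poly"
  assumes "poly (poly G 0) 0 = 0"
  shows "\<not> G dvd 1"
proof
  assume "G dvd 1"
  then obtain H where "1 = G * H" ..
  from arg_cong[OF this, of "\<lambda>P. poly (poly P 0) 0"] show False using assms by simp
qed

text \<open>The factors of a splitting vanish at the origin, hence are not units. Conversely, as a
  polynomial in y over the ring of polynomials in x, an unsplit form has the nonzero constant
  leading coefficient \<open>e\<close>. The leading coefficients of any two factors are then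
  constants as well, so setting x = 1 preserves their degrees, and a factor of degree 0 in y is a
  unit.\<close>

lemma irreducible_over_rat_iff: "irreducible_over_rat f \<longleftrightarrow> \<not> splits TYPE(rat) f"
proof (cases f)
  case (BQF a b c d e)
  let ?X = "[:[:0, 1:]:] :: rat poly poly" and ?Y = "[:0, 1:] :: rat poly poly"
  define F where "F = form f ?X ?Y"
  define k :: "rat \<Rightarrow> rat poly poly" where "k = (\<lambda>c. [:[:c:]:])"
  have k: "k (x * y) = k x * k y" "k (x + y) = k x + k y" for x y
    by (simp_all add: k_def)
  have ki: "of_int n = k (of_int n)" for n by (simp add: k_def of_int_poly)
  have pk: "poly (poly (k x) 0) 0 = x" for x by (simp add: k_def)
  have F: "F = k (of_int a) * ?X^4 + k (of_int b) * ?X^3 * ?Y + k (of_int c) * ?X^2 * ?Y^2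
     + k (of_int d) * ?X * ?Y^3 + k (of_int e) * ?Y^4"
    unfolding F_def BQF form.simps ki ..
  have F0: "poly (poly F 0) 0 = 0" unfolding F by simp
  have "irreducible F \<longleftrightarrow> \<not> splits TYPE(rat) f"
  proof
    assume irr: "irreducible F"
    show "\<not> splits TYPE(rat) f"
    proof
      assume "splits TYPE(rat) f"
      then consider (1) g1 g0 h3 h2 h1 h0 :: rat where "lin_cub g1 g0 h3 h2 h1 h0 f"
        | (2) g2 g1 g0 h2 h1 h0 :: rat where "quad_quad g2 g1 g0 h2 h1 h0 f"
        unfolding splits_def by blast
      then show False
      proof cases
        case 1
        then have eq: "of_int a = g1 * h3" "of_int b = g1 * h2 + g0 * h3" "of_int c = g1 * h1 + g0 * h2"
          "of_int d = g1 * h0 + g0 * h1" "of_int e = g0 * h0"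
          unfolding lin_cub_def BQF by auto
        let ?G = "k g1 * ?X + k g0 * ?Y"
        let ?H = "k h3 * ?X^3 + k h2 * ?X^2 * ?Y + k h1 * ?X * ?Y^2 + k h0 * ?Y^3"
        have "F = ?G * ?H" unfolding F eq k by algebra
        moreover have "\<not> ?G dvd 1" "\<not> ?H dvd 1" by (rule not_unit_poly_poly; simp)+
        ultimately show False using irr irreducibleD by blast
      next
        case 2
        then have eq: "of_int a = g2 * h2" "of_int b = g2 * h1 + g1 * h2" "of_int c = g2 * h0 + g1 * h1 + g0 * h2"
          "of_int d = g1 * h0 + g0 * h1" "of_int e = g0 * h0"
          unfolding quad_quad_def BQF by auto
        let ?G = "k g2 * ?X^2 + k g1 * ?X * ?Y + k g0 * ?Y^2"
        let ?H = "k h2 * ?X^2 + k h1 * ?X * ?Y + k h0 * ?Y^2"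
        have "F = ?G * ?H" unfolding F eq k by algebra
        moreover have "\<not> ?G dvd 1" "\<not> ?H dvd 1" by (rule not_unit_poly_poly; simp)+
        ultimately show False using irr irreducibleD by blast
      qed
    qed
  next
    assume ns: "\<not> splits TYPE(rat) f"
    have e: "e \<noteq> 0"
    proof
      assume "e = 0"
      then have "lin_cub (1::rat) 0 (of_int a) (of_int b) (of_int c) (of_int d) f"
        by (simp add: lin_cub_def BQF)
      then show False using ns unfolding splits_def by blast
    qed
    have FL: "F = [:[:0,0,0,0,of_int a:], [:0,0,0,of_int b:], [:0,0,of_int c:], [:0,of_int d:], [:of_int e:]:]"
      unfolding F k_def by (simp add: power2_eq_square power3_eq_cube power4_eq_xxxx)
    show "irreducible F"
    proof (rule irreducibleI)
      show "F \<noteq> 0" using e by (simp add: FL)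
      show "\<not> F dvd 1" by (rule not_unit_poly_poly[OF F0])
      fix G H assume GH: "F = G * H"
      show "G dvd 1 \<or> H dvd 1"
      proof (rule ccontr)
        assume nu: "\<not> (G dvd 1 \<or> H dvd 1)"
        have lc: "lead_coeff G * lead_coeff H = [:of_int e:]"
          unfolding lead_coeff_mult[symmetric] GH[symmetric] using e by (simp add: FL)
        have *: "\<exists>c. c \<noteq> 0 \<and> lead_coeff P = [:c:]" if "P = G \<or> P = H" for P
        proof -
          have nz: "lead_coeff G \<noteq> 0" "lead_coeff H \<noteq> 0" using lc e by (metis mult_zero_left mult_zero_right of_int_eq_0_iff pCons_eq_0_iff)+
          then have "degree (lead_coeff G) + degree (lead_coeff H) = 0" using arg_cong[OF lc, of degree] by (simp add: degree_mult_eq)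
          then have "degree (lead_coeff P) = 0" using that by auto
          then show ?thesis using nz that by (metis degree_eq_zeroE pCons_0_0)
        qed
        define \<phi> :: "rat poly poly \<Rightarrow> rat poly" where "\<phi> = map_poly (\<lambda>c. poly c 1)"
        have cphi: "coeff (\<phi> P) n = poly (coeff P n) 1" for P n
          unfolding \<phi>_def by (simp add: coeff_map_poly)
        have phi_mult: "\<phi> (P * Q) = \<phi> P * \<phi> Q" for P Q
          by (rule poly_eqI) (simp add: cphi coeff_mult poly_sum)
        have dphi: "degree (\<phi> P) > 0" if P: "P = G \<or> P = H" for P
        proof -
          obtain c where c: "c \<noteq> 0" "lead_coeff P = [:c:]" using *[OF P] by blast
          have "degree P > 0"
          proof (rule ccontr)
            assume "\<not> degree P > 0"
            then have "P = [:[:c:]:]" using c by (metis degree_0_id neq0_conv)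
            then have "1 = P * [:[:1 / c:]:]" using c by (simp add: one_pCons)
            then have "P dvd 1" by (rule dvdI)
            then show False using nu P by blast
          qed
          moreover have "coeff (\<phi> P) (degree P) \<noteq> 0" unfolding cphi c using c by simp
          then have "degree P \<le> degree (\<phi> P)" by (rule le_degree)
          ultimately show ?thesis by simp
        qed
        have "\<phi> F = [:of_int a, of_int b, of_int c, of_int d, of_int e:]"
          unfolding FL \<phi>_def by (simp add: map_poly_pCons)
        then have "splits TYPE(rat) (BQF a b c d e)"
          using splits_of_poly_factor[of a b c d e "\<phi> G" "\<phi> H"] e dphi phi_mult[of G H] GH by simp
        then show False using ns BQF by simp
      qed
    qed
  qed
  then show ?thesis unfolding irreducible_over_rat_def F_def .
qed

lemma irreducible_over_rat_act:
  assumes "irreducible_over_rat f" "\<bar>p * s - q * r\<bar> = 1"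
  shows "irreducible_over_rat (act p q r s f)"
proof -
  obtain p' q' r' s' where "f = act p' q' r' s' (act p q r s f)"
  proof -
    have "(f, act p q r s f) \<in> GL2Z_rel" using assms(2) GL2Z_rel_iff_act by blast
    then have "(act p q r s f, f) \<in> GL2Z_rel" using equiv_GL2Z_rel by (meson equivE symE)
    then show ?thesis using that GL2Z_rel_iff_act by blast
  qed
  then show ?thesis using assms(1) splits_act unfolding irreducible_over_rat_iff by metis
qed

lemma irreducible_coeff_nonzero:
  assumes "irreducible_over_rat (BQF a b c d e)"
  shows "a \<noteq> 0" "e \<noteq> 0"
proof -
  have "lin_cub (0::rat) 1 (of_int b) (of_int c) (of_int d) (of_int e) (BQF a b c d e)" if "a = 0"
    using that by (simp add: lin_cub_def)
  then show "a \<noteq> 0" using assms unfolding irreducible_over_rat_iff splits_def by blast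
  have "lin_cub (1::rat) 0 (of_int a) (of_int b) (of_int c) (of_int d) (BQF a b c d e)" if "e = 0"
    using that by (simp add: lin_cub_def)
  then show "e \<noteq> 0" using assms unfolding irreducible_over_rat_iff splits_def by blast
qed

text \<open>A rational polynomial \<open>g\<close> of least degree with the zero \<open>t\<close>
  divides the quartic. At a double root the derivative vanishes too, so \<open>g\<close> has degree
  at most 3 and the factorization is proper.\<close>

lemma irreducible_no_double_root:
  fixes t :: real
  assumes irr: "irreducible_over_rat (BQF a b c d e)"
    and root: "of_int a * t^4 + of_int b * t^3 + of_int c * t^2 + of_int d * t + of_int e = 0"
  shows "4 * of_int a * t^3 + 3 * of_int b * t^2 + 2 * of_int c * t + of_int d \<noteq> 0"
proof
  assume root': "4 * of_int a * t^3 + 3 * of_int b * t^2 + 2 * of_int c * t + of_int d = 0"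
  \<comment> \<open>Exchanging the variables puts the nonzero \<open>a\<close> in the place of the
    leading coefficient in \<open>splits_of_poly_factor\<close>.\<close>
  have "irreducible_over_rat (act 0 1 1 0 (BQF a b c d e))"
    using irreducible_over_rat_act[OF irr, of 0 0 1 1] by simp
  then have irr': "irreducible_over_rat (BQF e d c b a)" by simp
  have a: "a \<noteq> 0" using irreducible_coeff_nonzero[OF irr] by blast
  define p :: "rat poly" where "p = [:of_int e, of_int d, of_int c, of_int b, of_int a:]"
  define E :: "rat poly \<Rightarrow> real" where "E = (\<lambda>q. poly (map_poly of_rat q) t)"
  have E_mult: "E (P * Q) = E P * E Q" for P Q
  proof -
    have "map_poly (of_rat :: rat \<Rightarrow> real) (P * Q) = map_poly of_rat P * map_poly of_rat Q"
      by (rule poly_eqI) (simp add: coeff_map_poly coeff_mult of_rat_sum of_rat_mult)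
    then show ?thesis by (simp add: E_def)
  qed
  have E_add: "E (P + Q) = E P + E Q" for P Q
  proof -
    have "map_poly (of_rat :: rat \<Rightarrow> real) (P + Q) = map_poly of_rat P + map_poly of_rat Q"
      by (rule poly_eqI) (simp add: coeff_map_poly of_rat_add)
    then show ?thesis by (simp add: E_def)
  qed
  have dp: "degree p = 4" using a by (simp add: p_def)
  have p0: "p \<noteq> 0" using dp by auto
  have Ep: "E p = 0" using root
    by (simp add: E_def p_def map_poly_pCons algebra_simps power2_eq_square power3_eq_cube power4_eq_xxxx)
  have Ep': "E (pderiv p) = 0" using root'
    by (simp add: E_def p_def pderiv_pCons map_poly_pCons of_rat_mult of_rat_add algebra_simps power2_eq_square power3_eq_cube)
  obtain g where g: "g \<noteq> 0" "E g = 0" and min: "\<And>q. q \<noteq> 0 \<Longrightarrow> E q = 0 \<Longrightarrow> degree g \<le> degree q"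
    using ex_has_least_nat[of "\<lambda>q. q \<noteq> 0 \<and> E q = 0" p degree] p0 Ep by blast
  have "degree g \<noteq> 0"
  proof
    assume "degree g = 0"
    then obtain k where k: "g = [:k:]" by (metis degree_eq_zeroE)
    then have "E g = of_rat k" by (simp add: E_def map_poly_pCons)
    then show False using g k by simp
  qed
  moreover obtain h where h: "p = g * h"
  proof -
    define r where "r = pseudo_mod p g"
    obtain k h where k: "k \<noteq> 0" and h: "smult k p = g * h + r" and r: "r = 0 \<or> degree r < degree g"
      using pseudo_mod[OF g(1), of p] unfolding r_def by blast
    have "E (smult k p) = 0" using Ep E_mult[of "[:k:]" p] by simp
    then have "E r = 0" using g(2) unfolding h E_add E_mult by simp
    then have "r = 0" using r min[of r] by (meson not_le)
    then have "smult k p = g * h" using h by simp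
    then have "smult (1 / k) (smult k p) = g * smult (1 / k) h" by simp
    then have "p = g * smult (1 / k) h" using k by simp
    then show ?thesis by (rule that)
  qed
  moreover have "degree h \<noteq> 0"
  proof
    assume "degree h = 0"
    then have "degree g = 4" using dp h p0 by (metis add.right_neutral degree_mult_eq mult_eq_0_iff)
    moreover have "pderiv p \<noteq> 0" using dp by (simp add: pderiv_eq_0_iff)
    then have "degree g \<le> degree (pderiv p)" using Ep' by (rule min)
    ultimately show False using dp by (simp add: degree_pderiv)
  qed
  ultimately have "splits TYPE(rat) (BQF e d c b a)"
    using splits_of_poly_factor[of e d c b a g h] a unfolding p_def by auto
  then show False using irr' irreducible_over_rat_iff by blast
qed

section \<open>Gauss's lemma: rational factors can be made integral\<close>

abbreviation rat_poly_of_int :: "int poly \<Rightarrow> rat poly" where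
  "rat_poly_of_int \<equiv> map_poly of_int"

lemma rat_poly_of_int_mult: "rat_poly_of_int (p * q) = rat_poly_of_int p * rat_poly_of_int q"
  by (rule poly_eqI) (simp add: coeff_map_poly coeff_mult)

lemma rat_poly_of_int_smult: "rat_poly_of_int (smult k p) = smult (of_int k) (rat_poly_of_int p)"
  by (rule poly_eqI) (simp add: coeff_map_poly)

lemma degree_rat_poly_of_int: "degree (rat_poly_of_int p) = degree p"
  by (rule degree_map_poly) simp

lemma rat_poly_of_int_inject: "rat_poly_of_int p = rat_poly_of_int q \<longleftrightarrow> p = q"
  by (simp add: poly_eq_iff coeff_map_poly)

lemma rat_poly_clear_denominators:
  fixes g :: "rat poly"
  shows "\<exists>n G. n > 0 \<and> rat_poly_of_int G = smult (of_int n) g"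
proof (induction g)
  case 0
  have "(1::int) > 0 \<and> rat_poly_of_int 0 = smult (of_int 1) 0" by simp
  then show ?case by blast
next
  case (pCons c g)
  then obtain n G where G: "n > 0" "rat_poly_of_int G = smult (of_int n) g" by blast
  obtain u v where uv: "quotient_of c = (u, v)" by (cases "quotient_of c")
  have v: "v > 0" using quotient_of_denom_pos[OF uv] .
  have c: "of_int v * c = of_int u" using quotient_of_div[OF uv] v by simp
  have "rat_poly_of_int (pCons (n * u) (smult v G)) = smult (of_int (n * v)) (pCons c g)"
    using c by (simp add: map_poly_pCons rat_poly_of_int_smult G mult.assoc) (simp add: mult.commute)
  moreover have "n * v > 0" using G v by simp
  ultimately show ?case by blast
qed

text \<open>Clearing denominators gives G H = n m F. The content is multiplicative, so the primitive
  parts of G and H multiply to F up to the content of F, which is absorbed into one of them.\<close>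

lemma gauss_factor:
  fixes g h :: "rat poly" and F :: "int poly"
  assumes "rat_poly_of_int F = g * h" "F \<noteq> 0"
  shows "\<exists>G H. F = G * H \<and> degree G = degree g \<and> degree H = degree h"
proof -
  obtain n G where G: "n > 0" "rat_poly_of_int G = smult (of_int n) g" using rat_poly_clear_denominators by blast
  obtain m H where H: "m > 0" "rat_poly_of_int H = smult (of_int m) h" using rat_poly_clear_denominators by blast
  have "rat_poly_of_int (G * H) = rat_poly_of_int (smult (n * m) F)"
    using G H assms by (simp add: rat_poly_of_int_mult rat_poly_of_int_smult mult.commute)
  then have GH: "G * H = smult (n * m) F" by (simp add: rat_poly_of_int_inject)
  have dG: "degree G = degree g" using G degree_rat_poly_of_int[of G] by simp
  have dH: "degree H = degree h" using H degree_rat_poly_of_int[of H] by simp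
  have nm: "n * m > 0" using G H by simp
  have "content (G * H) = content G * content H" by (rule content_mult)
  then have "content G * content H = n * m * content F" unfolding GH using nm by (simp add: content_smult)
  define G' H' where "G' = primitive_part G" and "H' = primitive_part H"
  have "smult (n * m) F = smult (content G * content H) (G' * H')"
    unfolding GH[symmetric] G'_def H'_def
    by (metis content_times_primitive_part mult_smult_left mult_smult_right smult_smult)
  also have "\<dots> = smult (n * m) (smult (content F) (G' * H'))"
    using \<open>content G * content H = n * m * content F\<close> by simp
  finally have eq: "smult (n * m) F = smult (n * m) (smult (content F) (G' * H'))" .
  have "F = smult (content F) G' * H'"
  proof (rule poly_eqI)
    fix i
    have "n * m * coeff F i = n * m * coeff (smult (content F) (G' * H')) i"
      using arg_cong[OF eq, of "\<lambda>p. coeff p i"] by simp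
    then have "coeff F i = coeff (smult (content F) (G' * H')) i" using nm by (metis less_irrefl mult_cancel_left)
    then show "coeff F i = coeff (smult (content F) G' * H') i" by simp
  qed
  moreover have "content F \<noteq> 0" using assms by simp
  ultimately show ?thesis using dG dH unfolding G'_def H'_def
    by (intro exI[of _ "smult (content F) (primitive_part G)"] exI[of _ "primitive_part H"]) simp
qed

section \<open>Reducible forms are rare\<close>

lemma splits_int:
  assumes sp: "splits TYPE(rat) (BQF a b c d e)" and a: "a \<noteq> 0"
  shows "splits TYPE(int) (BQF a b c d e)"
proof -
  define F where "F = [:a, b, c, d, e:]"
  have F0: "F \<noteq> 0" using a by (simp add: F_def)
  have c0: "coeff F 0 = a" "coeff F 1 = b" "coeff F 2 = c" "coeff F 3 = d" "coeff F 4 = e"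
    by (simp_all add: F_def numeral_eq_Suc)
  from sp consider (1) g1 g0 h3 h2 h1 h0 :: rat where "lin_cub g1 g0 h3 h2 h1 h0 (BQF a b c d e)"
    | (2) g2 g1 g0 h2 h1 h0 :: rat where "quad_quad g2 g1 g0 h2 h1 h0 (BQF a b c d e)"
    unfolding splits_def by blast
  then show ?thesis
  proof cases
    case 1
    have "rat_poly_of_int F = [:g1, g0:] * [:h3, h2, h1, h0:]"
      using 1 unfolding F_def lin_cub_def by (simp add: map_poly_pCons algebra_simps)
    from gauss_factor[OF this F0] obtain G H where GH: "F = G * H"
      "degree G = degree [:g1, g0:]" "degree H = degree [:h3, h2, h1, h0:]" by blast
    then have dG: "degree G \<le> 1" and dH: "degree H \<le> 3" by simp_all
    \<comment> \<open>Only upper bounds on the degrees are available, because the leading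
      coefficients of the rational factors may vanish.\<close>
    have z: "coeff G i = 0" if "i > 1" for i using that dG by (intro coeff_eq_0) simp
    have z': "coeff H i = 0" if "i > 3" for i using that dH by (intro coeff_eq_0) simp
    have cm: "coeff F n = (\<Sum>i\<le>n. coeff G i * coeff H (n - i))" for n unfolding GH(1) coeff_mult ..
    note ev = c0[unfolded cm]
    have "lin_cub (coeff G 0) (coeff G 1) (coeff H 0) (coeff H 1) (coeff H 2) (coeff H 3) (BQF a b c d e)"
      using ev z z' by (simp add: lin_cub_def numeral_eq_Suc algebra_simps)
    then show ?thesis unfolding splits_def by blast
  next
    case 2
    have "rat_poly_of_int F = [:g2, g1, g0:] * [:h2, h1, h0:]"
      using 2 unfolding F_def quad_quad_def by (simp add: map_poly_pCons algebra_simps)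
    from gauss_factor[OF this F0] obtain G H where GH: "F = G * H"
      "degree G = degree [:g2, g1, g0:]" "degree H = degree [:h2, h1, h0:]" by blast
    then have dG: "degree G \<le> 2" and dH: "degree H \<le> 2" by simp_all
    have z: "coeff G i = 0" if "i > 2" for i using that dG by (intro coeff_eq_0) simp
    have z': "coeff H i = 0" if "i > 2" for i using that dH by (intro coeff_eq_0) simp
    have cm: "coeff F n = (\<Sum>i\<le>n. coeff G i * coeff H (n - i))" for n unfolding GH(1) coeff_mult ..
    note ev = c0[unfolded cm]
    have "quad_quad (coeff G 0) (coeff G 1) (coeff G 2) (coeff H 0) (coeff H 1) (coeff H 2) (BQF a b c d e)"
      using ev z z' by (simp add: quad_quad_def numeral_eq_Suc algebra_simps)
    then show ?thesis unfolding splits_def by blast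
  qed
qed

section \<open>The coefficients of a product control those of its factors\<close>

lemma lin_cub_bound_lead:
  fixes g1 g0 h3 h2 h1 h0 M :: real
  assumes "\<bar>g0\<bar> \<le> \<bar>g1\<bar>"
    and "\<bar>g1 * h3\<bar> \<le> M" "\<bar>g1 * h2 + g0 * h3\<bar> \<le> M" "\<bar>g1 * h1 + g0 * h2\<bar> \<le> M" "\<bar>g1 * h0 + g0 * h1\<bar> \<le> M"
  shows "\<bar>g1\<bar> * \<bar>h3\<bar> \<le> M \<and> \<bar>g1\<bar> * \<bar>h2\<bar> \<le> 2 * M \<and> \<bar>g1\<bar> * \<bar>h1\<bar> \<le> 3 * M \<and> \<bar>g1\<bar> * \<bar>h0\<bar> \<le> 4 * M"
proof -
  have m: "\<bar>g0 * x\<bar> \<le> \<bar>g1\<bar> * \<bar>x\<bar>" for x using assms(1) by (simp add: abs_mult mult_right_mono)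
  have 3: "\<bar>g1\<bar> * \<bar>h3\<bar> \<le> M" using assms(2) by (simp add: abs_mult)
  have 2: "\<bar>g1\<bar> * \<bar>h2\<bar> \<le> 2 * M" using assms(3) 3 m[of h3] unfolding abs_mult[symmetric] by linarith
  have 1: "\<bar>g1\<bar> * \<bar>h1\<bar> \<le> 3 * M" using assms(4) 2 m[of h2] unfolding abs_mult[symmetric] by linarith
  have 0: "\<bar>g1\<bar> * \<bar>h0\<bar> \<le> 4 * M" using assms(5) 1 m[of h1] unfolding abs_mult[symmetric] by linarith
  show ?thesis using 0 1 2 3 by blast
qed

text \<open>If \<open>g1\<close> dominates the linear factor, the coefficients of the cubic are
  bounded one after the other from the top; if \<open>g0\<close> does, the reversed form is treated
  in the same way.\<close>

lemma lin_cub_bound: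
  fixes g1 g0 h3 h2 h1 h0 M h :: real
  assumes "\<bar>g1 * h3\<bar> \<le> M" "\<bar>g1 * h2 + g0 * h3\<bar> \<le> M" "\<bar>g1 * h1 + g0 * h2\<bar> \<le> M"
    "\<bar>g1 * h0 + g0 * h1\<bar> \<le> M" "\<bar>g0 * h0\<bar> \<le> M" and h: "h \<in> {h3, h2, h1, h0}"
  shows "max \<bar>g1\<bar> \<bar>g0\<bar> * \<bar>h\<bar> \<le> 5 * M"
proof -
  have "M \<ge> 0" using assms(1) by linarith
  then have up: "t \<le> 5 * M" if "t \<le> M \<or> t \<le> 2 * M \<or> t \<le> 3 * M \<or> t \<le> 4 * M" for t using that by linarith
  show ?thesis
  proof (cases "\<bar>g0\<bar> \<le> \<bar>g1\<bar>")
    case True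
    then have m: "max \<bar>g1\<bar> \<bar>g0\<bar> = \<bar>g1\<bar>" by simp
    show ?thesis unfolding m using lin_cub_bound_lead[OF True assms(1-4)] h up by (elim insertE emptyE) metis+
  next
    case False
    then have m: "max \<bar>g1\<bar> \<bar>g0\<bar> = \<bar>g0\<bar>" and le: "\<bar>g1\<bar> \<le> \<bar>g0\<bar>" by simp_all
    have "\<bar>g0\<bar> * \<bar>h0\<bar> \<le> M \<and> \<bar>g0\<bar> * \<bar>h1\<bar> \<le> 2 * M \<and> \<bar>g0\<bar> * \<bar>h2\<bar> \<le> 3 * M \<and> \<bar>g0\<bar> * \<bar>h3\<bar> \<le> 4 * M"
      using lin_cub_bound_lead[OF le, of h0 M h1 h2 h3] assms(1-5) by (simp add: add.commute)
    then show ?thesis unfolding m using h up by (elim insertE emptyE) metis+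
  qed
qed

lemma quad_quad_bound_lead:
  fixes g2 g1 g0 h2 h1 h0 M :: real
  assumes "\<bar>g0\<bar> \<le> \<bar>g2\<bar>" "\<bar>g1\<bar> \<le> \<bar>g2\<bar>"
    and "\<bar>g2 * h2\<bar> \<le> M" "\<bar>g2 * h1 + g1 * h2\<bar> \<le> M" "\<bar>g2 * h0 + g1 * h1 + g0 * h2\<bar> \<le> M"
  shows "\<bar>g2\<bar> * \<bar>h2\<bar> \<le> M \<and> \<bar>g2\<bar> * \<bar>h1\<bar> \<le> 2 * M \<and> \<bar>g2\<bar> * \<bar>h0\<bar> \<le> 4 * M"
proof -
  have m: "\<bar>g0 * x\<bar> \<le> \<bar>g2\<bar> * \<bar>x\<bar>" "\<bar>g1 * x\<bar> \<le> \<bar>g2\<bar> * \<bar>x\<bar>" for x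
    using assms(1,2) by (simp_all add: abs_mult mult_right_mono)
  have 2: "\<bar>g2\<bar> * \<bar>h2\<bar> \<le> M" using assms(3) by (simp add: abs_mult)
  have 1: "\<bar>g2\<bar> * \<bar>h1\<bar> \<le> 2 * M" using assms(4) 2 m(2)[of h2] unfolding abs_mult[symmetric] by linarith
  have 0: "\<bar>g2\<bar> * \<bar>h0\<bar> \<le> 4 * M" using assms(5) 1 2 m(2)[of h1] m(1)[of h2] unfolding abs_mult[symmetric] by linarith
  show ?thesis using 0 1 2 by blast
qed

text \<open>The case in which the middle coefficients dominate, so that no recursion from an end is
  available. If K = |g1 h1| exceeded 5 M, the products of a middle with an outer coefficient would
  have squares at most 2 M K. Multiplying the middle coefficient of the product by g1 h1 would then
  give K^2 <= 5 M K.\<close>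

lemma quad_quad_bound_middle:
  fixes g2 g1 g0 h2 h1 h0 M :: real
  assumes g: "\<bar>g0\<bar> \<le> \<bar>g1\<bar>" "\<bar>g2\<bar> \<le> \<bar>g1\<bar>" and h: "\<bar>h0\<bar> \<le> \<bar>h1\<bar>" "\<bar>h2\<bar> \<le> \<bar>h1\<bar>"
    and b: "\<bar>g2 * h2\<bar> \<le> M" "\<bar>g2 * h1 + g1 * h2\<bar> \<le> M" "\<bar>g2 * h0 + g1 * h1 + g0 * h2\<bar> \<le> M"
      "\<bar>g1 * h0 + g0 * h1\<bar> \<le> M" "\<bar>g0 * h0\<bar> \<le> M"
  shows "\<bar>g1\<bar> * \<bar>h1\<bar> \<le> 5 * M"
proof (rule ccontr)
  assume "\<not> ?thesis"
  then have K: "\<bar>g1\<bar> * \<bar>h1\<bar> > 5 * M" by simp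
  have M: "M \<ge> 0" using b(1) by linarith
  define K where "K = \<bar>g1\<bar> * \<bar>h1\<bar>"
  have K0: "K > 5 * M" "K > 0" using K M by (auto simp: K_def)
  have sq: "(u * y)^2 \<le> 2 * M * K" if "\<bar>u\<bar> \<le> \<bar>x\<bar>" "\<bar>v\<bar> \<le> \<bar>y\<bar>" "\<bar>u * v\<bar> \<le> M" "\<bar>u * y + x * v\<bar> \<le> M" "\<bar>x\<bar> * \<bar>y\<bar> = K"
    for u v x y :: real
  proof -
    have "(u * y)^2 = (u * y) * (u * y + x * v) - (x * y) * (u * v)" by (simp add: power2_eq_square algebra_simps)
    also have "\<dots> \<le> \<bar>u * y\<bar> * \<bar>u * y + x * v\<bar> + \<bar>x * y\<bar> * \<bar>u * v\<bar>"
      unfolding abs_mult[symmetric] by linarith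
    also have "\<dots> \<le> K * M + K * M"
    proof (intro add_mono mult_mono)
      show "\<bar>u * y\<bar> \<le> K" using that mult_right_mono[of "\<bar>u\<bar>" "\<bar>x\<bar>" "\<bar>y\<bar>"] by (simp add: abs_mult)
      show "\<bar>x * y\<bar> \<le> K" using that by (simp add: abs_mult)
    qed (use that K0 in auto)
    finally show ?thesis by (simp add: mult.commute mult.left_commute)
  qed
  have b': "\<bar>h2 * g2\<bar> \<le> M" "\<bar>h2 * g1 + h1 * g2\<bar> \<le> M" "\<bar>g0 * h1 + g1 * h0\<bar> \<le> M"
      "\<bar>h0 * g0\<bar> \<le> M" "\<bar>h0 * g1 + h1 * g0\<bar> \<le> M"
    using b(1,2,4,5) by (metis mult.commute add.commute)+
  have K': "\<bar>g1\<bar> * \<bar>h1\<bar> = K" "\<bar>h1\<bar> * \<bar>g1\<bar> = K" by (simp_all only: K_def mult.commute)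
  have s1: "(g2 * h1)^2 \<le> 2 * M * K" by (rule sq[OF g(2) h(2) b(1,2) K'(1)])
  have s2: "(h2 * g1)^2 \<le> 2 * M * K" by (rule sq[OF h(2) g(2) b'(1,2) K'(2)])
  have s3: "(g0 * h1)^2 \<le> 2 * M * K" by (rule sq[OF g(1) h(1) b(5) b'(3) K'(1)])
  have s4: "(h0 * g1)^2 \<le> 2 * M * K" by (rule sq[OF h(1) g(1) b'(4,5) K'(2)])
  have pr: "\<bar>x * y\<bar> \<le> 2 * M * K" if "x^2 \<le> 2 * M * K" "y^2 \<le> 2 * M * K" for x y :: real
  proof -
    have "2 * \<bar>x * y\<bar> \<le> x^2 + y^2" using sum_squares_bound[of "\<bar>x\<bar>" "\<bar>y\<bar>"] by (simp add: abs_mult)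
    then show ?thesis using that by linarith
  qed
  have K2: "\<bar>(g2 * h0 + g1 * h1 + g0 * h2) * (g1 * h1)\<bar> \<le> M * K"
    unfolding abs_mult[of "g2 * h0 + g1 * h1 + g0 * h2"] abs_mult[of g1] K_def[symmetric]
    using b(3) K0 by (intro mult_right_mono) auto
  have "(g1 * h1)^2 = (g2 * h0 + g1 * h1 + g0 * h2) * (g1 * h1) - (g2 * h1) * (h0 * g1) - (g0 * h1) * (h2 * g1)"
    by (simp add: power2_eq_square algebra_simps)
  also have "\<dots> \<le> M * K + 2 * M * K + 2 * M * K"
    using K2 pr[OF s1 s4] pr[OF s3 s2] by linarith
  also have "\<dots> = 5 * M * K" by simp
  finally have "(g1 * h1)^2 \<le> 5 * M * K" .
  moreover have "(g1 * h1)^2 = K * K" by (simp add: K_def power2_eq_square abs_mult[symmetric] mult.assoc)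
  ultimately have "K * K \<le> 5 * M * K" by simp
  then show False using K0 by simp
qed

lemma quad_quad_bound:
  fixes g2 g1 g0 h2 h1 h0 M g h :: real
  assumes b: "\<bar>g2 * h2\<bar> \<le> M" "\<bar>g2 * h1 + g1 * h2\<bar> \<le> M" "\<bar>g2 * h0 + g1 * h1 + g0 * h2\<bar> \<le> M"
      "\<bar>g1 * h0 + g0 * h1\<bar> \<le> M" "\<bar>g0 * h0\<bar> \<le> M"
    and g: "g \<in> {g2, g1, g0}" and h: "h \<in> {h2, h1, h0}"
  shows "\<bar>g\<bar> * \<bar>h\<bar> \<le> 5 * M"
proof -
  have M: "M \<ge> 0" using b(1) by linarith
  define G where "G = max \<bar>g1\<bar> (max \<bar>g2\<bar> \<bar>g0\<bar>)"
  define H where "H = max \<bar>h1\<bar> (max \<bar>h2\<bar> \<bar>h0\<bar>)"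
  have gG: "\<bar>g\<bar> \<le> G" using g by (auto simp: G_def)
  have hH: "\<bar>h\<bar> \<le> H" using h by (auto simp: H_def)
  note bb = b(1,2,4,5) b(3)
  have c: "h2 * g2 = g2 * h2" "h2 * g1 + h1 * g2 = g2 * h1 + g1 * h2"
    "h2 * g0 + h1 * g1 + h0 * g2 = g2 * h0 + g1 * h1 + g0 * h2" "g0 * h2 + g1 * h1 + g2 * h0 = g2 * h0 + g1 * h1 + g0 * h2"
    "h0 * g2 + h1 * g1 + h2 * g0 = g2 * h0 + g1 * h1 + g0 * h2"
    "h0 * g1 + h1 * g0 = g1 * h0 + g0 * h1" "h0 * g0 = g0 * h0" "g0 * h1 + g1 * h0 = g1 * h0 + g0 * h1"
    by (simp_all add: algebra_simps)
  have "G * H \<le> 5 * M"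
  proof -
    consider "\<bar>g0\<bar> \<le> \<bar>g1\<bar>" "\<bar>g2\<bar> \<le> \<bar>g1\<bar>" "\<bar>h0\<bar> \<le> \<bar>h1\<bar>" "\<bar>h2\<bar> \<le> \<bar>h1\<bar>"
      | "\<bar>g0\<bar> \<le> \<bar>g2\<bar>" "\<bar>g1\<bar> \<le> \<bar>g2\<bar>" | "\<bar>g2\<bar> \<le> \<bar>g0\<bar>" "\<bar>g1\<bar> \<le> \<bar>g0\<bar>"
      | "\<bar>h0\<bar> \<le> \<bar>h2\<bar>" "\<bar>h1\<bar> \<le> \<bar>h2\<bar>" | "\<bar>h2\<bar> \<le> \<bar>h0\<bar>" "\<bar>h1\<bar> \<le> \<bar>h0\<bar>"
      by linarith
    moreover have up: "t \<le> 5 * M" if "t \<le> M \<or> t \<le> 2 * M \<or> t \<le> 4 * M" for t using that M by linarith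
    have Gc: "G = \<bar>g1\<bar> \<or> G = \<bar>g2\<bar> \<or> G = \<bar>g0\<bar>" and Hc: "H = \<bar>h1\<bar> \<or> H = \<bar>h2\<bar> \<or> H = \<bar>h0\<bar>"
      unfolding G_def H_def by (simp_all only: max_def split: if_split) blast+
    ultimately show ?thesis
    proof cases
      case 1
      then have "G = \<bar>g1\<bar>" "H = \<bar>h1\<bar>" by (auto simp: G_def H_def)
      then show ?thesis using quad_quad_bound_middle[OF 1 b] by simp
    next
      case 2
      have "G = \<bar>g2\<bar>" using 2 by (simp add: G_def max_def)
      moreover have "\<bar>g2\<bar> * \<bar>h2\<bar> \<le> M \<and> \<bar>g2\<bar> * \<bar>h1\<bar> \<le> 2 * M \<and> \<bar>g2\<bar> * \<bar>h0\<bar> \<le> 4 * M"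
        by (rule quad_quad_bound_lead[OF 2 b(1-3)])
      ultimately show ?thesis using Hc up by metis
    next
      case 3
      have "G = \<bar>g0\<bar>" using 3 by (simp add: G_def max_def)
      moreover have "\<bar>g0\<bar> * \<bar>h0\<bar> \<le> M \<and> \<bar>g0\<bar> * \<bar>h1\<bar> \<le> 2 * M \<and> \<bar>g0\<bar> * \<bar>h2\<bar> \<le> 4 * M"
        by (rule quad_quad_bound_lead[OF 3]) (unfold c, fact+)
      ultimately show ?thesis using Hc up by metis
    next
      case 4
      have "H = \<bar>h2\<bar>" using 4 by (simp add: H_def max_def)
      moreover have "\<bar>h2\<bar> * \<bar>g2\<bar> \<le> M \<and> \<bar>h2\<bar> * \<bar>g1\<bar> \<le> 2 * M \<and> \<bar>h2\<bar> * \<bar>g0\<bar> \<le> 4 * M"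
        by (rule quad_quad_bound_lead[OF 4]) (unfold c, fact+)
      ultimately show ?thesis using Gc up by (metis mult.commute)
    next
      case 5
      have "H = \<bar>h0\<bar>" using 5 by (simp add: H_def max_def)
      moreover have "\<bar>h0\<bar> * \<bar>g0\<bar> \<le> M \<and> \<bar>h0\<bar> * \<bar>g1\<bar> \<le> 2 * M \<and> \<bar>h0\<bar> * \<bar>g2\<bar> \<le> 4 * M"
        by (rule quad_quad_bound_lead[OF 5]) (unfold c, fact+)
      ultimately show ?thesis using Gc up by (metis mult.commute)
    qed
  qed
  moreover have "\<bar>g\<bar> * \<bar>h\<bar> \<le> G * H" using gG hH by (intro mult_mono) auto
  ultimately show ?thesis by linarith
qed

definition ball_int :: "real \<Rightarrow> real \<Rightarrow> int set" where
  "ball_int r B = {n. \<bar>of_int n - r\<bar> \<le> B}"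

lemma ball_int_subset: "ball_int r B \<subseteq> {\<lceil>r - B\<rceil>..\<lfloor>r + B\<rfloor>}"
  unfolding ball_int_def by (auto simp: ceiling_le_iff le_floor_iff abs_le_iff)

lemma finite_ball_int [simp]: "finite (ball_int r B)"
  by (rule finite_subset[OF ball_int_subset]) simp

lemma card_ball_int:
  assumes "B \<ge> 0"
  shows "real (card (ball_int r B)) \<le> 2 * B + 1"
proof -
  have "card (ball_int r B) \<le> card {\<lceil>r - B\<rceil>..\<lfloor>r + B\<rfloor>}"
    by (rule card_mono[OF _ ball_int_subset]) simp
  also have "\<dots> = nat (\<lfloor>r + B\<rfloor> - \<lceil>r - B\<rceil> + 1)" by simp
  finally have "real (card (ball_int r B)) \<le> real (nat (\<lfloor>r + B\<rfloor> - \<lceil>r - B\<rceil> + 1))" by simp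
  also have "\<dots> \<le> 2 * B + 1"
  proof (cases "\<lfloor>r + B\<rfloor> - \<lceil>r - B\<rceil> + 1 \<ge> 0")
    case True
    then have "real (nat (\<lfloor>r + B\<rfloor> - \<lceil>r - B\<rceil> + 1)) = of_int \<lfloor>r + B\<rfloor> - of_int \<lceil>r - B\<rceil> + 1" by simp
    also have "\<dots> \<le> (r + B) - (r - B) + 1" by (intro add_mono diff_mono) auto
    finally show ?thesis by simp
  qed (use assms in simp)
  finally show ?thesis .
qed

lemma card_ball_int_3:
  assumes "B \<ge> 1"
  shows "real (card (ball_int r B)) \<le> 3 * B"
  using card_ball_int[of B r] assms by simp

lemma sum_inverse_squares_tail:
  assumes "m \<ge> 1"
  shows "(\<Sum>k=m..n. 1 / real k ^ 2) \<le> 2 / real m"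
proof (cases "m \<le> n")
  case True
  have "(\<Sum>k=m..n. 1 / real k ^ 2) \<le> 2 / real m - 1 / real n"
    using True
  proof (induction n rule: dec_induct)
    case base
    have "1 / real m ^ 2 \<le> 1 / real m" using assms by (simp add: field_simps power2_eq_square)
    then show ?case by simp
  next
    case (step n)
    have "1 / real n - 1 / real (Suc n) = 1 / (real n * real (Suc n))"
      using step.hyps assms by (simp add: field_simps)
    moreover have "1 / real (Suc n) ^ 2 \<le> 1 / (real n * real (Suc n))"
      unfolding power2_eq_square using step.hyps assms by (intro divide_left_mono mult_right_mono mult_pos_pos) auto
    ultimately show ?case using step by simp
  qed
  moreover have "1 / real n \<ge> 0" by simp
  ultimately show ?thesis by linarith
qed simp

definition coeffs_le :: "real \<Rightarrow> bqf \<Rightarrow> bool" where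
  "coeffs_le N f \<longleftrightarrow> (case f of BQF a b c d e \<Rightarrow> \<bar>of_int a\<bar> \<le> N \<and> \<bar>of_int b\<bar> \<le> N \<and> \<bar>of_int c\<bar> \<le> N
      \<and> \<bar>of_int d\<bar> \<le> N \<and> \<bar>of_int e\<bar> \<le> N)"

text \<open>If \<open>k\<close> is the largest absolute coefficient of one factor, those of the
  other are at most 5 N / k. A linear factor and a cubic leave about k^2 (N/k)^4 = N^4/k^2 choices,
  summable over k; two quadratics leave about k^3 (N/k)^3 = N^3 choices for each of at most 5 N
  values of k.\<close>

lemma card_reducible_le:
  assumes N: "N \<ge> 1"
  defines "R \<equiv> {f. coeffs_le N f \<and> (\<exists>a b c d e. f = BQF a b c d e \<and> a \<noteq> 0) \<and> splits TYPE(rat) f}"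
  shows "finite R" "real (card R) \<le> (18 * 15^4 + 27 * 15^3 * 5) * N^4"
proof -
  define K where "K = nat \<lfloor>5 * N\<rfloor>"
  let ?B = "\<lambda>r. ball_int 0 r"
  define P where "P k = (?B (real k) \<times> ?B (real k)) \<times> (?B (5 * N / real k) \<times> ?B (5 * N / real k) \<times> ?B (5 * N / real k) \<times> ?B (5 * N / real k))" for k
  define Q where "Q k = (?B (real k) \<times> ?B (real k) \<times> ?B (real k)) \<times> (?B (5 * N / real k) \<times> ?B (5 * N / real k) \<times> ?B (5 * N / real k))" for k
  define p :: "(int \<times> int) \<times> int \<times> int \<times> int \<times> int \<Rightarrow> bqf" where
    "p = (\<lambda>((g1, g0), h3, h2, h1, h0). BQF (g1 * h3) (g1 * h2 + g0 * h3) (g1 * h1 + g0 * h2) (g1 * h0 + g0 * h1) (g0 * h0))"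
  define q :: "(int \<times> int \<times> int) \<times> int \<times> int \<times> int \<Rightarrow> bqf" where
    "q = (\<lambda>((g2, g1, g0), h2, h1, h0). BQF (g2 * h2) (g2 * h1 + g1 * h2) (g2 * h0 + g1 * h1 + g0 * h2) (g1 * h0 + g0 * h1) (g0 * h0))"
  have sub: "R \<subseteq> (\<Union>k\<in>{1..K}. p ` P k) \<union> (\<Union>k\<in>{1..K}. q ` Q k)"
  proof
    fix f assume "f \<in> R"
    then obtain a b c d e where f: "f = BQF a b c d e" and a: "a \<noteq> 0" and bd: "coeffs_le N f"
      and sp: "splits TYPE(rat) f" unfolding R_def by blast
    have bdd: "\<bar>real_of_int a\<bar> \<le> N" "\<bar>real_of_int b\<bar> \<le> N" "\<bar>real_of_int c\<bar> \<le> N" "\<bar>real_of_int d\<bar> \<le> N" "\<bar>real_of_int e\<bar> \<le> N"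
      using bd unfolding f coeffs_le_def by auto
    have "splits TYPE(int) f" using splits_int[of a b c d e] sp a f by simp
    then consider (1) g1 g0 h3 h2 h1 h0 :: int where "lin_cub g1 g0 h3 h2 h1 h0 f"
      | (2) g2 g1 g0 h2 h1 h0 :: int where "quad_quad g2 g1 g0 h2 h1 h0 f"
      unfolding splits_def by blast
    then show "f \<in> (\<Union>k\<in>{1..K}. p ` P k) \<union> (\<Union>k\<in>{1..K}. q ` Q k)"
    proof cases
      case 1
      then have eq: "a = g1 * h3" "b = g1 * h2 + g0 * h3" "c = g1 * h1 + g0 * h2"
        "d = g1 * h0 + g0 * h1" "e = g0 * h0"
        unfolding lin_cub_def f by auto
      define k where "k = nat (max \<bar>g1\<bar> \<bar>g0\<bar>)"
      have rk: "real k = max \<bar>real_of_int g1\<bar> \<bar>real_of_int g0\<bar>" by (simp add: k_def of_int_max)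
      have g1: "g1 \<noteq> 0" "h3 \<noteq> 0" using a eq by auto
      then have k1: "k \<ge> 1" by (simp add: k_def)
      have bnd: "real k * \<bar>real_of_int h\<bar> \<le> 5 * N" if "h \<in> {h3, h2, h1, h0}" for h
        unfolding rk using bdd that unfolding eq of_int_mult of_int_add
        by (intro lin_cub_bound[of "of_int g1" "of_int h3" N "of_int h2" "of_int g0" "of_int h1" "of_int h0"]) auto
      have hB: "h \<in> ?B (5 * N / real k)" if "h \<in> {h3, h2, h1, h0}" for h
        using bnd[OF that] k1 by (simp add: ball_int_def field_simps)
      have gB: "g \<in> ?B (real k)" if "g \<in> {g1, g0}" for g
      proof -
        have "\<bar>real_of_int g\<bar> \<le> real k" unfolding rk using that
          by (elim insertE emptyE; simp only: le_max_iff_disj order_refl simp_thms)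
        then show ?thesis by (simp only: ball_int_def mem_Collect_eq diff_zero)
      qed
      \<comment> \<open>\<open>h3\<close> divides the nonzero \<open>a\<close>, so it has absolute
        value at least 1, and k itself is at most 5 N.\<close>
      have "real k * 1 \<le> real k * \<bar>real_of_int h3\<bar>" using g1 by (intro mult_left_mono) linarith+
      then have "real k \<le> 5 * N" using bnd[of h3] by simp
      then have "k \<in> {1..K}" using k1 by (simp add: K_def le_nat_iff le_floor_iff)
      moreover have "((g1, g0), h3, h2, h1, h0) \<in> P k"
        unfolding P_def by (simp add: gB hB)
      moreover have "f = p ((g1, g0), h3, h2, h1, h0)" by (simp add: p_def f eq)
      ultimately show ?thesis by blast
    next
      case 2
      then have eq: "a = g2 * h2" "b = g2 * h1 + g1 * h2" "c = g2 * h0 + g1 * h1 + g0 * h2"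
        "d = g1 * h0 + g0 * h1" "e = g0 * h0"
        unfolding quad_quad_def f by auto
      define k where "k = nat (max \<bar>g1\<bar> (max \<bar>g2\<bar> \<bar>g0\<bar>))"
      have rk: "real k = max \<bar>real_of_int g1\<bar> (max \<bar>real_of_int g2\<bar> \<bar>real_of_int g0\<bar>)" by (simp add: k_def of_int_max)
      have g1: "g2 \<noteq> 0" "h2 \<noteq> 0" using a eq by auto
      then have k1: "k \<ge> 1" by (simp add: k_def)
      have bnd: "real k * \<bar>real_of_int h\<bar> \<le> 5 * N" if h: "h \<in> {h2, h1, h0}" for h
      proof -
        have "real k = \<bar>real_of_int g1\<bar> \<or> real k = \<bar>real_of_int g2\<bar> \<or> real k = \<bar>real_of_int g0\<bar>"
          unfolding rk by (simp only: max_def split: if_split) blast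
        then obtain g where g: "g \<in> {g2, g1, g0}" "real k = \<bar>real_of_int g\<bar>" by blast
        show ?thesis unfolding g(2)
          by (rule quad_quad_bound[of "of_int g2" "of_int h2" N "of_int h1" "of_int g1" "of_int h0" "of_int g0"])
            (use bdd g(1) h in \<open>auto simp: eq\<close>)
      qed
      have hB: "h \<in> ?B (5 * N / real k)" if "h \<in> {h2, h1, h0}" for h
        using bnd[OF that] k1 by (simp add: ball_int_def field_simps)
      have gB: "g \<in> ?B (real k)" if "g \<in> {g2, g1, g0}" for g
      proof -
        have "\<bar>real_of_int g\<bar> \<le> real k" unfolding rk using that
          by (elim insertE emptyE; simp only: le_max_iff_disj order_refl simp_thms)
        then show ?thesis by (simp only: ball_int_def mem_Collect_eq diff_zero)
      qed
      have "real k * 1 \<le> real k * \<bar>real_of_int h2\<bar>" using g1 by (intro mult_left_mono) linarith+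
      then have "real k \<le> 5 * N" using bnd[of h2] by simp
      then have "k \<in> {1..K}" using k1 by (simp add: K_def le_nat_iff le_floor_iff)
      moreover have "((g2, g1, g0), h2, h1, h0) \<in> Q k"
        unfolding Q_def by (simp add: gB hB)
      moreover have "f = q ((g2, g1, g0), h2, h1, h0)" by (simp add: q_def f eq)
      ultimately show ?thesis by blast
    qed
  qed
  have fin: "finite (P k)" "finite (Q k)" for k by (auto simp: P_def Q_def)
  then have finU: "finite ((\<Union>k\<in>{1..K}. p ` P k) \<union> (\<Union>k\<in>{1..K}. q ` Q k))" by auto
  show "finite R" by (rule finite_subset[OF sub finU])
  have KN: "real K \<le> 5 * N" using N by (simp add: K_def)
  have cB: "real (card (?B (real k))) \<le> 3 * real k" "real (card (?B (5 * N / real k))) \<le> 15 * N / real k"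
    if "k \<in> {1..K}" for k
  proof -
    show "real (card (?B (real k))) \<le> 3 * real k" using that by (intro card_ball_int_3) simp
    have "real k \<le> real K" using that by simp
    then have "5 * N / real k \<ge> 1" using that KN by (simp add: field_simps)
    then show "real (card (?B (5 * N / real k))) \<le> 15 * N / real k" using card_ball_int_3 by fastforce
  qed
  have cP: "real (card (P k)) \<le> 9 * 15^4 * N^4 * (1 / real k^2)" if k: "k \<in> {1..K}" for k
  proof -
    have "real (card (P k)) = (real (card (?B (real k))))^2 * (real (card (?B (5 * N / real k))))^4"
      unfolding P_def card_cartesian_product by (simp add: power2_eq_square power4_eq_xxxx)
    also have "\<dots> \<le> (3 * real k)^2 * (15 * N / real k)^4"
      using cB[OF k] by (intro mult_mono power_mono) auto
    also have "\<dots> = 9 * 15^4 * N^4 * (1 / real k^2)"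
      using k by (simp add: field_simps power2_eq_square power4_eq_xxxx)
    finally show ?thesis .
  qed
  have cQ: "real (card (Q k)) \<le> 27 * 15^3 * N^3" if k: "k \<in> {1..K}" for k
  proof -
    have "real (card (Q k)) = (real (card (?B (real k))))^3 * (real (card (?B (5 * N / real k))))^3"
      unfolding Q_def card_cartesian_product by (simp add: power3_eq_cube)
    also have "\<dots> \<le> (3 * real k)^3 * (15 * N / real k)^3"
      using cB[OF k] by (intro mult_mono power_mono) auto
    also have "\<dots> = 27 * 15^3 * N^3"
      using k by (simp add: field_simps power3_eq_cube)
    finally show ?thesis .
  qed
  have "card R \<le> card ((\<Union>k\<in>{1..K}. p ` P k) \<union> (\<Union>k\<in>{1..K}. q ` Q k))" by (rule card_mono[OF finU sub])
  also have "\<dots> \<le> card (\<Union>k\<in>{1..K}. p ` P k) + card (\<Union>k\<in>{1..K}. q ` Q k)" by (rule card_Un_le)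
  also have "\<dots> \<le> (\<Sum>k=1..K. card (P k)) + (\<Sum>k=1..K. card (Q k))"
  proof (intro add_mono order_trans[OF card_UN_le] sum_mono)
  qed (auto intro: card_image_le fin)
  finally have "real (card R) \<le> real ((\<Sum>k=1..K. card (P k)) + (\<Sum>k=1..K. card (Q k)))"
    by (simp only: of_nat_le_iff)
  then have "real (card R) \<le> (\<Sum>k=1..K. real (card (P k))) + (\<Sum>k=1..K. real (card (Q k)))"
    by (simp only: of_nat_add of_nat_sum)
  also have "\<dots> \<le> (\<Sum>k=1..K. 9 * 15^4 * N^4 * (1 / real k^2)) + (\<Sum>k=1..K. 27 * 15^3 * N^3)"
    by (intro add_mono sum_mono cP cQ)
  also have "\<dots> \<le> 9 * 15^4 * N^4 * 2 + (5 * N) * (27 * 15^3 * N^3)"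
  proof (intro add_mono)
    show "(\<Sum>k=1..K. 9 * 15^4 * N^4 * (1 / real k^2)) \<le> 9 * 15^4 * N^4 * 2"
      unfolding sum_distrib_left[symmetric] using N sum_inverse_squares_tail[of 1 K]
        by (intro mult_left_mono) auto
    show "(\<Sum>k=1..K. 27 * 15^3 * N^3) \<le> (5 * N) * (27 * 15^3 * N^3)"
      using KN N by (simp add: mult_right_mono)
  qed
  also have "\<dots> = (18 * 15^4 + 27 * 15^3 * 5) * N^4" by (simp add: algebra_simps power4_eq_xxxx power3_eq_cube)
  finally show "real (card R) \<le> (18 * 15^4 + 27 * 15^3 * 5) * N^4" .
qed

section \<open>Counting lattice points\<close>

definition grid_round :: "'a::euclidean_space \<Rightarrow> 'a \<Rightarrow> 'a \<Rightarrow> 'a" where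
  "grid_round u m x = (\<Sum>b\<in>Basis. (u \<bullet> b + (m \<bullet> b) * of_int \<lfloor>((x - u) \<bullet> b) / (m \<bullet> b)\<rfloor>) *\<^sub>R b)"

text \<open>The side lengths \<open>m\<close> may differ by coordinate, since I scales with t^2 and
  J with t^3; the origin \<open>u\<close> serves to describe residue classes.\<close>

definition grid :: "'a::euclidean_space \<Rightarrow> 'a \<Rightarrow> 'a set" where
  "grid u m = {p. \<forall>b\<in>Basis. ((p - u) \<bullet> b) / (m \<bullet> b) \<in> \<int>}"

definition grid_cell :: "'a::euclidean_space \<Rightarrow> 'a \<Rightarrow> 'a set" where
  "grid_cell m p = {x. \<forall>b\<in>Basis. p \<bullet> b \<le> x \<bullet> b \<and> x \<bullet> b < p \<bullet> b + m \<bullet> b}"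

lemma grid_round_inner:
  "b \<in> Basis \<Longrightarrow> grid_round u m x \<bullet> b = u \<bullet> b + (m \<bullet> b) * of_int \<lfloor>((x - u) \<bullet> b) / (m \<bullet> b)\<rfloor>"
  unfolding grid_round_def by simp

lemma grid_round_in_grid:
  assumes "\<And>b. b \<in> Basis \<Longrightarrow> m \<bullet> b > 0"
  shows "grid_round u m x \<in> grid u m"
  unfolding grid_def using assms by (auto simp: grid_round_inner inner_diff_left less_imp_neq[symmetric])

lemma grid_round_eq_iff:
  assumes m: "\<And>b. b \<in> Basis \<Longrightarrow> m \<bullet> b > 0" and p: "p \<in> grid u m"
  shows "grid_round u m x = p \<longleftrightarrow> x \<in> grid_cell m p"
proof -
  have "grid_round u m x \<bullet> b = p \<bullet> b \<longleftrightarrow> p \<bullet> b \<le> x \<bullet> b \<and> x \<bullet> b < p \<bullet> b + m \<bullet> b" if b: "b \<in> Basis" for b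
  proof -
    obtain k where k: "((p - u) \<bullet> b) / (m \<bullet> b) = of_int k"
      using p b unfolding grid_def by (auto elim!: Ints_cases)
    then have pk: "p \<bullet> b = u \<bullet> b + m \<bullet> b * of_int k"
      using m[OF b] by (simp add: field_simps inner_diff_left)
    have "grid_round u m x \<bullet> b = p \<bullet> b \<longleftrightarrow> \<lfloor>((x - u) \<bullet> b) / (m \<bullet> b)\<rfloor> = k"
      unfolding grid_round_inner[OF b] pk using m[OF b] by auto
    also have "\<dots> \<longleftrightarrow> of_int k \<le> ((x - u) \<bullet> b) / (m \<bullet> b) \<and> ((x - u) \<bullet> b) / (m \<bullet> b) < of_int k + 1"
      by (rule floor_eq_iff)
    also have "\<dots> \<longleftrightarrow> p \<bullet> b \<le> x \<bullet> b \<and> x \<bullet> b < p \<bullet> b + m \<bullet> b"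
      unfolding pk using m[OF b] by (auto simp: field_simps inner_diff_left)
    finally show ?thesis .
  qed
  then show ?thesis unfolding grid_cell_def by (subst euclidean_eq_iff) auto
qed

lemma grid_cell_measurable [measurable]: "grid_cell m p \<in> sets borel"
  unfolding grid_cell_def by measurable

lemma emeasure_grid_cell:
  assumes m: "\<And>b. b \<in> Basis \<Longrightarrow> m \<bullet> b > 0"
  shows "emeasure lborel (grid_cell m p) = ennreal (\<Prod>b\<in>Basis. m \<bullet> b)"
proof (rule antisym)
  have "emeasure lborel (grid_cell m p) \<le> emeasure lborel (cbox p (p + m))"
    by (rule emeasure_mono) (auto simp: grid_cell_def mem_box inner_add_left less_imp_le)
  also have "\<dots> = ennreal (\<Prod>b\<in>Basis. m \<bullet> b)"
    using m by (subst emeasure_lborel_cbox) (auto simp: inner_add_left less_imp_le)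
  finally show "emeasure lborel (grid_cell m p) \<le> ennreal (\<Prod>b\<in>Basis. m \<bullet> b)" .
  have "emeasure lborel (box p (p + m)) \<le> emeasure lborel (grid_cell m p)"
    by (rule emeasure_mono) (auto simp: grid_cell_def mem_box inner_add_left less_imp_le)
  moreover have "emeasure lborel (box p (p + m)) = ennreal (\<Prod>b\<in>Basis. m \<bullet> b)"
    using m by (subst emeasure_lborel_box) (auto simp: inner_add_left less_imp_le)
  ultimately show "ennreal (\<Prod>b\<in>Basis. m \<bullet> b) \<le> emeasure lborel (grid_cell m p)" by simp
qed

lemma finite_grid_bounded:
  fixes S :: "'a::euclidean_space set"
  assumes m: "\<And>b. b \<in> Basis \<Longrightarrow> m \<bullet> b > 0" and S: "bounded S"
  shows "finite (S \<inter> grid u m)"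
proof -
  obtain R where R: "\<And>x. x \<in> S \<Longrightarrow> norm x \<le> R" using S bounded_iff by blast
  define k :: "'a \<Rightarrow> 'a \<Rightarrow> int" where "k p = restrict (\<lambda>b. \<lfloor>((p - u) \<bullet> b) / (m \<bullet> b)\<rfloor>) Basis" for p
  define N where "N b = \<lceil>(R + \<bar>u \<bullet> b\<bar>) / (m \<bullet> b)\<rceil> + 1" for b
  have "inj_on k (S \<inter> grid u m)"
  proof (rule inj_onI)
    fix p q assume p: "p \<in> S \<inter> grid u m" and q: "q \<in> S \<inter> grid u m" and eq: "k p = k q"
    show "p = q"
    proof (rule euclidean_eqI)
      fix b :: 'a assume b: "b \<in> Basis"
      have "\<lfloor>((p - u) \<bullet> b) / (m \<bullet> b)\<rfloor> = \<lfloor>((q - u) \<bullet> b) / (m \<bullet> b)\<rfloor>"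
        using fun_cong[OF eq, of b] b by (simp add: k_def)
      moreover have "((p - u) \<bullet> b) / (m \<bullet> b) \<in> \<int>" "((q - u) \<bullet> b) / (m \<bullet> b) \<in> \<int>"
        using p q b by (auto simp: grid_def)
      ultimately have "((p - u) \<bullet> b) / (m \<bullet> b) = ((q - u) \<bullet> b) / (m \<bullet> b)"
        by (metis Ints_cases floor_of_int)
      then show "p \<bullet> b = q \<bullet> b" using m[OF b] by (simp add: inner_diff_left)
    qed
  qed
  moreover have "k ` (S \<inter> grid u m) \<subseteq> (\<Pi>\<^sub>E b\<in>Basis. {- N b .. N b})"
  proof clarify
    fix p assume p: "p \<in> S"
    show "k p \<in> (\<Pi>\<^sub>E b\<in>Basis. {- N b .. N b})"
    proof (rule PiE_I)
      fix b :: 'a assume b: "b \<in> Basis"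
      have "\<bar>p \<bullet> b\<bar> \<le> R" using Basis_le_norm[OF b, of p] R[OF p] by linarith
      then have "\<bar>(p - u) \<bullet> b\<bar> \<le> R + \<bar>u \<bullet> b\<bar>" by (simp add: inner_diff_left)
      define y where "y = ((p - u) \<bullet> b) / (m \<bullet> b)"
      have "\<bar>y\<bar> \<le> (R + \<bar>u \<bullet> b\<bar>) / (m \<bullet> b)"
        unfolding y_def abs_divide using \<open>\<bar>(p - u) \<bullet> b\<bar> \<le> _\<close> m[OF b] by (simp add: divide_right_mono)
      then have "\<bar>y\<bar> \<le> of_int (\<lceil>(R + \<bar>u \<bullet> b\<bar>) / (m \<bullet> b)\<rceil>)" by linarith
      then have "- N b \<le> \<lfloor>y\<rfloor> \<and> \<lfloor>y\<rfloor> \<le> N b" unfolding N_def by linarith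
      then show "k p b \<in> {- N b .. N b}" using b unfolding k_def y_def by simp
    qed (simp add: k_def)
  qed
  moreover have "finite (\<Pi>\<^sub>E b\<in>(Basis::'a set). {- N b .. N b})" by (rule finite_PiE) auto
  ultimately show ?thesis by (metis finite_imageD finite_subset)
qed

text \<open>The integrand is the sum of the indicators of the finitely many cells whose lower corner
  lies in \<open>S\<close>, all of the same volume.\<close>

lemma grid_count_integral:
  assumes m: "\<And>b. b \<in> Basis \<Longrightarrow> m \<bullet> b > 0" and S: "bounded S"
  shows "(\<lambda>x. indicator S (grid_round u m x) :: real) \<in> borel_measurable borel"
    "(\<integral>x. indicator S (grid_round u m x) \<partial>lborel) = real (card (S \<inter> grid u m)) * (\<Prod>b\<in>Basis. m \<bullet> b)"
proof -
  note fin = finite_grid_bounded[OF m S, of u]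
  have eq: "(\<lambda>x. indicator S (grid_round u m x) :: real) = (\<lambda>x. \<Sum>p\<in>S \<inter> grid u m. indicator (grid_cell m p) x)"
  proof
    fix x
    have "(\<Sum>p\<in>S \<inter> grid u m. indicator (grid_cell m p) x :: real)
       = (\<Sum>p\<in>S \<inter> grid u m. if grid_round u m x = p then 1 else 0)"
      using grid_round_eq_iff[OF m] by (intro sum.cong) (auto simp: indicator_def)
    also have "\<dots> = (if grid_round u m x \<in> S \<inter> grid u m then 1 else 0)"
      by (rule sum.delta'[OF fin])
    also have "\<dots> = indicator S (grid_round u m x)"
      using grid_round_in_grid[OF m] by (auto simp: indicator_def)
    finally show "indicator S (grid_round u m x) = (\<Sum>p\<in>S \<inter> grid u m. indicator (grid_cell m p) x :: real)" by simp
  qed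
  show "(\<lambda>x. indicator S (grid_round u m x) :: real) \<in> borel_measurable borel"
    unfolding eq by measurable
  have pos: "(\<Prod>b\<in>Basis. m \<bullet> b) \<ge> 0" using m by (intro prod_nonneg) (auto simp: less_imp_le)
  have me: "measure lborel (grid_cell m p) = (\<Prod>b\<in>Basis. m \<bullet> b)" for p
    using emeasure_grid_cell[OF m, of p] pos by (simp add: measure_def)
  have "integrable lborel (indicator (grid_cell m p) :: _ \<Rightarrow> real)" for p
    by (rule integrable_real_indicator) (simp_all add: emeasure_grid_cell[OF m])
  then show "(\<integral>x. indicator S (grid_round u m x) \<partial>lborel) = real (card (S \<inter> grid u m)) * (\<Prod>b\<in>Basis. m \<bullet> b)"
    unfolding eq by (subst Bochner_Integration.integral_sum) (simp_all add: me)
qed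

text \<open>The number of grid points times the cell volume is the integral of the indicator function
  composed with rounding to the grid, so dominated convergence gives the asymptotics.\<close>

theorem grid_count_tendsto:
  fixes S U K :: "'a::euclidean_space set" and u m :: "real \<Rightarrow> 'a"
  assumes U: "open U" "U \<subseteq> S" and K: "compact K" "S \<subseteq> K" and null: "emeasure lborel (K - U) = 0"
    and m: "\<And>t b. b \<in> Basis \<Longrightarrow> m t \<bullet> b > 0" and m0: "(m \<longlongrightarrow> 0) at_top"
  shows "((\<lambda>t. real (card (S \<inter> grid (u t) (m t))) * (\<Prod>b\<in>Basis. m t \<bullet> b)) \<longlongrightarrow> measure lborel U) at_top"
proof -
  have bS: "bounded S" using K bounded_subset compact_imp_bounded by blast
  define d where "d t = (\<Sum>b\<in>Basis. m t \<bullet> b)" for t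
  have d0: "(d \<longlongrightarrow> 0) at_top"
  proof -
    have "((\<lambda>t. \<Sum>b\<in>Basis. m t \<bullet> b) \<longlongrightarrow> (\<Sum>b\<in>(Basis::'a set). 0 \<bullet> b)) at_top"
      by (intro tendsto_sum tendsto_inner m0 tendsto_const)
    then show ?thesis by (simp add: d_def[abs_def])
  qed
  have nd: "norm (grid_round (u t) (m t) x - x) \<le> d t" for t x
  proof -
    have "norm (grid_round (u t) (m t) x - x) \<le> (\<Sum>b\<in>Basis. \<bar>(grid_round (u t) (m t) x - x) \<bullet> b\<bar>)"
      by (rule norm_le_l1)
    also have "\<dots> \<le> d t"
      unfolding d_def
    proof (rule sum_mono)
      fix b :: 'a assume b: "b \<in> Basis"
      define y where "y = ((x - u t) \<bullet> b) / (m t \<bullet> b)"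
      have xy: "x \<bullet> b = u t \<bullet> b + m t \<bullet> b * y" using m[OF b, of t] by (simp add: y_def inner_diff_left)
      have "(grid_round (u t) (m t) x - x) \<bullet> b = m t \<bullet> b * (of_int \<lfloor>y\<rfloor> - y)"
        unfolding inner_diff_left grid_round_inner[OF b] y_def[symmetric, unfolded inner_diff_left] xy
        by (simp add: algebra_simps)
      moreover have "\<bar>of_int \<lfloor>y\<rfloor> - y\<bar> \<le> 1" by linarith
      ultimately show "\<bar>(grid_round (u t) (m t) x - x) \<bullet> b\<bar> \<le> m t \<bullet> b"
        using m[OF b, of t] by (simp add: abs_mult mult_left_le)
    qed
    finally show ?thesis .
  qed
  have conv: "((\<lambda>t. grid_round (u t) (m t) x) \<longlongrightarrow> x) at_top" for x
  proof (rule Lim_null_comparison[THEN Lim_null[THEN iffD2]])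
    show "\<forall>\<^sub>F t in at_top. norm (grid_round (u t) (m t) x - x) \<le> d t" using nd by simp
  qed (rule d0)
  have "bounded K" using K by (simp add: compact_imp_bounded)
  then obtain R where R: "\<And>x. x \<in> K \<Longrightarrow> norm x \<le> R" unfolding bounded_iff by blast
  have "((\<lambda>t. \<integral>x. indicator S (grid_round (u t) (m t) x) \<partial>lborel) \<longlongrightarrow> (\<integral>x. indicator U x \<partial>lborel :: real)) at_top"
  proof (rule integral_dominated_convergence_at_top)
    show "(indicator U :: 'a \<Rightarrow> real) \<in> borel_measurable lborel" using U by simp
    show "(\<lambda>x. indicator S (grid_round (u t) (m t) x) :: real) \<in> borel_measurable lborel" for t
      using grid_count_integral(1)[OF m bS] by simp
    \<comment> \<open>This ball dominates: once the sides of a cell add up to less than 1, a point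
      that is rounded into \<open>S\<close> has norm at most R + 1.\<close>
    show "integrable lborel (indicator (cball (0::'a) (R + 1)) :: 'a \<Rightarrow> real)"
      by (intro integrable_real_indicator)
        (use emeasure_bounded_finite[OF bounded_cball, of "0::'a" "R + 1"] in \<open>simp_all add: infinity_ennreal_def\<close>)
    have "AE x in lborel. x \<notin> K - U"
      by (rule AE_not_in) (use null U K in \<open>simp add: null_sets_def compact_imp_closed borel_closed borel_open\<close>)
    then show "AE x in lborel. ((\<lambda>t. indicator S (grid_round (u t) (m t) x) :: real) \<longlongrightarrow> indicator U x) at_top"
    proof eventually_elim
      case (elim x)
      show ?case
      proof (cases "x \<in> U")
        case True
        have "\<forall>\<^sub>F t in at_top. grid_round (u t) (m t) x \<in> U" using topological_tendstoD[OF conv U(1) True] .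
        then have "\<forall>\<^sub>F t in at_top. indicator S (grid_round (u t) (m t) x) = (indicator U x :: real)"
          by (rule eventually_mono) (use True U in auto)
        then show ?thesis by (rule tendsto_eventually)
      next
        case False
        then have "x \<in> - K" using elim by auto
        moreover have "open (- K)" using K by (simp add: compact_imp_closed open_Compl)
        ultimately have "\<forall>\<^sub>F t in at_top. grid_round (u t) (m t) x \<in> - K" using topological_tendstoD[OF conv] by blast
        then have "\<forall>\<^sub>F t in at_top. indicator S (grid_round (u t) (m t) x) = (indicator U x :: real)"
          by (rule eventually_mono) (use False K in \<open>auto simp: indicator_def\<close>)
        then show ?thesis by (rule tendsto_eventually)
      qed
    qed
    have "\<forall>\<^sub>F t in at_top. d t < 1" using order_tendstoD(2)[OF d0, of 1] by simp
    then show "\<forall>\<^sub>F t in at_top. AE x in lborel. norm (indicator S (grid_round (u t) (m t) x) :: real) \<le> indicator (cball 0 (R + 1)) x"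
    proof eventually_elim
      case (elim t)
      have "x \<in> cball 0 (R + 1)" if "grid_round (u t) (m t) x \<in> S" for x
      proof -
        have "norm x \<le> norm (grid_round (u t) (m t) x) + norm (grid_round (u t) (m t) x - x)"
          by (metis norm_minus_commute norm_triangle_sub)
        then show ?thesis using nd[of t x] elim R[of "grid_round (u t) (m t) x"] that K by auto
      qed
      then show ?case by (intro AE_I2) (auto simp: indicator_def)
    qed
  qed
  then show ?thesis using grid_count_integral(2)[OF m bS] by simp
qed

section \<open>Iterated integrals and radial coordinates\<close>

lemma borel_measurable_fst_comp [measurable (raw)]:
  fixes f :: "'m \<Rightarrow> 'a::second_countable_topology \<times> 'b::second_countable_topology"
  assumes "f \<in> borel_measurable M"
  shows "(\<lambda>x. fst (f x)) \<in> borel_measurable M"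
  using assms by (intro borel_measurable_continuous_on[where f=fst]) (auto intro: continuous_intros)

lemma borel_measurable_snd_comp [measurable (raw)]:
  fixes f :: "'m \<Rightarrow> 'a::second_countable_topology \<times> 'b::second_countable_topology"
  assumes "f \<in> borel_measurable M"
  shows "(\<lambda>x. snd (f x)) \<in> borel_measurable M"
  using assms by (intro borel_measurable_continuous_on[where f=snd]) (auto intro: continuous_intros)

lemma nn_integral_lborel_pair:
  fixes f :: "'a::euclidean_space \<times> 'b::euclidean_space \<Rightarrow> ennreal"
  assumes f: "f \<in> borel_measurable borel"
  shows "integral\<^sup>N lborel f = (\<integral>\<^sup>+x. (\<integral>\<^sup>+y. f (x, y) \<partial>lborel) \<partial>lborel)"
  using lborel.nn_integral_fst[of f lborel] f by (simp add: lborel_prod)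

lemma nn_integral_lborel_swap:
  fixes f :: "'a::euclidean_space \<Rightarrow> 'b::euclidean_space \<Rightarrow> ennreal"
  assumes f: "case_prod f \<in> borel_measurable borel"
  shows "(\<integral>\<^sup>+x. (\<integral>\<^sup>+y. f x y \<partial>lborel) \<partial>lborel) = (\<integral>\<^sup>+y. (\<integral>\<^sup>+x. f x y \<partial>lborel) \<partial>lborel)"
proof -
  show ?thesis using lborel_pair.Fubini'[of "\<lambda>x y. f x y"] f by (simp add: lborel_prod)
qed

lemma nn_integral_shift:
  fixes f :: "real \<Rightarrow> ennreal"
  assumes "f \<in> borel_measurable borel"
  shows "(\<integral>\<^sup>+x. f (x + t) \<partial>lborel) = integral\<^sup>N lborel f"
  using nn_integral_real_affine[OF assms, of 1 t] by (simp add: add.commute)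

text \<open>The image of plane Lebesgue measure under u^2 + v^2 is pi times Lebesgue measure on the
  positive reals: by the area of a disc, both give measure pi r to the half-line up to r.\<close>

lemma nn_integral_radial:
  fixes g :: "real \<Rightarrow> ennreal"
  assumes [measurable]: "g \<in> borel_measurable borel"
  shows "(\<integral>\<^sup>+u. (\<integral>\<^sup>+v. g (u^2 + v^2) \<partial>lborel) \<partial>lborel) = ennreal pi * (\<integral>\<^sup>+w. g w * indicator {0<..} w \<partial>lborel)"
proof -
  have [measurable]: "(\<lambda>(u, v). u^2 + v^2 :: real) \<in> borel_measurable borel"
    unfolding case_prod_beta by measurable
  define M where "M = distr (lborel :: (real \<times> real) measure) borel (\<lambda>(u, v). u^2 + v^2)"
  define N where "N = density lborel (\<lambda>w. ennreal pi * indicator {0<..} (w :: real))"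
  have disc: "emeasure lborel {z :: real \<times> real. fst z^2 + snd z^2 \<le> r} = ennreal (pi * r)" if "r \<ge> 0" for r
  proof -
    have "{z :: real \<times> real. fst z^2 + snd z^2 \<le> r} = cball 0 (sqrt r)"
      using that by (auto simp: norm_prod_def real_sqrt_le_iff)
    then show ?thesis using emeasure_cball[of "sqrt r" "0 :: real \<times> real"] that
      by (simp add: unit_ball_vol_2)
  qed
  have "M = N"
  proof (rule measure_eqI_generator_eq[of "range (\<lambda>r. {..r})" UNIV])
    show "Int_stable (range (\<lambda>r::real. {..r}))" by (auto simp: Int_stable_def)
    show "sets M = sigma_sets UNIV (range (\<lambda>r. {..r}))" "sets N = sigma_sets UNIV (range (\<lambda>r. {..r}))"
      by (simp_all add: M_def N_def borel_eq_atMost)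
    show "range (\<lambda>n. {..real n}) \<subseteq> range (\<lambda>r. {..r})" by auto
    show "(\<Union>n. {..real n}) = UNIV" using real_arch_simple by auto
    have Meq: "emeasure M {..r} = ennreal (pi * max 0 r)" for r
    proof (cases "r \<ge> 0")
      case True
      have "emeasure M {..r} = emeasure lborel {z :: real \<times> real. fst z^2 + snd z^2 \<le> r}"
        unfolding M_def by (subst emeasure_distr) (auto intro!: arg_cong2[where f=emeasure] simp: case_prod_beta)
      then show ?thesis using disc True by simp
    next
      case False
      have "emeasure M {..r} = emeasure lborel ({} :: (real \<times> real) set)"
        unfolding M_def
      proof (subst emeasure_distr)
        have "u^2 + v^2 > r" for u v :: real
          using False sum_power2_ge_zero[of u v] by linarith
        then have "(\<lambda>(u, v). u^2 + v^2) -` {..r} \<inter> space lborel = ({} :: (real \<times> real) set)"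
          by (auto simp: not_le[symmetric])
        then show "emeasure lborel ((\<lambda>(u, v). u^2 + v^2) -` {..r} \<inter> space lborel) = emeasure lborel ({} :: (real \<times> real) set)"
          by (rule arg_cong)
      qed auto
      then show ?thesis using False by simp
    qed
    then show "emeasure M {..real n} \<noteq> \<infinity>" for n by simp
    show "emeasure M X = emeasure N X" if "X \<in> range (\<lambda>r. {..r})" for X
    proof -
      from that obtain r where X: "X = {..r}" by blast
      have "emeasure N X = ennreal pi * emeasure lborel ({0<..} \<inter> {..r})"
        unfolding N_def X by (simp add: emeasure_density mult.assoc nn_integral_cmult indicator_inter_arith[symmetric])
      also have "{0<..} \<inter> {..r} = {0<..r}" by auto
      also have "ennreal pi * emeasure lborel {0<..r} = ennreal (pi * max 0 r)"
        by (cases "r \<ge> 0") (auto simp: ennreal_mult')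
      finally show ?thesis unfolding X Meq by simp
    qed
  qed simp
  have "(\<integral>\<^sup>+u. (\<integral>\<^sup>+v. g (u^2 + v^2) \<partial>lborel) \<partial>lborel) = (\<integral>\<^sup>+z. g (fst z^2 + snd z^2) \<partial>(lborel :: (real \<times> real) measure))"
    by (subst nn_integral_lborel_pair) simp_all
  also have "\<dots> = integral\<^sup>N M g"
    unfolding M_def by (subst nn_integral_distr) (simp_all add: case_prod_beta)
  also have "\<dots> = ennreal pi * (\<integral>\<^sup>+w. g w * indicator {0<..} w \<partial>lborel)"
    unfolding \<open>M = N\<close> N_def
    by (subst nn_integral_density) (simp_all add: nn_integral_cmult[symmetric] mult_ac)
  finally show ?thesis .
qed

section \<open>Change of variables for planar regions\<close>

definition to_vec :: "real \<times> real \<Rightarrow> real ^ 2" where "to_vec z = vector [fst z, snd z]"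
definition of_vec :: "real ^ 2 \<Rightarrow> real \<times> real" where "of_vec v = (v $ 1, v $ 2)"

lemma to_of_vec [simp]: "to_vec (of_vec v) = v" "of_vec (to_vec z) = z"
  by (simp_all add: to_vec_def of_vec_def vec_eq_iff forall_2)

lemma linear_to_vec: "linear to_vec" and linear_of_vec: "linear of_vec"
  by (auto simp: linear_iff to_vec_def of_vec_def vec_eq_iff forall_2)

lemma borel_to_vec [measurable]: "to_vec \<in> borel_measurable borel"
  and borel_of_vec [measurable]: "of_vec \<in> borel_measurable borel"
  using linear_to_vec linear_of_vec
  by (auto intro!: borel_measurable_continuous_onI linear_continuous_on simp: linear_conv_bounded_linear)

lemma Basis_vec2: "(Basis :: (real^2) set) = {axis 1 1, axis 2 1}"
  by (auto simp: Basis_vec_def) (metis exhaust_2)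

lemma lborel_of_vec: "(lborel :: (real \<times> real) measure) = distr lborel borel of_vec"
proof (rule lborel_eqI)
  fix l u :: "real \<times> real"
  assume le: "\<And>b. b \<in> Basis \<Longrightarrow> l \<bullet> b \<le> u \<bullet> b"
  have le': "fst l \<le> fst u" "snd l \<le> snd u"
    using le[of "(1, 0)"] le[of "(0, 1)"] by (cases l; cases u; simp add: Basis_prod_def)+
  have "of_vec -` box l u \<inter> space lborel = box (to_vec l) (to_vec u)"
    by (auto simp: of_vec_def to_vec_def box_def Basis_prod_def Basis_vec_def forall_2 inner_axis
        case_prod_beta inner_prod_def exhaust_2)
  then have "emeasure (distr lborel borel of_vec) (box l u) = emeasure lborel (box (to_vec l) (to_vec u))"
    by (subst emeasure_distr) auto
  also have "\<dots> = ennreal (\<Prod>b\<in>Basis. (to_vec u - to_vec l) \<bullet> b)"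
    using le' by (intro emeasure_lborel_box) (auto simp: Basis_vec2 inner_axis to_vec_def)
  also have "(\<Prod>b\<in>(Basis :: (real^2) set). (to_vec u - to_vec l) \<bullet> b) = (fst u - fst l) * (snd u - snd l)"
    by (simp add: Basis_vec2 axis_eq_axis inner_axis to_vec_def)
  also have "\<dots> = (\<Prod>b\<in>Basis. (u - l) \<bullet> b)"
    by (cases l; cases u) (simp add: Basis_prod_def prod.union_disjoint)
  finally show "emeasure (distr lborel borel of_vec) (box l u) = ennreal (\<Prod>b\<in>Basis. (u - l) \<bullet> b)" .
qed simp

text \<open>The change of variables formula of the library is stated for vectors, not for pairs.\<close>

lemma emeasure_differentiable_image_pair:
  fixes g :: "real \<times> real \<Rightarrow> real \<times> real" and p q r s :: "real \<times> real \<Rightarrow> real"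
  assumes S: "open S" "bounded S"
    and der: "\<And>z. z \<in> S \<Longrightarrow> (g has_derivative (\<lambda>h. (p z * fst h + q z * snd h, r z * fst h + s z * snd h))) (at z)"
    and inj: "inj_on g S"
    and cont: "continuous_on UNIV (\<lambda>z. p z * s z - q z * r z)"
  shows "emeasure lborel (g ` S) = (\<integral>\<^sup>+z. ennreal \<bar>p z * s z - q z * r z\<bar> * indicator S z \<partial>lborel)"
proof -
  define J where "J z = \<bar>p z * s z - q z * r z\<bar>" for z
  have Jc: "continuous_on UNIV J" unfolding J_def[abs_def] by (intro continuous_intros cont)
  then have [measurable]: "J \<in> borel_measurable borel" by (rule borel_measurable_continuous_onI)
  have [measurable]: "S \<in> sets borel" using S by simp
  define S' where "S' = to_vec ` S"
  have S'v: "S' = of_vec -` S" unfolding S'_def by (auto intro: image_eqI[of _ to_vec "of_vec _"])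
  have "continuous_on UNIV of_vec"
    using linear_of_vec by (intro linear_continuous_on) (simp add: linear_conv_bounded_linear)
  then have oS': "open S'" unfolding S'v using S(1) by (rule open_vimage[rotated])
  define G where "G v = to_vec (g (of_vec v))" for v
  define G' where "G' v h = to_vec (p (of_vec v) * fst (of_vec h) + q (of_vec v) * snd (of_vec h),
      r (of_vec v) * fst (of_vec h) + s (of_vec v) * snd (of_vec h))"
    for v h
  have derG: "(G has_derivative G' v) (at v within S')" if "v \<in> S'" for v
  proof -
    have z: "of_vec v \<in> S" using that by (simp add: S'v)
    have 1: "(of_vec has_derivative of_vec) (at v)"
      using linear_of_vec by (intro bounded_linear_imp_has_derivative) (simp add: linear_conv_bounded_linear)
    have 2: "(to_vec has_derivative to_vec) (at (g (of_vec v)))"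
      using linear_to_vec by (intro bounded_linear_imp_has_derivative) (simp add: linear_conv_bounded_linear)
    have "(G has_derivative (\<lambda>h. to_vec ((\<lambda>h. (p (of_vec v) * fst h + q (of_vec v) * snd h, r (of_vec v) * fst h + s (of_vec v) * snd h)) (of_vec h)))) (at v)"
      unfolding G_def[abs_def]
      by (rule has_derivative_compose[OF has_derivative_compose[OF 1 der[OF z]] 2, simplified])
    then show ?thesis unfolding G'_def[abs_def] by (simp add: has_derivative_at_withinI)
  qed
  have injG: "inj_on G S'"
    using inj unfolding inj_on_def G_def S'v by (metis to_of_vec vimageE)
  have det: "\<bar>det (matrix (G' v))\<bar> = J (of_vec v)" for v
    by (simp add: det_2 matrix_def G'_def to_vec_def axis_def J_def) (simp add: of_vec_def)
  \<comment> \<open>By invariance of domain the image is open, hence Borel; this identifies its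
    Lebesgue measure with its \<open>lborel\<close> measure.\<close>
  have oG: "open (G ` S')"
  proof (rule invariance_of_domain[OF _ oS' injG])
    show "continuous_on S' G" using derG by (meson has_derivative_continuous continuous_on_eq_continuous_within)
  qed
  have gG: "of_vec -` (g ` S) = G ` S'"
    unfolding G_def S'_def by (auto simp: image_iff) (metis to_of_vec)+
  have nn: "(\<integral>\<^sup>+z. ennreal (J z) * indicator S z \<partial>lborel) = (\<integral>\<^sup>+v. ennreal (J (of_vec v) * indicator S' v) \<partial>lborel)"
    unfolding lborel_of_vec
    by (subst nn_integral_distr) (auto intro!: nn_integral_cong simp: S'v indicator_def)
  \<comment> \<open>The Jacobian is bounded on the bounded set, so the integral is finite; the
    change of variables formula needs its value as a real number.\<close>
  obtain C where C: "\<And>z. z \<in> S \<Longrightarrow> J z \<le> C" "C \<ge> 0"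
  proof -
    have "compact (J ` closure S)"
      using S Jc by (intro compact_continuous_image) (auto intro: continuous_on_subset simp: compact_closure)
    then have "bounded (J ` closure S)" by (rule compact_imp_bounded)
    then obtain C where C: "\<forall>x\<in>J ` closure S. norm x \<le> C" unfolding bounded_iff by blast
    have "J z \<le> max C 0" if "z \<in> S" for z
    proof -
      have "z \<in> closure S" using that closure_subset by blast
      then have "norm (J z) \<le> C" using C by blast
      then show ?thesis by simp
    qed
    then show ?thesis using that[of "max C 0"] by simp
  qed
  have "(\<integral>\<^sup>+z. ennreal (J z) * indicator S z \<partial>lborel) \<le> (\<integral>\<^sup>+z. ennreal C * indicator S z \<partial>lborel)"
    using C by (intro nn_integral_mono) (auto simp: indicator_def intro: ennreal_leI)
  also have "\<dots> = ennreal C * emeasure lborel S" by (simp add: nn_integral_cmult_indicator)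
  also have "\<dots> < \<infinity>" using emeasure_bounded_finite[OF S(2)] by (simp add: ennreal_mult_less_top infinity_ennreal_def)
  finally have fin: "(\<integral>\<^sup>+z. ennreal (J z) * indicator S z \<partial>lborel) < \<infinity>" .
  then obtain m where m: "(\<integral>\<^sup>+z. ennreal (J z) * indicator S z \<partial>lborel) = ennreal m" "m \<ge> 0"
    by (cases "\<integral>\<^sup>+z. ennreal (J z) * indicator S z \<partial>lborel" rule: ennreal_cases) auto
  have bS': "S' \<in> sets borel" using oS' by simp
  have Jn: "J z \<ge> 0" for z by (simp add: J_def)
  have "((\<lambda>v. J (of_vec v) * indicator S' v) has_integral m) UNIV"
    using m(1) Jn bS' unfolding nn by (intro nn_integral_has_integral[OF _ _ _ m(2)]) auto
  then have "((\<lambda>v. if v \<in> S' then J (of_vec v) else 0) has_integral m) UNIV"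
    by (rule has_integral_eq[rotated]) (auto simp: indicator_def)
  then have hi: "((\<lambda>v. \<bar>det (matrix (G' v))\<bar>) has_integral m) S'"
    unfolding det has_integral_restrict_UNIV .
  have "S' \<in> sets lebesgue" using bS' by simp
  from has_measure_differentiable_image[OF this derG injG, of m] hi
  have lm: "G ` S' \<in> lmeasurable" "measure lebesgue (G ` S') = m" by auto
  have "emeasure lborel (G ` S') = emeasure lebesgue (G ` S')" using oG by simp
  also have "\<dots> = ennreal m" using lm by (simp add: emeasure_eq_measure2 fmeasurableD2)
  finally have "emeasure lborel (G ` S') = ennreal m" .
  moreover have "g ` S \<in> sets borel"
  proof -
    have "continuous_on S g" using der by (meson has_derivative_continuous continuous_at_imp_continuous_on)
    then have "open (g ` S)" by (rule invariance_of_domain[OF _ S(1) inj])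
    then show ?thesis by simp
  qed
  then have "emeasure lborel (g ` S) = emeasure lborel (G ` S')"
    unfolding lborel_of_vec by (subst emeasure_distr) (auto simp: gG)
  ultimately show ?thesis using m(1) by (simp add: J_def)
qed

section \<open>The volume of the region of reduced forms\<close>

text \<open>The bounds 1 and 2 on the invariants together mean height below 1; larger heights are
  reached by scaling the coefficients.\<close>

definition reduced :: "nat \<Rightarrow> real \<Rightarrow> real \<Rightarrow> real \<Rightarrow> real \<Rightarrow> bool" where
  "reduced i Y a b c \<longleftrightarrow> dm i Y a b c > 0 \<and> \<bar>rI a b c (cD i Y b) (cE i Y a c)\<bar> < 1
     \<and> \<bar>rJ a b c (cD i Y b) (cE i Y a c)\<bar> < 2"

definition reduced_le :: "nat \<Rightarrow> real \<Rightarrow> real \<Rightarrow> real \<Rightarrow> real \<Rightarrow> bool" where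
  "reduced_le i Y a b c \<longleftrightarrow> dm i Y a b c \<ge> 0 \<and> \<bar>rI a b c (cD i Y b) (cE i Y a c)\<bar> \<le> 1
     \<and> \<bar>rJ a b c (cD i Y b) (cE i Y a c)\<bar> \<le> 2"

text \<open>The density of Lebesgue measure on the coefficients in the coordinates (a, b, c, x, Y),
  to be evaluated at the translated coefficients.\<close>

definition weight :: "nat \<Rightarrow> real \<Rightarrow> real \<Rightarrow> real \<Rightarrow> real \<Rightarrow> ennreal" where
  "weight i Y a b c = (if reduced i Y a b c then ennreal (jc i Y a b c) else 0)"

lemma weight_measurable [measurable (raw)]:
  assumes [measurable]: "Y \<in> borel_measurable M" "a \<in> borel_measurable M" "b \<in> borel_measurable M" "c \<in> borel_measurable M"
  shows "(\<lambda>x. weight i (Y x) (a x) (b x) (c x)) \<in> borel_measurable M"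
  unfolding weight_def reduced_def dm_def rI_def rJ_def cD_def cE_def jc_def
  by (cases "i = 0"; cases "i = 1"; simp only: if_True if_False simp_thms; measurable)

text \<open>\<open>Y\<close> is the square of the imaginary part, and \<open>T\<close> cuts off the
  cusp.\<close>

definition fund :: "real \<Rightarrow> (real \<times> real) set" where
  "fund T = {(x, Y). 0 < x \<and> x < 1/2 \<and> 1 < x^2 + Y \<and> Y < T}"

definition fund_le :: "real \<Rightarrow> (real \<times> real) set" where
  "fund_le T = {(x, Y). 0 \<le> x \<and> x \<le> 1/2 \<and> 1 \<le> x^2 + Y \<and> Y \<le> T}"

lemma fund_le_pos:
  fixes x Y :: real
  assumes "0 \<le> x" "x \<le> 1/2" "1 \<le> x^2 + Y"
  shows "Y \<ge> 3/4"
proof -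
  have "x^2 \<le> (1/2)^2" using assms by (intro power_mono) auto
  then show ?thesis using assms by (simp add: power2_eq_square)
qed

type_synonym params = "(real \<times> real \<times> real) \<times> (real \<times> real)"

definition dom_open :: "nat \<Rightarrow> real \<Rightarrow> params set" where
  "dom_open i T = {((a, b, c), (x, Y)). (x, Y) \<in> fund T \<and> reduced i Y a (sB x a b) (sC x a b c)}"

definition dom_closed :: "nat \<Rightarrow> real \<Rightarrow> params set" where
  "dom_closed i T = {((a, b, c), (x, Y)). (x, Y) \<in> fund_le T \<and> reduced_le i Y a (sB x a b) (sC x a b c)}"

definition par :: "nat \<Rightarrow> params \<Rightarrow> params" where
  "par i = (\<lambda>((a, b, c), (x, Y)). ((a, b, c), (pD i x Y a b c, pE i x Y a b c)))"

lemmas coordinate_defs = sB_def sC_def cD_def cE_def dm_def rI_def rJ_def pD_def pE_def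

lemma continuous_par: "continuous_on S (par i)"
  unfolding par_def case_prod_beta coordinate_defs
  by (cases "i = 1"; simp only: if_True if_False simp_thms; intro continuous_intros)

lemma differentiable_fst_comp: "f differentiable F \<Longrightarrow> (\<lambda>x. fst (f x)) differentiable F"
  and differentiable_snd_comp: "f differentiable F \<Longrightarrow> (\<lambda>x. snd (f x)) differentiable F"
  unfolding differentiable_def using has_derivative_fst has_derivative_snd by blast+

lemma differentiable_Pair_comp:
  assumes "f differentiable (at x within A)" "g differentiable (at x within A)"
  shows "(\<lambda>x. (f x, g x)) differentiable (at x within A)"
proof -
  obtain D D' where "(f has_derivative D) (at x within A)" "(g has_derivative D') (at x within A)"
    using assms unfolding differentiable_def by blast
  from has_derivative_Pair[OF this] show ?thesis unfolding differentiable_def by blast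
qed

lemma differentiable_par: "par i differentiable_on S"
  unfolding differentiable_on_def par_def case_prod_beta coordinate_defs
  by (cases "i = 1"; simp only: if_True if_False simp_thms; intro ballI differentiable_Pair_comp differentiable_fst_comp
     differentiable_snd_comp differentiable_ident differentiable_add differentiable_diff differentiable_mult
     differentiable_power differentiable_const differentiable_minus)

lemma open_dom_open: "open (dom_open i T)"
proof -
  have "dom_open i T = {w. 0 < fst (snd w)} \<inter> {w. fst (snd w) < 1/2} \<inter> {w. 1 < fst (snd w)^2 + snd (snd w)} \<inter> {w. snd (snd w) < T}
     \<inter> {w. 0 < (\<lambda>((a, b, c), (x, Y)). dm i Y a (sB x a b) (sC x a b c)) w}
     \<inter> {w. \<bar>(\<lambda>((a, b, c), (x, Y)). rI a (sB x a b) (sC x a b c) (cD i Y (sB x a b)) (cE i Y a (sC x a b c))) w\<bar> < 1}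
     \<inter> {w. \<bar>(\<lambda>((a, b, c), (x, Y)). rJ a (sB x a b) (sC x a b c) (cD i Y (sB x a b)) (cE i Y a (sC x a b c))) w\<bar> < 2}"
    by (auto simp: dom_open_def fund_def reduced_def)
  moreover have "open \<dots>"
    unfolding case_prod_beta coordinate_defs
    by (cases "i = 0"; cases "i = 1"; simp only: if_True if_False simp_thms; intro open_Int open_Collect_less continuous_intros)
  ultimately show ?thesis by simp
qed

lemma closed_dom_closed: "closed (dom_closed i T)"
proof -
  have "dom_closed i T = {w. 0 \<le> fst (snd w)} \<inter> {w. fst (snd w) \<le> 1/2} \<inter> {w. 1 \<le> fst (snd w)^2 + snd (snd w)} \<inter> {w. snd (snd w) \<le> T}
     \<inter> {w. 0 \<le> (\<lambda>((a, b, c), (x, Y)). dm i Y a (sB x a b) (sC x a b c)) w}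
     \<inter> {w. \<bar>(\<lambda>((a, b, c), (x, Y)). rI a (sB x a b) (sC x a b c) (cD i Y (sB x a b)) (cE i Y a (sC x a b c))) w\<bar> \<le> 1}
     \<inter> {w. \<bar>(\<lambda>((a, b, c), (x, Y)). rJ a (sB x a b) (sC x a b c) (cD i Y (sB x a b)) (cE i Y a (sC x a b c))) w\<bar> \<le> 2}"
    by (auto simp: dom_closed_def fund_le_def reduced_le_def)
  moreover have "closed \<dots>"
    unfolding case_prod_beta coordinate_defs
    by (cases "i = 0"; cases "i = 1"; simp only: if_True if_False simp_thms; intro closed_Int closed_Collect_le continuous_intros)
  ultimately show ?thesis by simp
qed

text \<open>As Y >= 3/4 and 0 <= x <= 1/2, the bounds on the translated coefficients pass to
  \<open>a\<close>, then \<open>b\<close>, then \<open>c\<close>, with crude constants. This is the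
  source of compactness.\<close>

lemma dom_closed_bounds:
  assumes "((a, b, c), (x, Y)) \<in> dom_closed i T"
  shows "\<bar>a\<bar> \<le> 3" "\<bar>b\<bar> \<le> 9" "\<bar>c\<bar> \<le> 21" "\<bar>x\<bar> \<le> 1" "3/4 \<le> Y" "Y \<le> T"
proof -
  have x: "0 \<le> x" "x \<le> 1/2" and xY: "1 \<le> x^2 + Y" and YT: "Y \<le> T"
    and red: "reduced_le i Y a (sB x a b) (sC x a b c)"
    using assms by (auto simp: dom_closed_def fund_le_def)
  have Y: "Y \<ge> 3/4" by (rule fund_le_pos[OF x xY])
  have bd: "\<bar>a\<bar> * Y \<le> 2" "\<bar>sB x a b\<bar> * sqrt Y \<le> 2" "\<bar>sC x a b c\<bar> \<le> 2"
    using reduced_coeff_bounds[of Y a "sB x a b" "sC x a b c" i] red Y by (auto simp: reduced_le_def)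
  have "\<bar>a\<bar> * (3/4) \<le> \<bar>a\<bar> * Y" using Y by (intro mult_left_mono) auto
  then show a: "\<bar>a\<bar> \<le> 3" using bd(1) by linarith
  have "sqrt Y \<ge> 3/4" using Y by (intro real_le_rsqrt) (simp add: power2_eq_square)
  then have "\<bar>sB x a b\<bar> * (3/4) \<le> \<bar>sB x a b\<bar> * sqrt Y" by (intro mult_left_mono) auto
  then have sb: "\<bar>sB x a b\<bar> \<le> 3" using bd(2) by linarith
  have xa: "\<bar>x * a\<bar> \<le> (1/2) * 3" unfolding abs_mult using x a by (intro mult_mono) auto
  then show b: "\<bar>b\<bar> \<le> 9" using sb unfolding sB_def by linarith
  have xb: "\<bar>x * b\<bar> \<le> (1/2) * 9" unfolding abs_mult using x b by (intro mult_mono) auto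
  have "\<bar>x * (x * a)\<bar> \<le> (1/2) * (3/2)" unfolding abs_mult[of x "x * a"] using x xa by (intro mult_mono) auto
  then have "\<bar>x^2 * a\<bar> \<le> 3/4" by (simp add: power2_eq_square mult.assoc)
  then show "\<bar>c\<bar> \<le> 21" using bd(3) xb unfolding sC_def by linarith
  show "\<bar>x\<bar> \<le> 1" using x by simp
  show "3/4 \<le> Y" "Y \<le> T" using Y YT by auto
qed

lemma compact_dom_closed: "compact (dom_closed i T)"
proof -
  have "dom_closed i T \<subseteq> cbox ((-3, -9, -21), (-1, -\<bar>T\<bar>)) ((3, 9, 21), (1, \<bar>T\<bar>))"
  proof
    fix w assume "w \<in> dom_closed i T"
    moreover obtain a b c x Y where we: "w = ((a, b, c), (x, Y))" by (metis prod.exhaust)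
    ultimately have w: "((a, b, c), (x, Y)) \<in> dom_closed i T" by simp
    show "w \<in> cbox ((-3, -9, -21), (-1, -\<bar>T\<bar>)) ((3, 9, 21), (1, \<bar>T\<bar>))"
      using dom_closed_bounds[OF w] unfolding we by (auto simp: cbox_Pair_eq mem_Times_iff abs_le_iff)
  qed
  then have "bounded (dom_closed i T)" by (rule bounded_subset[OF bounded_cbox])
  then show ?thesis using closed_dom_closed compact_eq_bounded_closed by blast
qed

lemma dom_open_subset: "dom_open i T \<subseteq> dom_closed i T"
  by (auto simp: dom_open_def dom_closed_def fund_def fund_le_def reduced_def reduced_le_def)

text \<open>Two parameters with the same image give two covariant points of a single
  quartic.\<close>

lemma inj_on_par: "inj_on (par i) (dom_open i T)"
proof (rule inj_onI)
  fix w w' assume ww: "w \<in> dom_open i T" "w' \<in> dom_open i T" and eqw: "par i w = par i w'"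
  obtain a b c x Y where ww1: "w = ((a, b, c), (x, Y))" by (metis prod.exhaust)
  obtain a' b' c' x' Y' where ww2: "w' = ((a', b', c'), (x', Y'))" by (metis prod.exhaust)
  have w: "((a, b, c), (x, Y)) \<in> dom_open i T" and w': "((a', b', c'), (x', Y')) \<in> dom_open i T"
    and eq: "par i ((a, b, c), (x, Y)) = par i ((a', b', c'), (x', Y'))"
    using ww eqw unfolding ww1 ww2 by auto
  define d e where "d = pD i x Y a b c" and "e = pE i x Y a b c"
  have eqs: "a' = a" "b' = b" "c' = c" "d = pD i x' Y' a b c" "e = pE i x' Y' a b c"
    using eq by (auto simp: par_def d_def e_def)
  have Y: "Y > 0" "Y' > 0"
    using dom_closed_bounds(5)[of _ _ _ _ _ i T] w w' dom_open_subset by fastforce+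
  have "dm i Y a (sB x a b) (sC x a b c) > 0" using w by (simp add: dom_open_def reduced_def)
  from covariant_point_unique[OF Y _ _ _ _ this] have "x = x' \<and> Y = Y'"
    using pD_eq_iff[of d i x Y a b c] pE_eq_iff[of d i x Y a b c e] pD_eq_iff[of d i x' Y' a b c] pE_eq_iff[of d i x' Y' a b c e]
      eqs d_def e_def by blast
  then show "w = w'" using eqs unfolding ww1 ww2 by simp
qed

definition region :: "nat \<Rightarrow> real \<Rightarrow> params set" where
  "region i T = par i ` dom_open i T"

definition region_le :: "nat \<Rightarrow> real \<Rightarrow> params set" where
  "region_le i T = par i ` dom_closed i T"

lemma open_region: "open (region i T)"
  unfolding region_def by (rule invariance_of_domain[OF continuous_par open_dom_open inj_on_par])

lemma compact_region_le: "compact (region_le i T)"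
  unfolding region_le_def by (rule compact_continuous_image[OF continuous_par compact_dom_closed])

lemma region_subset: "region i T \<subseteq> region_le i T"
  unfolding region_def region_le_def using dom_open_subset by blast

text \<open>\<open>d_x\<close>, \<open>d_Y\<close>, \<open>e_x\<close>, \<open>e_Y\<close> are the
  partial derivatives of \<open>pD\<close> and \<open>pE\<close>, written in terms of the translated
  coefficients.\<close>

definition d_x :: "nat \<Rightarrow> real \<Rightarrow> real \<Rightarrow> real \<Rightarrow> real \<Rightarrow> real \<Rightarrow> real" where
  "d_x i x Y a b c = (if i = 1 then 4 * a * Y else - 4 * a * Y) - 2 * sC x a b c"
definition d_Y :: "nat \<Rightarrow> real \<Rightarrow> real \<Rightarrow> real \<Rightarrow> real" where
  "d_Y i x a b = (if i = 1 then sB x a b else - sB x a b)"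
definition e_x :: "nat \<Rightarrow> real \<Rightarrow> real \<Rightarrow> real \<Rightarrow> real \<Rightarrow> real \<Rightarrow> real" where
  "e_x i x Y a b c = (if i = 1 then 3 * Y * sB x a b else 0) - cD i Y (sB x a b) - x * d_x i x Y a b c"
definition e_Y :: "nat \<Rightarrow> real \<Rightarrow> real \<Rightarrow> real \<Rightarrow> real \<Rightarrow> real \<Rightarrow> real" where
  "e_Y i x Y a b c = (if i = 1 then sC x a b c - 2 * Y * a else 2 * Y * a) - x * d_Y i x a b"

text \<open>The terms with factor -x in \<open>e_x\<close> and \<open>e_Y\<close> form -x times the
  row of \<open>d_x\<close> and \<open>d_Y\<close>, so they drop out of the determinant.\<close>

lemma jacobian:
  assumes "i \<in> {0, 1, 2}" "Y > 0"
  shows "\<bar>d_x i x Y a b c * e_Y i x Y a b c - d_Y i x a b * e_x i x Y a b c\<bar> = jc i Y a (sB x a b) (sC x a b c)"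
proof (cases "i = 1")
  case True
  have "d_x i x Y a b c * e_Y i x Y a b c - d_Y i x a b * e_x i x Y a b c
     = - (2 * ((sC x a b c - 2 * Y * a)^2 + Y * (sB x a b)^2))"
    using True by (simp add: d_x_def d_Y_def e_x_def e_Y_def cD_def power2_eq_square algebra_simps)
  moreover have "2 * ((sC x a b c - 2 * Y * a)^2 + Y * (sB x a b)^2) \<ge> 0" using assms by simp
  ultimately show ?thesis using True by (simp add: jc_def)
next
  case False
  have "d_x i x Y a b c * e_Y i x Y a b c - d_Y i x a b * e_x i x Y a b c
     = - (Y * (8 * a^2 * Y + 4 * a * sC x a b c - (sB x a b)^2))"
    using False by (simp add: d_x_def d_Y_def e_x_def e_Y_def cD_def power2_eq_square algebra_simps)
  then show ?thesis using False assms by (simp add: jc_def abs_mult)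
qed

lemma par_has_derivative:
  "((\<lambda>z. (pD i (fst z) (snd z) a b c, pE i (fst z) (snd z) a b c)) has_derivative
     (\<lambda>h. (d_x i x Y a b c * fst h + d_Y i x a b * snd h, e_x i x Y a b c * fst h + e_Y i x Y a b c * snd h))) (at (x, Y))"
proof -
  have D: "((\<lambda>z. pD i (fst z) (snd z) a b c) has_derivative (\<lambda>h. d_x i x Y a b c * fst h + d_Y i x a b * snd h)) (at (x, Y))"
    unfolding pD_def cD_def sB_def d_x_def d_Y_def sC_def
    by (cases "i = 1"; simp only: if_True if_False simp_thms;
      (rule has_derivative_eq_rhs, (rule derivative_intros refl)+, simp add: fun_eq_iff algebra_simps power2_eq_square power3_eq_cube))
  have C: "((\<lambda>z. cE i (snd z) a (sC (fst z) a b c)) has_derivative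
      (\<lambda>h. (if i = 1 then 3 * Y * sB x a b else 0) * fst h + (if i = 1 then sC x a b c - 2 * Y * a else 2 * Y * a) * snd h)) (at (x, Y))"
    unfolding cE_def sC_def sB_def
    by (cases "i = 1"; simp only: if_True if_False simp_thms;
      (rule has_derivative_eq_rhs, (rule derivative_intros refl)+, simp add: fun_eq_iff algebra_simps power2_eq_square power3_eq_cube))
  have "((\<lambda>z. cE i (snd z) a (sC (fst z) a b c) - fst z * pD i (fst z) (snd z) a b c - fst z^2 * c - fst z^3 * b - fst z^4 * a)
    has_derivative (\<lambda>h. e_x i x Y a b c * fst h + e_Y i x Y a b c * snd h)) (at (x, Y))"
    by (rule has_derivative_eq_rhs, (rule C D derivative_intros refl)+, cases "i = 1")
      (simp_all add: fun_eq_iff e_x_def e_Y_def pD_def cD_def sB_def sC_def algebra_simps power2_eq_square power3_eq_cube)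
  then have E: "((\<lambda>z. pE i (fst z) (snd z) a b c) has_derivative (\<lambda>h. e_x i x Y a b c * fst h + e_Y i x Y a b c * snd h)) (at (x, Y))"
    by (simp add: pE_def)
  show ?thesis by (rule has_derivative_Pair[OF D E])
qed

text \<open>For fixed (a, b, c) the map \<open>par\<close> is the planar map from (x, Y) to (d, e),
  so a two-dimensional change of variables is enough for a volume in dimension five.\<close>

lemma emeasure_slice:
  assumes i: "i \<in> {0, 1, 2}"
  shows "emeasure lborel (Pair (a, b, c) -` region i T)
    = (\<integral>\<^sup>+z. indicator (fund T) z * weight i (snd z) a (sB (fst z) a b) (sC (fst z) a b c) \<partial>lborel)"
proof -
  define S where "S = Pair (a, b, c) -` dom_open i T"
  define g where "g z = (pD i (fst z) (snd z) a b c, pE i (fst z) (snd z) a b c)" for z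
  have eq: "Pair (a, b, c) -` region i T = g ` S"
    unfolding region_def S_def g_def[abs_def] par_def by (force simp: image_iff)
  have "open S" unfolding S_def by (intro open_vimage open_dom_open continuous_intros)
  moreover have "bounded S"
  proof (rule bounded_subset)
    show "S \<subseteq> cbox (0, 0) (1, \<bar>T\<bar>)"
    proof
      fix z assume "z \<in> S"
      moreover obtain x Y where z: "z = (x, Y)" by (cases z)
      ultimately have w: "((a, b, c), (x, Y)) \<in> dom_closed i T" using dom_open_subset unfolding S_def by blast
      then have "0 \<le> x" by (simp add: dom_closed_def fund_le_def)
      then show "z \<in> cbox (0, 0) (1, \<bar>T\<bar>)" using dom_closed_bounds[OF w] unfolding z by (auto simp: cbox_Pair_eq)
    qed
  qed simp
  moreover have "(g has_derivative (\<lambda>h. (d_x i (fst z) (snd z) a b c * fst h + d_Y i (fst z) a b * snd h,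
      e_x i (fst z) (snd z) a b c * fst h + e_Y i (fst z) (snd z) a b c * snd h))) (at z)" if "z \<in> S" for z
    using par_has_derivative[of i a b c "fst z" "snd z"] by (simp add: g_def[abs_def])
  moreover have "inj_on g S"
  proof (rule inj_onI)
    fix z w assume zw: "z \<in> S" "w \<in> S" "g z = g w"
    have "par i ((a, b, c), z) = par i ((a, b, c), w)"
      using zw(3) by (simp add: par_def g_def case_prod_beta)
    then have "((a, b, c), z) = ((a, b, c), w)" using inj_on_par[of i T] zw(1,2) unfolding inj_on_def S_def by blast
    then show "z = w" by simp
  qed
  moreover have "continuous_on UNIV (\<lambda>z. d_x i (fst z) (snd z) a b c * e_Y i (fst z) (snd z) a b c
     - d_Y i (fst z) a b * e_x i (fst z) (snd z) a b c)"
    unfolding d_x_def e_Y_def d_Y_def e_x_def cD_def sB_def sC_def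
    by (cases "i = 1"; simp only: if_True if_False simp_thms; intro continuous_intros)
  ultimately have "emeasure lborel (g ` S) = (\<integral>\<^sup>+z. ennreal \<bar>d_x i (fst z) (snd z) a b c * e_Y i (fst z) (snd z) a b c
     - d_Y i (fst z) a b * e_x i (fst z) (snd z) a b c\<bar> * indicator S z \<partial>lborel)"
    by (rule emeasure_differentiable_image_pair)
  also have "\<dots> = (\<integral>\<^sup>+z. indicator (fund T) z * weight i (snd z) a (sB (fst z) a b) (sC (fst z) a b c) \<partial>lborel)"
  proof (rule nn_integral_cong)
    fix z :: "real \<times> real"
    obtain x Y where z: "z = (x, Y)" by (cases z)
    show "ennreal \<bar>d_x i (fst z) (snd z) a b c * e_Y i (fst z) (snd z) a b c
     - d_Y i (fst z) a b * e_x i (fst z) (snd z) a b c\<bar> * indicator S z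
      = indicator (fund T) z * weight i (snd z) a (sB (fst z) a b) (sC (fst z) a b c)"
    proof (cases "z \<in> fund T")
      case True
      then have "Y > 0" using fund_le_pos[of x Y] unfolding z fund_def by auto
      then show ?thesis using True jacobian[OF i, of Y x a b c]
        by (auto simp: z S_def dom_open_def weight_def indicator_def)
    next
      case False
      then show ?thesis by (auto simp: z S_def dom_open_def indicator_def)
    qed
  qed
  finally show ?thesis unfolding eq .
qed

definition total_weight :: "nat \<Rightarrow> ennreal" where
  "total_weight i = (\<integral>\<^sup>+a. (\<integral>\<^sup>+b. (\<integral>\<^sup>+c. weight i 1 a b c \<partial>lborel) \<partial>lborel) \<partial>lborel)"

text \<open>Scaling the variable by sqrt Y preserves both invariants, the Jacobian and the sign of
  \<open>dm\<close>.\<close>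

lemma weight_scale:
  assumes Y: "Y > 0"
  shows "weight i Y (a / Y) (b / sqrt Y) c = weight i 1 a b c"
proof -
  define s where "s = sqrt Y"
  have s: "s > 0" "s \<noteq> 0" "Y = s^2" using Y by (auto simp: s_def)
  have a: "a / Y = a / s^2" using s(3) by simp
  have e: "dm i Y (a / Y) (b / s) c = dm i 1 a b c / Y"
    "rI (a / Y) (b / s) c (cD i Y (b / s)) (cE i Y (a / Y) c) = rI a b c (cD i 1 b) (cE i 1 a c)"
    "rJ (a / Y) (b / s) c (cD i Y (b / s)) (cE i Y (a / Y) c) = rJ a b c (cD i 1 b) (cE i 1 a c)"
    "jc i Y (a / Y) (b / s) c = jc i 1 a b c"
  proof -
    show "dm i Y (a / Y) (b / s) c = dm i 1 a b c / Y"
      unfolding dm_def a unfolding s(3) using s(2) by (simp add: field_simps power2_eq_square)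
    show "rI (a / Y) (b / s) c (cD i Y (b / s)) (cE i Y (a / Y) c) = rI a b c (cD i 1 b) (cE i 1 a c)"
      unfolding rI_def cD_def cE_def a unfolding s(3) using s(2) by (simp add: field_simps power2_eq_square)
    show "rJ (a / Y) (b / s) c (cD i Y (b / s)) (cE i Y (a / Y) c) = rJ a b c (cD i 1 b) (cE i 1 a c)"
      unfolding rJ_def cD_def cE_def a unfolding s(3) using s(2) by (simp add: field_simps power2_eq_square)
    have "Y * \<bar>8 * (a / Y)^2 * Y + 4 * (a / Y) * c - (b / s)^2\<bar> = \<bar>Y * (8 * (a / Y)^2 * Y + 4 * (a / Y) * c - (b / s)^2)\<bar>"
      using Y by (simp add: abs_mult)
    also have "Y * (8 * (a / Y)^2 * Y + 4 * (a / Y) * c - (b / s)^2) = 8 * a^2 + 4 * a * c - b^2"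
      unfolding a unfolding s(3) using s(2) by (simp add: field_simps power2_eq_square)
    finally have 1: "Y * \<bar>8 * (a / Y)^2 * Y + 4 * (a / Y) * c - (b / s)^2\<bar> = \<bar>8 * a^2 + 4 * a * c - b^2\<bar>" .
    have "(c - 2 * Y * (a / Y))^2 + Y * (b / s)^2 = (c - 2 * a)^2 + b^2"
      unfolding a unfolding s(3) using s(2) by (simp add: field_simps power2_eq_square)
    with 1 show "jc i Y (a / Y) (b / s) c = jc i 1 a b c" unfolding jc_def by simp
  qed
  show ?thesis unfolding weight_def reduced_def s_def[symmetric] e using Y by (simp add: zero_less_divide_iff)
qed

text \<open>Passing to translated coefficients only shifts \<open>b\<close> and then
  \<open>c\<close>; the scaling to Y = 1 contributes 1/Y from \<open>a\<close> and 1/sqrt Y from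
  \<open>b\<close>.\<close>

lemma weight_integral:
  assumes Y: "Y > 0"
  shows "(\<integral>\<^sup>+w. weight i Y (fst w) (sB x (fst w) (fst (snd w))) (sC x (fst w) (fst (snd w)) (snd (snd w))) \<partial>lborel)
    = ennreal (Y powr (- 3 / 2)) * total_weight i"
proof -
  have [measurable]: "(\<lambda>w::real \<times> real \<times> real. sB x (fst w) (fst (snd w))) \<in> borel_measurable borel"
    "(\<lambda>w::real \<times> real \<times> real. sC x (fst w) (fst (snd w)) (snd (snd w))) \<in> borel_measurable borel"
    unfolding sB_def sC_def by measurable
  have "(\<integral>\<^sup>+w. weight i Y (fst w) (sB x (fst w) (fst (snd w))) (sC x (fst w) (fst (snd w)) (snd (snd w))) \<partial>lborel)
    = (\<integral>\<^sup>+a. (\<integral>\<^sup>+b. (\<integral>\<^sup>+c. weight i Y a (sB x a b) (sC x a b c) \<partial>lborel) \<partial>lborel) \<partial>lborel)"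
    by (subst nn_integral_lborel_pair, measurable, subst nn_integral_lborel_pair)
      (simp_all add: sB_def sC_def)
  also have "\<dots> = (\<integral>\<^sup>+a. (\<integral>\<^sup>+b. (\<integral>\<^sup>+c. weight i Y a b c \<partial>lborel) \<partial>lborel) \<partial>lborel)"
  proof (rule nn_integral_cong)
    fix a :: real
    have "(\<integral>\<^sup>+b. (\<integral>\<^sup>+c. weight i Y a (sB x a b) (sC x a b c) \<partial>lborel) \<partial>lborel)
      = (\<integral>\<^sup>+b. (\<integral>\<^sup>+c. weight i Y a (b + 4 * x * a) c \<partial>lborel) \<partial>lborel)"
    proof (rule nn_integral_cong)
      fix b :: real
      show "(\<integral>\<^sup>+c. weight i Y a (sB x a b) (sC x a b c) \<partial>lborel) = (\<integral>\<^sup>+c. weight i Y a (b + 4 * x * a) c \<partial>lborel)"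
        using nn_integral_shift[of "weight i Y a (sB x a b)" "3 * x * b + 6 * x^2 * a"]
        by (simp add: sB_def sC_def add.assoc)
    qed
    also have "\<dots> = (\<integral>\<^sup>+b. (\<integral>\<^sup>+c. weight i Y a b c \<partial>lborel) \<partial>lborel)"
      by (rule nn_integral_shift) measurable
    finally show "(\<integral>\<^sup>+b. (\<integral>\<^sup>+c. weight i Y a (sB x a b) (sC x a b c) \<partial>lborel) \<partial>lborel)
      = (\<integral>\<^sup>+b. (\<integral>\<^sup>+c. weight i Y a b c \<partial>lborel) \<partial>lborel)" .
  qed
  also have "\<dots> = ennreal (1 / Y) * (\<integral>\<^sup>+a. (\<integral>\<^sup>+b. (\<integral>\<^sup>+c. weight i Y (a / Y) b c \<partial>lborel) \<partial>lborel) \<partial>lborel)"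
    by (subst nn_integral_real_affine[where c = "1 / Y" and t = 0]) (use Y in simp_all)
  also have "(\<integral>\<^sup>+a. (\<integral>\<^sup>+b. (\<integral>\<^sup>+c. weight i Y (a / Y) b c \<partial>lborel) \<partial>lborel) \<partial>lborel)
     = (\<integral>\<^sup>+a. ennreal (1 / sqrt Y) * (\<integral>\<^sup>+b. (\<integral>\<^sup>+c. weight i Y (a / Y) (b / sqrt Y) c \<partial>lborel) \<partial>lborel) \<partial>lborel)"
    by (intro nn_integral_cong, subst nn_integral_real_affine[where c = "1 / sqrt Y" and t = 0]) (use Y in simp_all)
  also have "\<dots> = ennreal (1 / sqrt Y) * total_weight i"
    unfolding weight_scale[OF Y] total_weight_def by (rule nn_integral_cmult) measurable
  also have "ennreal (1 / Y) * (ennreal (1 / sqrt Y) * total_weight i) = ennreal (1 / Y * (1 / sqrt Y)) * total_weight i"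
    using Y by (subst ennreal_mult) (simp_all add: mult.assoc)
  also have "1 / Y * (1 / sqrt Y) = Y powr (- 3 / 2)"
  proof -
    have "Y powr (-1 + - (1/2)) = Y powr (-1) * Y powr (- (1/2))" by (rule powr_add)
    moreover have "-1 + - (1/2) = (- 3 / 2 :: real)" by simp
    ultimately have "Y powr (- 3 / 2) = Y powr (-1) * Y powr (- (1/2))" by (simp only:)
    then show ?thesis using Y by (simp add: powr_minus powr_half_sqrt inverse_eq_divide)
  qed
  finally show ?thesis .
qed

text \<open>Differentiability is asked for in the open interval only, which admits the power u^(5/2)
  down to the endpoint u = 0.\<close>

lemma nn_integral_FTC_interior:
  fixes f F :: "real \<Rightarrow> real"
  assumes ab: "a \<le> b" and c: "continuous_on {a..b} F"
    and d: "\<And>x. a < x \<Longrightarrow> x < b \<Longrightarrow> (F has_real_derivative f x) (at x)"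
    and f: "\<And>x. a < x \<Longrightarrow> x < b \<Longrightarrow> 0 \<le> f x"
  shows "(\<integral>\<^sup>+x. ennreal (f x) * indicator {a<..<b} x \<partial>lborel) = ennreal (F b - F a)"
proof -
  have "(f has_integral (F b - F a)) {a..b}"
    by (rule fundamental_theorem_of_calculus_interior[OF ab c])
      (use d in \<open>simp add: has_real_derivative_iff_has_vector_derivative[symmetric]\<close>)
  then have "(f has_integral (F b - F a)) {a<..<b}" by (simp add: has_integral_Icc_iff_Ioo)
  then show ?thesis by (rule nn_integral_has_integral_lebesgue'[rotated]) (use f in auto)
qed

lemma nn_integral_FTC_open:
  fixes f F :: "real \<Rightarrow> real"
  assumes ab: "a \<le> b" and d: "\<And>x. a \<le> x \<Longrightarrow> x \<le> b \<Longrightarrow> (F has_real_derivative f x) (at x)"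
    and f: "\<And>x. a \<le> x \<Longrightarrow> x \<le> b \<Longrightarrow> 0 \<le> f x"
  shows "(\<integral>\<^sup>+x. ennreal (f x) * indicator {a<..<b} x \<partial>lborel) = ennreal (F b - F a)"
  using assms
  by (intro nn_integral_FTC_interior DERIV_continuous_on) (auto intro: has_field_derivative_at_within)

text \<open>With Y = y^2, the measure Y^(-3/2) dx dY is twice the hyperbolic area dx dy / y^2. So
  pi/3 is twice the area pi/6 of the half domain, and 1 / sqrt T comes from the part above Y =
  T.\<close>

lemma fund_integral:
  assumes T: "T \<ge> 1"
  shows "(\<integral>\<^sup>+z. indicator (fund T) z * ennreal (snd z powr (- 3 / 2)) \<partial>lborel) = ennreal (pi / 3 - 1 / sqrt T)"
proof -
  have "open (fund T)"
  proof -
    have "fund T = {z. 0 < fst z} \<inter> {z. fst z < 1/2} \<inter> {z. 1 < fst z^2 + snd z} \<inter> {z. snd z < T}"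
      by (auto simp: fund_def)
    moreover have "open \<dots>" by (intro open_Int open_Collect_less continuous_intros)
    ultimately show ?thesis by simp
  qed
  then have [measurable]: "fund T \<in> sets borel" by simp
  have "(\<integral>\<^sup>+z. indicator (fund T) z * ennreal (snd z powr (- 3 / 2)) \<partial>lborel)
    = (\<integral>\<^sup>+x. (\<integral>\<^sup>+Y. indicator (fund T) (x, Y) * ennreal (Y powr (- 3 / 2)) \<partial>lborel) \<partial>lborel)"
    by (subst nn_integral_lborel_pair) simp_all
  also have "\<dots> = (\<integral>\<^sup>+x. ennreal (2 / sqrt (1 - x^2) - 2 / sqrt T) * indicator {0<..<1/2} x \<partial>lborel)"
  proof (rule nn_integral_cong)
    fix x :: real
    show "(\<integral>\<^sup>+Y. indicator (fund T) (x, Y) * ennreal (Y powr (- 3 / 2)) \<partial>lborel)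
      = ennreal (2 / sqrt (1 - x^2) - 2 / sqrt T) * indicator {0<..<1/2} x"
    proof (cases "x \<in> {0<..<1/2}")
      case False
      then show ?thesis by (auto simp: fund_def)
    next
      case True
      then have x2: "0 \<le> x^2" "x^2 < 1" using abs_square_less_1[of x] by auto
      have "(\<integral>\<^sup>+Y. indicator (fund T) (x, Y) * ennreal (Y powr (- 3 / 2)) \<partial>lborel)
        = (\<integral>\<^sup>+Y. ennreal (Y powr (- 3 / 2)) * indicator {1 - x^2<..<T} Y \<partial>lborel)"
        using True by (intro nn_integral_cong) (auto simp: fund_def indicator_def)
      also have "\<dots> = ennreal (- 2 / sqrt T - (- 2 / sqrt (1 - x^2)))"
      proof (rule nn_integral_FTC_open)
        show "1 - x^2 \<le> T" using x2 T by linarith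
        fix Y assume "1 - x^2 \<le> Y"
        then have Y: "Y > 0" using x2 by simp
        have D: "((\<lambda>Y. - 2 * Y powr (- 1 / 2)) has_real_derivative Y powr (- 3 / 2)) (at Y)"
          using Y by (auto intro!: derivative_eq_intros)
        have E: "\<forall>\<^sub>F Z in nhds Y. - 2 * Z powr (- 1 / 2) = - 2 / sqrt Z"
        proof -
          have "\<forall>\<^sub>F Z in nhds Y. Z \<in> {0<..}" using Y by (intro eventually_nhds_in_open) auto
          moreover have "- 2 * Z powr (- 1 / 2) = - 2 / sqrt Z" if "Z \<in> {0<..}" for Z
            using powr_minus[of Z "1/2"] powr_half_sqrt[of Z] that by (simp add: inverse_eq_divide)
          ultimately show ?thesis by (rule eventually_mono)
        qed
        show "((\<lambda>Y. - 2 / sqrt Y) has_real_derivative Y powr (- 3 / 2)) (at Y)"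
          by (rule DERIV_cong_ev[OF refl E refl, THEN iffD1, OF D])
      qed simp
      finally show ?thesis using True by simp
    qed
  qed
  also have "\<dots> = ennreal ((2 * arcsin (1/2) - (2 / sqrt T) * (1/2)) - (2 * arcsin 0 - (2 / sqrt T) * 0))"
  proof (rule nn_integral_FTC_open)
    fix x :: real assume x: "0 \<le> x" "x \<le> 1/2"
    have x2: "x^2 \<le> (1/2)^2" using x by (intro power_mono) auto
    have "(arcsin has_real_derivative inverse (sqrt (1 - x^2))) (at x)" using x by (intro DERIV_arcsin) auto
    from DERIV_diff[OF DERIV_cmult[OF this, of 2] DERIV_cmult_Id[of "2 / sqrt T" x]]
    show "((\<lambda>x. 2 * arcsin x - (2 / sqrt T) * x) has_real_derivative 2 / sqrt (1 - x^2) - 2 / sqrt T) (at x)"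
      by (simp only: divide_inverse)
    have "1 - x^2 \<le> T" using T zero_le_power2[of x] by linarith
    then have "sqrt (1 - x^2) \<le> sqrt T" by simp
    moreover have "sqrt (1 - x^2) > 0" using x2 by (simp add: power2_eq_square)
    ultimately show "0 \<le> 2 / sqrt (1 - x^2) - 2 / sqrt T" by (simp add: frac_le)
  qed simp
  also have "arcsin (1/2) = pi / 6"
    using arcsin_sin[of "pi / 6"] pi_ge_zero by (simp add: sin_30)
  finally show ?thesis by simp
qed

text \<open>Slices over (a, b, c) are measured first; after exchanging the integrations, the fibre
  over each point (x, Y) contributes the same \<open>total_weight\<close> up to the factor
  Y^(-3/2).\<close>

theorem emeasure_region:
  assumes i: "i \<in> {0, 1, 2}" and T: "T \<ge> 1"
  shows "emeasure lborel (region i T) = ennreal (pi / 3 - 1 / sqrt T) * total_weight i"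
proof -
  have [measurable]: "region i T \<in> sets borel" using open_region by simp
  have [measurable]: "fund T \<in> sets borel"
  proof -
    have "fund T = {z. 0 < fst z} \<inter> {z. fst z < 1/2} \<inter> {z. 1 < fst z^2 + snd z} \<inter> {z. snd z < T}"
      by (auto simp: fund_def)
    moreover have "open \<dots>" by (intro open_Int open_Collect_less continuous_intros)
    ultimately show ?thesis by simp
  qed
  have "emeasure lborel (region i T) = (\<integral>\<^sup>+w. emeasure lborel (Pair w -` region i T) \<partial>lborel)"
  proof -
    have "region i T \<in> sets ((lborel :: (real \<times> real \<times> real) measure) \<Otimes>\<^sub>M (lborel :: (real \<times> real) measure))"
      unfolding lborel_prod by simp
    from lborel.emeasure_pair_measure_alt[OF this] show ?thesis unfolding lborel_prod .
  qed
  also have "\<dots> = (\<integral>\<^sup>+w. (\<integral>\<^sup>+z. indicator (fund T) z * weight i (snd z) (fst w) (sB (fst z) (fst w) (fst (snd w)))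
      (sC (fst z) (fst w) (fst (snd w)) (snd (snd w))) \<partial>lborel) \<partial>lborel)"
    using emeasure_slice[OF i] by (intro nn_integral_cong) (metis prod.collapse)
  also have "\<dots> = (\<integral>\<^sup>+z. (\<integral>\<^sup>+w. indicator (fund T) z * weight i (snd z) (fst w) (sB (fst z) (fst w) (fst (snd w)))
      (sC (fst z) (fst w) (fst (snd w)) (snd (snd w))) \<partial>lborel) \<partial>lborel)"
    by (rule nn_integral_lborel_swap) (unfold case_prod_beta sB_def sC_def, measurable)
  also have "\<dots> = (\<integral>\<^sup>+z. indicator (fund T) z * ennreal (snd z powr (- 3 / 2)) * total_weight i \<partial>lborel)"
  proof (rule nn_integral_cong)
    fix z :: "real \<times> real"
    show "(\<integral>\<^sup>+w. indicator (fund T) z * weight i (snd z) (fst w) (sB (fst z) (fst w) (fst (snd w)))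
      (sC (fst z) (fst w) (fst (snd w)) (snd (snd w))) \<partial>lborel) = indicator (fund T) z * ennreal (snd z powr (- 3 / 2)) * total_weight i"
    proof (cases "z \<in> fund T")
      case True
      then have "snd z > 0" using fund_le_pos[of "fst z" "snd z"] by (auto simp: fund_def)
      then show ?thesis using True weight_integral[of "snd z" i "fst z"] by simp
    qed simp
  qed
  also have "\<dots> = ennreal (pi / 3 - 1 / sqrt T) * total_weight i"
    unfolding fund_integral[OF T, symmetric] by (rule nn_integral_multc) measurable
  finally show ?thesis .
qed

section \<open>Evaluation of the volume integrals\<close>

lemma nn_integral_even:
  fixes f :: "real \<Rightarrow> ennreal"
  assumes [measurable]: "f \<in> borel_measurable borel" and even: "\<And>x. f (- x) = f x"
  shows "integral\<^sup>N lborel f = 2 * (\<integral>\<^sup>+x. f x * indicator {0<..} x \<partial>lborel)"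
proof -
  have "integral\<^sup>N lborel f = (\<integral>\<^sup>+x. f x * indicator {0<..} x + f x * indicator {..<0} x \<partial>lborel)"
    by (intro nn_integral_cong_AE) (use AE_lborel_singleton[of "0::real"] in eventually_elim, auto simp: indicator_def)
  also have "\<dots> = (\<integral>\<^sup>+x. f x * indicator {0<..} x \<partial>lborel) + (\<integral>\<^sup>+x. f x * indicator {..<0} x \<partial>lborel)"
    by (rule nn_integral_add) measurable
  also have "(\<integral>\<^sup>+x. f x * indicator {..<0} x \<partial>lborel) = (\<integral>\<^sup>+x. f x * indicator {0<..} x \<partial>lborel)"
    by (subst nn_integral_real_affine[where c = "-1" and t = 0])
      (auto intro!: nn_integral_cong simp: even indicator_def)
  finally show ?thesis by (simp add: mult_2)
qed

text \<open>Quartics with covariant point at the imaginary unit are decomposed under rotations: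
  \<open>g\<close> is the coefficient of the invariant part (t^2 + 1)^2, and w = u^2 + v^2 measures
  the rest. The invariants, the sign condition and the Jacobian depend on g and w only.\<close>

definition profile :: "nat \<Rightarrow> real \<Rightarrow> real \<Rightarrow> ennreal" where
  "profile i g w = (if i = 1 then
       (if g^2 < w \<and> 12 * w - 16 * g^2 < 1 \<and> 16 * g^2 - 12 * w < 1 \<and> 8 * \<bar>g\<bar> * (9 * w - 8 * g^2) < 1 then ennreal (8 * w) else 0)
     else if (if i = 0 then g^2 < w else w < g^2) \<and> 16 * (g^2 + 3 * w) < 1 then ennreal (16 * \<bar>g^2 - w\<bar>) else 0)"

lemma profile_measurable [measurable (raw)]:
  assumes [measurable]: "g \<in> borel_measurable M" "w \<in> borel_measurable M"
  shows "(\<lambda>x. profile i (g x) (w x)) \<in> borel_measurable M"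
  unfolding profile_def
  by (cases "i = 0"; cases "i = 1"; simp only: if_True if_False simp_thms; measurable)

lemma profile_even: "profile i (- g) w = profile i g w"
  by (simp only: profile_def power2_minus abs_minus_cancel)

text \<open>With j the imaginary unit and t real, the substitution writes the quartic as g (t^2 +
  1)^2 + u Re (t + j)^4 + v Im (t + j)^4.\<close>

lemma weight_eq_profile:
  assumes "i = 0 \<or> i = 2"
  shows "weight i 1 (g + u) (4 * v) (2 * g - 6 * u) = profile i g (u^2 + v^2)"
proof -
  define w where "w = u^2 + v^2"
  have w: "w \<ge> 0" by (simp add: w_def)
  have i1: "i \<noteq> 1" using assms by auto
  have I: "rI (g + u) (4 * v) (2 * g - 6 * u) (cD i 1 (4 * v)) (cE i 1 (g + u) (2 * g - 6 * u)) = 16 * (g^2 + 3 * w)"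
    using i1 by (simp add: rI_def cD_def cE_def w_def power2_eq_square algebra_simps)
  have J: "rJ (g + u) (4 * v) (2 * g - 6 * u) (cD i 1 (4 * v)) (cE i 1 (g + u) (2 * g - 6 * u)) = 128 * (g * (g^2 - 9 * w))"
    using i1 by (simp add: rJ_def cD_def cE_def w_def power2_eq_square power3_eq_cube algebra_simps)
  have D: "8 * (g + u)^2 + 4 * (g + u) * (2 * g - 6 * u) - (4 * v)^2 = 16 * (g^2 - w)"
    by (simp add: w_def power2_eq_square algebra_simps)
  have "dm i 1 (g + u) (4 * v) (2 * g - 6 * u) = (if i = 0 then - 16 * (g^2 - w) else 16 * (g^2 - w))"
    using D assms by (auto simp: dm_def)
  then have dm: "0 < dm i 1 (g + u) (4 * v) (2 * g - 6 * u) \<longleftrightarrow> (if i = 0 then g^2 < w else w < g^2)" by auto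
  have jc: "jc i 1 (g + u) (4 * v) (2 * g - 6 * u) = 16 * \<bar>g^2 - w\<bar>"
  proof -
    have "jc i 1 (g + u) (4 * v) (2 * g - 6 * u) = \<bar>8 * (g + u)^2 + 4 * (g + u) * (2 * g - 6 * u) - (4 * v)^2\<bar>"
      using i1 by (simp add: jc_def)
    then show ?thesis unfolding D by (simp only: abs_mult abs_numeral)
  qed
  \<comment> \<open>4 I^3 - J^2 is nonnegative here, so the bound on the first invariant implies the
    bound on the second; hence \<open>profile\<close> mentions only the first in this case.\<close>
  have Jless: "\<bar>128 * (g * (g^2 - 9 * w))\<bar> < 2" if less: "16 * (g^2 + 3 * w) < 1"
  proof -
    have "(16 * (g^2 + 3 * w))^3 - (64 * (g * (g^2 - 9 * w)))^2 = 4096 * 27 * (w * (g^2 - w)^2)"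
      by algebra
    moreover have "4096 * 27 * (w * (g^2 - w)^2) \<ge> 0" using w by simp
    moreover have "(16 * (g^2 + 3 * w))^3 < 1"
      using power_strict_mono[OF less, of 3] w by simp
    ultimately have "(64 * (g * (g^2 - 9 * w)))^2 < 1" by linarith
    then have "\<bar>64 * (g * (g^2 - 9 * w))\<bar> < 1" by (simp only: abs_square_less_1)
    then show ?thesis by simp
  qed
  have "\<bar>16 * (g^2 + 3 * w)\<bar> = 16 * (g^2 + 3 * w)" using w by simp
  then show ?thesis
    unfolding weight_def reduced_def I J dm jc profile_def w_def[symmetric] using i1 Jless by simp
qed

text \<open>Here the quartic is (t^2 + 1) (g (t^2 + 1) + u (t^2 - 1) + 2 v t).\<close>

lemma weight_1_eq_profile: "weight 1 1 (u + g) (2 * v) (2 * g) = profile 1 g (u^2 + v^2)"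
proof -
  define w where "w = u^2 + v^2"
  have I: "rI (u + g) (2 * v) (2 * g) (cD 1 1 (2 * v)) (cE 1 1 (u + g) (2 * g)) = 16 * g^2 - 12 * w"
    by (simp add: rI_def cD_def cE_def w_def power2_eq_square algebra_simps)
  have J: "rJ (u + g) (2 * v) (2 * g) (cD 1 1 (2 * v)) (cE 1 1 (u + g) (2 * g)) = - 16 * g * (9 * w - 8 * g^2)"
    by (simp add: rJ_def cD_def cE_def w_def power2_eq_square power3_eq_cube algebra_simps)
  have dm: "dm 1 1 (u + g) (2 * v) (2 * g) = 4 * (w - g^2)"
    by (simp add: dm_def w_def power2_eq_square algebra_simps)
  have jc: "jc 1 1 (u + g) (2 * v) (2 * g) = 8 * w"
    by (simp add: jc_def w_def power2_eq_square algebra_simps)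
  have "\<bar>- 16 * g * (9 * w - 8 * g^2)\<bar> < 2 \<longleftrightarrow> 8 * \<bar>g\<bar> * (9 * w - 8 * g^2) < 1" if "g^2 < w"
  proof -
    have "0 \<le> g^2" by simp
    then have "9 * w - 8 * g^2 > 0" using that by linarith
    then have "\<bar>- 16 * g * (9 * w - 8 * g^2)\<bar> = 2 * (8 * \<bar>g\<bar> * (9 * w - 8 * g^2))" by (simp add: abs_mult)
    then show ?thesis by linarith
  qed
  then show ?thesis
    unfolding weight_def reduced_def I J dm jc profile_def w_def[symmetric] by auto
qed

lemma radial_inner:
  "(\<integral>\<^sup>+u. (\<integral>\<^sup>+v. profile i g (u^2 + v^2) \<partial>lborel) \<partial>lborel) = ennreal pi * (\<integral>\<^sup>+w. profile i g w * indicator {0<..} w \<partial>lborel)"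
  by (rule nn_integral_radial) measurable

text \<open>The substitutions c = 2 a - 8 u, b = 4 v and a = g + u contribute the factors 8, 4 and
  1; the radial integration over (u, v) contributes pi.\<close>

lemma total_weight_eq:
  assumes "i = 0 \<or> i = 2"
  shows "total_weight i = ennreal (32 * pi) * (\<integral>\<^sup>+g. (\<integral>\<^sup>+w. profile i g w * indicator {0<..} w \<partial>lborel) \<partial>lborel)"
proof -
  have "total_weight i = (\<integral>\<^sup>+a. (\<integral>\<^sup>+c. (\<integral>\<^sup>+b. weight i 1 a b c \<partial>lborel) \<partial>lborel) \<partial>lborel)"
    unfolding total_weight_def by (intro nn_integral_cong nn_integral_lborel_swap) (unfold case_prod_beta, measurable)
  also have "\<dots> = (\<integral>\<^sup>+a. 8 * (\<integral>\<^sup>+u. (\<integral>\<^sup>+b. weight i 1 a b (2 * a - 8 * u) \<partial>lborel) \<partial>lborel) \<partial>lborel)"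
  proof (rule nn_integral_cong)
    fix a :: real
    show "(\<integral>\<^sup>+c. (\<integral>\<^sup>+b. weight i 1 a b c \<partial>lborel) \<partial>lborel) = 8 * (\<integral>\<^sup>+u. (\<integral>\<^sup>+b. weight i 1 a b (2 * a - 8 * u) \<partial>lborel) \<partial>lborel)"
      by (subst nn_integral_real_affine[where c = "-8" and t = "2 * a"]) simp_all
  qed
  also have "\<dots> = (\<integral>\<^sup>+a. 8 * (\<integral>\<^sup>+u. 4 * (\<integral>\<^sup>+v. weight i 1 a (4 * v) (2 * a - 8 * u) \<partial>lborel) \<partial>lborel) \<partial>lborel)"
  proof -
    have "(\<integral>\<^sup>+b. weight i 1 a b (2 * a - 8 * u) \<partial>lborel) = 4 * (\<integral>\<^sup>+v. weight i 1 a (4 * v) (2 * a - 8 * u) \<partial>lborel)" for a u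
      by (subst nn_integral_real_affine[where c = 4 and t = 0]) simp_all
    then show ?thesis by simp
  qed
  also have "\<dots> = 32 * (\<integral>\<^sup>+a. (\<integral>\<^sup>+u. (\<integral>\<^sup>+v. weight i 1 a (4 * v) (2 * a - 8 * u) \<partial>lborel) \<partial>lborel) \<partial>lborel)"
    by (simp add: nn_integral_cmult mult.assoc[symmetric])
  also have "(\<integral>\<^sup>+a. (\<integral>\<^sup>+u. (\<integral>\<^sup>+v. weight i 1 a (4 * v) (2 * a - 8 * u) \<partial>lborel) \<partial>lborel) \<partial>lborel)
    = (\<integral>\<^sup>+u. (\<integral>\<^sup>+a. (\<integral>\<^sup>+v. weight i 1 a (4 * v) (2 * a - 8 * u) \<partial>lborel) \<partial>lborel) \<partial>lborel)"
    by (rule nn_integral_lborel_swap) (unfold case_prod_beta, measurable)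
  also have "\<dots> = (\<integral>\<^sup>+u. (\<integral>\<^sup>+g. (\<integral>\<^sup>+v. profile i g (u^2 + v^2) \<partial>lborel) \<partial>lborel) \<partial>lborel)"
  proof (rule nn_integral_cong)
    fix u :: real
    have "(\<integral>\<^sup>+a. (\<integral>\<^sup>+v. weight i 1 a (4 * v) (2 * a - 8 * u) \<partial>lborel) \<partial>lborel)
      = (\<integral>\<^sup>+g. (\<integral>\<^sup>+v. weight i 1 (g + u) (4 * v) (2 * (g + u) - 8 * u) \<partial>lborel) \<partial>lborel)"
      by (rule nn_integral_shift[symmetric]) measurable
    also have "\<dots> = (\<integral>\<^sup>+g. (\<integral>\<^sup>+v. profile i g (u^2 + v^2) \<partial>lborel) \<partial>lborel)"
    proof (intro nn_integral_cong)
      fix g v :: real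
      have "2 * (g + u) - 8 * u = 2 * g - 6 * u" by simp
      then show "weight i 1 (g + u) (4 * v) (2 * (g + u) - 8 * u) = profile i g (u^2 + v^2)"
        using weight_eq_profile[OF assms] by metis
    qed
    finally show "(\<integral>\<^sup>+a. (\<integral>\<^sup>+v. weight i 1 a (4 * v) (2 * a - 8 * u) \<partial>lborel) \<partial>lborel)
      = (\<integral>\<^sup>+g. (\<integral>\<^sup>+v. profile i g (u^2 + v^2) \<partial>lborel) \<partial>lborel)" .
  qed
  also have "\<dots> = (\<integral>\<^sup>+g. (\<integral>\<^sup>+u. (\<integral>\<^sup>+v. profile i g (u^2 + v^2) \<partial>lborel) \<partial>lborel) \<partial>lborel)"
    by (rule nn_integral_lborel_swap) (unfold case_prod_beta, measurable)
  also have "\<dots> = ennreal pi * (\<integral>\<^sup>+g. (\<integral>\<^sup>+w. profile i g w * indicator {0<..} w \<partial>lborel) \<partial>lborel)"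
    unfolding radial_inner by (rule nn_integral_cmult) measurable
  finally show ?thesis by (simp add: ennreal_mult' mult.assoc)
qed

text \<open>The substitutions c = 2 g, b = 2 v and a = u + g contribute the factors 2, 2 and
  1.\<close>

lemma total_weight_1_eq:
  "total_weight 1 = ennreal (4 * pi) * (\<integral>\<^sup>+g. (\<integral>\<^sup>+w. profile 1 g w * indicator {0<..} w \<partial>lborel) \<partial>lborel)"
proof -
  have "total_weight 1 = (\<integral>\<^sup>+a. (\<integral>\<^sup>+c. (\<integral>\<^sup>+b. weight 1 1 a b c \<partial>lborel) \<partial>lborel) \<partial>lborel)"
    unfolding total_weight_def by (intro nn_integral_cong nn_integral_lborel_swap) (unfold case_prod_beta, measurable)
  also have "\<dots> = (\<integral>\<^sup>+c. (\<integral>\<^sup>+a. (\<integral>\<^sup>+b. weight 1 1 a b c \<partial>lborel) \<partial>lborel) \<partial>lborel)"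
    by (rule nn_integral_lborel_swap) (unfold case_prod_beta, measurable)
  also have "\<dots> = 2 * (\<integral>\<^sup>+g. (\<integral>\<^sup>+a. (\<integral>\<^sup>+b. weight 1 1 a b (2 * g) \<partial>lborel) \<partial>lborel) \<partial>lborel)"
    by (subst nn_integral_real_affine[where c = 2 and t = 0]) simp_all
  also have "\<dots> = 2 * (\<integral>\<^sup>+g. (\<integral>\<^sup>+a. 2 * (\<integral>\<^sup>+v. weight 1 1 a (2 * v) (2 * g) \<partial>lborel) \<partial>lborel) \<partial>lborel)"
  proof -
    have "(\<integral>\<^sup>+b. weight 1 1 a b (2 * g) \<partial>lborel) = 2 * (\<integral>\<^sup>+v. weight 1 1 a (2 * v) (2 * g) \<partial>lborel)" for a g
      by (subst nn_integral_real_affine[where c = 2 and t = 0]) simp_all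
    then show ?thesis by simp
  qed
  also have "\<dots> = 4 * (\<integral>\<^sup>+g. (\<integral>\<^sup>+a. (\<integral>\<^sup>+v. weight 1 1 a (2 * v) (2 * g) \<partial>lborel) \<partial>lborel) \<partial>lborel)"
    by (simp add: nn_integral_cmult mult.assoc[symmetric])
  also have "(\<integral>\<^sup>+g. (\<integral>\<^sup>+a. (\<integral>\<^sup>+v. weight 1 1 a (2 * v) (2 * g) \<partial>lborel) \<partial>lborel) \<partial>lborel)
    = (\<integral>\<^sup>+g. (\<integral>\<^sup>+u. (\<integral>\<^sup>+v. profile 1 g (u^2 + v^2) \<partial>lborel) \<partial>lborel) \<partial>lborel)"
  proof (rule nn_integral_cong)
    fix g :: real
    have "(\<integral>\<^sup>+a. (\<integral>\<^sup>+v. weight 1 1 a (2 * v) (2 * g) \<partial>lborel) \<partial>lborel)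
      = (\<integral>\<^sup>+u. (\<integral>\<^sup>+v. weight 1 1 (u + g) (2 * v) (2 * g) \<partial>lborel) \<partial>lborel)"
      by (rule nn_integral_shift[symmetric]) measurable
    then show "(\<integral>\<^sup>+a. (\<integral>\<^sup>+v. weight 1 1 a (2 * v) (2 * g) \<partial>lborel) \<partial>lborel)
      = (\<integral>\<^sup>+u. (\<integral>\<^sup>+v. profile 1 g (u^2 + v^2) \<partial>lborel) \<partial>lborel)" by (simp only: weight_1_eq_profile)
  qed
  also have "\<dots> = ennreal pi * (\<integral>\<^sup>+g. (\<integral>\<^sup>+w. profile 1 g w * indicator {0<..} w \<partial>lborel) \<partial>lborel)"
    unfolding radial_inner by (rule nn_integral_cmult) measurable
  finally show ?thesis by (simp add: ennreal_mult' mult.assoc)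
qed

text \<open>The range of w is g^2 < w < (1/16 - g^2)/3, nonempty exactly for |g| < 1/8.\<close>

lemma profile_0_inner:
  "(\<integral>\<^sup>+w. profile 0 g w * indicator {0<..} w \<partial>lborel)
    = ennreal (8 / 9 * (1 / 256 - g^2 / 2 + 16 * g^4)) * indicator {-1/8<..<1/8} g"
proof (cases "g \<in> {-1/8<..<1/8}")
  case True
  define m where "m = (1 / 16 - g^2) / 3"
  have "\<bar>g\<bar> < \<bar>1/8\<bar>" using True by auto
  then have "g^2 < (1/8)^2" using abs_square_le_1 power2_less_imp_less power_strict_mono[of "\<bar>g\<bar>" "1/8" 2] by simp
  then have g2: "g^2 < 1/64" by (simp add: power2_eq_square)
  have g0: "0 \<le> g^2" by simp
  have "(\<integral>\<^sup>+w. profile 0 g w * indicator {0<..} w \<partial>lborel) = (\<integral>\<^sup>+w. ennreal (16 * (w - g^2)) * indicator {g^2<..<m} w \<partial>lborel)"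
  proof (rule nn_integral_cong)
    fix w :: real
    have iff: "g^2 < w \<and> 16 * (g^2 + 3 * w) < 1 \<longleftrightarrow> w \<in> {g^2<..<m}" unfolding m_def by (auto simp: field_simps)
    have "profile 0 g w = (if g^2 < w \<and> 16 * (g^2 + 3 * w) < 1 then ennreal (16 * \<bar>g^2 - w\<bar>) else 0)"
      by (simp add: profile_def)
    then have P: "profile 0 g w = (if w \<in> {g^2<..<m} then ennreal (16 * \<bar>g^2 - w\<bar>) else 0)" unfolding iff .
    show "profile 0 g w * indicator {0<..} w = ennreal (16 * (w - g^2)) * indicator {g^2<..<m} w"
    proof (cases "w \<in> {g^2<..<m}")
      case True
      then have "w > 0" "\<bar>g^2 - w\<bar> = w - g^2" using g0 unfolding greaterThanLessThan_iff by linarith+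
      then show ?thesis using True unfolding P by simp
    next
      case False
      then have "indicator {g^2<..<m} w = (0 :: ennreal)" by (rule indicator_simps)
      moreover have "profile 0 g w = 0" unfolding P using False by (rule if_not_P)
      ultimately show ?thesis by (simp only: mult_zero_left mult_zero_right)
    qed
  qed
  also have "\<dots> = ennreal (8 * (m - g^2)^2 - 8 * (g^2 - g^2)^2)"
  proof (rule nn_integral_FTC_open)
    show "g^2 \<le> m" using g2 by (simp add: m_def)
  qed (auto intro!: derivative_eq_intros)
  also have "8 * (m - g^2)^2 - 8 * (g^2 - g^2)^2 = 8 / 9 * (1 / 256 - g^2 / 2 + 16 * g^4)"
    unfolding m_def by (simp add: field_simps power2_eq_square power4_eq_xxxx)
  finally show ?thesis using True by simp
next
  case False
  then have "(1/8)^2 \<le> \<bar>g\<bar>^2" by (intro power_mono) auto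
  then have "1/64 \<le> g^2" by (simp add: power2_eq_square)
  then have "profile 0 g w = 0" for w by (auto simp: profile_def)
  then show ?thesis using False by simp
qed

lemma total_weight_0: "total_weight 0 = ennreal (2 * pi / 135)"
proof -
  define F :: "real \<Rightarrow> real" where "F g = 8 / 9 * (g / 256 - g^3 / 6 + 16 / 5 * g^5)" for g
  have "(\<integral>\<^sup>+g. (\<integral>\<^sup>+w. profile 0 g w * indicator {0<..} w \<partial>lborel) \<partial>lborel) = ennreal (F (1/8) - F (-1/8))"
    unfolding profile_0_inner
  proof (rule nn_integral_FTC_open)
    show "(F has_real_derivative 8 / 9 * (1 / 256 - g^2 / 2 + 16 * g^4)) (at g)" for g
      unfolding F_def[abs_def] by (auto intro!: derivative_eq_intros simp: field_simps)
    show "0 \<le> 8 / 9 * (1 / 256 - g^2 / 2 + 16 * g^4)" for g :: real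
    proof -
      have "1 / 256 - g^2 / 2 + 16 * g^4 = (1/16 - 4 * g^2)^2" by (simp add: field_simps power2_eq_square power4_eq_xxxx)
      then show ?thesis by simp
    qed
  qed simp
  also have "F (1/8) - F (-1/8) = 1 / 2160" by (simp add: F_def power_divide eval_nat_numeral)
  finally have "total_weight 0 = ennreal (32 * pi) * ennreal (1 / 2160)" using total_weight_eq[of 0] by simp
  also have "\<dots> = ennreal (32 * pi * (1 / 2160))" by (rule ennreal_mult'[symmetric]) simp
  finally show ?thesis by simp
qed

text \<open>The upper limit of w is the smaller of g^2 and (1/16 - g^2)/3. They cross at g = 1/8,
  and the second vanishes at g = 1/4.\<close>

lemma profile_2_inner:
  assumes g: "g > 0" "g \<noteq> 1/8"
  shows "(\<integral>\<^sup>+w. profile 2 g w * indicator {0<..} w \<partial>lborel)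
    = ennreal (8 * g^4) * indicator {0<..<1/8} g
      + ennreal (- 1 / 288 + 4 / 9 * g^2 - 56 / 9 * g^4) * indicator {1/8<..<1/4} g"
proof (cases "g < 1/4")
  case True
  define m where "m = (if g < 1/8 then g^2 else (1 / 16 - g^2) / 3)"
  have sq: "g^2 < 1/64 \<longleftrightarrow> g < 1/8" "g^2 < 1/16"
    using power_strict_mono[of g "1/8" 2] power_mono[of "1/8" g 2] power_strict_mono[of g "1/4" 2] g True
    by (auto simp: power2_eq_square not_less[symmetric])
  have "(\<integral>\<^sup>+w. profile 2 g w * indicator {0<..} w \<partial>lborel) = (\<integral>\<^sup>+w. ennreal (16 * (g^2 - w)) * indicator {0<..<m} w \<partial>lborel)"
  proof (rule nn_integral_cong)
    fix w :: real
    have iff: "w < g^2 \<and> 16 * (g^2 + 3 * w) < 1 \<longleftrightarrow> w < m"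
      using sq unfolding m_def by (auto simp: field_simps)
    have "profile 2 g w = (if w < g^2 \<and> 16 * (g^2 + 3 * w) < 1 then ennreal (16 * \<bar>g^2 - w\<bar>) else 0)"
      by (simp add: profile_def)
    then have P: "profile 2 g w = (if w < m then ennreal (16 * \<bar>g^2 - w\<bar>) else 0)" unfolding iff .
    show "profile 2 g w * indicator {0<..} w = ennreal (16 * (g^2 - w)) * indicator {0<..<m} w"
    proof (cases "w < m")
      case True
      then have "\<bar>g^2 - w\<bar> = g^2 - w" using iff by auto
      then show ?thesis using True unfolding P by (simp add: indicator_def)
    qed (simp add: P)
  qed
  also have "\<dots> = ennreal ((16 * g^2 * m - 8 * m^2) - (16 * g^2 * 0 - 8 * 0^2))"
  proof (rule nn_integral_FTC_open)
    show "0 \<le> m" using sq by (simp add: m_def)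
    have "m \<le> g^2" using sq by (auto simp: m_def field_simps not_less)
    then show "0 \<le> 16 * (g^2 - w)" if "w \<le> m" for w using that by simp
  qed (auto intro!: derivative_eq_intros)
  also have "(16 * g^2 * m - 8 * m^2) - (16 * g^2 * 0 - 8 * 0^2)
    = (if g < 1/8 then 8 * g^4 else - 1 / 288 + 4 / 9 * g^2 - 56 / 9 * g^4)"
    unfolding m_def by (simp add: field_simps power2_eq_square power4_eq_xxxx)
  finally show ?thesis using True g by (auto simp: indicator_def)
next
  case False
  then have "(1/4)^2 \<le> g^2" by (intro power_mono) auto
  then have "1/16 \<le> g^2" by (simp add: power2_eq_square)
  then have Z: "profile 2 g w * indicator {0<..} w = 0" for w by (auto simp: profile_def)
  show ?thesis unfolding Z using False by simp
qed

lemma total_weight_2: "total_weight 2 = ennreal (4 * pi / 135)"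
proof -
  define F :: "real \<Rightarrow> real" where "F g = - g / 288 + 4 / 27 * g^3 - 56 / 45 * g^5" for g
  have "(\<integral>\<^sup>+g. (\<integral>\<^sup>+w. profile 2 g w * indicator {0<..} w \<partial>lborel) \<partial>lborel)
    = 2 * (\<integral>\<^sup>+g. (\<integral>\<^sup>+w. profile 2 g w * indicator {0<..} w \<partial>lborel) * indicator {0<..} g \<partial>lborel)"
    by (rule nn_integral_even, measurable) (simp add: profile_even)
  also have "(\<integral>\<^sup>+g. (\<integral>\<^sup>+w. profile 2 g w * indicator {0<..} w \<partial>lborel) * indicator {0<..} g \<partial>lborel)
    = (\<integral>\<^sup>+g. ennreal (8 * g^4) * indicator {0<..<1/8} g
      + ennreal (- 1 / 288 + 4 / 9 * g^2 - 56 / 9 * g^4) * indicator {1/8<..<1/4} g \<partial>lborel)"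
  proof (rule nn_integral_cong_AE)
    show "AE g in lborel. (\<integral>\<^sup>+w. profile 2 g w * indicator {0<..} w \<partial>lborel) * indicator {0<..} g
       = ennreal (8 * g^4) * indicator {0<..<1/8} g
      + ennreal (- 1 / 288 + 4 / 9 * g^2 - 56 / 9 * g^4) * indicator {1/8<..<1/4} g"
      using AE_lborel_singleton[of "1/8"]
    proof eventually_elim
      case (elim g)
      then show ?case using profile_2_inner[of g] by (cases "g > 0") (auto simp: indicator_def)
    qed
  qed
  also have "\<dots> = (\<integral>\<^sup>+g. ennreal (8 * g^4) * indicator {0<..<1/8} g \<partial>lborel)
     + (\<integral>\<^sup>+g. ennreal (- 1 / 288 + 4 / 9 * g^2 - 56 / 9 * g^4) * indicator {1/8<..<1/4} g \<partial>lborel)"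
    by (rule nn_integral_add) measurable
  also have "(\<integral>\<^sup>+g. ennreal (8 * g^4) * indicator {0<..<1/8} g \<partial>lborel) = ennreal (8 / 5 * (1/8)^5 - 8 / 5 * 0^5)"
    by (rule nn_integral_FTC_open) (auto intro!: derivative_eq_intros)
  also have "(\<integral>\<^sup>+g. ennreal (- 1 / 288 + 4 / 9 * g^2 - 56 / 9 * g^4) * indicator {1/8<..<1/4} g \<partial>lborel) = ennreal (F (1/4) - F (1/8))"
  proof (rule nn_integral_FTC_open)
    show "(F has_real_derivative - 1 / 288 + 4 / 9 * g^2 - 56 / 9 * g^4) (at g)" for g
      unfolding F_def[abs_def] by (auto intro!: derivative_eq_intros simp: field_simps)
    show "0 \<le> - 1 / 288 + 4 / 9 * g^2 - 56 / 9 * g^4" if "1/8 \<le> g" "g \<le> 1/4" for g :: real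
    proof -
      have "(1/8)^2 \<le> g^2" "g^2 \<le> (1/4)^2" using that by (intro power_mono; simp)+
      \<comment> \<open>1/16 and 1/112 are the zeros of the integrand as a polynomial in
        g^2.\<close>
      then have "0 \<le> (1/16 - g^2) * (g^2 - 1/112)" by (intro mult_nonneg_nonneg) (simp_all add: power2_eq_square)
      also have "\<dots> = 9 / 56 * (- 1 / 288 + 4 / 9 * g^2 - 56 / 9 * g^4)" by (simp add: field_simps power2_eq_square power4_eq_xxxx)
      finally show ?thesis by simp
    qed
  qed simp
  also have "ennreal (8 / 5 * (1/8)^5 - 8 / 5 * 0^5) + ennreal (F (1/4) - F (1/8)) = ennreal (1 / 2160)"
    by (subst ennreal_plus[symmetric]) (simp_all add: F_def power_divide eval_nat_numeral)
  also have "2 * ennreal (1 / 2160) = ennreal (1 / 1080)"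
    using ennreal_mult[of 2 "1 / 2160"] by simp
  finally have "total_weight 2 = ennreal (32 * pi) * ennreal (1 / 1080)" using total_weight_eq[of 2] by simp
  also have "\<dots> = ennreal (32 * pi * (1 / 1080))" by (rule ennreal_mult'[symmetric]) simp
  finally show ?thesis by simp
qed

text \<open>The upper limit of w is the smaller of (1 + 16 g^2)/12, from the first invariant, and
  (1/(8 g) + 8 g^2)/9, from the second; they cross at \<theta>. At g = 1/2 the second has come down
  to the lower limit g^2.\<close>

lemma profile_1_inner:
  assumes th: "32 * \<theta>^3 + 6 * \<theta> = 1" "0 < \<theta>" "\<theta> < 1/2" and g: "g > 0" "g \<noteq> \<theta>"
  shows "(\<integral>\<^sup>+w. profile 1 g w * indicator {0<..} w \<partial>lborel)
    = ennreal (1 / 36 + 8 / 9 * g^2 + 28 / 9 * g^4) * indicator {0<..<\<theta>} g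
      + ennreal (1 / (1296 * g^2) + 8 / 81 * g - 68 / 81 * g^4) * indicator {\<theta><..<1/2} g"
proof (cases "g < 1/2")
  case True
  define m where "m = (if g < \<theta> then (1 + 16 * g^2) / 12 else (1 / (8 * g) + 8 * g^2) / 9)"
  have g2: "g^2 < 1/4" using power_strict_mono[of g "1/2" 2] g True by (simp add: power2_eq_square)
  have mono: "32 * x^3 + 6 * x < 32 * y^3 + 6 * y" if "0 < x" "x < y" for x y :: real
    using power_strict_mono[of x y 3] that by simp
  have lt: "g < \<theta> \<Longrightarrow> 32 * g^3 + 6 * g < 1" "\<theta> < g \<Longrightarrow> 1 < 32 * g^3 + 6 * g"
    using mono[of g \<theta>] mono[of \<theta> g] th g by auto
  have pq: "(1 + 16 * g^2) / 12 - (1 / (8 * g) + 8 * g^2) / 9 = (32 * g^3 + 6 * g - 1) / (72 * g)"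
    using g by (simp add: field_simps power2_eq_square power3_eq_cube)
  have cmp: "g < \<theta> \<Longrightarrow> (1 + 16 * g^2) / 12 \<le> (1 / (8 * g) + 8 * g^2) / 9"
     "\<theta> < g \<Longrightarrow> (1 / (8 * g) + 8 * g^2) / 9 \<le> (1 + 16 * g^2) / 12"
  proof -
    assume "g < \<theta>"
    then have "(32 * g^3 + 6 * g - 1) / (72 * g) \<le> 0" using lt g by (intro divide_nonpos_pos) auto
    then show "(1 + 16 * g^2) / 12 \<le> (1 / (8 * g) + 8 * g^2) / 9" using pq by linarith
  next
    assume "\<theta> < g"
    then have "(32 * g^3 + 6 * g - 1) / (72 * g) \<ge> 0" using lt g by (intro divide_nonneg_pos) auto
    then show "(1 / (8 * g) + 8 * g^2) / 9 \<le> (1 + 16 * g^2) / 12" using pq by linarith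
  qed
  have gm: "g^2 \<le> m"
  proof -
    have "g^2 \<le> (1 + 16 * g^2) / 12" using g2 by simp
    moreover have "g^2 \<le> (1 / (8 * g) + 8 * g^2) / 9"
    proof -
      have "g^3 \<le> (1/2)^3" using g True by (intro power_mono) auto
      then have "g^2 \<le> 1 / (8 * g)" using g by (simp add: field_simps power2_eq_square power3_eq_cube)
      then show ?thesis by simp
    qed
    ultimately show ?thesis by (simp add: m_def)
  qed
  have g0: "0 < g^2" using g by simp
  have "(\<integral>\<^sup>+w. profile 1 g w * indicator {0<..} w \<partial>lborel) = (\<integral>\<^sup>+w. ennreal (8 * w) * indicator {g^2<..<m} w \<partial>lborel)"
  proof (rule nn_integral_cong)
    fix w :: real
    have q: "8 * \<bar>g\<bar> * (9 * w - 8 * g^2) < 1 \<longleftrightarrow> w < (1 / (8 * g) + 8 * g^2) / 9"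
      using g by (simp add: field_simps power2_eq_square)
    have p: "12 * w - 16 * g^2 < 1 \<longleftrightarrow> w < (1 + 16 * g^2) / 12" by (simp add: field_simps)
    have iff: "g^2 < w \<and> 12 * w - 16 * g^2 < 1 \<and> 16 * g^2 - 12 * w < 1 \<and> 8 * \<bar>g\<bar> * (9 * w - 8 * g^2) < 1 \<longleftrightarrow> w \<in> {g^2<..<m}"
      unfolding p q m_def using cmp g2 g(2) by (auto split: if_splits)
    show "profile 1 g w * indicator {0<..} w = ennreal (8 * w) * indicator {g^2<..<m} w"
    proof (cases "w \<in> {g^2<..<m}")
      case True
      then have "w > 0" using g0 by (simp add: order_less_trans[OF g0])
      then show ?thesis using iff True by (simp add: profile_def)
    next
      case False
      then have "profile 1 g w = 0" using iff unfolding profile_def by (simp only: if_False refl if_True)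
      then show ?thesis using False by simp
    qed
  qed
  also have "\<dots> = ennreal (4 * m^2 - 4 * (g^2)^2)"
  proof (rule nn_integral_FTC_open[OF gm])
    show "0 \<le> 8 * w" if "g^2 \<le> w" for w using that g0 by linarith
  qed (auto intro!: derivative_eq_intros)
  also have "4 * m^2 - 4 * (g^2)^2
    = (if g < \<theta> then 1 / 36 + 8 / 9 * g^2 + 28 / 9 * g^4 else 1 / (1296 * g^2) + 8 / 81 * g - 68 / 81 * g^4)"
    unfolding m_def using g by (simp add: field_simps power2_eq_square power4_eq_xxxx)
  finally show ?thesis using True g by (auto simp: indicator_def)
next
  case False
  have "profile 1 g w = 0" for w
  proof -
    have "\<not> (g^2 < w \<and> 8 * \<bar>g\<bar> * (9 * w - 8 * g^2) < 1)"
    proof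
      assume *: "g^2 < w \<and> 8 * \<bar>g\<bar> * (9 * w - 8 * g^2) < 1"
      have "(1/2)^3 \<le> g^3" using False by (intro power_mono) auto
      then have "1 \<le> 8 * g * (9 * g^2 - 8 * g^2)" by (simp add: power2_eq_square power3_eq_cube)
      also have "\<dots> \<le> 8 * g * (9 * w - 8 * g^2)" using * g by (intro mult_left_mono) auto
      finally show False using * g by simp
    qed
    then show ?thesis by (auto simp: profile_def)
  qed
  then show ?thesis using False th by simp
qed

lemma total_weight_1: "total_weight 1 = ennreal (16 * pi / 135)"
proof -
  have "\<exists>x\<ge>0. x \<le> 1/2 \<and> 32 * x^3 + 6 * x = (1::real)"
    by (rule IVT') (auto intro!: continuous_intros simp: power3_eq_cube)
  then obtain \<theta> :: real where th: "0 \<le> \<theta>" "\<theta> \<le> 1/2" "32 * \<theta>^3 + 6 * \<theta> = 1" by blast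
  have "\<theta> \<noteq> 0" using th(3) by auto
  moreover have "\<theta> \<noteq> 1/2"
  proof
    assume "\<theta> = 1/2"
    then have "32 * (1/2)^3 + 6 * (1/2) = (1::real)" using th(3) by (simp only:)
    then show False by (simp add: power_divide)
  qed
  ultimately have th': "0 < \<theta>" "\<theta> < 1/2" using th by auto
  define F1 :: "real \<Rightarrow> real" where "F1 g = g / 36 + 8 / 27 * g^3 + 28 / 45 * g^5" for g
  define F2 :: "real \<Rightarrow> real" where "F2 g = - (1 / 1296) * inverse g + 4 / 81 * g^2 - 68 / 405 * g^5" for g
  have "(\<integral>\<^sup>+g. (\<integral>\<^sup>+w. profile 1 g w * indicator {0<..} w \<partial>lborel) \<partial>lborel)
    = 2 * (\<integral>\<^sup>+g. (\<integral>\<^sup>+w. profile 1 g w * indicator {0<..} w \<partial>lborel) * indicator {0<..} g \<partial>lborel)"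
    by (rule nn_integral_even, measurable) (simp add: profile_even)
  also have "(\<integral>\<^sup>+g. (\<integral>\<^sup>+w. profile 1 g w * indicator {0<..} w \<partial>lborel) * indicator {0<..} g \<partial>lborel)
    = (\<integral>\<^sup>+g. ennreal (1 / 36 + 8 / 9 * g^2 + 28 / 9 * g^4) * indicator {0<..<\<theta>} g
      + ennreal (1 / (1296 * g^2) + 8 / 81 * g - 68 / 81 * g^4) * indicator {\<theta><..<1/2} g \<partial>lborel)"
  proof (rule nn_integral_cong_AE)
    show "AE g in lborel. (\<integral>\<^sup>+w. profile 1 g w * indicator {0<..} w \<partial>lborel) * indicator {0<..} g
       = ennreal (1 / 36 + 8 / 9 * g^2 + 28 / 9 * g^4) * indicator {0<..<\<theta>} g
      + ennreal (1 / (1296 * g^2) + 8 / 81 * g - 68 / 81 * g^4) * indicator {\<theta><..<1/2} g"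
      using AE_lborel_singleton[of \<theta>]
    proof eventually_elim
      case (elim g)
      then show ?case using profile_1_inner[OF th(3) th', of g] th' by (cases "g > 0") (simp_all add: indicator_def)
    qed
  qed
  also have "\<dots> = (\<integral>\<^sup>+g. ennreal (1 / 36 + 8 / 9 * g^2 + 28 / 9 * g^4) * indicator {0<..<\<theta>} g \<partial>lborel)
     + (\<integral>\<^sup>+g. ennreal (1 / (1296 * g^2) + 8 / 81 * g - 68 / 81 * g^4) * indicator {\<theta><..<1/2} g \<partial>lborel)"
    by (rule nn_integral_add) measurable
  also have "(\<integral>\<^sup>+g. ennreal (1 / 36 + 8 / 9 * g^2 + 28 / 9 * g^4) * indicator {0<..<\<theta>} g \<partial>lborel) = ennreal (F1 \<theta> - F1 0)"
  proof (rule nn_integral_FTC_open)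
    show "(F1 has_real_derivative 1 / 36 + 8 / 9 * g^2 + 28 / 9 * g^4) (at g)" for g
      unfolding F1_def[abs_def] by (auto intro!: derivative_eq_intros simp: field_simps)
    show "0 \<le> 1 / 36 + 8 / 9 * g^2 + 28 / 9 * g^4" for g :: real by simp
  qed (use th in simp)
  also have "(\<integral>\<^sup>+g. ennreal (1 / (1296 * g^2) + 8 / 81 * g - 68 / 81 * g^4) * indicator {\<theta><..<1/2} g \<partial>lborel) = ennreal (F2 (1/2) - F2 \<theta>)"
  proof (rule nn_integral_FTC_open)
    show "(F2 has_real_derivative 1 / (1296 * g^2) + 8 / 81 * g - 68 / 81 * g^4) (at g)" if "\<theta> \<le> g" for g
      unfolding F2_def[abs_def] using that th'
      by (auto intro!: derivative_eq_intros simp: field_simps power2_eq_square)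
    show "0 \<le> 1 / (1296 * g^2) + 8 / 81 * g - 68 / 81 * g^4" if "\<theta> \<le> g" "g \<le> 1/2" for g :: real
    proof -
      have g: "g > 0" using that th' by simp
      have "g^3 \<le> (1/2)^3" using g that by (intro power_mono) auto
      then have "0 \<le> (1 - 8 * g^3) * (1 + 136 * g^3) / (1296 * g^2)"
        using g by (intro divide_nonneg_pos mult_nonneg_nonneg) (simp_all add: power_divide)
      also have "\<dots> = 1 / (1296 * g^2) + 8 / 81 * g - 68 / 81 * g^4"
        using g by (simp add: field_simps power2_eq_square power3_eq_cube power4_eq_xxxx)
      finally show ?thesis .
    qed
  qed (use th in simp)
  also have "ennreal (F1 \<theta> - F1 0) + ennreal (F2 (1/2) - F2 \<theta>) = ennreal (2 / 135)"
  proof -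
    \<comment> \<open>The cubic equation of \<theta> turns its inverse into a polynomial.\<close>
    have inv: "inverse \<theta> = 32 * \<theta>^2 + 6"
      using th(3) th' by (simp add: field_simps power2_eq_square power3_eq_cube)
    have s: "F1 \<theta> - F1 0 + (F2 (1/2) - F2 \<theta>) = 2 / 135"
    proof -
      have "F1 \<theta> - F1 0 + (F2 (1/2) - F2 \<theta>) = \<theta> / 36 + 8 / 27 * \<theta>^3 + 64 / 81 * \<theta>^5 + (32 * \<theta>^2 + 6) / 1296 - 4 / 81 * \<theta>^2 + 1 / 180"
        unfolding F1_def F2_def inv
          by (simp add: power_divide eval_nat_numeral algebra_simps) (simp add: add_divide_distrib)
      \<comment> \<open>\<theta> is never computed: modulo its cubic equation the total is the
        rational number 2/135.\<close>
      also have "\<dots> = 2 / 135 + (32 * \<theta>^3 + 6 * \<theta> - 1) * (2 / 81 * \<theta>^2 + 1 / 216)"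
        by (simp add: field_simps eval_nat_numeral)
      finally show ?thesis using th(3) by simp
    qed
    have "F1 \<theta> - F1 0 \<ge> 0" using th' by (simp add: F1_def)
    moreover have "F2 (1/2) - F2 \<theta> \<ge> 0"
    proof -
      have "\<theta>^5 \<ge> 0" "\<theta>^2 \<le> (1/2)^2" using th' by (simp, intro power_mono) auto
      moreover have "F2 (1/2) - F2 \<theta> = 11 / 1080 - 2 / 81 * \<theta>^2 + 68 / 405 * \<theta>^5"
        unfolding F2_def inv by (simp add: power_divide eval_nat_numeral algebra_simps)
      moreover have "(1/2)^2 = (1/4::real)" by (simp add: power_divide)
      ultimately show ?thesis by linarith
    qed
    ultimately have "ennreal (F1 \<theta> - F1 0) + ennreal (F2 (1/2) - F2 \<theta>) = ennreal (F1 \<theta> - F1 0 + (F2 (1/2) - F2 \<theta>))"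
      by (rule ennreal_plus[symmetric])
    then show ?thesis unfolding s .
  qed
  also have "2 * ennreal (2 / 135) = ennreal (4 / 135)"
    using ennreal_mult[of 2 "2 / 135"] by simp
  finally have "total_weight 1 = ennreal (4 * pi) * ennreal (4 / 135)" using total_weight_1_eq by simp
  also have "\<dots> = ennreal (4 * pi * (4 / 135))" by (rule ennreal_mult'[symmetric]) simp
  finally show ?thesis by simp
qed

section \<open>Reduced forms as lattice points\<close>

lemma finite_poly_zero_set:
  fixes p :: "real poly"
  assumes "p \<noteq> 0" "\<And>x. f x = poly p x"
  shows "finite {x. f x = 0}"
  using poly_roots_finite[OF assms(1)] unfolding assms(2) .

text \<open>As polynomials in \<open>c\<close> the invariants have the leading terms c^2 and -2 c^3,
  and \<open>dm\<close> is linear with leading coefficient 4 a up to sign. So each boundary equation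
  is nontrivial when \<open>a\<close> is nonzero.\<close>

lemma finite_boundary_values:
  assumes a: "a \<noteq> 0" and i: "i \<in> {0, 1, 2}"
  shows "finite {c. dm i Y a b c = 0 \<or> \<bar>rI a b c (cD i Y b) (cE i Y a c)\<bar> = 1 \<or> \<bar>rJ a b c (cD i Y b) (cE i Y a c)\<bar> = 2}"
proof -
  have 1: "finite {c. dm i Y a b c = 0}"
  proof -
    define p where "p = (if i = 0 then [:b^2 - 8 * a^2 * Y, - 4 * a:]
      else if i = 1 then [:b^2 + 4 * a^2 * Y, - 4 * a:] else [:8 * a^2 * Y - b^2, 4 * a:])"
    have "p \<noteq> 0" using a by (auto simp: p_def)
    then show ?thesis by (rule finite_poly_zero_set) (simp add: p_def dm_def algebra_simps)
  qed
  have 2: "finite {c. rI a b c (cD i Y b) (cE i Y a c) - s = 0}" for s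
  proof -
    define p where "p = (if i = 1 then [:- 12 * a * Y * (Y * a) - 3 * Y * b^2 - s, 12 * a * Y, 1:]
      else [:12 * a^2 * Y^2 + 3 * Y * b^2 - s, 0, 1:])"
    have "p \<noteq> 0" by (auto simp: p_def)
    then show ?thesis
      by (rule finite_poly_zero_set) (simp add: p_def rI_def cD_def cE_def algebra_simps power2_eq_square)
  qed
  have 3: "finite {c. rJ a b c (cD i Y b) (cE i Y a c) - s = 0}" for s
  proof -
    define p where "p = (if i = 1 then [:- 27 * a * Y^2 * b^2 + 27 * Y * Y * a * b^2 - s, - 72 * a^2 * Y^2 + 9 * Y * b^2 - 27 * Y * b^2, 72 * a * Y, - 2:]
      else [:- 27 * a * Y^2 * b^2 - 27 * Y^2 * a * b^2 - s, 72 * a^2 * Y^2 - 9 * Y * b^2, 0, - 2:])"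
    have "p \<noteq> 0" by (auto simp: p_def)
    then show ?thesis
      by (rule finite_poly_zero_set) (simp add: p_def rJ_def cD_def cE_def algebra_simps power2_eq_square power3_eq_cube)
  qed
  have abs: "\<bar>x\<bar> = r \<Longrightarrow> x - r = 0 \<or> x - (- r) = 0" for x r :: real by auto
  have "{c. dm i Y a b c = 0 \<or> \<bar>rI a b c (cD i Y b) (cE i Y a c)\<bar> = 1 \<or> \<bar>rJ a b c (cD i Y b) (cE i Y a c)\<bar> = 2}
    \<subseteq> {c. dm i Y a b c = 0} \<union> {c. rI a b c (cD i Y b) (cE i Y a c) - 1 = 0} \<union> {c. rI a b c (cD i Y b) (cE i Y a c) - (- 1) = 0}
     \<union> {c. rJ a b c (cD i Y b) (cE i Y a c) - 2 = 0} \<union> {c. rJ a b c (cD i Y b) (cE i Y a c) - (- 2) = 0}"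
    using abs by blast
  then show ?thesis by (rule finite_subset) (intro finite_UnI 1 2 3)
qed

text \<open>By Fubini with \<open>c\<close> innermost: apart from the null sets a = 0, x = 0, x =
  1/2, Y = T and Y = 1 - x^2, only finitely many values of \<open>c\<close> are possible for given
  a, b, x, Y.\<close>

lemma null_boundary:
  assumes i: "i \<in> {0, 1, 2}"
  shows "emeasure lborel (dom_closed i T - dom_open i T) = 0"
proof -
  define N where "N = dom_closed i T - dom_open i T"
  have N [measurable]: "N \<in> sets borel"
    unfolding N_def using open_dom_open closed_dom_closed by (intro sets.Diff) auto
  have "emeasure lborel N = (\<integral>\<^sup>+w. indicator N w \<partial>lborel)" by simp
  also have "\<dots> = (\<integral>\<^sup>+v. (\<integral>\<^sup>+z. indicator N (v, z) \<partial>lborel) \<partial>lborel)"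
    by (rule nn_integral_lborel_pair) measurable
  also have "\<dots> = (\<integral>\<^sup>+z. (\<integral>\<^sup>+v. indicator N (v, z) \<partial>lborel) \<partial>lborel)"
    by (rule nn_integral_lborel_swap) (unfold case_prod_beta prod.collapse, measurable)
  also have "\<dots> = (\<integral>\<^sup>+x. (\<integral>\<^sup>+Y. (\<integral>\<^sup>+v. indicator N (v, (x, Y)) \<partial>lborel) \<partial>lborel) \<partial>lborel)"
    by (rule nn_integral_lborel_pair) measurable
  also have "\<dots> = integral\<^sup>N lborel (\<lambda>x::real. 0)"
  proof (rule nn_integral_cong_AE)
    show "AE x in lborel. (\<integral>\<^sup>+Y. (\<integral>\<^sup>+v. indicator N (v, (x, Y)) \<partial>lborel) \<partial>lborel) = 0"
      using AE_lborel_singleton[of 0] AE_lborel_singleton[of "1/2"]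
    proof eventually_elim
      case (elim x)
      have "(\<integral>\<^sup>+Y. (\<integral>\<^sup>+v. indicator N (v, (x, Y)) \<partial>lborel) \<partial>lborel) = integral\<^sup>N lborel (\<lambda>Y::real. 0)"
      proof (rule nn_integral_cong_AE)
        show "AE Y in lborel. (\<integral>\<^sup>+v. indicator N (v, (x, Y)) \<partial>lborel) = 0"
          using AE_lborel_singleton[of T] AE_lborel_singleton[of "1 - x^2"]
        proof eventually_elim
          case (elim Y)
          have "(\<integral>\<^sup>+v. indicator N (v, (x, Y)) \<partial>lborel)
             = (\<integral>\<^sup>+a. (\<integral>\<^sup>+v. indicator N ((a, v), (x, Y)) \<partial>lborel) \<partial>lborel)"
            by (rule nn_integral_lborel_pair) measurable
          also have "\<dots> = (\<integral>\<^sup>+a. (\<integral>\<^sup>+b. (\<integral>\<^sup>+c. indicator N ((a, (b, c)), (x, Y)) \<partial>lborel) \<partial>lborel) \<partial>lborel)"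
            by (intro nn_integral_cong nn_integral_lborel_pair) measurable
          also have "\<dots> = integral\<^sup>N lborel (\<lambda>a::real. 0)"
          proof (rule nn_integral_cong_AE)
            show "AE a in lborel. (\<integral>\<^sup>+b. (\<integral>\<^sup>+c. indicator N ((a, (b, c)), (x, Y)) \<partial>lborel) \<partial>lborel) = 0"
              using AE_lborel_singleton[of 0]
            proof eventually_elim
              case (elim a)
              have "(\<integral>\<^sup>+c. indicator N ((a, (b, c)), (x, Y)) \<partial>lborel) = integral\<^sup>N lborel (\<lambda>c::real. 0)" for b
              proof (rule nn_integral_cong_AE)
                define F where "F = {c. dm i Y a (sB x a b) c = 0 \<or> \<bar>rI a (sB x a b) c (cD i Y (sB x a b)) (cE i Y a c)\<bar> = 1
                   \<or> \<bar>rJ a (sB x a b) c (cD i Y (sB x a b)) (cE i Y a c)\<bar> = 2}"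
                define G where "G = (\<lambda>c. c - (3 * x * b + 6 * x^2 * a)) ` F"
                have "finite G" unfolding G_def F_def using finite_boundary_values[OF elim i] by (intro finite_imageI)
                then have "AE c in lborel. c \<notin> G" by (intro AE_not_in finite_imp_null_set_lborel)
                then show "AE c in lborel. indicator N ((a, (b, c)), (x, Y)) = (0 :: ennreal)"
                proof eventually_elim
                  case (elim c)
                  have "sC x a b c \<notin> F"
                  proof
                    assume "sC x a b c \<in> F"
                    moreover have "c = sC x a b c - (3 * x * b + 6 * x^2 * a)" by (simp add: sC_def)
                    ultimately show False using elim unfolding G_def by blast
                  qed
                  then have "((a, (b, c)), (x, Y)) \<notin> N"
                    using \<open>x \<noteq> 0\<close> \<open>x \<noteq> 1/2\<close> \<open>Y \<noteq> T\<close> \<open>Y \<noteq> 1 - x^2\<close>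
                    unfolding N_def F_def dom_open_def dom_closed_def fund_def fund_le_def reduced_def reduced_le_def
                    by auto
                  then show ?case by simp
                qed
              qed
              then show ?case by simp
            qed
          qed
          finally show ?case by simp
        qed
      qed
      then show ?case by simp
    qed
  qed
  finally show ?thesis by (simp add: N_def)
qed

text \<open>The difference of the images lies in the image of the difference, and a differentiable
  map between spaces of equal dimension sends null sets to null sets.\<close>

lemma null_region_boundary:
  assumes i: "i \<in> {0, 1, 2}"
  shows "emeasure lborel (region_le i T - region i T) = 0"
proof -
  have "dom_closed i T - dom_open i T \<in> null_sets lborel"
    using null_boundary[OF i] open_dom_open closed_dom_closed by (simp add: null_sets_def borel_open borel_closed sets.Diff)
  then have "negligible (dom_closed i T - dom_open i T)"
    unfolding negligible_iff_null_sets by (rule null_sets_completionI)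
  then have "negligible (par i ` (dom_closed i T - dom_open i T))"
    by (rule negligible_differentiable_image_negligible[OF order_refl _ differentiable_par])
  moreover have "region_le i T - region i T \<subseteq> par i ` (dom_closed i T - dom_open i T)"
    unfolding region_le_def region_def by blast
  ultimately have "negligible (region_le i T - region i T)" by (rule negligible_subset)
  then have "emeasure lebesgue (region_le i T - region i T) = 0"
    unfolding negligible_iff_null_sets by auto
  moreover have "region_le i T - region i T \<in> sets borel"
    using open_region compact_region_le by (intro sets.Diff) (auto simp: borel_compact)
  ultimately show ?thesis by simp
qed

section \<open>Forms as points of the grid of mesh 1/t\<close>

primrec coords :: "bqf \<Rightarrow> params" where
  "coords (BQF a b c d e) = ((of_int a, of_int b, of_int c), (of_int d, of_int e))"

lemma inj_coords: "inj coords"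
proof (rule injI)
  fix f g assume "coords f = coords g"
  then show "f = g" by (cases f; cases g) simp
qed

lemma One_inner_Basis: "b \<in> Basis \<Longrightarrow> (One :: 'a::euclidean_space) \<bullet> b = 1"
  by (simp add: inner_sum_left inner_Basis sum.delta)

lemma grid_eq_coords:
  assumes t: "t > 0"
  shows "grid 0 ((1 / t) *\<^sub>R One) = range (\<lambda>f. (1 / t) *\<^sub>R coords f)"
proof -
  have "p \<in> grid 0 ((1 / t) *\<^sub>R One) \<longleftrightarrow> (\<exists>f. p = (1 / t) *\<^sub>R coords f)" for p
  proof -
    obtain a b c d e where p: "p = ((a, b, c), (d, e))" by (metis prod.exhaust)
    have "p \<in> grid 0 ((1 / t) *\<^sub>R One) \<longleftrightarrow> (\<forall>v\<in>Basis. (p \<bullet> v) * t \<in> \<int>)"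
      unfolding grid_def using t by (simp add: One_inner_Basis)
    also have "\<dots> \<longleftrightarrow> a * t \<in> \<int> \<and> b * t \<in> \<int> \<and> c * t \<in> \<int> \<and> d * t \<in> \<int> \<and> e * t \<in> \<int>"
      unfolding p by (simp add: Basis_prod_def ball_Un inner_prod_def) blast
    also have "\<dots> \<longleftrightarrow> (\<exists>f. p = (1 / t) *\<^sub>R coords f)"
    proof
      assume "a * t \<in> \<int> \<and> b * t \<in> \<int> \<and> c * t \<in> \<int> \<and> d * t \<in> \<int> \<and> e * t \<in> \<int>"
      then obtain a' b' c' d' e' where "a * t = of_int a'" "b * t = of_int b'" "c * t = of_int c'" "d * t = of_int d'" "e * t = of_int e'"
        by (auto elim!: Ints_cases)
      then have "p = (1 / t) *\<^sub>R coords (BQF a' b' c' d' e')" using t unfolding p by (simp add: field_simps)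
      then show "\<exists>f. p = (1 / t) *\<^sub>R coords f" by blast
    next
      assume "\<exists>f. p = (1 / t) *\<^sub>R coords f"
      then obtain f where f: "p = (1 / t) *\<^sub>R coords f" by blast
      show "a * t \<in> \<int> \<and> b * t \<in> \<int> \<and> c * t \<in> \<int> \<and> d * t \<in> \<int> \<and> e * t \<in> \<int>"
        using f t unfolding p by (cases f) simp
    qed
    finally show ?thesis .
  qed
  then show ?thesis by blast
qed

definition real_total_weight :: "nat \<Rightarrow> real" where
  "real_total_weight i = (if i = 0 then 2 * pi / 135 else if i = 1 then 16 * pi / 135 else 4 * pi / 135)"

lemma total_weight_eq_real: "i \<in> {0, 1, 2} \<Longrightarrow> total_weight i = ennreal (real_total_weight i)"
  using total_weight_0 total_weight_1 total_weight_2 by (auto simp: real_total_weight_def)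

lemma measure_region:
  assumes i: "i \<in> {0, 1, 2}" and T: "T \<ge> 1"
  shows "measure lborel (region i T) = (pi / 3 - 1 / sqrt T) * real_total_weight i"
proof -
  have k: "real_total_weight i \<ge> 0" by (simp add: real_total_weight_def)
  have "1 / sqrt T \<le> 1" using T by simp
  then have "pi / 3 - 1 / sqrt T \<ge> 0" using pi_gt3 by linarith
  then show ?thesis
    unfolding measure_def emeasure_region[OF assms] total_weight_eq_real[OF i] using k
    by (simp add: ennreal_mult'[symmetric])
qed

text \<open>\<open>S\<close> may be any set between the open and the compact region, so the same
  limit serves the lower and the upper bound for the number of classes.\<close>

theorem region_count:
  assumes i: "i \<in> {0, 1, 2}" and T: "T \<ge> 1" and S: "region i T \<subseteq> S" "S \<subseteq> region_le i T"
  shows "((\<lambda>t. real (card {f. (1 / t) *\<^sub>R coords f \<in> S}) / t^5) \<longlongrightarrow> (pi / 3 - 1 / sqrt T) * real_total_weight i) at_top"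
proof -
  \<comment> \<open>The counting theorem wants a positive mesh for every t; \<open>max 1 t\<close>
    agrees with t for large t.\<close>
  define m :: "real \<Rightarrow> params" where "m t = (1 / max 1 t) *\<^sub>R One" for t
  have "((\<lambda>t. real (card (S \<inter> grid 0 (m t))) * (\<Prod>b\<in>Basis. m t \<bullet> b)) \<longlongrightarrow> measure lborel (region i T)) at_top"
  proof (rule grid_count_tendsto[OF open_region S(1) compact_region_le S(2) null_region_boundary[OF i]])
    show "m t \<bullet> b > 0" if "b \<in> Basis" for t b using that by (simp add: m_def One_inner_Basis)
    have "((\<lambda>t::real. 1 / max 1 t) \<longlongrightarrow> 0) at_top"
    proof -
      have "\<forall>\<^sub>F t in at_top. inverse t = 1 / max 1 (t :: real)"
        using eventually_ge_at_top[of "1::real"] by eventually_elim (simp add: inverse_eq_divide max_def)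
      then show ?thesis by (rule Lim_transform_eventually[OF tendsto_inverse_0_at_top[OF filterlim_ident]])
    qed
    from tendsto_scaleR[OF this tendsto_const[of One]] show "(m \<longlongrightarrow> 0) at_top" by (simp add: m_def[abs_def])
  qed
  moreover have "\<forall>\<^sub>F t in at_top. real (card (S \<inter> grid 0 (m t))) * (\<Prod>b\<in>Basis. m t \<bullet> b)
      = real (card {f. (1 / t) *\<^sub>R coords f \<in> S}) / t^5"
    using eventually_ge_at_top[of "1::real"]
  proof eventually_elim
    case (elim t)
    have m: "m t = (1 / t) *\<^sub>R One" using elim by (simp add: m_def max_def)
    have t: "t > 0" using elim by simp
    have "(\<Prod>b\<in>Basis. m t \<bullet> b) = (1 / t) ^ card (Basis :: params set)"
      unfolding m by (simp add: One_inner_Basis)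
    also have "card (Basis :: params set) = 5" by simp
    finally have pr: "(\<Prod>b\<in>Basis. m t \<bullet> b) = 1 / t^5" by (simp add: power_divide)
    have "S \<inter> grid 0 (m t) = (\<lambda>f. (1 / t) *\<^sub>R coords f) ` {f. (1 / t) *\<^sub>R coords f \<in> S}"
      unfolding m grid_eq_coords[OF t] by auto
    moreover have "inj_on (\<lambda>f. (1 / t) *\<^sub>R coords f) A" for A
      using t inj_coords by (auto simp: inj_on_def)
    ultimately have "card (S \<inter> grid 0 (m t)) = card {f. (1 / t) *\<^sub>R coords f \<in> S}" by (simp add: card_image)
    then show ?case unfolding pr by simp
  qed
  ultimately have "((\<lambda>t. real (card {f. (1 / t) *\<^sub>R coords f \<in> S}) / t^5) \<longlongrightarrow> measure lborel (region i T)) at_top"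
    by (rule Lim_transform_eventually)
  then show ?thesis unfolding measure_region[OF i T] .
qed

section \<open>Forms in the cusp\<close>

text \<open>In the cusp the two last coefficients of a form with covariant point \<open>(x, Y)\<close> are determined by
  the first three and by the integer part \<open>k\<close> of \<open>sqrt Y\<close>, up to errors of size \<open>t\<close> and \<open>t k\<close>.\<close>

definition d_center :: "nat \<Rightarrow> nat \<Rightarrow> real \<Rightarrow> real" where
  "d_center i k b = (if i = 1 then real k^2 * b else - (real k^2 * b))"

definition e_center :: "nat \<Rightarrow> nat \<Rightarrow> real \<Rightarrow> real \<Rightarrow> real" where
  "e_center i k a c = (if i = 1 then real k^2 * c - real k^4 * a else real k^4 * a)"

lemma cusp_coefficient_bounds:
  fixes a b c x Y t :: real and k :: nat
  assumes x: "0 \<le> x" "x \<le> 1/2" and k: "k \<ge> 1" "real k^2 \<le> Y" "Y \<le> (real k + 1)^2" and t: "t > 0"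
    and bd: "\<bar>a\<bar> * Y \<le> 2 * t" "\<bar>sB x a b\<bar> * sqrt Y \<le> 2 * t" "\<bar>sC x a b c\<bar> \<le> 2 * t"
  shows "\<bar>a\<bar> \<le> 2 * t / real k^2" "\<bar>b\<bar> \<le> 6 * t / real k" "\<bar>c\<bar> \<le> 14 * t"
    "\<bar>pD i x Y a b c - d_center i k b\<bar> \<le> 42 * t" "\<bar>pE i x Y a b c - e_center i k a c\<bar> \<le> 122 * t * real k"
proof -
  define K where "K = real k"
  have K: "K \<ge> 1" "K > 0" using k by (auto simp: K_def)
  have Y: "Y \<ge> K^2" "Y \<le> (K + 1)^2" using k by (auto simp: K_def)
  have K2: "1 \<le> K^2" "0 < K^2" using K by (auto simp: one_le_power)
  have KK: "K \<le> K^2" using K by (simp add: power2_eq_square)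
  have Y0: "Y > 0" using Y K2 by linarith
  \<comment> \<open>Replacing sqrt Y by its integer part changes Y by at most 3 K. In d this is
    multiplied by |b| <= 6 t / K and leaves O(t); in e it is multiplied by quantities of size O(t),
    such as |c| and |a| (Y + K^2), and leaves O(t K).\<close>
  have Ysub: "\<bar>Y - K^2\<bar> \<le> 3 * K" using Y K by (simp add: power2_eq_square algebra_simps)
  have Y4: "Y \<le> 4 * K^2"
  proof -
    have "(K + 1)^2 \<le> (2 * K)^2" using K by (intro power_mono) auto
    then show ?thesis using Y by (simp add: power_mult_distrib)
  qed
  have "\<bar>a\<bar> * K^2 \<le> \<bar>a\<bar> * Y" using Y by (intro mult_left_mono) auto
  then have aK2: "\<bar>a\<bar> * K^2 \<le> 2 * t" using bd(1) by linarith
  then show "\<bar>a\<bar> \<le> 2 * t / real k^2" using K2 by (simp add: K_def field_simps)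
  have "\<bar>a\<bar> * 1 \<le> \<bar>a\<bar> * K^2" using K2 by (intro mult_left_mono) auto
  then have a: "\<bar>a\<bar> \<le> 2 * t" using aK2 by linarith
  have "\<bar>a\<bar> * K \<le> \<bar>a\<bar> * K^2" using KK by (intro mult_left_mono) auto
  then have aK: "\<bar>a\<bar> * K \<le> 2 * t" using aK2 by linarith
  have "sqrt Y \<ge> K" using Y(1) K by (simp add: real_le_rsqrt)
  then have "\<bar>sB x a b\<bar> * K \<le> \<bar>sB x a b\<bar> * sqrt Y" by (intro mult_left_mono) auto
  then have bK: "\<bar>sB x a b\<bar> * K \<le> 2 * t" using bd(2) by linarith
  have xh: "\<bar>x * y\<bar> \<le> 1/2 * \<bar>y\<bar>" for y
    using mult_right_mono[of x "1/2" "\<bar>y\<bar>"] x by (simp add: abs_mult)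
  have x2: "\<bar>x^2 * y\<bar> \<le> 1/4 * \<bar>y\<bar>" for y
    using xh[of "x * y"] xh[of y] by (simp add: power2_eq_square mult.assoc)
  have x3: "\<bar>x^3 * y\<bar> \<le> 1/8 * \<bar>y\<bar>" for y
    using xh[of "x^2 * y"] x2[of y] by (simp add: power2_eq_square power3_eq_cube mult.assoc)
  have x4: "\<bar>x^4 * y\<bar> \<le> 1/16 * \<bar>y\<bar>" for y
    using xh[of "x^3 * y"] x3[of y] by (simp add: power3_eq_cube power4_eq_xxxx mult.assoc)
  have "\<bar>b\<bar> \<le> \<bar>sB x a b\<bar> + 2 * \<bar>a\<bar>" using xh[of a] unfolding sB_def by linarith
  then have "\<bar>b\<bar> * K \<le> (\<bar>sB x a b\<bar> + 2 * \<bar>a\<bar>) * K" using K by (intro mult_right_mono) auto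
  then have bK6: "\<bar>b\<bar> * K \<le> 6 * t" using bK aK by (simp add: algebra_simps)
  then show "\<bar>b\<bar> \<le> 6 * t / real k" using K by (simp add: K_def field_simps)
  have "\<bar>b\<bar> * 1 \<le> \<bar>b\<bar> * K" using K by (intro mult_left_mono) auto
  then have b: "\<bar>b\<bar> \<le> 6 * t" using bK6 by linarith
  have "\<bar>c\<bar> \<le> \<bar>sC x a b c\<bar> + 3 * \<bar>x * b\<bar> + 6 * \<bar>x^2 * a\<bar>" unfolding sC_def by linarith
  then show c: "\<bar>c\<bar> \<le> 14 * t" using bd(3) xh[of b] x2[of a] a b by linarith
  have le: "u \<le> r * B" if "u \<le> r * v" "v \<le> B" "r \<ge> 0" for u v r B :: real
    using that mult_left_mono by (meson order_trans)
  note le = le[OF _ _ divide_nonneg_nonneg[OF zero_le_one zero_le_numeral]]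
  define s :: real where "s = (if i = 1 then 1 else - 1)"
  have s: "\<bar>s * y\<bar> = \<bar>y\<bar>" for y by (simp add: s_def)
  have Yb: "\<bar>(Y - K^2) * b\<bar> \<le> 18 * t"
  proof -
    have "\<bar>(Y - K^2) * b\<bar> \<le> 3 * K * \<bar>b\<bar>" unfolding abs_mult using Ysub by (intro mult_right_mono) auto
    then show ?thesis using bK6 by (simp add: mult.commute mult.left_commute)
  qed
  have aY: "\<bar>a * Y\<bar> \<le> 2 * t" using bd(1) Y0 by (simp add: abs_mult)
  have "pD i x Y a b c - d_center i k b = s * ((Y - K^2) * b) + 4 * (s * (x * (a * Y))) - 2 * (x * c) - 3 * (x^2 * b) - 4 * (x^3 * a)"
    unfolding pD_def d_center_def cD_def sB_def s_def K_def by (simp add: algebra_simps)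
  moreover have "\<bar>u1 + 4 * u2 - 2 * u3 - 3 * u4 - 4 * u5\<bar> \<le> 42 * t"
    if "\<bar>u1\<bar> \<le> 18 * t" "\<bar>u2\<bar> \<le> 1/2 * (2 * t)" "\<bar>u3\<bar> \<le> 1/2 * (14 * t)" "\<bar>u4\<bar> \<le> 1/4 * (6 * t)" "\<bar>u5\<bar> \<le> 1/8 * (2 * t)"
    for u1 u2 u3 u4 u5 using that t unfolding abs_le_iff by linarith
  moreover have "\<bar>s * ((Y - K^2) * b)\<bar> \<le> 18 * t" "\<bar>s * (x * (a * Y))\<bar> \<le> 1/2 * (2 * t)"
    using Yb le[OF xh[of "a * Y"] aY] by (simp_all only: s)
  ultimately show d: "\<bar>pD i x Y a b c - d_center i k b\<bar> \<le> 42 * t"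
    using le[OF xh[of c] c] le[OF x2[of b] b] le[OF x3[of a] a] by metis
  have tK: "t \<le> t * K" using t K by simp
  have dc: "\<bar>d_center i k b\<bar> \<le> 6 * t * K"
  proof -
    have "\<bar>d_center i k b\<bar> = K * (\<bar>b\<bar> * K)" by (simp add: d_center_def K_def abs_mult power2_eq_square)
    also have "\<dots> \<le> K * (6 * t)" using bK6 K by (intro mult_left_mono) auto
    finally show ?thesis by (simp add: mult.commute mult.left_commute)
  qed
  then have dd: "\<bar>pD i x Y a b c\<bar> \<le> 48 * (t * K)" using d tK by linarith
  have e1: "\<bar>Y^2 * a - K^4 * a\<bar> \<le> 12 * (t * K)"
  proof -
    have "Y^2 * a - K^4 * a = (Y - K^2) * (a * Y + a * K^2)" by (simp add: algebra_simps power2_eq_square power4_eq_xxxx)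
    moreover have "\<bar>a * Y + a * K^2\<bar> \<le> 4 * t"
    proof -
      have "\<bar>a * K^2\<bar> \<le> 2 * t" using aK2 by (simp add: abs_mult)
      then show ?thesis using aY by linarith
    qed
    then have "\<bar>(Y - K^2) * (a * Y + a * K^2)\<bar> \<le> (3 * K) * (4 * t)"
      unfolding abs_mult using Ysub K by (intro mult_mono) auto
    ultimately show ?thesis by (simp add: mult.commute mult.left_commute)
  qed
  have e2: "\<bar>Y * sC x a b c - K^2 * c\<bar> \<le> 81 * (t * K)"
  proof -
    have eq: "Y * sC x a b c - K^2 * c = (Y - K^2) * c + 3 * (x * (Y * b)) + 6 * (x^2 * (a * Y))"
      unfolding sC_def by (simp add: algebra_simps)
    have "\<bar>(Y - K^2) * c\<bar> \<le> (3 * K) * (14 * t)" unfolding abs_mult using Ysub c K by (intro mult_mono) auto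
    then have 1: "\<bar>(Y - K^2) * c\<bar> \<le> 42 * (t * K)" by (simp add: mult.commute mult.left_commute)
    have "\<bar>Y * b\<bar> \<le> (4 * K^2) * \<bar>b\<bar>" unfolding abs_mult using Y4 Y0 by (intro mult_right_mono) auto
    also have "\<dots> = 4 * K * (\<bar>b\<bar> * K)" by (simp add: power2_eq_square)
    also have "\<dots> \<le> 4 * K * (6 * t)" using bK6 K by (intro mult_left_mono) auto
    finally have 2: "\<bar>Y * b\<bar> \<le> 24 * (t * K)" by (simp add: mult.commute mult.left_commute)
    have 3: "\<bar>x * (Y * b)\<bar> \<le> 12 * (t * K)" using le[OF xh[of "Y * b"] 2] by (simp add: mult.commute)
    have 4: "\<bar>x^2 * (a * Y)\<bar> \<le> 1/2 * t" using le[OF x2[of "a * Y"] aY] by simp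
    show ?thesis unfolding eq using 1 3 4 tK unfolding abs_le_iff by linarith
  qed
  have e3: "\<bar>cE i Y a (sC x a b c) - e_center i k a c\<bar> \<le> 93 * (t * K)"
  proof (cases "i = 1")
    case True
    have "cE i Y a (sC x a b c) - e_center i k a c = (Y * sC x a b c - K^2 * c) - (Y^2 * a - K^4 * a)"
      using True by (simp add: cE_def e_center_def K_def algebra_simps power2_eq_square)
    then show ?thesis using e1 e2 by linarith
  next
    case False
    have "cE i Y a (sC x a b c) - e_center i k a c = Y^2 * a - K^4 * a"
      using False by (simp add: cE_def e_center_def K_def)
    moreover have "0 \<le> t * K" using t K by simp
    ultimately show ?thesis using e1 by linarith
  qed
  have "\<bar>pE i x Y a b c - e_center i k a c\<bar> \<le> 122 * (t * K)"
  proof -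
    have 1: "\<bar>x * pD i x Y a b c\<bar> \<le> 24 * (t * K)" using le[OF xh dd] by (simp add: mult.commute)
    have 2: "\<bar>x^2 * c\<bar> \<le> 7/2 * t" "\<bar>x^3 * b\<bar> \<le> 3/4 * t" "\<bar>x^4 * a\<bar> \<le> 1/8 * t"
      using le[OF x2[of c] c] le[OF x3[of b] b] le[OF x4[of a] a] by simp_all
    show ?thesis unfolding pE_def using e3 1 2 tK t unfolding abs_le_iff by linarith
  qed
  then show "\<bar>pE i x Y a b c - e_center i k a c\<bar> \<le> 122 * t * real k" by (simp add: K_def mult.assoc)
qed

lemma card_Sigma_le:
  assumes "finite A" "\<And>a. a \<in> A \<Longrightarrow> finite (B a)" "\<And>a. a \<in> A \<Longrightarrow> real (card (B a)) \<le> M"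
  shows "real (card (Sigma A B)) \<le> real (card A) * M"
proof -
  have "real (card (Sigma A B)) = (\<Sum>a\<in>A. real (card (B a)))" using assms by simp
  also have "\<dots> \<le> (\<Sum>a\<in>A. M)" by (intro sum_mono assms)
  finally show ?thesis by simp
qed

definition cusp_forms :: "nat \<Rightarrow> nat \<Rightarrow> real \<Rightarrow> bqf set" where
  "cusp_forms i m t = {f. \<exists>a b c d e x Y. f = BQF a b c d e \<and> a \<noteq> 0 \<and> 0 \<le> x \<and> x \<le> 1/2 \<and> real m^2 \<le> Y \<and>
     of_int d = pD i x Y (of_int a) (of_int b) (of_int c) \<and> of_int e = pE i x Y (of_int a) (of_int b) (of_int c) \<and>
     \<bar>of_int a\<bar> * Y \<le> 2 * t \<and> \<bar>sB x (of_int a) (of_int b)\<bar> * sqrt Y \<le> 2 * t \<and> \<bar>sC x (of_int a) (of_int b) (of_int c)\<bar> \<le> 2 * t}"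

text \<open>If sqrt Y has integer part k, there are about (t/k^2)(t/k) t choices for (a, b, c) and
  then t and t k choices for d and e, together t^5/k^2; summing over k >= m gives the factor 1/m.
  The numbers 6, 18, 42, 126 and 366 are three times the coefficients in the radii of the five
  intervals.\<close>

lemma card_cusp_forms:
  assumes m: "m \<ge> 1" and t: "t \<ge> 1"
  shows "finite (cusp_forms i m t)"
    "real (card (cusp_forms i m t)) \<le> 2 * (6 * 18 * 42 * 126 * 366) * t^5 / real m"
proof -
  define n where "n = nat \<lfloor>2 * t\<rfloor>"
  define Ks where "Ks = {k \<in> {m..n}. real k^2 \<le> 2 * t}"
  define A where "A k = ball_int 0 (2 * t / real k^2) \<times> ball_int 0 (6 * t / real k) \<times> ball_int 0 (14 * t)" for k
  define B where "B k = (\<lambda>(a, b, c). ball_int (d_center i k (of_int b)) (42 * t)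
     \<times> ball_int (e_center i k (of_int a) (of_int c)) (122 * t * real k))" for k
  define F :: "(int \<times> int \<times> int) \<times> int \<times> int \<Rightarrow> bqf" where "F = (\<lambda>((a, b, c), (d, e)). BQF a b c d e)"
  have sub: "cusp_forms i m t \<subseteq> (\<Union>k\<in>Ks. F ` Sigma (A k) (B k))"
  proof
    fix f assume "f \<in> cusp_forms i m t"
    then obtain a b c d e x Y where f: "f = BQF a b c d e" and a: "a \<noteq> 0" and x: "0 \<le> x" "x \<le> 1/2" and Y: "real m^2 \<le> Y"
      and d: "of_int d = pD i x Y (of_int a) (of_int b) (of_int c)" and e: "of_int e = pE i x Y (of_int a) (of_int b) (of_int c)"
      and bd: "\<bar>of_int a\<bar> * Y \<le> 2 * t" "\<bar>sB x (of_int a) (of_int b)\<bar> * sqrt Y \<le> 2 * t" "\<bar>sC x (of_int a) (of_int b) (of_int c)\<bar> \<le> 2 * t"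
      unfolding cusp_forms_def by blast
    define k where "k = nat \<lfloor>sqrt Y\<rfloor>"
    have m2: "0 < real m^2" using m by simp
    have Y0: "Y > 0" using Y m2 by linarith
    have mk: "real m \<le> sqrt Y" using Y by (simp add: real_le_rsqrt)
    then have "int m \<le> \<lfloor>sqrt Y\<rfloor>" by (simp add: le_floor_iff)
    then have k: "m \<le> k" "k \<ge> 1" using m by (auto simp: k_def le_nat_iff)
    have rk: "real k \<le> sqrt Y" "sqrt Y \<le> real k + 1"
      using mk Y0 by (auto simp: k_def of_nat_nat floor_le_iff)
    have kY: "real k^2 \<le> Y" using power_mono[OF rk(1), of 2] Y0 by simp
    have Yk: "Y \<le> (real k + 1)^2" using power_mono[OF rk(2), of 2] Y0 by simp
    \<comment> \<open>\<open>a\<close> is a nonzero integer, so Y <= 2 t. This keeps the radii of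
      the intervals for \<open>a\<close> and \<open>b\<close> at least 1, where the number of
      integers is at most three times the radius.\<close>
    have "1 * Y \<le> \<bar>of_int a\<bar> * Y" using a Y0 by (intro mult_right_mono) linarith+
    then have k2: "real k^2 \<le> 2 * t" using kY bd(1) by linarith
    have "real k * 1 \<le> real k * real k" using k by (intro mult_left_mono) auto
    then have "real k \<le> 2 * t" using k2 by (simp add: power2_eq_square)
    then have "k \<le> n" by (simp add: n_def le_nat_iff le_floor_iff)
    then have "k \<in> Ks" using k k2 by (simp add: Ks_def)
    moreover have "t > 0" using t by simp
    note cb = cusp_coefficient_bounds(1-3)[OF x k(2) kY Yk this bd]
      cusp_coefficient_bounds(4,5)[OF x k(2) kY Yk this bd, of i]
    have "((a, b, c), (d, e)) \<in> Sigma (A k) (B k)"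
      using cb unfolding A_def B_def d[symmetric] e[symmetric] by (simp add: ball_int_def)
    then have "f \<in> F ` Sigma (A k) (B k)" unfolding f F_def by (intro image_eqI[of _ _ "((a, b, c), (d, e))"]) simp_all
    ultimately show "f \<in> (\<Union>k\<in>Ks. F ` Sigma (A k) (B k))" by blast
  qed
  have finA: "finite (A k)" for k by (simp add: A_def)
  have finB: "finite (B k v)" for k v by (cases v) (simp add: B_def)
  have fin: "finite (Sigma (A k) (B k))" for k using finA finB by (intro finite_SigmaI) auto
  have finK: "finite Ks" by (simp add: Ks_def)
  show "finite (cusp_forms i m t)" using sub fin finK by (meson finite_UN_I finite_imageI finite_subset)
  have ck: "real (card (F ` Sigma (A k) (B k))) \<le> (6 * 18 * 42 * 126 * 366) * t^5 * (1 / real k^2)" if k: "k \<in> Ks" for k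
  proof -
    have k1: "k \<ge> 1" and k2: "real k^2 \<le> 2 * t" using k m by (auto simp: Ks_def)
    have kr: "real k \<ge> 1" using k1 by simp
    have kk: "real k \<le> real k^2" using kr by (simp add: power2_eq_square)
    have kp: "real k^2 > 0" using kr by simp
    have r1: "2 * t / real k^2 \<ge> 1" using k2 kp by (simp add: field_simps)
    have "real k \<le> 6 * t" using k2 kk t by linarith
    then have r2: "6 * t / real k \<ge> 1" using kr by (simp add: field_simps)
    have r3: "14 * t \<ge> 1" "42 * t \<ge> 1" using t by auto
    have "1 * 1 \<le> (122 * t) * real k" using t kr by (intro mult_mono) auto
    then have r4: "122 * t * real k \<ge> 1" by simp
    have cB: "real (card (B k v)) \<le> (3 * (42 * t)) * (3 * (122 * t * real k))" for v
    proof -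
      obtain a b c where v: "v = (a, b, c)" by (cases v)
      show ?thesis unfolding v B_def prod.case card_cartesian_product of_nat_mult
        using card_ball_int_3[OF r3(2)] card_ball_int_3[OF r4] t by (intro mult_mono) auto
    qed
    have cA: "real (card (A k)) \<le> (3 * (2 * t / real k^2)) * ((3 * (6 * t / real k)) * (3 * (14 * t)))"
      unfolding A_def card_cartesian_product of_nat_mult
      using card_ball_int_3[OF r1] card_ball_int_3[OF r2] card_ball_int_3[OF r3(1)] t kr by (intro mult_mono) auto
    have "real (card (F ` Sigma (A k) (B k))) \<le> real (card (Sigma (A k) (B k)))"
      using card_image_le[OF fin] by simp
    also have "\<dots> \<le> real (card (A k)) * ((3 * (42 * t)) * (3 * (122 * t * real k)))"
      by (rule card_Sigma_le[OF finA finB cB])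
    also have "\<dots> \<le> ((3 * (2 * t / real k^2)) * ((3 * (6 * t / real k)) * (3 * (14 * t)))) * ((3 * (42 * t)) * (3 * (122 * t * real k)))"
      using cA t kr by (intro mult_right_mono) auto
    also have "\<dots> = (6 * 18 * 42 * 126 * 366) * t^5 * (1 / real k^2)"
      using kr by (simp add: field_simps eval_nat_numeral)
    finally show ?thesis .
  qed
  have "card (cusp_forms i m t) \<le> card (\<Union>k\<in>Ks. F ` Sigma (A k) (B k))"
    using fin finK by (intro card_mono[OF _ sub]) auto
  also have "\<dots> \<le> (\<Sum>k\<in>Ks. card (F ` Sigma (A k) (B k)))" by (rule card_UN_le[OF finK])
  finally have "real (card (cusp_forms i m t)) \<le> real (\<Sum>k\<in>Ks. card (F ` Sigma (A k) (B k)))" by (simp only: of_nat_le_iff)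
  also have "\<dots> = (\<Sum>k\<in>Ks. real (card (F ` Sigma (A k) (B k))))" by (rule of_nat_sum)
  also have "\<dots> \<le> (\<Sum>k\<in>Ks. (6 * 18 * 42 * 126 * 366) * t^5 * (1 / real k^2))" by (intro sum_mono ck)
  also have "\<dots> \<le> (\<Sum>k=m..n. (6 * 18 * 42 * 126 * 366) * t^5 * (1 / real k^2))"
    using t by (intro sum_mono2) (auto simp: Ks_def)
  also have "\<dots> = (6 * 18 * 42 * 126 * 366) * t^5 * (\<Sum>k=m..n. 1 / real k^2)" by (rule sum_distrib_left[symmetric])
  also have "\<dots> \<le> (6 * 18 * 42 * 126 * 366) * t^5 * (2 / real m)"
    using sum_inverse_squares_tail[OF m, of n] t by (intro mult_left_mono) auto
  finally show "real (card (cusp_forms i m t)) \<le> 2 * (6 * 18 * 42 * 126 * 366) * t^5 / real m" by simp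
qed

section \<open>Counting equivalence classes\<close>

text \<open>The real matrix permutes the lines through the origin and carries the roots of the new
  form to those of the old one.\<close>

lemma real_roots_act:
  assumes d: "\<bar>p * s - q * r\<bar> = 1"
  shows "card (real_roots (act p q r s f)) = card (real_roots f)"
    "finite (real_roots (act p q r s f)) \<longleftrightarrow> finite (real_roots f)"
proof -
  define M :: "real \<times> real \<Rightarrow> real \<times> real" where
    "M = (\<lambda>(u, v). (of_int p * u + of_int r * v, of_int q * u + of_int s * v))"
  define D :: real where "D = of_int (p * s - q * r)"
  have "p * s - q * r \<noteq> 0" using d by auto
  then have D: "D \<noteq> 0" unfolding D_def by (simp only: of_int_eq_0_iff not_False_eq_True)
  define M' :: "real \<times> real \<Rightarrow> real \<times> real" where
    "M' = (\<lambda>(u, v). ((of_int s * u - of_int r * v) / D, (- of_int q * u + of_int p * v) / D))"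
  have Dr: "D = of_int p * of_int s - of_int q * of_int r" by (simp add: D_def)
  have MM': "M (M' w) = w" for w
  proof (cases w)
    case (Pair u v)
    have "of_int p * (of_int s * u - of_int r * v) + of_int r * (- of_int q * u + of_int p * v) = u * D"
      "of_int q * (of_int s * u - of_int r * v) + of_int s * (- of_int q * u + of_int p * v) = v * D"
      unfolding Dr by (simp_all add: algebra_simps)
    then show ?thesis
      unfolding Pair M_def M'_def prod.case times_divide_eq_right add_divide_distrib[symmetric] using D by simp
  qed
  have M'M: "M' (M w) = w" for w
  proof (cases w)
    case (Pair u v)
    have "of_int s * (of_int p * u + of_int r * v) - of_int r * (of_int q * u + of_int s * v) = u * D"
      "- of_int q * (of_int p * u + of_int r * v) + of_int p * (of_int q * u + of_int s * v) = v * D"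
      unfolding Dr by (simp_all add: algebra_simps)
    then show ?thesis unfolding Pair M_def M'_def prod.case using D by simp
  qed
  have lin: "linear M" unfolding M_def by (rule linearI) (auto simp: algebra_simps)
  have M0: "M w = (0, 0) \<longleftrightarrow> w = (0, 0)" for w
    using M'M[of w] linear_0[OF lin] by (auto simp: zero_prod_def M'_def)
  have fM: "form f (fst (M w)) (snd (M w)) = form (act p q r s f) (fst w) (snd w)" for w
    unfolding form_act by (simp add: M_def case_prod_beta)
  have rr: "real_roots g = {span {w} | w. w \<noteq> (0, 0) \<and> form g (fst w) (snd w) = 0}" for g
    unfolding real_roots_def by auto
  have sp: "M ` span {w} = span {M w}" for w
    using linear_span_image[OF lin, of "{w}"] by simp
  have im: "real_roots f = (\<lambda>S. M ` S) ` real_roots (act p q r s f)"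
  proof (intro equalityI subsetI)
    fix S assume "S \<in> real_roots f"
    then obtain w where w: "S = span {w}" "w \<noteq> (0, 0)" "form f (fst w) (snd w) = 0" unfolding rr by blast
    have "S = M ` span {M' w}" unfolding sp MM' w(1) ..
    moreover have "M' w \<noteq> (0, 0)" using M0[of "M' w"] MM' w(2) by simp
    moreover have "form (act p q r s f) (fst (M' w)) (snd (M' w)) = 0" using fM[of "M' w"] MM' w(3) by simp
    ultimately show "S \<in> (\<lambda>S. M ` S) ` real_roots (act p q r s f)" unfolding rr by blast
  next
    fix S assume "S \<in> (\<lambda>S. M ` S) ` real_roots (act p q r s f)"
    then obtain w where w: "S = M ` span {w}" "w \<noteq> (0, 0)" "form (act p q r s f) (fst w) (snd w) = 0" unfolding rr by blast
    have "form f (fst (M w)) (snd (M w)) = 0" using fM w(3) by simp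
    then show "S \<in> real_roots f" using w M0 sp unfolding rr by blast
  qed
  have "inj M" using M'M by (metis injI)
  then have inj: "inj_on (\<lambda>S. M ` S) A" for A by (meson inj_image_eq_iff inj_onI)
  show "card (real_roots (act p q r s f)) = card (real_roots f)" unfolding im by (simp add: card_image[OF inj])
  show "finite (real_roots (act p q r s f)) \<longleftrightarrow> finite (real_roots f)" unfolding im by (simp add: finite_image_iff[OF inj])
qed

lemma h_forms_act:
  assumes d: "\<bar>p * s - q * r\<bar> = 1" and f: "f \<in> h_forms i I J"
  shows "act p q r s f \<in> h_forms i I J"
proof -
  define D where "D = p * s - q * r"
  have "D^2 = 1" using d unfolding D_def by (metis power2_abs power_one)
  then have "D^(2 * 2) = 1" "D^(2 * 3) = 1" unfolding power_mult by simp_all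
  then have "(p * s - q * r)^4 = 1" "(p * s - q * r)^6 = 1" by (simp_all add: D_def)
  then show ?thesis using f irreducible_over_rat_act[OF _ d] real_roots_act[OF d]
    unfolding h_forms_def by (simp add: inv_I_act inv_J_act)
qed

lemma form_dehomogenized: "form (BQF a b c d e) (t::real) 1
  = of_int a * t^4 + of_int b * t^3 + of_int c * t^2 + of_int d * t + of_int e"
  by simp

text \<open>In contrast to \<open>is_cov\<close>, this contains the sign condition, which makes the
  point unique and fixes the number of real roots.\<close>

definition cov_point :: "nat \<Rightarrow> bqf \<Rightarrow> real \<Rightarrow> real \<Rightarrow> bool" where
  "cov_point i f x Y \<longleftrightarrow> (case f of BQF a b c d e \<Rightarrow> Y > 0 \<and> of_int d = pD i x Y (of_int a) (of_int b) (of_int c)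
     \<and> of_int e = pE i x Y (of_int a) (of_int b) (of_int c) \<and> dm i Y (of_int a) (sB x (of_int a) (of_int b)) (sC x (of_int a) (of_int b) (of_int c)) > 0)"

lemma is_cov_coords:
  assumes Y: "Y > 0"
  shows "is_cov i (BQF a b c d e) (Complex x (sqrt Y)) \<longleftrightarrow>
    of_int d = pD i x Y (of_int a) (of_int b) (of_int c) \<and> of_int e = pE i x Y (of_int a) (of_int b) (of_int c)"
  using is_cov_iff[of "sqrt Y" i a b c d e x] Y
    pD_eq_iff[of "of_int d" i x Y "of_int a" "of_int b" "of_int c"]
    pE_eq_iff[of "of_int d" i x Y "of_int a" "of_int b" "of_int c" "of_int e"] by auto

lemma cov_point_is_cov: "cov_point i f x Y \<Longrightarrow> is_cov i f (Complex x (sqrt Y))"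
  unfolding cov_point_def by (cases f) (simp add: is_cov_coords)

text \<open>The second point need only satisfy \<open>is_cov\<close>, so the lemma applies to a
  point transported by a matrix.\<close>

lemma cov_point_unique:
  assumes g: "cov_point i f x Y" and c: "is_cov i f (Complex x' (sqrt Y'))" "Y' > 0"
  shows "x' = x \<and> Y' = Y"
proof (cases f)
  case (BQF a b c d e)
  note g' = g[unfolded cov_point_def BQF, simplified] and c' = c(1)[unfolded BQF is_cov_coords[OF c(2)]]
  have "x = x' \<and> Y = Y'"
  proof (rule covariant_point_unique[of Y Y' x "of_int a" "of_int b" "of_int c" "of_int d" i "of_int e" x'])
    show "sD x (of_int a) (of_int b) (of_int c) (of_int d) = cD i Y (sB x (of_int a) (of_int b))"
      "sD x' (of_int a) (of_int b) (of_int c) (of_int d) = cD i Y' (sB x' (of_int a) (of_int b))"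
      using g' c' pD_eq_iff by blast+
    show "sE x (of_int a) (of_int b) (of_int c) (of_int d) (of_int e) = cE i Y (of_int a) (sC x (of_int a) (of_int b) (of_int c))"
      "sE x' (of_int a) (of_int b) (of_int c) (of_int d) (of_int e) = cE i Y' (of_int a) (sC x' (of_int a) (of_int b) (of_int c))"
      using g' c' pE_eq_iff by blast+
  qed (use g' c in auto)
  then show ?thesis by simp
qed

lemma cov_point_exists:
  assumes i: "i \<in> {0, 1, 2}" and f: "f \<in> h_forms i I J"
  shows "\<exists>x Y. cov_point i f x Y"
proof (cases f)
  case (BQF a b c d e)
  have irr: "irreducible_over_rat (BQF a b c d e)" and fin: "finite (real_roots (BQF a b c d e))"
    and card: "card (real_roots (BQF a b c d e)) = 4 - 2 * i"
    using f unfolding h_forms_def BQF by auto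
  have a: "a \<noteq> 0" by (rule irreducible_coeff_nonzero[OF irr])
  have "\<exists>x Y. Y > 0 \<and> sD x (of_int a) (of_int b) (of_int c) (of_int d) = cD i Y (sB x (of_int a) (of_int b))
    \<and> sE x (of_int a) (of_int b) (of_int c) (of_int d) (of_int e) = cE i Y (of_int a) (sC x (of_int a) (of_int b) (of_int c))
    \<and> dm i Y (of_int a) (sB x (of_int a) (of_int b)) (sC x (of_int a) (of_int b) (of_int c)) > 0"
    by (rule covariant_exists[OF _ i])
      (use a fin card irreducible_no_double_root[OF irr] in \<open>simp_all only: card_real_roots[OF a] form_dehomogenized of_int_eq_0_iff not_False_eq_True\<close>)
  then show ?thesis unfolding cov_point_def BQF using pD_eq_iff pE_eq_iff by (simp only: bqf.case) blast
qed

text \<open>The sign condition determines the number of real roots, so an irreducible lattice point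
  of the region is automatically a form of type \<open>i\<close>.\<close>

lemma real_roots_of_cov_point:
  assumes i: "i \<in> {0, 1, 2}" and g: "cov_point i f x Y" and irr: "irreducible_over_rat f"
  shows "f \<in> h_forms i (inv_I f) (inv_J f)"
proof (cases f)
  case (BQF a b c d e)
  have a: "a \<noteq> 0" using irreducible_coeff_nonzero irr BQF by blast
  note g' = g[unfolded cov_point_def BQF, simplified]
  have "finite {t. of_int a * t^4 + of_int b * t^3 + of_int c * t^2 + of_int d * t + of_int e = (0::real)}
     \<and> card {t. of_int a * t^4 + of_int b * t^3 + of_int c * t^2 + of_int d * t + of_int e = (0::real)} = 4 - 2 * i"
  proof (rule card_roots_of_covariant[OF _ _ i, of Y "of_int a" x])
    show "sD x (of_int a) (of_int b) (of_int c) (of_int d) = cD i Y (sB x (of_int a) (of_int b))"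
      using g' pD_eq_iff by blast
    show "sE x (of_int a) (of_int b) (of_int c) (of_int d) (of_int e) = cE i Y (of_int a) (sC x (of_int a) (of_int b) (of_int c))"
      using g' pE_eq_iff by blast
  qed (use g' a in auto)
  then show ?thesis using irr unfolding h_forms_def BQF mem_Collect_eq card_real_roots[OF a] form_dehomogenized by blast
qed

lemma upper_moeb_upper:
  assumes "\<bar>p * s - q * r\<bar> = 1" "Im z > 0"
  shows "Im (upper (moeb p q r s z)) > 0"
proof -
  have "\<bar>Im (moeb p q r s z)\<bar> > 0"
    using Im_moeb[OF assms(1)] moeb_denom_nonzero[OF assms(1)] assms(2) by simp
  then show ?thesis by (auto simp: upper_def)
qed

lemma reduced_representative:
  assumes i: "i \<in> {0, 1, 2}" and f: "f \<in> h_forms i I J"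
  shows "\<exists>g x Y. (f, g) \<in> GL2Z_rel \<and> g \<in> h_forms i I J \<and> cov_point i g x Y \<and> 0 \<le> x \<and> x \<le> 1/2 \<and> 1 \<le> x^2 + Y"
proof -
  obtain x Y where xY: "cov_point i f x Y" using cov_point_exists[OF assms] by blast
  have Y: "Y > 0" using xY unfolding cov_point_def by (cases f) simp
  define z where "z = Complex x (sqrt Y)"
  have z: "Im z > 0" using Y by (simp add: z_def)
  obtain p q r s where d: "\<bar>p * s - q * r\<bar> = 1" and F: "0 \<le> Re (upper (moeb p q r s z))"
    "Re (upper (moeb p q r s z)) \<le> 1/2" "1 \<le> norm (upper (moeb p q r s z))"
    using fundamental_domain_exists[OF z] by blast
  define w where "w = upper (moeb p q r s z)"
  define g where "g = act p q r s f"
  have g: "g \<in> h_forms i I J" unfolding g_def by (rule h_forms_act[OF d f])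
  have rel: "(f, g) \<in> GL2Z_rel" unfolding GL2Z_rel_iff_act g_def using d by blast
  have w: "Im w > 0" unfolding w_def by (rule upper_moeb_upper[OF d z])
  have "is_cov i g w"
    unfolding g_def w_def is_cov_upper using is_cov_act[OF d] z cov_point_is_cov[OF xY] unfolding z_def by simp
  moreover have we: "w = Complex (Re w) (sqrt ((Im w)^2))" using w by (simp add: complex_eq_iff)
  ultimately have cov: "is_cov i g (Complex (Re w) (sqrt ((Im w)^2)))" by metis
  \<comment> \<open>The moved point is only known to satisfy \<open>is_cov\<close>. The form
    \<open>g\<close> has a covariant point by its own roots, and uniqueness identifies the
    two.\<close>
  obtain x' Y' where gp: "cov_point i g x' Y'" using cov_point_exists[OF i g] by blast
  have "Re w = x' \<and> (Im w)^2 = Y'" using cov_point_unique[OF gp cov] w by simp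
  then have "cov_point i g (Re w) ((Im w)^2)" using gp by simp
  moreover have "1 \<le> (Re w)^2 + (Im w)^2"
  proof -
    have "1 \<le> norm w" using F by (simp add: w_def)
    then have "1^2 \<le> norm w^2" by (intro power_mono) auto
    then show ?thesis by (simp add: cmod_power2)
  qed
  ultimately show ?thesis using g rel F unfolding w_def by blast
qed

lemma strictly_reduced_unique:
  assumes f: "cov_point i f x Y" "0 < x" "x < 1/2" "1 < x^2 + Y"
    and g: "cov_point i g x' Y'" "0 < x'" "x' < 1/2" "1 < x'^2 + Y'"
    and rel: "(f, g) \<in> GL2Z_rel"
  shows "f = g"
proof -
  obtain p q r s where d: "\<bar>p * s - q * r\<bar> = 1" and ge: "g = act p q r s f"
    using rel unfolding GL2Z_rel_iff_act by blast
  have Y: "Y > 0" "Y' > 0" using f(1) g(1) unfolding cov_point_def by (cases f, simp, cases g, simp)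
  define z where "z = Complex x (sqrt Y)"
  define w where "w = upper (moeb p q r s z)"
  have z: "Im z > 0" using Y by (simp add: z_def)
  have w0: "Im w > 0" unfolding w_def by (rule upper_moeb_upper[OF d z])
  have "is_cov i g w"
    unfolding ge w_def is_cov_upper using is_cov_act[OF d] z cov_point_is_cov[OF f(1)] unfolding z_def by simp
  moreover have we: "w = Complex (Re w) (sqrt ((Im w)^2))" using w0 by (simp add: complex_eq_iff)
  ultimately have cov: "is_cov i g (Complex (Re w) (sqrt ((Im w)^2)))" by metis
  have w: "Re w = x' \<and> (Im w)^2 = Y'" using cov_point_unique[OF g(1) cov] w0 by simp
  \<comment> \<open>Uniqueness makes the matrix carry one covariant point to the other. Both are
    interior to the domain, so only the identity and its negative remain, and these act trivially
    because the degree is even.\<close>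
  have "q = 0 \<and> r = 0 \<and> p = s"
  proof (rule fundamental_domain_unique[OF d _ _ _ z _ _ _ w0 w_def])
    have *: "1 < norm v" if "1 < (Re v)^2 + (Im v)^2" for v
      using that power_less_imp_less_base[of 1 2 "norm v"] unfolding cmod_power2[symmetric] by simp
    show "1 < norm z" by (rule *) (use f Y in \<open>simp add: z_def\<close>)
    show "1 < norm w" by (rule *) (use g w in simp)
  qed (use f g w in \<open>auto simp: z_def\<close>)
  then have qr: "q = 0" "r = 0" "s = p" by auto
  then have "\<bar>p\<bar> * \<bar>p\<bar> = 1" using d by (simp add: abs_mult)
  then have "p^2 = 1" by (simp add: power2_eq_square)
  then have "p^4 = 1" using power_mult[of p 2 2] by simp
  then have "act p q r s f = f" unfolding qr
    using \<open>p^2 = 1\<close> by (cases f) (simp add: power4_eq_xxxx power3_eq_cube power2_eq_square mult.assoc)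
  then show ?thesis using ge by simp
qed

section \<open>Scaling coefficients by 1/t and heights by 1/t^6\<close>

lemma scaled_forms:
  assumes t: "t > 0"
  shows "sB x (a / t) (b / t) = sB x a b / t" "sC x (a / t) (b / t) (c / t) = sC x a b c / t"
    "pD i x Y (a / t) (b / t) (c / t) = pD i x Y a b c / t"
    "pE i x Y (a / t) (b / t) (c / t) = pE i x Y a b c / t"
    "dm i Y (a / t) (b / t) (c / t) = dm i Y a b c / t^2"
    "rI (a / t) (b / t) (c / t) (d / t) (e / t) = rI a b c d e / t^2"
    "rJ (a / t) (b / t) (c / t) (d / t) (e / t) = rJ a b c d e / t^3"
    "cD i Y (b / t) = cD i Y b / t" "cE i Y (a / t) (c / t) = cE i Y a c / t"
proof -
  show 1: "sB x (a / t) (b / t) = sB x a b / t" for a b using t by (simp add: sB_def field_simps)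
  show 2: "sC x (a / t) (b / t) (c / t) = sC x a b c / t" for a b c using t by (simp add: sC_def field_simps)
  show 3: "cD i Y (b / t) = cD i Y b / t" for b using t by (simp add: cD_def)
  show 4: "cE i Y (a / t) (c / t) = cE i Y a c / t" for a c using t by (simp add: cE_def field_simps)
  show 5: "pD i x Y (a / t) (b / t) (c / t) = pD i x Y a b c / t"
    unfolding pD_def 1 3 using t by (simp add: field_simps)
  show "pE i x Y (a / t) (b / t) (c / t) = pE i x Y a b c / t"
    unfolding pE_def 2 4 5 using t by (simp add: field_simps)
  show "dm i Y (a / t) (b / t) (c / t) = dm i Y a b c / t^2"
    using t by (simp add: dm_def field_simps power2_eq_square)
  show "rI (a / t) (b / t) (c / t) (d / t) (e / t) = rI a b c d e / t^2"
    using t by (simp add: rI_def field_simps power2_eq_square)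
  show "rJ (a / t) (b / t) (c / t) (d / t) (e / t) = rJ a b c d e / t^3"
    using t by (simp add: rJ_def field_simps power2_eq_square power3_eq_cube)
qed

lemma invariants_real:
  "of_int (inv_I (BQF a b c d e)) = rI (of_int a) (of_int b) (of_int c) (of_int d) (of_int e)"
  "of_int (inv_J (BQF a b c d e)) = rJ (of_int a) (of_int b) (of_int c) (of_int d) (of_int e)"
  by (simp_all add: rI_def rJ_def)

lemma height_less_iff:
  assumes t: "t > 0"
  shows "height I J < t^6 \<longleftrightarrow> \<bar>of_int I / t^2\<bar> < 1 \<and> \<bar>of_int J / t^3\<bar> < (2::real)"
proof -
  have pw: "u ^ n < v ^ n \<longleftrightarrow> u < v" if "u \<ge> 0" "v \<ge> 0" "n > 0" for u v :: real and n
    unfolding linorder_not_le[symmetric] using power_mono_iff[of v u n] that by blast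
  have "\<bar>real_of_int I\<bar>^3 < t^6 \<longleftrightarrow> \<bar>real_of_int I\<bar>^3 < (t^2)^3" by (simp add: power_mult[symmetric])
  also have "\<dots> \<longleftrightarrow> \<bar>real_of_int I\<bar> < t^2" using t by (intro pw) auto
  also have "\<dots> \<longleftrightarrow> \<bar>of_int I / t^2\<bar> < 1" using t by (simp add: abs_divide)
  finally have 1: "\<bar>real_of_int I\<bar>^3 < t^6 \<longleftrightarrow> \<bar>of_int I / t^2\<bar> < 1" .
  have "real_of_int J^2 / 4 < t^6 \<longleftrightarrow> \<bar>real_of_int J\<bar>^2 < (2 * t^3)^2" by (simp add: power_mult_distrib power_mult[symmetric] mult.commute)
  also have "\<dots> \<longleftrightarrow> \<bar>real_of_int J\<bar> < 2 * t^3" using t by (intro pw) auto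
  also have "\<dots> \<longleftrightarrow> \<bar>of_int J / t^3\<bar> < (2::real)" using t by (simp add: abs_divide field_simps)
  finally show ?thesis using 1 unfolding height_def by auto
qed

lemma cov_point_invariants:
  assumes g: "cov_point i (BQF a b c d e) x Y" and t: "t > 0"
  defines "B \<equiv> sB x (of_int a / t) (of_int b / t)" and "C \<equiv> sC x (of_int a / t) (of_int b / t) (of_int c / t)"
  shows "rI (of_int a / t) B C (cD i Y B) (cE i Y (of_int a / t) C) = of_int (inv_I (BQF a b c d e)) / t^2"
    "rJ (of_int a / t) B C (cD i Y B) (cE i Y (of_int a / t) C) = of_int (inv_J (BQF a b c d e)) / t^3"
    "dm i Y (of_int a / t) B C > 0"
proof -
  let ?a = "real_of_int a" and ?b = "real_of_int b" and ?c = "real_of_int c" and ?d = "real_of_int d" and ?e = "real_of_int e"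
  note g' = g[unfolded cov_point_def, simplified]
  have D: "cD i Y (sB x ?a ?b) = sD x ?a ?b ?c ?d" and E: "cE i Y ?a (sC x ?a ?b ?c) = sE x ?a ?b ?c ?d ?e"
    using g' pD_eq_iff pE_eq_iff by metis+
  show "rI (of_int a / t) B C (cD i Y B) (cE i Y (of_int a / t) C) = of_int (inv_I (BQF a b c d e)) / t^2"
    unfolding B_def C_def scaled_forms[OF t] D E rI_shift invariants_real ..
  show "rJ (of_int a / t) B C (cD i Y B) (cE i Y (of_int a / t) C) = of_int (inv_J (BQF a b c d e)) / t^3"
    unfolding B_def C_def scaled_forms[OF t] D E rJ_shift invariants_real ..
  show "dm i Y (of_int a / t) B C > 0" unfolding B_def C_def scaled_forms[OF t] using g' t by simp
qed

lemma coords_scaled: "(1 / t) *\<^sub>R coords (BQF a b c d e)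
  = ((of_int a / t, of_int b / t, of_int c / t), (of_int d / t, of_int e / t))"
  by simp

lemma par_scaled:
  assumes t: "t > 0"
  shows "par i ((of_int a / t, of_int b / t, of_int c / t), (x, Y)) = (1 / t) *\<^sub>R coords (BQF a b c d e)
    \<longleftrightarrow> of_int d = pD i x Y (of_int a) (of_int b) (of_int c) \<and> of_int e = pE i x Y (of_int a) (of_int b) (of_int c)"
  unfolding coords_scaled par_def prod.case scaled_forms[OF t] using t by auto

lemma region_form_cov_point:
  assumes t: "t > 0" and f: "(1 / t) *\<^sub>R coords f \<in> region i T"
  shows "\<exists>x Y. cov_point i f x Y \<and> 0 < x \<and> x < 1/2 \<and> 1 < x^2 + Y \<and> height (inv_I f) (inv_J f) < t^6"
proof -
  obtain a b c d e where fe: "f = BQF a b c d e" by (cases f)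
  obtain w where w: "w \<in> dom_open i T" "(1 / t) *\<^sub>R coords f = par i w" using f unfolding region_def by blast
  obtain a' b' c' x Y where we: "w = ((a', b', c'), (x, Y))" by (metis prod.exhaust)
  have abc: "a' = of_int a / t" "b' = of_int b / t" "c' = of_int c / t"
    using w(2) unfolding we fe coords_scaled par_def by auto
  have F: "0 < x" "x < 1/2" "1 < x^2 + Y" and red: "reduced i Y a' (sB x a' b') (sC x a' b' c')"
    using w(1) unfolding we dom_open_def fund_def by auto
  have Y: "Y > 0" using fund_le_pos[of x Y] F by simp
  have de: "of_int d = pD i x Y (of_int a) (of_int b) (of_int c) \<and> of_int e = pE i x Y (of_int a) (of_int b) (of_int c)"
    using w(2) unfolding we abc fe using par_scaled[OF t, of i a b c x Y d e] by metis
  have "dm i Y a' (sB x a' b') (sC x a' b' c') > 0" using red by (simp add: reduced_def)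
  then have "dm i Y (of_int a) (sB x (of_int a) (of_int b)) (sC x (of_int a) (of_int b) (of_int c)) > 0"
    unfolding abc scaled_forms[OF t] using t by (simp add: zero_less_divide_iff)
  then have gp: "cov_point i f x Y" using de Y by (simp add: cov_point_def fe)
  have "height (inv_I f) (inv_J f) < t^6"
    unfolding height_less_iff[OF t] fe cov_point_invariants(1,2)[OF gp[unfolded fe] t, symmetric]
    using red unfolding abc reduced_def by blast
  then show ?thesis using gp F by blast
qed

text \<open>Height below t^6 makes the rescaled translated coefficients \<open>reduced\<close>; the
  cut at Y = m^2 then decides between the compact region and the cusp.\<close>

lemma cov_point_region_or_cusp:
  assumes t: "t > 0" and g: "cov_point i g x Y" and F: "0 \<le> x" "x \<le> 1/2" "1 \<le> x^2 + Y"
    and irr: "irreducible_over_rat g" and h: "height (inv_I g) (inv_J g) < t^6"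
  shows "(1 / t) *\<^sub>R coords g \<in> region_le i (real m^2) \<or> g \<in> cusp_forms i m t"
proof -
  obtain a b c d e where ge: "g = BQF a b c d e" by (cases g)
  define a' b' c' where "a' = of_int a / t" and "b' = of_int b / t" and "c' = of_int c / t"
  have a: "a \<noteq> 0" using irreducible_coeff_nonzero irr ge by blast
  note gi = cov_point_invariants[OF g[unfolded ge] t, folded a'_def b'_def c'_def]
  have red: "reduced i Y a' (sB x a' b') (sC x a' b' c')"
    unfolding reduced_def gi(1,2) using gi(3) h height_less_iff[OF t] ge by simp
  note g' = g[unfolded cov_point_def ge, simplified]
  show ?thesis
  proof (cases "Y \<le> real m^2")
    case True
    have "((a', b', c'), (x, Y)) \<in> dom_closed i (real m^2)"
      using True F red by (auto simp: dom_closed_def fund_le_def reduced_def reduced_le_def)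
    moreover have "par i ((a', b', c'), (x, Y)) = (1 / t) *\<^sub>R coords g"
      unfolding a'_def b'_def c'_def ge par_scaled[OF t] using g' by blast
    ultimately show ?thesis unfolding region_le_def by (metis image_eqI)
  next
    case False
    have "\<bar>a'\<bar> * Y \<le> 2" "\<bar>sB x a' b'\<bar> * sqrt Y \<le> 2" "\<bar>sC x a' b' c'\<bar> \<le> 2"
      using reduced_coeff_bounds[of Y a' "sB x a' b'" "sC x a' b' c'" i] red g' by (auto simp: reduced_def)
    then have "\<bar>of_int a\<bar> * Y \<le> 2 * t" "\<bar>sB x (of_int a) (of_int b)\<bar> * sqrt Y \<le> 2 * t" "\<bar>sC x (of_int a) (of_int b) (of_int c)\<bar> \<le> 2 * t"
      unfolding a'_def b'_def c'_def scaled_forms[OF t] using t by (simp_all add: abs_divide field_simps)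
    then have "g \<in> cusp_forms i m t"
      unfolding cusp_forms_def ge mem_Collect_eq using a F False g'
      by - (rule exI[of _ a], rule exI[of _ b], rule exI[of _ c], rule exI[of _ d], rule exI[of _ e],
          rule exI[of _ x], rule exI[of _ Y], simp)
    then show ?thesis ..
  qed
qed

section \<open>Equivalence classes of bounded height\<close>

definition classes :: "nat \<Rightarrow> real \<Rightarrow> bqf set set" where
  "classes i X = (\<Union>(I, J)\<in>{(I, J). height I J < X}. h_forms i I J // GL2Z_rel)"

text \<open>The invariants are constant on classes, so the quotients for different pairs (I, J) are
  disjoint.\<close>

lemma sum_h_eq_card_classes:
  assumes fin: "finite (classes i X)"
  shows "(\<Sum>(I, J)\<in>{(I, J). height I J < X}. h i I J) = card (classes i X)"
proof -
  let ?H = "{(I, J). height I J < X}"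
  have disj: "h_forms i I J // GL2Z_rel \<inter> h_forms i I' J' // GL2Z_rel = {}" if "(I, J) \<noteq> (I', J')" for I J I' J'
  proof (rule ccontr)
    assume "\<not> ?thesis"
    then obtain f f' where f: "f \<in> h_forms i I J" and f': "f' \<in> h_forms i I' J'" and eq: "GL2Z_rel `` {f} = GL2Z_rel `` {f'}"
      unfolding quotient_def by blast
    then have "(f', f) \<in> GL2Z_rel" using eq_equiv_class[OF eq[symmetric] equiv_GL2Z_rel] by simp
    then obtain p q r s where "\<bar>p * s - q * r\<bar> = 1" "f = act p q r s f'" unfolding GL2Z_rel_iff_act by blast
    then have "f \<in> h_forms i I' J'" using h_forms_act f' by blast
    then show False using f that unfolding h_forms_def by auto
  qed
  have "card (classes i X) = (\<Sum>p\<in>?H. card (case p of (I, J) \<Rightarrow> h_forms i I J // GL2Z_rel))"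
    unfolding classes_def
  proof (rule card_UN_disjoint[OF finite_height_less])
    show "\<forall>p\<in>?H. finite (case p of (I, J) \<Rightarrow> h_forms i I J // GL2Z_rel)"
    proof
      fix p assume "p \<in> ?H"
      then have "(case p of (I, J) \<Rightarrow> h_forms i I J // GL2Z_rel) \<subseteq> classes i X" unfolding classes_def by blast
      then show "finite (case p of (I, J) \<Rightarrow> h_forms i I J // GL2Z_rel)" using fin finite_subset by blast
    qed
    show "\<forall>p\<in>?H. \<forall>p'\<in>?H. p \<noteq> p' \<longrightarrow> (case p of (I, J) \<Rightarrow> h_forms i I J // GL2Z_rel) \<inter> (case p' of (I, J) \<Rightarrow> h_forms i I J // GL2Z_rel) = {}"
      using disj by (auto split: prod.splits)
  qed
  then show ?thesis by (simp add: h_def case_prod_beta)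
qed

lemma finite_region_le_forms:
  assumes t: "t > 0"
  shows "finite {f. (1 / t) *\<^sub>R coords f \<in> region_le i T}"
proof -
  have "finite (region_le i T \<inter> grid 0 ((1 / t) *\<^sub>R One))"
    by (rule finite_grid_bounded) (use t compact_imp_bounded[OF compact_region_le] in \<open>simp_all add: One_inner_Basis\<close>)
  then have "finite ((\<lambda>f. (1 / t) *\<^sub>R coords f) ` {f. (1 / t) *\<^sub>R coords f \<in> region_le i T})"
    by (rule finite_subset[rotated]) (auto simp: grid_eq_coords[OF t])
  moreover have "inj_on (\<lambda>f. (1 / t) *\<^sub>R coords f) A" for A using t inj_coords by (auto simp: inj_on_def)
  ultimately show ?thesis by (rule finite_imageD)
qed

text \<open>Every class has a representative with covariant point in the closed domain, so these
  forms map onto the classes, possibly with repetitions on the boundary.\<close>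

lemma classes_upper:
  assumes i: "i \<in> {0, 1, 2}" and t: "t \<ge> 1" and m: "m \<ge> 1"
  shows "finite (classes i (t^6))"
    "card (classes i (t^6)) \<le> card {f. (1 / t) *\<^sub>R coords f \<in> region_le i (real m^2)} + card (cusp_forms i m t)"
proof -
  have t0: "t > 0" using t by simp
  let ?R = "{f. (1 / t) *\<^sub>R coords f \<in> region_le i (real m^2)}"
  have sub: "classes i (t^6) \<subseteq> (\<lambda>f. GL2Z_rel `` {f}) ` (?R \<union> cusp_forms i m t)"
  proof
    fix C assume "C \<in> classes i (t^6)"
    then obtain I J f where h: "height I J < t^6" and f: "f \<in> h_forms i I J" and C: "C = GL2Z_rel `` {f}"
      unfolding classes_def quotient_def by blast
    obtain g x Y where rel: "(f, g) \<in> GL2Z_rel" and g: "g \<in> h_forms i I J" and gp: "cov_point i g x Y" "0 \<le> x" "x \<le> 1/2" "1 \<le> x^2 + Y"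
      using reduced_representative[OF i f] by blast
    have "irreducible_over_rat g" "height (inv_I g) (inv_J g) < t^6" using g h unfolding h_forms_def by auto
    then have "g \<in> ?R \<union> cusp_forms i m t" using cov_point_region_or_cusp[OF t0 gp] by blast
    moreover have "C = GL2Z_rel `` {g}" unfolding C using equiv_class_eq[OF equiv_GL2Z_rel rel] .
    ultimately show "C \<in> (\<lambda>f. GL2Z_rel `` {f}) ` (?R \<union> cusp_forms i m t)" by blast
  qed
  have fin: "finite (?R \<union> cusp_forms i m t)"
    using finite_region_le_forms[OF t0] card_cusp_forms(1)[OF m t] by blast
  show "finite (classes i (t^6))" using sub fin finite_subset by blast
  have "card (classes i (t^6)) \<le> card ((\<lambda>f. GL2Z_rel `` {f}) ` (?R \<union> cusp_forms i m t))" using sub fin by (intro card_mono) auto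
  also have "\<dots> \<le> card (?R \<union> cusp_forms i m t)" by (rule card_image_le[OF fin])
  also have "\<dots> \<le> card ?R + card (cusp_forms i m t)" by (rule card_Un_le)
  finally show "card (classes i (t^6)) \<le> card ?R + card (cusp_forms i m t)" .
qed

lemma norm_fst_le': "norm (fst w) \<le> norm w" and norm_snd_le': "norm (snd w) \<le> norm w"
  using norm_fst_le[of "fst w" "snd w"] norm_snd_le[of "snd w" "fst w"] by simp_all

text \<open>The region is bounded, so all coefficients are O(t). Reducible forms with nonzero
  \<open>a\<close> are covered by \<open>card_reducible_le\<close>, and forms with a = 0 have only
  four free coefficients; both numbers are of lower order than t^5.\<close>

lemma card_reducible_region:
  "\<exists>C. \<forall>t\<ge>1. real (card {f. (1 / t) *\<^sub>R coords f \<in> region i T \<and> \<not> irreducible_over_rat f}) \<le> C * t^4"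
proof -
  obtain R where R: "\<And>v. v \<in> region_le i T \<Longrightarrow> norm v \<le> R"
    using compact_imp_bounded[OF compact_region_le] unfolding bounded_iff by blast
  define N where "N = max 1 R"
  define C where "C = ((18 * 15^4 + 27 * 15^3 * 5) + 3^4) * N^4"
  have "real (card {f. (1 / t) *\<^sub>R coords f \<in> region i T \<and> \<not> irreducible_over_rat f}) \<le> C * t^4" if t: "t \<ge> 1" for t
  proof -
    have t0: "t > 0" using t by simp
    have Nt: "N * t \<ge> 1"
    proof -
      have "1 * 1 \<le> N * t" using t by (intro mult_mono) (auto simp: N_def)
      then show ?thesis by simp
    qed
    define A where "A = {f. coeffs_le (N * t) f \<and> (\<exists>a b c d e. f = BQF a b c d e \<and> a \<noteq> 0) \<and> splits TYPE(rat) f}"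
    let ?B = "ball_int 0 (N * t)"
    define Z where "Z = (\<lambda>(b, c, d, e). BQF 0 b c d e) ` (?B \<times> ?B \<times> ?B \<times> ?B)"
    have sub: "{f. (1 / t) *\<^sub>R coords f \<in> region i T \<and> \<not> irreducible_over_rat f} \<subseteq> A \<union> Z"
    proof clarify
      fix f assume f: "(1 / t) *\<^sub>R coords f \<in> region i T" "\<not> irreducible_over_rat f" "f \<notin> Z"
      obtain a b c d e where fe: "f = BQF a b c d e" by (cases f)
      define v where "v = (1 / t) *\<^sub>R coords f"
      have v: "v = ((of_int a / t, of_int b / t, of_int c / t), (of_int d / t, of_int e / t))" unfolding v_def fe coords_scaled ..
      have nv: "norm v \<le> N" using R[of v] f(1) region_subset unfolding v_def N_def by fastforce
      have q: "\<bar>of_int n\<bar> \<le> N * t" if "\<bar>of_int n / t\<bar> \<le> norm v" for n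
      proof -
        have "\<bar>of_int n / t\<bar> \<le> N" using that nv by linarith
        then show ?thesis using t0 by (simp add: abs_divide field_simps)
      qed
      have n1: "norm (fst v) \<le> norm v" "norm (snd v) \<le> norm v" by (rule norm_fst_le' norm_snd_le')+
      have n2: "norm (fst (fst v)) \<le> norm (fst v)" "norm (snd (fst v)) \<le> norm (fst v)" by (rule norm_fst_le' norm_snd_le')+
      have n3: "norm (fst (snd (fst v))) \<le> norm (snd (fst v))" "norm (snd (snd (fst v))) \<le> norm (snd (fst v))" by (rule norm_fst_le' norm_snd_le')+
      have n4: "norm (fst (snd v)) \<le> norm (snd v)" "norm (snd (snd v)) \<le> norm (snd v)" by (rule norm_fst_le' norm_snd_le')+
      have le: "norm (fst (fst v)) \<le> norm v" "norm (fst (snd (fst v))) \<le> norm v" "norm (snd (snd (fst v))) \<le> norm v"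
        "norm (fst (snd v)) \<le> norm v" "norm (snd (snd v)) \<le> norm v"
        using n1 n2 n3 n4 by linarith+
      have cb: "\<bar>real_of_int a\<bar> \<le> N * t" "\<bar>real_of_int b\<bar> \<le> N * t" "\<bar>real_of_int c\<bar> \<le> N * t" "\<bar>real_of_int d\<bar> \<le> N * t" "\<bar>real_of_int e\<bar> \<le> N * t"
        by (rule q, use le in \<open>simp add: v\<close>)+
      have "a \<noteq> 0"
      proof
        assume "a = 0"
        then have "f = (\<lambda>(b, c, d, e). BQF 0 b c d e) (b, c, d, e)" by (simp add: fe)
        moreover have "(b, c, d, e) \<in> ?B \<times> ?B \<times> ?B \<times> ?B" using cb by (simp add: ball_int_def)
        ultimately show False using f(3) unfolding Z_def by blast
      qed
      then show "f \<in> A" using cb f(2) unfolding A_def fe coeffs_le_def irreducible_over_rat_iff by auto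
    qed
    have finZ: "finite Z" by (simp add: Z_def)
    have cZ: "real (card Z) \<le> (3 * (N * t))^4"
    proof -
      have "card Z \<le> card (?B \<times> ?B \<times> ?B \<times> ?B)" unfolding Z_def by (rule card_image_le) simp
      also have "\<dots> = card ?B ^ 4" by (simp add: card_cartesian_product power4_eq_xxxx)
      finally have "real (card Z) \<le> real (card ?B) ^ 4" by (metis of_nat_le_iff of_nat_power)
      also have "\<dots> \<le> (3 * (N * t))^4" by (intro power_mono card_ball_int_3[OF Nt]) simp
      finally show ?thesis .
    qed
    note cA = card_reducible_le[OF Nt, folded A_def]
    have "card {f. (1 / t) *\<^sub>R coords f \<in> region i T \<and> \<not> irreducible_over_rat f} \<le> card (A \<union> Z)"
      using cA(1) finZ by (intro card_mono[OF _ sub]) simp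
    also have "\<dots> \<le> card A + card Z" by (rule card_Un_le)
    finally have "real (card {f. (1 / t) *\<^sub>R coords f \<in> region i T \<and> \<not> irreducible_over_rat f}) \<le> real (card A + card Z)" by (simp only: of_nat_le_iff)
    also have "\<dots> \<le> (18 * 15^4 + 27 * 15^3 * 5) * (N * t)^4 + (3 * (N * t))^4" using cA(2) cZ by simp
    also have "\<dots> = C * t^4" by (simp add: C_def power_mult_distrib algebra_simps)
    finally show ?thesis .
  qed
  then show ?thesis by blast
qed

text \<open>Irreducible forms in the open region have their covariant points inside the domain, so
  distinct ones lie in distinct classes.\<close>

lemma classes_lower:
  assumes i: "i \<in> {0, 1, 2}" and t: "t \<ge> 1"
  shows "card {f. (1 / t) *\<^sub>R coords f \<in> region i T}
    \<le> card (classes i (t^6)) + card {f. (1 / t) *\<^sub>R coords f \<in> region i T \<and> \<not> irreducible_over_rat f}"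
proof -
  have t0: "t > 0" using t by simp
  let ?G = "{f. (1 / t) *\<^sub>R coords f \<in> region i T \<and> irreducible_over_rat f}"
  let ?N = "{f. (1 / t) *\<^sub>R coords f \<in> region i T \<and> \<not> irreducible_over_rat f}"
  have inj: "inj_on (\<lambda>f. GL2Z_rel `` {f}) ?G"
  proof (rule inj_onI)
    fix f g assume f: "f \<in> ?G" and g: "g \<in> ?G" and eq: "GL2Z_rel `` {f} = GL2Z_rel `` {g}"
    have rel: "(f, g) \<in> GL2Z_rel" using eq_equiv_class[OF eq equiv_GL2Z_rel] by simp
    obtain x Y where "cov_point i f x Y" "0 < x" "x < 1/2" "1 < x^2 + Y" using region_form_cov_point[OF t0] f by blast
    moreover obtain x' Y' where "cov_point i g x' Y'" "0 < x'" "x' < 1/2" "1 < x'^2 + Y'" using region_form_cov_point[OF t0] g by blast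
    ultimately show "f = g" using strictly_reduced_unique rel by blast
  qed
  have im: "(\<lambda>f. GL2Z_rel `` {f}) ` ?G \<subseteq> classes i (t^6)"
  proof clarify
    fix f assume f: "(1 / t) *\<^sub>R coords f \<in> region i T" "irreducible_over_rat f"
    obtain x Y where gp: "cov_point i f x Y" and h: "height (inv_I f) (inv_J f) < t^6" using region_form_cov_point[OF t0 f(1)] by blast
    have "f \<in> h_forms i (inv_I f) (inv_J f)" by (rule real_roots_of_cov_point[OF i gp f(2)])
    then have "GL2Z_rel `` {f} \<in> h_forms i (inv_I f) (inv_J f) // GL2Z_rel" by (rule quotientI)
    then show "GL2Z_rel `` {f} \<in> classes i (t^6)" unfolding classes_def using h by blast
  qed
  have "card ?G = card ((\<lambda>f. GL2Z_rel `` {f}) ` ?G)" by (rule card_image[OF inj, symmetric])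
  also have "\<dots> \<le> card (classes i (t^6))" by (rule card_mono[OF classes_upper(1)[OF i t, of 1] im]) simp
  finally have "card ?G \<le> card (classes i (t^6))" .
  moreover have eq: "{f. (1 / t) *\<^sub>R coords f \<in> region i T} = ?G \<union> ?N" by blast
  have "card {f. (1 / t) *\<^sub>R coords f \<in> region i T} \<le> card ?G + card ?N" by (subst eq) (rule card_Un_le)
  ultimately show ?thesis by linarith
qed

theorem card_classes_tendsto:
  assumes i: "i \<in> {0, 1, 2}"
  shows "((\<lambda>t. real (card (classes i (t^6))) / t^5) \<longlongrightarrow> pi / 3 * real_total_weight i) at_top"
proof (rule tendstoI)
  fix \<epsilon> :: real assume e: "\<epsilon> > 0"
  define Q where "Q = 2 * (6 * 18 * 42 * 126 * 366 :: real)"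
  have k: "real_total_weight i > 0" by (simp add: real_total_weight_def)
  \<comment> \<open>In units of t^5, \<open>Q / m\<close> bounds the number of forms in the cusp and
    \<open>real_total_weight i / m\<close> is the volume lost by cutting at T = m^2; both become at
    most \<epsilon>/3.\<close>
  obtain m :: nat where m: "m > 0" "inverse (real m) < \<epsilon> / (3 * (Q + real_total_weight i))"
    using reals_Archimedean2[of "(3 * (Q + real_total_weight i)) / \<epsilon>"] e k
    by (metis (no_types, lifting) Q_def add_pos_pos divide_pos_pos ex_inverse_of_nat_less mult_pos_pos zero_less_numeral)
  have m1: "m \<ge> 1" using m by simp
  have Qk: "Q + real_total_weight i > 0" using k by (simp add: Q_def)
  have small: "(Q + real_total_weight i) / real m < \<epsilon> / 3"
    using m(2) Qk e m(1) by (simp add: field_simps)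
  define T where "T = real m^2"
  have T: "T \<ge> 1" "sqrt T = real m" using m1 by (simp_all add: T_def)
  define V where "V = (pi / 3 - 1 / real m) * real_total_weight i"
  have lim1: "((\<lambda>t. real (card {f. (1 / t) *\<^sub>R coords f \<in> region i T}) / t^5) \<longlongrightarrow> V) at_top"
    using region_count[OF i T(1) order_refl region_subset] unfolding V_def T(2) .
  have lim2: "((\<lambda>t. real (card {f. (1 / t) *\<^sub>R coords f \<in> region_le i T}) / t^5) \<longlongrightarrow> V) at_top"
    using region_count[OF i T(1) region_subset order_refl] unfolding V_def T(2) .
  obtain C where C: "\<And>t. t \<ge> 1 \<Longrightarrow> real (card {f. (1 / t) *\<^sub>R coords f \<in> region i T \<and> \<not> irreducible_over_rat f}) \<le> C * t^4"
    using card_reducible_region by blast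
  have lim3: "((\<lambda>t. C / t) \<longlongrightarrow> 0) at_top" by (intro tendsto_divide_0[OF tendsto_const] filterlim_at_top_imp_at_infinity filterlim_ident)
  have Vle: "V \<le> pi / 3 * real_total_weight i" "pi / 3 * real_total_weight i = V + real_total_weight i / real m" using k by (simp_all add: V_def algebra_simps)
  have e3: "\<epsilon> / 3 > 0" using e by simp
  have sp: "real_total_weight i / real m \<le> \<epsilon> / 3" "Q / real m \<le> \<epsilon> / 3"
  proof -
    have "real_total_weight i / real m \<le> (Q + real_total_weight i) / real m" "Q / real m \<le> (Q + real_total_weight i) / real m"
      using k m1 by (auto intro!: divide_right_mono simp: Q_def)
    then show "real_total_weight i / real m \<le> \<epsilon> / 3" "Q / real m \<le> \<epsilon> / 3" using small by linarith+
  qed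
  show "\<forall>\<^sub>F t in at_top. dist (real (card (classes i (t^6))) / t^5) (pi / 3 * real_total_weight i) < \<epsilon>"
    using tendstoD[OF lim1 e3] tendstoD[OF lim2 e3] tendstoD[OF lim3 e3] eventually_ge_at_top[of "1::real"]
  proof eventually_elim
    case (elim t)
    have t5: "t^5 > 0" using elim(4) by simp
    have up: "real (card (classes i (t^6))) / t^5 \<le> real (card {f. (1 / t) *\<^sub>R coords f \<in> region_le i T}) / t^5 + Q / real m"
    proof -
      have "real (card (classes i (t^6))) \<le> real (card {f. (1 / t) *\<^sub>R coords f \<in> region_le i T} + card (cusp_forms i m t))"
        using classes_upper(2)[OF i elim(4) m1] unfolding T_def[symmetric] by (simp only: of_nat_le_iff)
      also have "\<dots> \<le> real (card {f. (1 / t) *\<^sub>R coords f \<in> region_le i T}) + Q * t^5 / real m"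
        using card_cusp_forms(2)[OF m1 elim(4), of i] unfolding Q_def by simp
      finally have "real (card (classes i (t^6))) / t^5
         \<le> (real (card {f. (1 / t) *\<^sub>R coords f \<in> region_le i T}) + Q * t^5 / real m) / t^5"
        using t5 by (intro divide_right_mono) auto
      then show ?thesis using t5 by (simp add: add_divide_distrib)
    qed
    have lo: "real (card {f. (1 / t) *\<^sub>R coords f \<in> region i T}) / t^5 \<le> real (card (classes i (t^6))) / t^5 + C / t"
    proof -
      have "real (card {f. (1 / t) *\<^sub>R coords f \<in> region i T})
        \<le> real (card (classes i (t^6)) + card {f. (1 / t) *\<^sub>R coords f \<in> region i T \<and> \<not> irreducible_over_rat f})"
        using classes_lower[OF i elim(4), of T] by (simp only: of_nat_le_iff)
      also have "\<dots> \<le> real (card (classes i (t^6))) + C * t^4" using C[OF elim(4)] by simp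
      finally have "real (card {f. (1 / t) *\<^sub>R coords f \<in> region i T}) / t^5 \<le> (real (card (classes i (t^6))) + C * t^4) / t^5"
        using t5 by (intro divide_right_mono) auto
      also have "\<dots> = real (card (classes i (t^6))) / t^5 + C / t"
      proof -
        have "C * t^4 / t^5 = C / t" using elim(4) by (simp add: eval_nat_numeral)
        then show ?thesis by (simp only: add_divide_distrib)
      qed
      finally show ?thesis .
    qed
    show ?case using elim(1-3) up lo Vle sp unfolding dist_real_def abs_less_iff by linarith
  qed
qed

section \<open>Eligible invariants\<close>

text \<open>Nine of the 9 * 27 = 243 residue classes, which is the density 1/27.\<close>

definition eligible_residues :: "(int \<times> int) set" where
  "eligible_residues = {(0, 0), (3, 0), (6, 0), (1, 2), (1, 25), (4, 11), (4, 16), (7, 7), (7, 20)}"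

lemma eligible_residues_iff:
  assumes "0 \<le> r" "r < 9" "0 \<le> s" "s < 27"
  shows "(r, s) \<in> eligible_residues \<longleftrightarrow>
    (r mod 3 = 0 \<and> s = 0) \<or> (r mod 3 = 1 \<and> (s = (1 - 3 * r) mod 27 \<or> s = (3 * r - 1) mod 27))"
proof -
  have "r \<in> {0, 1, 2, 3, 4, 5, 6, 7, 8}" using assms by auto
  then show ?thesis unfolding eligible_residues_def by (elim insertE emptyE) auto
qed

text \<open>The residue of \<open>c\<close> modulo 3 decides. If it is 0, then 3 divides I and 27
  divides J; if it is 1, then J = 1 - 3 I modulo 27; residue 2 gives the negative of this
  value.\<close>

lemma eligible_iff_residues: "eligible I J \<longleftrightarrow> (I mod 9, J mod 27) \<in> eligible_residues"
proof -
  have I3: "I mod 9 mod 3 = I mod 3" by (simp add: mod_mod_cancel)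
  have J1: "(1 - 3 * (I mod 9)) mod 27 = (1 - 3 * I) mod 27" "(3 * (I mod 9) - 1) mod 27 = (3 * I - 1) mod 27"
  proof -
    define q where "q = I div 9"
    have "I mod 9 = I - 9 * q" by (simp add: q_def minus_mult_div_eq_mod)
    then have "1 - 3 * (I mod 9) = (1 - 3 * I) + 27 * q" "3 * (I mod 9) - 1 = (3 * I - 1) + 27 * (- q)" by simp_all
    then show "(1 - 3 * (I mod 9)) mod 27 = (1 - 3 * I) mod 27" "(3 * (I mod 9) - 1) mod 27 = (3 * I - 1) mod 27"
      by (simp_all only: mod_mult_self2)
  qed
  have res: "(I mod 9, J mod 27) \<in> eligible_residues \<longleftrightarrow>
    (I mod 3 = 0 \<and> J mod 27 = 0) \<or> (I mod 3 = 1 \<and> (J mod 27 = (1 - 3 * I) mod 27 \<or> J mod 27 = (3 * I - 1) mod 27))"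
    by (subst eligible_residues_iff) (simp_all add: I3 J1)
  have "eligible I J \<longleftrightarrow> (I mod 3 = 0 \<and> J mod 27 = 0) \<or> (I mod 3 = 1 \<and> (J mod 27 = (1 - 3 * I) mod 27 \<or> J mod 27 = (3 * I - 1) mod 27))"
  proof
    assume "eligible I J"
    then obtain f where f: "inv_I f = I" "inv_J f = J" unfolding eligible_def by blast
    obtain a b c d e where fe: "f = BQF a b c d e" by (cases f)
    have I: "I = 12 * a * e - 3 * b * d + c^2" and J: "J = 72 * a * c * e + 9 * b * c * d - 27 * a * d^2 - 27 * e * b^2 - 2 * c^3"
      using f unfolding fe by auto
    define k where "k = c div 3"
    have "c = 3 * k \<or> c = 3 * k + 1 \<or> c = 3 * k + 2" unfolding k_def by presburger
    then consider "c = 3 * k" | "c = 3 * k + 1" | "c = 3 * k + 2" by blast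
    then show "(I mod 3 = 0 \<and> J mod 27 = 0) \<or> (I mod 3 = 1 \<and> (J mod 27 = (1 - 3 * I) mod 27 \<or> J mod 27 = (3 * I - 1) mod 27))"
    proof cases
      case 1
      have "I = 3 * (4 * a * e - b * d + 3 * k^2)" unfolding I 1 by algebra
      moreover have "J = 27 * (8 * a * k * e + b * k * d - a * d^2 - e * b^2 - 2 * k^3)" unfolding J 1 by algebra
      ultimately show ?thesis by simp
    next
      case 2
      have I': "I = 3 * (4 * a * e - b * d + 3 * k^2 + 2 * k) + 1" unfolding I 2 by algebra
      define n where "n = 4 * a * e - b * d + 3 * k^2 + 2 * k"
      have "J = (1 - 3 * I) + 27 * (4 * a * e * c - a * d^2 - e * b^2 + k^3 + k^2 - k * n)"
        unfolding J I' 2 n_def by algebra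
      then have "J mod 27 = (1 - 3 * I) mod 27" by (simp only: mod_mult_self2)
      moreover have "I mod 3 = 1" using I' by presburger
      ultimately show ?thesis by blast
    next
      case 3
      define l where "l = k + 1"
      have c: "c = 3 * l - 1" using 3 by (simp add: l_def)
      have I': "I = 3 * (4 * a * e - b * d + 3 * l^2 - 2 * l) + 1" unfolding I c by algebra
      define n where "n = 4 * a * e - b * d + 3 * l^2 - 2 * l"
      have "J = (3 * I - 1) + 27 * (4 * a * e * c - a * d^2 - e * b^2 + l^3 - l^2 - l * n)"
        unfolding J I' c n_def by algebra
      then have "J mod 27 = (3 * I - 1) mod 27" by (simp only: mod_mult_self2)
      moreover have "I mod 3 = 1" using I' by presburger
      ultimately show ?thesis by blast
    qed
  next
    assume "(I mod 3 = 0 \<and> J mod 27 = 0) \<or> (I mod 3 = 1 \<and> (J mod 27 = (1 - 3 * I) mod 27 \<or> J mod 27 = (3 * I - 1) mod 27))"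
    then consider "I mod 3 = 0" "J mod 27 = 0" | "I mod 3 = 1" "J mod 27 = (1 - 3 * I) mod 27" | "I mod 3 = 1" "J mod 27 = (3 * I - 1) mod 27"
      by blast
    then show "eligible I J"
    proof cases
      case 1
      then obtain m n where "I = 3 * m" "J = 27 * n" by (metis mod_0_imp_dvd dvdE)
      \<comment> \<open>For a = 0 and b = 1 the invariants are I = c^2 - 3 d and J = 9 c d - 27 e -
        2 c^3. With c in {0, 1, -1} and free \<open>d\<close> and \<open>e\<close>, they reach all
        admissible pairs.\<close>
      then have "inv_I (BQF 0 1 0 (- m) (- n)) = I" "inv_J (BQF 0 1 0 (- m) (- n)) = J" by simp_all
      then show ?thesis unfolding eligible_def by blast
    next
      case 2
      obtain m where m: "I = 3 * m + 1" using 2(1) by (metis mult_div_mod_eq)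
      have "27 dvd J - (1 - 3 * I)" using 2(2) by (simp add: mod_eq_dvd_iff)
      then obtain n where n: "J = 1 - 3 * I + 27 * n" by (metis dvdE diff_add_cancel add.commute)
      have "inv_I (BQF 0 1 1 (- m) (- n)) = I" "inv_J (BQF 0 1 1 (- m) (- n)) = J" using m n by simp_all
      then show ?thesis unfolding eligible_def by blast
    next
      case 3
      obtain m where m: "I = 3 * m + 1" using 3(1) by (metis mult_div_mod_eq)
      have "27 dvd J - (3 * I - 1)" using 3(2) by (simp add: mod_eq_dvd_iff)
      then obtain n where n: "J = 3 * I - 1 + 27 * n" by (metis dvdE diff_add_cancel add.commute)
      have "inv_I (BQF 0 1 (- 1) (- m) (- n)) = I" "inv_J (BQF 0 1 (- 1) (- m) (- n)) = J" using m n by simp_all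
      then show ?thesis unfolding eligible_def by blast
    qed
  qed
  then show ?thesis by (rule trans[OF _ res[symmetric]])
qed

section \<open>The region of rescaled invariants and its area\<close>

definition inv_region :: "nat \<Rightarrow> (real \<times> real) set" where
  "inv_region i = {(u, v). (-1)^i * (4 * u^3 - v^2) > 0 \<and> \<bar>u\<bar> < 1 \<and> \<bar>v\<bar> < 2}"

definition inv_region_le :: "nat \<Rightarrow> (real \<times> real) set" where
  "inv_region_le i = {(u, v). (-1)^i * (4 * u^3 - v^2) \<ge> 0 \<and> \<bar>u\<bar> \<le> 1 \<and> \<bar>v\<bar> \<le> 2}"

lemma open_inv_region: "open (inv_region i)"
proof -
  have "inv_region i = {z. 0 < (-1)^i * (4 * fst z^3 - snd z^2)} \<inter> {z. \<bar>fst z\<bar> < 1} \<inter> {z. \<bar>snd z\<bar> < 2}"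
    by (auto simp: inv_region_def)
  moreover have "open \<dots>" by (intro open_Int open_Collect_less continuous_intros)
  ultimately show ?thesis by simp
qed

lemma compact_inv_region_le: "compact (inv_region_le i)"
proof -
  have "inv_region_le i = {z. 0 \<le> (-1)^i * (4 * fst z^3 - snd z^2)} \<inter> {z. \<bar>fst z\<bar> \<le> 1} \<inter> {z. \<bar>snd z\<bar> \<le> 2}"
    by (auto simp: inv_region_le_def)
  moreover have "closed \<dots>" by (intro closed_Int closed_Collect_le continuous_intros)
  ultimately have "closed (inv_region_le i)" by simp
  moreover have "inv_region_le i \<subseteq> cbox (-1, -2) (1, 2)" by (auto simp: inv_region_le_def cbox_Pair_eq abs_le_iff)
  then have "bounded (inv_region_le i)" by (rule bounded_subset[OF bounded_cbox])
  ultimately show ?thesis using compact_eq_bounded_closed by blast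
qed

text \<open>Apart from the lines |u| = 1, each u allows at most the four boundary values 2, -2 and
  the two square roots of 4 u^3.\<close>

lemma null_inv_region_boundary: "emeasure lborel (inv_region_le i - inv_region i) = 0"
proof -
  define N where "N = inv_region_le i - inv_region i"
  have N [measurable]: "N \<in> sets borel"
    unfolding N_def using open_inv_region compact_inv_region_le by (intro sets.Diff) (auto simp: borel_compact)
  have "emeasure lborel N = (\<integral>\<^sup>+w. indicator N w \<partial>lborel)" by simp
  also have "\<dots> = (\<integral>\<^sup>+u. (\<integral>\<^sup>+v. indicator N (u, v) \<partial>lborel) \<partial>lborel)"
    by (rule nn_integral_lborel_pair) measurable
  also have "\<dots> = integral\<^sup>N lborel (\<lambda>u::real. 0)"
  proof (rule nn_integral_cong_AE)
    show "AE u in lborel. (\<integral>\<^sup>+v. indicator N (u, v) \<partial>lborel) = 0"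
      using AE_lborel_singleton[of 1] AE_lborel_singleton[of "-1"]
    proof eventually_elim
      case (elim u)
      have "(\<integral>\<^sup>+v. indicator N (u, v) \<partial>lborel) = integral\<^sup>N lborel (\<lambda>v::real. 0)"
      proof (rule nn_integral_cong_AE)
        show "AE v in lborel. indicator N (u, v) = (0 :: ennreal)"
          using AE_lborel_singleton[of 2] AE_lborel_singleton[of "-2"]
            AE_lborel_singleton[of "sqrt (4 * u^3)"] AE_lborel_singleton[of "- sqrt (4 * u^3)"]
        proof eventually_elim
          case (elim v)
          have "4 * u^3 \<noteq> v^2"
          proof
            assume "4 * u^3 = v^2"
            then have "sqrt (4 * u^3) = \<bar>v\<bar>" by simp
            then show False using elim(3,4) by (auto simp: abs_if split: if_splits)
          qed
          moreover have "\<bar>u\<bar> \<noteq> 1" "\<bar>v\<bar> \<noteq> 2" using \<open>u \<noteq> 1\<close> \<open>u \<noteq> - 1\<close> elim(1,2) by linarith+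
          moreover have "0 < s" if "0 \<le> s" "s = (-1)^i * (4 * u^3 - v^2)" "4 * u^3 \<noteq> v^2" for s :: real
          proof -
            have "s \<noteq> 0" unfolding that(2) using that(3) by simp
            then show ?thesis using that(1) by linarith
          qed
          ultimately have "(u, v) \<notin> N" unfolding N_def inv_region_def inv_region_le_def by auto
          then show ?case by simp
        qed
      qed
      then show ?case by simp
    qed
  qed
  finally show ?thesis by (simp add: N_def)
qed

lemma power_powr_integral:
  "(\<integral>\<^sup>+u. ennreal (4 * u powr (3/2)) * indicator {0<..<1} u \<partial>lborel) = ennreal (8/5)"
  "(\<integral>\<^sup>+u. ennreal (4 - 4 * u powr (3/2)) * indicator {0<..<1} u \<partial>lborel) = ennreal (12/5)"
proof -
  have c: "continuous_on {0..1} (\<lambda>u::real. u powr (5/2))" by (intro continuous_on_powr' continuous_intros) auto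
  have d: "((\<lambda>u. u powr (5/2)) has_real_derivative 5/2 * u powr (3/2)) (at u)" if "0 < u" for u :: real
    using that by (auto intro!: derivative_eq_intros)
  have "(\<integral>\<^sup>+u. ennreal (4 * u powr (3/2)) * indicator {0<..<1} u \<partial>lborel) = ennreal (8/5 * 1 powr (5/2) - 8/5 * 0 powr (5/2))"
  proof (rule nn_integral_FTC_interior)
    show "continuous_on {0..1} (\<lambda>u::real. 8/5 * u powr (5/2))" by (intro continuous_on_mult c continuous_on_const)
    show "((\<lambda>u. 8/5 * u powr (5/2)) has_real_derivative 4 * u powr (3/2)) (at u)" if "0 < u" for u :: real
      using DERIV_cmult[OF d[OF that], of "8/5"] by simp
  qed simp_all
  then show "(\<integral>\<^sup>+u. ennreal (4 * u powr (3/2)) * indicator {0<..<1} u \<partial>lborel) = ennreal (8/5)" by simp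
  have "(\<integral>\<^sup>+u. ennreal (4 - 4 * u powr (3/2)) * indicator {0<..<1} u \<partial>lborel)
     = ennreal ((4 * 1 - 8/5 * 1 powr (5/2)) - (4 * 0 - 8/5 * 0 powr (5/2)))"
  proof (rule nn_integral_FTC_interior)
    show "continuous_on {0..1} (\<lambda>u::real. 4 * u - 8/5 * u powr (5/2))" by (intro continuous_intros c)
    show "((\<lambda>u. 4 * u - 8/5 * u powr (5/2)) has_real_derivative 4 - 4 * u powr (3/2)) (at u)" if "0 < u" for u :: real
      using DERIV_diff[OF DERIV_cmult_Id[of 4 u] DERIV_cmult[OF d[OF that], of "8/5"]] by simp
    show "0 \<le> 4 - 4 * u powr (3/2)" if "0 < u" "u < 1" for u :: real
      using powr_le_one_le[of u "3/2"] powr_mono2[of "3/2" u 1] that by simp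
  qed simp
  then show "(\<integral>\<^sup>+u. ennreal (4 - 4 * u powr (3/2)) * indicator {0<..<1} u \<partial>lborel) = ennreal (12/5)" by simp
qed

text \<open>The set v^2 < 4 u^3 with 0 < u < 1 has area 8/5; its boundary curve reaches |v| = 2 only
  at u = 1, so the bound on v cuts nothing off. For odd \<open>i\<close> the rest of the rectangle
  of area 8 is left, up to a null set.\<close>

lemma measure_inv_region:
  "measure lborel (inv_region i) = (if even i then 8 / 5 else 32 / 5)"
proof -
  have [measurable]: "inv_region i \<in> sets borel" using open_inv_region by simp
  define w :: "real \<Rightarrow> real" where "w u = 2 * u powr (3/2)" for u
  have w: "w u \<ge> 0" for u by (simp add: w_def)
  have w2: "(w u)^2 = 4 * u^3" if "u > 0" for u
  proof -
    have "(u powr (3/2))^2 = u powr (3/2 + 3/2)" by (simp only: powr_add power2_eq_square)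
    also have "\<dots> = u^3" using that powr_realpow[of u 3] by simp
    finally show ?thesis by (simp add: w_def power_mult_distrib)
  qed
  have cmp: "v^2 < 4 * u^3 \<longleftrightarrow> \<bar>v\<bar> < w u" "4 * u^3 < v^2 \<longleftrightarrow> w u < \<bar>v\<bar>" if "u > 0" for u v
    unfolding w2[OF that, symmetric] using w[of u] abs_le_square_iff[of v "w u"] abs_le_square_iff[of "w u" v]
    by (simp_all add: not_le[symmetric])
  have w_le: "w u \<le> 2" if "0 < u" "u < 1" for u using that powr_mono2[of "3/2" u 1] by (simp add: w_def)
  have neg: "u^3 \<le> 0" if "u \<le> 0" for u :: real using that by (simp add: power3_eq_cube mult_nonpos_nonpos mult_nonneg_nonpos)
  have neg': "u^3 < 0" if "u < 0" for u :: real using that by (simp add: power3_eq_cube mult_neg_neg mult_pos_neg)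
  have em: "emeasure lborel (inv_region i) = (\<integral>\<^sup>+u. emeasure lborel {v. (u, v) \<in> inv_region i} \<partial>lborel)"
  proof -
    have "inv_region i \<in> sets ((lborel :: real measure) \<Otimes>\<^sub>M (lborel :: real measure))" unfolding lborel_prod by simp
    from lborel.emeasure_pair_measure_alt[OF this] show ?thesis unfolding lborel_prod by (simp add: vimage_def)
  qed
  have "emeasure lborel (inv_region i) = ennreal (if even i then 8 / 5 else 32 / 5)"
  proof (cases "even i")
    case True
    have "emeasure lborel (inv_region i) = (\<integral>\<^sup>+u. ennreal (4 * u powr (3/2)) * indicator {0<..<1} u \<partial>lborel)"
      unfolding em
    proof (rule nn_integral_cong)
      fix u :: real
      show "emeasure lborel {v. (u, v) \<in> inv_region i} = ennreal (4 * u powr (3/2)) * indicator {0<..<1} u"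
      proof (cases "u \<in> {0<..<1}")
        case True
        then have u: "0 < u" "u < 1" by auto
        have "(u, v) \<in> inv_region i \<longleftrightarrow> v^2 < 4 * u^3 \<and> \<bar>v\<bar> < 2" for v
          using \<open>even i\<close> u by (auto simp: inv_region_def)
        moreover have "v^2 < 4 * u^3 \<and> \<bar>v\<bar> < 2 \<longleftrightarrow> - w u < v \<and> v < w u" for v
          unfolding cmp(1)[OF u(1)] using w_le[OF u] by linarith
        ultimately have "{v. (u, v) \<in> inv_region i} = {- w u<..<w u}" by (simp add: set_eq_iff)
        then show ?thesis using True w[of u] by (simp add: w_def)
      next
        case False
        have "(u, v) \<notin> inv_region i" for v
        proof (cases "u \<le> 0")
          case True
          then have "\<not> v^2 < 4 * u^3" using neg[of u] zero_le_power2[of v] by linarith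
          then show ?thesis using \<open>even i\<close> by (simp add: inv_region_def)
        next
          case False
          then show ?thesis using \<open>u \<notin> {0<..<1}\<close> by (simp add: inv_region_def)
        qed
        then have "{v. (u, v) \<in> inv_region i} = {}" by simp
        then show ?thesis using False by simp
      qed
    qed
    then show ?thesis using True power_powr_integral(1) by simp
  next
    case False
    have "emeasure lborel (inv_region i) = (\<integral>\<^sup>+u. ennreal (4 - 4 * u powr (3/2)) * indicator {0<..<1} u + ennreal 4 * indicator {-1<..<0} u \<partial>lborel)"
      unfolding em
    proof (rule nn_integral_cong_AE)
      show "AE u in lborel. emeasure lborel {v. (u, v) \<in> inv_region i}
        = ennreal (4 - 4 * u powr (3/2)) * indicator {0<..<1} u + ennreal 4 * indicator {-1<..<0} u"
        using AE_lborel_singleton[of "0::real"]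
      proof eventually_elim
        case (elim u)
        consider "0 < u" "u < 1" | "-1 < u" "u < 0" | "\<not> \<bar>u\<bar> < 1" using elim by linarith
        then show ?case
        proof cases
          case 1
          have "(u, v) \<in> inv_region i \<longleftrightarrow> 4 * u^3 < v^2 \<and> \<bar>v\<bar> < 2" for v
            using \<open>odd i\<close> 1 by (auto simp: inv_region_def)
          then have "{v. (u, v) \<in> inv_region i} = {v. w u < \<bar>v\<bar> \<and> \<bar>v\<bar> < 2}"
            unfolding cmp(2)[OF 1(1)] by simp
          also have "\<dots> = {-2<..<- w u} \<union> {w u<..<2}"
          proof -
            have "w u < \<bar>v\<bar> \<and> \<bar>v\<bar> < 2 \<longleftrightarrow> -2 < v \<and> v < - w u \<or> w u < v \<and> v < 2" for v
              using w[of u] by linarith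
            then show ?thesis unfolding set_eq_iff mem_Collect_eq Un_iff greaterThanLessThan_iff by blast
          qed
          finally have "{v. (u, v) \<in> inv_region i} = {-2<..<- w u} \<union> {w u<..<2}" .
          moreover have "emeasure lborel ({-2<..<- w u} \<union> {w u<..<2}) = emeasure lborel {-2<..<- w u} + emeasure lborel {w u<..<2}"
            using w[of u] by (intro plus_emeasure[symmetric]) auto
          moreover have "\<dots> = ennreal ((2 - w u) + (2 - w u))" using w_le[OF 1] by (simp add: ennreal_plus[symmetric] del: ennreal_plus)
          moreover have "(2 - w u) + (2 - w u) = 4 - 4 * u powr (3/2)" by (simp add: w_def)
          ultimately show ?thesis using 1 by simp
        next
          case 2
          have "u^3 < 0" using neg'[OF 2(2)] .
          then have "4 * u^3 < v^2" for v :: real using zero_le_power2[of v] by linarith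
          then have "{v. (u, v) \<in> inv_region i} = {v. \<bar>v\<bar> < 2}"
            using \<open>odd i\<close> 2 by (simp add: inv_region_def)
          also have "\<dots> = {-2<..<2}" by (auto simp: abs_less_iff)
          finally have "{v. (u, v) \<in> inv_region i} = {-2<..<2}" .
          then show ?thesis using 2 by simp
        next
          case 3
          then have "{v. (u, v) \<in> inv_region i} = {}" by (auto simp: inv_region_def)
          then show ?thesis using 3 by (auto simp: indicator_def)
        qed
      qed
    qed
    also have "\<dots> = (\<integral>\<^sup>+u. ennreal (4 - 4 * u powr (3/2)) * indicator {0<..<1} u \<partial>lborel) + (\<integral>\<^sup>+u. ennreal 4 * indicator {-1<..<0::real} u \<partial>lborel)"
      by (rule nn_integral_add) measurable
    also have "(\<integral>\<^sup>+u. ennreal 4 * indicator {-1<..<0::real} u \<partial>lborel) = ennreal 4"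
      by (subst nn_integral_cmult_indicator) simp_all
    also have "(\<integral>\<^sup>+u. ennreal (4 - 4 * u powr (3/2)) * indicator {0<..<1} u \<partial>lborel) + ennreal 4 = ennreal (12/5 + 4)"
      unfolding power_powr_integral(2) by (rule ennreal_plus[symmetric]) simp_all
    finally show ?thesis using False by simp
  qed
  then show ?thesis by (simp add: measure_def)
qed

definition eligible_set :: "nat \<Rightarrow> real \<Rightarrow> (int \<times> int) set" where
  "eligible_set i X = {(I, J). eligible I J \<and> (-1) ^ i * Delta I J > 0 \<and> height I J < X}"

lemma in_inv_region_iff:
  assumes t: "t > 0"
  shows "(of_int I / t^2, of_int J / t^3) \<in> inv_region i \<longleftrightarrow> (-1) ^ i * Delta I J > 0 \<and> height I J < t^6"
proof -
  have "(-1)^i * (4 * (of_int I / t^2)^3 - (of_int J / t^3)^2) = ((-1)^i * Delta I J) * (27 / t^6)"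
    using t by (simp add: Delta_def power_divide power_mult[symmetric] diff_divide_distrib[symmetric] field_simps)
  moreover have "27 / t^6 > 0" using t by simp
  ultimately have "(-1)^i * (4 * (of_int I / t^2)^3 - (of_int J / t^3)^2) > 0 \<longleftrightarrow> (-1) ^ i * Delta I J > 0"
    by (simp only: zero_less_mult_iff) (auto simp: not_less)
  then show ?thesis unfolding inv_region_def height_less_iff[OF t] by simp
qed

text \<open>After scaling by t^2 and t^3 each eligible residue class is a grid with cells of area
  243 / t^5, and nine such grids give 9/243 = 1/27.\<close>

theorem eligible_count:
  "((\<lambda>t. real (card (eligible_set i (t^6))) / t^5) \<longlongrightarrow> measure lborel (inv_region i) / 27) at_top"
proof -
  define T where "T t = max 1 t" for t :: real
  define m where "m t = (9 / T t^2, 27 / T t^3)" for t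
  define o0 where "o0 rs t = (of_int (fst rs) / T t^2, of_int (snd rs) / T t^3 :: real)" for rs :: "int \<times> int" and t
  have T1: "T t \<ge> 1" for t by (simp add: T_def)
  have T0: "T t > 0" for t using T1[of t] by linarith
  have prodB: "(\<Prod>b\<in>Basis. z \<bullet> b) = fst z * snd z" for z :: "real \<times> real"
    by (cases z) (simp add: Basis_prod_def prod.union_disjoint)
  have lim: "((\<lambda>t. real (card (inv_region i \<inter> grid (o0 rs t) (m t))) * (\<Prod>b\<in>Basis. m t \<bullet> b)) \<longlongrightarrow> measure lborel (inv_region i)) at_top" for rs
  proof (rule grid_count_tendsto[OF open_inv_region order_refl compact_inv_region_le _ null_inv_region_boundary])
    show "inv_region i \<subseteq> inv_region_le i" by (auto simp: inv_region_def inv_region_le_def)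
    show "m t \<bullet> b > 0" if "b \<in> Basis" for t b
      using that T0[of t] by (auto simp: m_def Basis_prod_def)
    have ev: "\<forall>\<^sub>F t in at_top. c * inverse t ^ n = c / T t^n" for c :: real and n
      using eventually_ge_at_top[of "1::real"] by eventually_elim (simp add: T_def max_def field_simps)
    have "((\<lambda>t. c / T t^n) \<longlongrightarrow> 0) at_top" if "n > 0" for c :: real and n
    proof (rule Lim_transform_eventually[OF _ ev])
      have "((\<lambda>t::real. c * inverse t ^ n) \<longlongrightarrow> c * 0 ^ n) at_top"
        by (intro tendsto_intros tendsto_inverse_0_at_top filterlim_ident)
      then show "((\<lambda>t::real. c * inverse t ^ n) \<longlongrightarrow> 0) at_top"
        unfolding zero_power[OF that] by simp
    qed
    then have "((\<lambda>t. (9 / T t^2, 27 / T t^3)) \<longlongrightarrow> (0, 0)) at_top" by (intro tendsto_Pair) auto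
    then show "(m \<longlongrightarrow> 0) at_top" by (simp add: m_def[abs_def] zero_prod_def)
  qed
  have gridE: "(of_int I / T t^2, of_int J / T t^3) \<in> grid (o0 rs t) (m t) \<longleftrightarrow> 9 dvd I - fst rs \<and> 27 dvd J - snd rs" for I J rs t
  proof -
    have int: "real_of_int a / real_of_int n \<in> \<int> \<longleftrightarrow> n dvd a" if "n \<noteq> 0" for a n
      using that by (auto simp: of_int_div_of_int_in_Ints_iff)
    have 1: "(of_int I / T t^2 - of_int (fst rs) / T t^2) / (9 / T t^2) = real_of_int (I - fst rs) / real_of_int 9"
      using T0[of t] by (simp add: field_simps)
    have 2: "(of_int J / T t^3 - of_int (snd rs) / T t^3) / (27 / T t^3) = real_of_int (J - snd rs) / real_of_int 27"
      using T0[of t] by (simp add: field_simps)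
    have "(of_int I / T t^2, of_int J / T t^3) \<in> grid (o0 rs t) (m t) \<longleftrightarrow>
       (of_int I / T t^2 - of_int (fst rs) / T t^2) / (9 / T t^2) \<in> \<int> \<and> (of_int J / T t^3 - of_int (snd rs) / T t^3) / (27 / T t^3) \<in> \<int>"
      unfolding grid_def o0_def m_def by (auto simp: Basis_prod_def ball_Un)
    then show ?thesis unfolding 1 2 int[of 9 "I - fst rs", simplified] using int[of 9 "I - fst rs"] int[of 27 "J - snd rs"] by simp
  qed
  have gridI: "\<exists>I J. p = (of_int I / T t^2, of_int J / T t^3)" if "p \<in> grid (o0 rs t) (m t)" for p rs t
  proof -
    obtain x y where p: "p = (x, y)" by (cases p)
    have "(x - of_int (fst rs) / T t^2) / (9 / T t^2) \<in> \<int> \<and> (y - of_int (snd rs) / T t^3) / (27 / T t^3) \<in> \<int>"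
      using that unfolding p grid_def o0_def m_def by (auto simp: Basis_prod_def ball_Un)
    then obtain k l where kl: "(x - of_int (fst rs) / T t^2) / (9 / T t^2) = of_int k" "(y - of_int (snd rs) / T t^3) / (27 / T t^3) = of_int l"
      by (auto elim!: Ints_cases)
    have solve: "z = (c * w + r) / d" if "(z - r / d) / (c / d) = w" "c > 0" "d > 0" for z w r c d :: real
    proof -
      have "z - r / d = w * (c / d)" using that by (metis divide_eq_eq divide_pos_pos less_irrefl)
      then show ?thesis by (simp add: add_divide_distrib mult.commute)
    qed
    have "x = of_int (9 * k + fst rs) / T t^2" "y = of_int (27 * l + snd rs) / T t^3"
      using solve[OF kl(1)] solve[OF kl(2)] T0[of t] by simp_all
    then show ?thesis unfolding p by blast
  qed
  have mods: "9 dvd I - r \<and> 27 dvd J - s \<longleftrightarrow> (I mod 9, J mod 27) = (r, s)" if "(r, s) \<in> eligible_residues" for I J r s :: int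
    using that unfolding eligible_residues_def by (auto simp: mod_eq_dvd_iff[symmetric])
  have cardE: "card (eligible_set i (t^6)) = (\<Sum>rs\<in>eligible_residues. card (inv_region i \<inter> grid (o0 rs t) (m t)))" if t: "t \<ge> 1" for t
  proof -
    have Tt: "T t = t" using t by (simp add: T_def max_def)
    have t0: "t > 0" using t by simp
    define \<phi> where "\<phi> = (\<lambda>(I, J). (real_of_int I / t^2, real_of_int J / t^3))"
    have inj: "inj_on \<phi> A" for A using t0 by (auto simp: inj_on_def \<phi>_def)
    define E where "E rs = {(I, J). (I mod 9, J mod 27) = rs \<and> (-1) ^ i * Delta I J > 0 \<and> height I J < t^6}" for rs :: "int \<times> int"
    have fin: "finite (E rs)" for rs
      by (rule finite_subset[OF _ finite_height_less[of "t^6"]]) (auto simp: E_def)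
    have fin_res: "finite eligible_residues" by (simp add: eligible_residues_def)
    have disj: "\<forall>rs\<in>eligible_residues. \<forall>rs'\<in>eligible_residues. rs \<noteq> rs' \<longrightarrow> E rs \<inter> E rs' = {}"
      unfolding E_def by blast
    have "eligible_set i (t^6) = (\<Union>rs\<in>eligible_residues. E rs)"
      unfolding eligible_set_def E_def eligible_iff_residues by auto
    then have "card (eligible_set i (t^6)) = (\<Sum>rs\<in>eligible_residues. card (E rs))"
      using card_UN_disjoint[OF fin_res ballI[OF fin] disj] by simp
    also have "\<dots> = (\<Sum>rs\<in>eligible_residues. card (inv_region i \<inter> grid (o0 rs t) (m t)))"
    proof (rule sum.cong[OF refl])
      fix rs assume rs: "rs \<in> eligible_residues"
      have "inv_region i \<inter> grid (o0 rs t) (m t) = \<phi> ` E rs"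
      proof (intro equalityI subsetI)
        fix p assume p: "p \<in> inv_region i \<inter> grid (o0 rs t) (m t)"
        then obtain I J where pe: "p = (of_int I / t^2, of_int J / t^3)" using gridI[of p rs t] unfolding Tt by blast
        have "(I, J) \<in> E rs"
          using p gridE[of I t J rs] mods[of "fst rs" "snd rs" I J] rs in_inv_region_iff[OF t0, of I J i]
          unfolding pe Tt E_def by auto
        then show "p \<in> \<phi> ` E rs" unfolding pe \<phi>_def by (intro image_eqI[of _ _ "(I, J)"]) auto
      next
        fix p assume "p \<in> \<phi> ` E rs"
        then obtain I J where IJ: "(I, J) \<in> E rs" and pe: "p = (of_int I / t^2, of_int J / t^3)" unfolding \<phi>_def by auto
        then show "p \<in> inv_region i \<inter> grid (o0 rs t) (m t)"
          using gridE[of I t J rs] mods[of "fst rs" "snd rs" I J] rs in_inv_region_iff[OF t0, of I J i]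
          unfolding pe Tt E_def by auto
      qed
      then show "card (E rs) = card (inv_region i \<inter> grid (o0 rs t) (m t))" by (simp add: card_image[OF inj])
    qed
    finally show ?thesis .
  qed
  have lim': "((\<lambda>t. (\<Sum>rs\<in>eligible_residues. real (card (inv_region i \<inter> grid (o0 rs t) (m t))) * (\<Prod>b\<in>Basis. m t \<bullet> b)) / 243)
     \<longlongrightarrow> (\<Sum>rs\<in>eligible_residues. measure lborel (inv_region i)) / 243) at_top"
    by (intro tendsto_divide tendsto_sum lim tendsto_const) simp
  have sum: "(\<Sum>rs\<in>eligible_residues. measure lborel (inv_region i)) / 243 = measure lborel (inv_region i) / 27"
    by (simp add: eligible_residues_def)
  have "\<forall>\<^sub>F t in at_top. (\<Sum>rs\<in>eligible_residues. real (card (inv_region i \<inter> grid (o0 rs t) (m t))) * (\<Prod>b\<in>Basis. m t \<bullet> b)) / 243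
     = real (card (eligible_set i (t^6))) / t^5"
    using eventually_ge_at_top[of "1::real"]
  proof eventually_elim
    case (elim t)
    have "T t = t" using elim by (simp add: T_def max_def)
    then have "(\<Prod>b\<in>Basis. m t \<bullet> b) = 243 / t^5"
      using elim unfolding prodB m_def by (simp add: eval_nat_numeral)
    then show ?case unfolding cardE[OF elim] sum_distrib_right[symmetric] of_nat_sum by simp
  qed
  then show ?thesis by (rule Lim_transform_eventually[OF lim'[unfolded sum]])
qed

lemma zeta_2: "zeta 2 = pi^2 / 6"
proof -
  have "(\<lambda>n. 1 / real (Suc n) powr 2) = (\<lambda>n. 1 / (real n + 1)^2)"
    by (rule ext) (simp add: add.commute)
  then have "(\<lambda>n. 1 / real (Suc n) powr 2) sums (pi^2 / 6)" using inverse_squares_sums by simp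
  then show ?thesis unfolding zeta_def by (rule sums_unique[symmetric])
qed

theorem theorem1p8:
  fixes i :: nat and n :: "nat \<Rightarrow> real"
  assumes "i \<in> {0, 1, 2}"
    and "n 0 = 4" and "n 1 = 2" and "n 2 = 2"
  shows "((\<lambda>X :: real.
      real (\<Sum>(I, J) \<in> {(I, J). height I J < X}. h i I J)
      / real (card {(I, J). eligible I J \<and> (-1) ^ i * Delta I J > 0 \<and> height I J < X}))
    \<longlongrightarrow> 2 * zeta 2 / n i) at_top"
proof -
  define A where "A = measure lborel (inv_region i)"
  have A: "A = (if even i then 8 / 5 else 32 / 5)" unfolding A_def by (rule measure_inv_region)
  have "((\<lambda>t. (real (card (classes i (t^6))) / t^5) / (real (card (eligible_set i (t^6))) / t^5)) \<longlongrightarrow> pi / 3 * real_total_weight i / (A / 27)) at_top"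
    by (intro tendsto_divide card_classes_tendsto[OF assms(1)] eligible_count[of i, folded A_def]) (simp add: A)
  \<comment> \<open>For i = 0, 1, 2 the left side is pi^2/12, pi^2/6 and pi^2/6, while 2 zeta(2) =
    pi^2/3.\<close>
  moreover have "pi / 3 * real_total_weight i / (A / 27) = 2 * zeta 2 / n i"
    using assms unfolding A real_total_weight_def zeta_2 by (auto simp: power2_eq_square)
  ultimately have lim: "((\<lambda>t. (real (card (classes i (t^6))) / t^5) / (real (card (eligible_set i (t^6))) / t^5)) \<longlongrightarrow> 2 * zeta 2 / n i) at_top"
    by simp
  \<comment> \<open>The limit was taken in t with X = t^6; composing with the sixth root of X
    returns to the height bound.\<close>
  have "filterlim (\<lambda>X::real. X powr (1/6)) at_top at_top"
    unfolding filterlim_at_top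
  proof
    fix Z :: real
    show "\<forall>\<^sub>F X in at_top. Z \<le> X powr (1/6)"
      using eventually_ge_at_top[of "max 1 (max 1 Z ^ 6)"]
    proof eventually_elim
      case (elim X)
      define m where "m = max 1 Z"
      have m: "m > 0" "Z \<le> m" "m ^ 6 \<le> X" using elim by (auto simp: m_def)
      have "m ^ 6 = m powr 6" using m(1) powr_realpow[of m 6] by simp
      then have "(m ^ 6) powr (1/6) = m" using m(1) by (simp only: powr_powr) simp
      moreover have "(m ^ 6) powr (1/6) \<le> X powr (1/6)" using m by (intro powr_mono2) auto
      ultimately show ?case using m(2) by linarith
    qed
  qed
  from filterlim_compose[OF lim this]
  have "((\<lambda>X::real. (real (card (classes i ((X powr (1/6))^6))) / (X powr (1/6))^5) / (real (card (eligible_set i ((X powr (1/6))^6))) / (X powr (1/6))^5))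
    \<longlongrightarrow> 2 * zeta 2 / n i) at_top" .
  then show ?thesis
  proof (rule Lim_transform_eventually)
    show "\<forall>\<^sub>F X in at_top. (real (card (classes i ((X powr (1/6))^6))) / (X powr (1/6))^5) / (real (card (eligible_set i ((X powr (1/6))^6))) / (X powr (1/6))^5)
      = real (\<Sum>(I, J) \<in> {(I, J). height I J < X}. h i I J)
      / real (card {(I, J). eligible I J \<and> (-1) ^ i * Delta I J > 0 \<and> height I J < X})"
      using eventually_ge_at_top[of "1::real"]
    proof eventually_elim
      case (elim X)
      define t where "t = X powr (1/6)"
      have t: "t \<ge> 1" unfolding t_def using elim by (simp add: ge_one_powr_ge_zero)
      have t6: "t^6 = X"
      proof -
        have "t^6 = t powr 6" using t powr_realpow[of t 6] by simp
        also have "\<dots> = X" unfolding t_def using elim by (simp add: powr_powr)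
        finally show ?thesis .
      qed
      have "finite (classes i X)" using classes_upper(1)[OF assms(1) t, of 1] unfolding t6 by simp
      from sum_h_eq_card_classes[OF this] show ?case
        unfolding t_def[symmetric] t6 eligible_set_def using t by simp
    qed
  qed
qed

end
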